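(* Let $E\to(X,\omega)$ be a holomorphic vector bundle over a compact K\"ahler manifold, $Z$ a polynomial central charge with $Z(E)\ne0$ and fixed representatives $\omega,\tilde U$, and fix a reference Hermitian metric $\tilde h$ on $E$. Then a Hermitian metric $h$ on $E$ is a critical point of the functional $\mathcal{M}_Z(\cdot,\tilde h)$ if and only if $h$ is $Z$-critical.
   Context: Let $n=\dim X$. A stability vector is $\rho\in(\mathbb{C}^* )^{n+1}$ with $\mathrm{Im}(\rho_n)>0$ and $\mathrm{Im}(\rho_d/\rho_{d+1})>0$ for $d<n$. A polynomial central charge is given by such $\rho$, the class $[\omega]$ and a real class $U=1+N$, $N\in H^{>0}(X,\mathbb{R})$; $Z(E)=\int_X\big(\sum_d\rho_d[\omega]^d\big)\cdot\mathrm{Ch}(E)\cdot U$, $\varphi(E)=\arg Z(E)$. Fix $\omega$ and a closed real form $\tilde U$ representing $U$ (degree $2\ell$ part $\tilde U_\ell$). For a Hermitian metric $h$ with Chern curvature $F(h)$, $\tilde Z(h)=\sum_{d+j+\ell=n}\rho_d\omega^d\wedge\frac1{j!}(\frac{i}{2\pi}F(h))^j\wedge\tilde U_\ell$, $\mathrm{Im}(T)=(T-T^* )/(2i)$, and $D_Z(h)=\mathrm{Im}(e^{-i\varphi(E)}\tilde Z(h))$; $h$ is $Z$-critical if $D_Z(h)=0$. The functional $\mathcal{M}_Z(h,h')$ is obtained by replacing in $D_Z(h)$ each factor $(\frac{i}{2\pi}F(h))^k$ by the Bott--Chern form $R_{k+1}(h,h')$ (with $\mathrm{id}_E$ treated as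 the case $k=0$), taking the trace and integrating over $X$. Here, for a smooth path $h_t$ of Hermitian metrics from $h'$ to $h$, $R_{k+1}(h,h')=\int_0^1\big[h_t^{-1}\partial_th_t\,(\frac{i}{2\pi}F(h_t))^{k}\big]_{\mathrm{sym}}dt$, where $[\cdot]_{\mathrm{sym}}$ averages over all orderings of the factors; its trace is independent of the path modulo $\mathrm{im}\,\partial+\mathrm{im}\,\bar\partial$. Thus $\mathcal{M}_Z(h,h')=\int_0^1\int_X\mathrm{tr}\big(h_t^{-1}\partial_th_t\circ D_Z(h_t)\big)dt$, and $\mathcal{M}_Z(h,h)=0$.
   Formalization: The closed real form Ũ is assumed in addition to have ∂-closed even-degree parts (automatic for parts of type (ℓ,ℓ) and for harmonic representatives); for a general closed Ũ the functional M_Z depends on the chosen path and is not well defined. *)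

theory Defs
  imports "HOL-Analysis.Analysis" "HOL-Combinatorics.Permutations"
begin

section \<open>Smoothness and holomorphy\<close>

primrec Ck_on :: "nat \<Rightarrow> ('a::real_normed_vector \<Rightarrow> 'b::real_normed_vector) \<Rightarrow> 'a set \<Rightarrow> bool" where
  "Ck_on 0 f S \<longleftrightarrow> continuous_on S f"
| "Ck_on (Suc k) f S \<longleftrightarrow>
     f differentiable_on S \<and> (\<forall>v. Ck_on k (\<lambda>x. frechet_derivative f (at x) v) S)"

text \<open>Only used for open \<open>S\<close>.\<close>
definition smooth_on :: "('a::real_normed_vector \<Rightarrow> 'b::real_normed_vector) \<Rightarrow> 'a set \<Rightarrow> bool" where
  "smooth_on f S \<longleftrightarrow> (\<forall>k. Ck_on k f S)"

definition holo_on :: "(complex^'n \<Rightarrow> complex) \<Rightarrow> (complex^'n) set \<Rightarrow> bool" where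
  "holo_on f S \<longleftrightarrow> (\<forall>z\<in>S. \<exists>f'. (f has_derivative f') (at z) \<and> (\<forall>c v. f' (c *s v) = c * f' v))"

section \<open>Compact complex manifolds\<close>

text \<open>
  The underlying space is the whole type \<open>'a\<close>; the charts are indexed by \<open>charts X\<close> and
  take values in \<open>complex^'n\<close>, so that the complex dimension is \<open>CARD('n)\<close>.
  Charts need not have connected domains and the space need not be connected.
\<close>

record ('a, 'i, 'n) atlas =
  charts :: "'i set"
  dom :: "'i \<Rightarrow> 'a set"
  chart :: "'i \<Rightarrow> 'a \<Rightarrow> complex^'n"

definition img :: "('a, 'i, 'n::finite) atlas \<Rightarrow> 'i \<Rightarrow> (complex^'n) set" where
  "img X i = chart X i ` dom X i"

definition chart_inv :: "('a, 'i, 'n::finite) atlas \<Rightarrow> 'i \<Rightarrow> complex^'n \<Rightarrow> 'a" where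
  "chart_inv X i = inv_into (dom X i) (chart X i)"

definition overlap :: "('a, 'i, 'n::finite) atlas \<Rightarrow> 'i \<Rightarrow> 'i \<Rightarrow> (complex^'n) set" where
  "overlap X i j = chart X i ` (dom X i \<inter> dom X j)"

definition transition :: "('a, 'i, 'n::finite) atlas \<Rightarrow> 'i \<Rightarrow> 'i \<Rightarrow> complex^'n \<Rightarrow> complex^'n" where
  "transition X i j z = chart X j (chart_inv X i z)"

definition compact_complex_manifold :: "('a::t2_space, 'i, 'n::finite) atlas \<Rightarrow> bool" where
  "compact_complex_manifold X \<longleftrightarrow>
     compact (UNIV :: 'a set) \<and>
     (\<Union>i\<in>charts X. dom X i) = UNIV \<and>
     (\<forall>i\<in>charts X. open (dom X i) \<and> open (img X i) \<and>
        homeomorphism (dom X i) (img X i) (chart X i) (chart_inv X i)) \<and>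
     (\<forall>i\<in>charts X. \<forall>j\<in>charts X. \<forall>a. holo_on (\<lambda>z. transition X i j z $ a) (overlap X i j))"

section \<open>Differential forms\<close>

text \<open>
  The value of a \<open>k\<close>-form at a point is an alternating real-multilinear function of \<open>k\<close> tangent
  vectors.  These are passed as a sequence of which only the entries \<open>0, \<dots>, k - 1\<close> matter.
  A global form is the family of its expressions in the charts.
\<close>

type_synonym ('n, 'b) lform = "complex^'n \<Rightarrow> (nat \<Rightarrow> complex^'n) \<Rightarrow> 'b"
type_synonym ('i, 'n, 'b) form = "'i \<Rightarrow> ('n, 'b) lform"

definition alternating :: "nat \<Rightarrow> ((nat \<Rightarrow> complex^'n) \<Rightarrow> 'b::real_vector) \<Rightarrow> bool" where
  "alternating k A \<longleftrightarrow>
     (\<forall>v w. (\<forall>m<k. v m = w m) \<longrightarrow> A v = A w) \<and>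
     (\<forall>v. \<forall>m<k. linear (\<lambda>x. A (v(m := x)))) \<and>
     (\<forall>v l m. l < m \<and> m < k \<and> v l = v m \<longrightarrow> A v = 0)"

definition is_form ::
  "('a, 'i, 'n::finite) atlas \<Rightarrow> nat \<Rightarrow> ('i, 'n, complex) form \<Rightarrow> bool" where
  "is_form X k \<alpha> \<longleftrightarrow>
     (\<forall>i\<in>charts X. \<forall>z\<in>img X i. alternating k (\<alpha> i z)) \<and>
     (\<forall>i\<in>charts X. \<forall>v. smooth_on (\<lambda>z. \<alpha> i z v) (img X i)) \<and>
     (\<forall>i\<in>charts X. \<forall>j\<in>charts X. \<forall>z\<in>overlap X i j. \<forall>v.
        \<alpha> i z v = \<alpha> j (transition X i j z)
          (\<lambda>m. frechet_derivative (transition X i j) (at z) (v m)))"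

definition real_form ::
  "('a, 'i, 'n::finite) atlas \<Rightarrow> ('i, 'n, complex) form \<Rightarrow> bool" where
  "real_form X \<alpha> \<longleftrightarrow> (\<forall>i\<in>charts X. \<forall>z\<in>img X i. \<forall>v. \<alpha> i z v \<in> \<real>)"

text \<open>
  Normalised so that \<open>(\<alpha> \<and> \<beta>)(v, w) = \<alpha> v \<beta> w - \<alpha> w \<beta> v\<close> for one-forms.  The values are
  multiplied with \<open>m\<close>, which allows scalar and matrix coefficients.
\<close>
definition wedge ::
  "('b \<Rightarrow> 'c \<Rightarrow> 'd::real_vector) \<Rightarrow> nat \<Rightarrow> nat \<Rightarrow>
   ('n, 'b) lform \<Rightarrow> ('n, 'c) lform \<Rightarrow> ('n, 'd) lform" where
  "wedge m p q \<alpha> \<beta> z v =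
     (1 / (fact p * fact q)) *\<^sub>R
       (\<Sum>\<sigma> | \<sigma> permutes {..<p + q}.
          of_int (sign \<sigma>) *\<^sub>R m (\<alpha> z (\<lambda>k. v (\<sigma> k))) (\<beta> z (\<lambda>k. v (\<sigma> (p + k)))))"

text \<open>Product of a list of forms, each paired with its degree; \<open>e\<close> is the unit for \<open>m\<close>.\<close>
primrec wedge_list ::
  "('b \<Rightarrow> 'b \<Rightarrow> 'b::real_vector) \<Rightarrow> 'b \<Rightarrow> (nat \<times> ('n, 'b) lform) list \<Rightarrow> ('n, 'b) lform" where
  "wedge_list m e [] = (\<lambda>z v. e)"
| "wedge_list m e (a # as) =
     wedge m (fst a) (sum_list (map fst as)) (snd a) (wedge_list m e as)"

abbreviation wedge_power ::
  "('b \<Rightarrow> 'b \<Rightarrow> 'b::real_vector) \<Rightarrow> 'b \<Rightarrow> nat \<Rightarrow> ('n, 'b) lform \<Rightarrow> nat \<Rightarrow> ('n, 'b) lform" where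
  "wedge_power m e p \<alpha> k \<equiv> wedge_list m e (replicate k (p, \<alpha>))"

definition omit :: "nat \<Rightarrow> (nat \<Rightarrow> 'b) \<Rightarrow> nat \<Rightarrow> 'b" where
  "omit s v = (\<lambda>m. if m < s then v m else v (Suc m))"

definition ext_deriv :: "nat \<Rightarrow> ('n::finite, 'b::real_normed_vector) lform \<Rightarrow> ('n, 'b) lform" where
  "ext_deriv k \<alpha> z v =
     (\<Sum>s\<le>k. (- 1) ^ s *\<^sub>R frechet_derivative (\<lambda>y. \<alpha> y (omit s v)) (at z) (v s))"

text \<open>The \<open>(1,0)\<close>-part \<open>\<partial>f\<close> of the differential, evaluated at a tangent vector.\<close>
definition del_dir :: "(complex^'n::finite \<Rightarrow> complex) \<Rightarrow> complex^'n \<Rightarrow> complex^'n \<Rightarrow> complex" where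
  "del_dir f z v =
     (frechet_derivative f (at z) v - \<i> * frechet_derivative f (at z) (\<i> *s v)) / 2"

text \<open>The operator \<open>\<partial>\<close> on complex-valued forms.\<close>
definition del :: "nat \<Rightarrow> ('n::finite, complex) lform \<Rightarrow> ('n, complex) lform" where
  "del k \<alpha> z v = (\<Sum>s\<le>k. (- 1) ^ s * del_dir (\<lambda>y. \<alpha> y (omit s v)) z (v s))"

definition closed_form ::
  "('a, 'i, 'n::finite) atlas \<Rightarrow> nat \<Rightarrow> ('i, 'n, complex) form \<Rightarrow> bool" where
  "closed_form X k \<alpha> \<longleftrightarrow> (\<forall>i\<in>charts X. \<forall>z\<in>img X i. \<forall>v. ext_deriv k (\<alpha> i) z v = 0)"

text \<open>
  A closed form is \<open>\<partial>\<close>-closed iff all its \<open>(p,q)\<close>-parts are closed; this holds for every closed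
  form of pure type and for every harmonic form on a compact Kaehler manifold.
\<close>
definition del_closed_form ::
  "('a, 'i, 'n::finite) atlas \<Rightarrow> nat \<Rightarrow> ('i, 'n, complex) form \<Rightarrow> bool" where
  "del_closed_form X k \<alpha> \<longleftrightarrow> (\<forall>i\<in>charts X. \<forall>z\<in>img X i. \<forall>v. del k (\<alpha> i) z v = 0)"

definition kaehler_form ::
  "('a, 'i, 'n::finite) atlas \<Rightarrow> ('i, 'n, complex) form \<Rightarrow> bool" where
  "kaehler_form X \<omega> \<longleftrightarrow>
     is_form X 2 \<omega> \<and> real_form X \<omega> \<and> closed_form X 2 \<omega> \<and>
     (\<forall>i\<in>charts X. \<forall>z\<in>img X i.
        (\<forall>v. \<omega> i z (\<lambda>m. \<i> *s v m) = \<omega> i z v) \<and>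
        (\<forall>v. v 0 \<noteq> 0 \<and> v 1 = \<i> *s v 0 \<longrightarrow> 0 < Re (\<omega> i z v)))"

section \<open>Integration\<close>

definition partition_of_unity ::
  "('a::t2_space, 'i, 'n::finite) atlas \<Rightarrow> ('i \<Rightarrow> 'a \<Rightarrow> real) \<Rightarrow> bool" where
  "partition_of_unity X \<psi> \<longleftrightarrow>
     finite {i\<in>charts X. \<exists>x. \<psi> i x \<noteq> 0} \<and>
     (\<forall>i\<in>charts X. (\<forall>x. 0 \<le> \<psi> i x) \<and> closure {x. \<psi> i x \<noteq> 0} \<subseteq> dom X i) \<and>
     (\<forall>i\<in>charts X. \<forall>j\<in>charts X. smooth_on (\<lambda>z. \<psi> i (chart_inv X j z)) (img X j)) \<and>
     (\<forall>x. (\<Sum>i | i \<in> charts X \<and> \<psi> i x \<noteq> 0. \<psi> i x) = 1)"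

text \<open>
  The frame \<open>e\<^sub>1, \<i>e\<^sub>1, e\<^sub>2, \<i>e\<^sub>2, \<dots>\<close>, which is orthonormal and positively oriented for the complex
  orientation; the order in which the coordinates are enumerated is irrelevant.
\<close>
definition std_frame :: "nat \<Rightarrow> complex^'n::finite" where
  "std_frame k = axis (from_nat_into (UNIV :: 'n set) (k div 2)) (if even k then 1 else \<i>)"

text \<open>Integral of a form of degree \<open>2 CARD('n)\<close>; it does not depend on the partition of unity.\<close>
definition integral_over ::
  "('a::t2_space, 'i, 'n::finite) atlas \<Rightarrow> ('i, 'n, complex) form \<Rightarrow> complex" where
  "integral_over X \<eta> =
     (let \<psi> = (SOME \<psi>. partition_of_unity X \<psi>) in
        \<Sum>i | i \<in> charts X \<and> (\<exists>x. \<psi> i x \<noteq> 0).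
          (LINT z:img X i|lborel. \<psi> i (chart_inv X i z) *\<^sub>R \<eta> i z std_frame))"

section \<open>Holomorphic bundles and Hermitian metrics\<close>

text \<open>
  A bundle of rank \<open>CARD('r)\<close> with a holomorphic frame over each \<open>dom X i\<close> is given by its
  transition functions: a vector with components \<open>\<xi>\<close> in frame \<open>i\<close> has components \<open>E j i x *v \<xi>\<close> in
  frame \<open>j\<close>.  As the atlas is not assumed to be maximal, it can be refined so that any given
  bundle is trivial over each chart domain.
\<close>

type_synonym ('a, 'i, 'r) cocycle = "'i \<Rightarrow> 'i \<Rightarrow> 'a \<Rightarrow> complex^'r^'r"

definition holomorphic_bundle ::
  "('a, 'i, 'n::finite) atlas \<Rightarrow> ('a, 'i, 'r::finite) cocycle \<Rightarrow> bool" where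
  "holomorphic_bundle X E \<longleftrightarrow>
     (\<forall>i\<in>charts X. \<forall>x\<in>dom X i. E i i x = mat 1) \<and>
     (\<forall>i\<in>charts X. \<forall>j\<in>charts X. \<forall>k\<in>charts X. \<forall>x\<in>dom X i \<inter> dom X j \<inter> dom X k.
        E k j x ** E j i x = E k i x) \<and>
     (\<forall>i\<in>charts X. \<forall>j\<in>charts X. \<forall>a b.
        holo_on (\<lambda>z. E j i (chart_inv X i z) $ a $ b) (overlap X i j))"

definition cscale :: "complex \<Rightarrow> complex^'r^'s \<Rightarrow> complex^'r^'s" where
  "cscale c A = (\<chi> a b. c * A $ a $ b)"

definition conj_transpose :: "complex^'r^'s \<Rightarrow> complex^'s^'r" where
  "conj_transpose A = (\<chi> a b. cnj (A $ b $ a))"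

definition pos_def_hermitian :: "complex^'r::finite^'r \<Rightarrow> bool" where
  "pos_def_hermitian A \<longleftrightarrow>
     conj_transpose A = A \<and>
     (\<forall>\<xi>. \<xi> \<noteq> 0 \<longrightarrow> 0 < Re (\<Sum>a\<in>UNIV. \<Sum>b\<in>UNIV. cnj (\<xi> $ a) * A $ a $ b * \<xi> $ b))"

text \<open>
  \<open>h i z\<close> is the Gram matrix of the metric in frame \<open>i\<close> at the point with coordinate \<open>z\<close>, i.e. the
  inner product of \<open>\<xi>\<close> and \<open>\<eta>\<close> is \<open>\<eta>\<^sup>* (h i z) \<xi>\<close>.
\<close>
type_synonym ('i, 'n, 'r) metric = "'i \<Rightarrow> complex^'n \<Rightarrow> complex^'r^'r"

definition hermitian_metric ::
  "('a, 'i, 'n::finite) atlas \<Rightarrow> ('a, 'i, 'r::finite) cocycle \<Rightarrow> ('i, 'n, 'r) metric \<Rightarrow> bool" where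
  "hermitian_metric X E h \<longleftrightarrow>
     (\<forall>i\<in>charts X. smooth_on (h i) (img X i) \<and> (\<forall>z\<in>img X i. pos_def_hermitian (h i z))) \<and>
     (\<forall>i\<in>charts X. \<forall>j\<in>charts X. \<forall>z\<in>overlap X i j.
        let g = E j i (chart_inv X i z)
        in h i z = conj_transpose g ** h j (transition X i j z) ** g)"

text \<open>Equality of metrics: the local expressions are arbitrary outside the chart images.\<close>
definition same_metric ::
  "('a, 'i, 'n::finite) atlas \<Rightarrow> ('i, 'n, 'r::finite) metric \<Rightarrow> ('i, 'n, 'r) metric \<Rightarrow> bool" where
  "same_metric X h h' \<longleftrightarrow> (\<forall>i\<in>charts X. \<forall>z\<in>img X i. h i z = h' i z)"

text \<open>The Chern connection form \<open>h\<^sup>-\<^sup>1 \<partial>h\<close> and its curvature \<open>d\<theta> + \<theta> \<and> \<theta>\<close> in a holomorphic frame.\<close>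

definition chern_connection ::
  "(complex^'n::finite \<Rightarrow> complex^'r::finite^'r) \<Rightarrow> ('n, complex^'r^'r) lform" where
  "chern_connection H z v =
     matrix_inv (H z) ** (\<chi> a b. del_dir (\<lambda>y. H y $ a $ b) z (v 0))"

definition chern_curvature ::
  "(complex^'n::finite \<Rightarrow> complex^'r::finite^'r) \<Rightarrow> ('n, complex^'r^'r) lform" where
  "chern_curvature H z v =
     (let \<theta> = chern_connection H in ext_deriv 1 \<theta> z v + wedge (\<lambda>A B. A ** B) 1 1 \<theta> \<theta> z v)"

definition normalized_curvature ::
  "(complex^'n::finite \<Rightarrow> complex^'r::finite^'r) \<Rightarrow> ('n, complex^'r^'r) lform" where
  "normalized_curvature H z v = cscale (\<i> / (2 * complex_of_real pi)) (chern_curvature H z v)"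

definition chern_character ::
  "nat \<Rightarrow> (complex^'n::finite \<Rightarrow> complex^'r::finite^'r) \<Rightarrow> ('n, complex) lform" where
  "chern_character j H z v =
     trace (wedge_power (\<lambda>A B. A ** B) (mat 1) 2 (normalized_curvature H) j z v) / fact j"

section \<open>Polynomial central charges\<close>

definition stability_vector :: "nat \<Rightarrow> (nat \<Rightarrow> complex) \<Rightarrow> bool" where
  "stability_vector n \<rho> \<longleftrightarrow>
     (\<forall>d\<le>n. \<rho> d \<noteq> 0) \<and> 0 < Im (\<rho> n) \<and> (\<forall>d<n. 0 < Im (\<rho> d / \<rho> (Suc d)))"

text \<open>
  A closed real form representing a class \<open>1 + N\<close> with \<open>N\<close> of positive degree; \<open>U k\<close> is its part
  of degree \<open>k\<close>.
\<close>
definition unipotent_form ::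
  "('a, 'i, 'n::finite) atlas \<Rightarrow> (nat \<Rightarrow> ('i, 'n, complex) form) \<Rightarrow> bool" where
  "unipotent_form X U \<longleftrightarrow>
     (\<forall>k. is_form X k (U k) \<and> real_form X (U k) \<and> closed_form X k (U k)) \<and>
     (\<forall>i\<in>charts X. \<forall>z\<in>img X i. \<forall>v. U 0 i z v = 1)"

definition degree_triples :: "nat \<Rightarrow> (nat \<times> nat \<times> nat) set" where
  "degree_triples n = {(d, j, l). d + j + l = n}"

text \<open>\<open>Z(E)\<close> by Chern--Weil theory: the class \<open>Ch(E)\<close> is represented using some Hermitian metric.\<close>
definition central_charge ::
  "('a::t2_space, 'i, 'n::finite) atlas \<Rightarrow> ('a, 'i, 'r::finite) cocycle \<Rightarrow>
   ('i, 'n, complex) form \<Rightarrow> (nat \<Rightarrow> complex) \<Rightarrow> (nat \<Rightarrow> ('i, 'n, complex) form) \<Rightarrow> complex" where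
  "central_charge X E \<omega> \<rho> U =
     (let k = (SOME k. hermitian_metric X E k) in
      integral_over X (\<lambda>i z v. \<Sum>(d, j, l)\<in>degree_triples CARD('n).
        \<rho> d * wedge times (2 * d) (2 * j + 2 * l) (wedge_power times 1 2 (\<omega> i) d)
                 (wedge times (2 * j) (2 * l) (chern_character j (k i)) (U (2 * l) i)) z v))"

definition phase ::
  "('a::t2_space, 'i, 'n::finite) atlas \<Rightarrow> ('a, 'i, 'r::finite) cocycle \<Rightarrow>
   ('i, 'n, complex) form \<Rightarrow> (nat \<Rightarrow> complex) \<Rightarrow> (nat \<Rightarrow> ('i, 'n, complex) form) \<Rightarrow> real" where
  "phase X E \<omega> \<rho> U = Arg (central_charge X E \<omega> \<rho> U)"

text \<open>
  \<open>\<Sum> c\<^sub>d \<omega>\<^sup>d \<and> (1/j!) P\<^sub>j \<and> U\<^sub>l\<close> over \<open>d + j + l = n\<close>, where \<open>P\<^sub>j\<close> is an endomorphism-valued form of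
  degree \<open>2 j\<close>: the curvature power in the definition of \<open>Z\<close>-critical metrics, and the
  Bott--Chern form that replaces it in the functional.
\<close>
definition charge_form ::
  "(nat \<Rightarrow> complex) \<Rightarrow> ('n::finite, complex) lform \<Rightarrow> (nat \<Rightarrow> ('n, complex) lform) \<Rightarrow>
   (nat \<Rightarrow> ('n, complex^'r::finite^'r) lform) \<Rightarrow> ('n, complex^'r^'r) lform" where
  "charge_form c \<omega> U P z v =
     (\<Sum>(d, j, l)\<in>degree_triples CARD('n).
        cscale (c d / fact j)
          (wedge cscale (2 * d) (2 * j + 2 * l) (wedge_power times 1 2 \<omega> d)
             (wedge (\<lambda>A s. cscale s A) (2 * j) (2 * l) (P j) (U (2 * l))) z v))"

definition Z_tilde ::
  "(nat \<Rightarrow> complex) \<Rightarrow> ('i, 'n, complex) form \<Rightarrow> (nat \<Rightarrow> ('i, 'n, complex) form) \<Rightarrow>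
   ('i, 'n::finite, 'r::finite) metric \<Rightarrow> ('i, 'n, complex^'r^'r) form" where
  "Z_tilde \<rho> \<omega> U h i =
     charge_form \<rho> (\<omega> i) (\<lambda>k. U k i) (wedge_power (\<lambda>A B. A ** B) (mat 1) 2 (normalized_curvature (h i)))"

text \<open>Adjoint of an endomorphism with respect to the inner product with Gram matrix \<open>H\<close>.\<close>
definition adj :: "complex^'r::finite^'r \<Rightarrow> complex^'r^'r \<Rightarrow> complex^'r^'r" where
  "adj H T = matrix_inv H ** conj_transpose T ** H"

definition Im_endo :: "complex^'r::finite^'r \<Rightarrow> complex^'r^'r \<Rightarrow> complex^'r^'r" where
  "Im_endo H T = cscale (1 / (2 * \<i>)) (T - adj H T)"

definition D_Z ::
  "('a::t2_space, 'i, 'n::finite) atlas \<Rightarrow> ('a, 'i, 'r::finite) cocycle \<Rightarrow>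
   ('i, 'n, complex) form \<Rightarrow> (nat \<Rightarrow> complex) \<Rightarrow> (nat \<Rightarrow> ('i, 'n, complex) form) \<Rightarrow>
   ('i, 'n, 'r) metric \<Rightarrow> ('i, 'n, complex^'r^'r) form" where
  "D_Z X E \<omega> \<rho> U h i z v =
     Im_endo (h i z) (cscale (cis (- phase X E \<omega> \<rho> U)) (Z_tilde \<rho> \<omega> U h i z v))"

definition Z_critical ::
  "('a::t2_space, 'i, 'n::finite) atlas \<Rightarrow> ('a, 'i, 'r::finite) cocycle \<Rightarrow>
   ('i, 'n, complex) form \<Rightarrow> (nat \<Rightarrow> complex) \<Rightarrow> (nat \<Rightarrow> ('i, 'n, complex) form) \<Rightarrow>
   ('i, 'n, 'r) metric \<Rightarrow> bool" where
  "Z_critical X E \<omega> \<rho> U h \<longleftrightarrow>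
     (\<forall>i\<in>charts X. \<forall>z\<in>img X i. \<forall>v. D_Z X E \<omega> \<rho> U h i z v = 0)"

section \<open>The functional\<close>

text \<open>
  Smooth curves of metrics are parametrised by the whole real line.  A smooth curve on \<open>[0, 1]\<close> or
  on a neighbourhood of \<open>0\<close> agrees there (in the second case, near \<open>0\<close>) with such a curve.
\<close>
definition metric_curve ::
  "('a, 'i, 'n::finite) atlas \<Rightarrow> ('a, 'i, 'r::finite) cocycle \<Rightarrow>
   (real \<Rightarrow> ('i, 'n, 'r) metric) \<Rightarrow> bool" where
  "metric_curve X E \<gamma> \<longleftrightarrow>
     (\<forall>t. hermitian_metric X E (\<gamma> t)) \<and>
     (\<forall>i\<in>charts X. smooth_on (\<lambda>(t, z). \<gamma> t i z) (UNIV \<times> img X i))"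

definition metric_path ::
  "('a, 'i, 'n::finite) atlas \<Rightarrow> ('a, 'i, 'r::finite) cocycle \<Rightarrow>
   ('i, 'n, 'r) metric \<Rightarrow> ('i, 'n, 'r) metric \<Rightarrow> (real \<Rightarrow> ('i, 'n, 'r) metric) \<Rightarrow> bool" where
  "metric_path X E h' h \<gamma> \<longleftrightarrow>
     metric_curve X E \<gamma> \<and> same_metric X (\<gamma> 0) h' \<and> same_metric X (\<gamma> 1) h"

definition velocity ::
  "(real \<Rightarrow> ('i, 'n, 'r::finite) metric) \<Rightarrow> real \<Rightarrow> 'i \<Rightarrow> complex^'n::finite \<Rightarrow> complex^'r^'r" where
  "velocity \<gamma> t i z = matrix_inv (\<gamma> t i z) ** vector_derivative (\<lambda>s. \<gamma> s i z) (at t)"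

text \<open>
  Average of the products over all orderings.  All forms this is applied to have even degree, so
  reordering introduces no signs.
\<close>
definition sym_product ::
  "(nat \<times> ('n, complex^'r::finite^'r) lform) list \<Rightarrow> ('n, complex^'r^'r) lform" where
  "sym_product as z v =
     (1 / fact (length as)) *\<^sub>R
       (\<Sum>\<sigma> | \<sigma> permutes {..<length as}. wedge_list (\<lambda>A B. A ** B) (mat 1) (permute_list \<sigma> as) z v)"

text \<open>
  The form \<open>R\<^sub>k\<^sub>+\<^sub>1\<close> of degree \<open>2 k\<close> along the path \<open>\<gamma>\<close>, with one factor \<open>h\<^sub>t\<^sup>-\<^sup>1 \<partial>\<^sub>t h\<^sub>t\<close> and \<open>k\<close> curvature
  factors.
\<close>
definition bott_chern ::
  "(real \<Rightarrow> ('i, 'n::finite, 'r::finite) metric) \<Rightarrow> nat \<Rightarrow> ('i, 'n, complex^'r^'r) form" where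
  "bott_chern \<gamma> k i z v =
     integral {0..1} (\<lambda>t. sym_product
       ((0, \<lambda>y w. velocity \<gamma> t i y) # replicate k (2, normalized_curvature (\<gamma> t i))) z v)"

text \<open>
  Since \<open>\<omega>\<close> and the parts of \<open>U\<close> are real and the normalised curvature is self-adjoint, the
  imaginary part in \<open>D_Z\<close> only affects the coefficients:
  \<open>D_Z(h)\<close> is the sum of \<open>Im (e\<^sup>-\<^sup>i\<^sup>\<phi> \<rho>\<^sub>d) \<omega>\<^sup>d \<and> (1/j!) (i/2\<pi> F(h))\<^sup>j \<and> U\<^sub>l\<close>.  In this expression the
  curvature powers are replaced.
\<close>
definition M_Z_along ::
  "('a::t2_space, 'i, 'n::finite) atlas \<Rightarrow> ('a, 'i, 'r::finite) cocycle \<Rightarrow>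
   ('i, 'n, complex) form \<Rightarrow> (nat \<Rightarrow> complex) \<Rightarrow> (nat \<Rightarrow> ('i, 'n, complex) form) \<Rightarrow>
   (real \<Rightarrow> ('i, 'n, 'r) metric) \<Rightarrow> complex" where
  "M_Z_along X E \<omega> \<rho> U \<gamma> =
     integral_over X (\<lambda>i z v. trace
       (charge_form (\<lambda>d. complex_of_real (Im (cis (- phase X E \<omega> \<rho> U) * \<rho> d))) (\<omega> i) (\<lambda>k. U k i)
          (\<lambda>k. bott_chern \<gamma> k i) z v))"

definition M_Z ::
  "('a::t2_space, 'i, 'n::finite) atlas \<Rightarrow> ('a, 'i, 'r::finite) cocycle \<Rightarrow>
   ('i, 'n, complex) form \<Rightarrow> (nat \<Rightarrow> complex) \<Rightarrow> (nat \<Rightarrow> ('i, 'n, complex) form) \<Rightarrow>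
   ('i, 'n, 'r) metric \<Rightarrow> ('i, 'n, 'r) metric \<Rightarrow> complex" where
  "M_Z X E \<omega> \<rho> U h h' = M_Z_along X E \<omega> \<rho> U (SOME \<gamma>. metric_path X E h' h \<gamma>)"

text \<open>Criticality on the space of Hermitian metrics: the derivative vanishes in every direction.\<close>
definition critical_point ::
  "('a, 'i, 'n::finite) atlas \<Rightarrow> ('a, 'i, 'r::finite) cocycle \<Rightarrow>
   (('i, 'n, 'r) metric \<Rightarrow> complex) \<Rightarrow> ('i, 'n, 'r) metric \<Rightarrow> bool" where
  "critical_point X E M h \<longleftrightarrow>
     (\<forall>\<gamma>. metric_curve X E \<gamma> \<and> same_metric X (\<gamma> 0) h \<longrightarrow>
        ((\<lambda>s. M (\<gamma> s)) has_vector_derivative 0) (at 0))"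

end

theory Submission
  imports Defs "HOL-Complex_Analysis.Conformal_Mappings"
begin

text \<open>
  The derivative of \<open>M\<^sub>Z\<close> along a curve of metrics is the one-form \<open>\<Theta>\<^sub>h(A) = \<integral> tr (A D\<^sub>Z(h))\<close>,
  \<open>A = h\<^sup>-\<^sup>1 dh\<close>, on the space of metrics, provided that \<open>\<Theta>\<close> is closed: then its integral
  over a path depends on the end points only. The integrand of \<open>d\<Theta>\<close> at \<open>(A, B)\<close> is a sum of words
  in \<open>A\<close>, \<open>B\<close>, the curvature, \<open>\<omega>\<close> and \<open>U\<close>, in which \<open>d F = \<partial>-bar \<partial>\<^sub>h B\<close> along \<open>B\<close>. By a partition
  of unity it suffices to treat \<open>A\<close> with compact support in one chart, and there the words add up to
  a divergence: the Bianchi identity and the closedness of \<open>\<omega>\<close> and of all \<open>(p,q)\<close>-parts of \<open>U\<close>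
  remove the terms where another factor is differentiated, and the commutators that remain cancel
  because \<open>tr ([A, B] F\<^sup>j) = \<Sum> tr (B F \<cdots> [F, A] \<cdots> F)\<close>.

  A metric with \<open>D\<^sub>Z = 0\<close> is therefore critical. Conversely the curvature is self-adjoint, hence so is
  \<open>D\<^sub>Z\<close>, and testing \<open>\<Theta>\<^sub>h = 0\<close> with a cut-off of \<open>h T h\<close>, where \<open>T\<close> is the coefficient of \<open>D\<^sub>Z(h)\<close> in
  a chart, gives \<open>\<integral> \<chi> tr ((h T)\<^sup>* (h T)) = 0\<close>.
\<close>

text \<open>Forms are functions of tuples of tangent vectors and wedge products are fully expanded,
  so every nested product is first collapsed into one unnormalised antisymmetrisation
  \<open>altz\<close> of a word. Curvature and \<omega> occupy pairs of slots, and permuting pairs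
  of slots is even; hence factors move past each other without signs, and cyclicity of the trace
  does the rest. The divergence in question mixes types: one word is differentiated by
  \<partial>-bar, another by \<partial>. The factors that are left over must vanish for each type
  separately, which dU = 0 alone does not give; this is where the \<partial>-closedness of U enters.
  The space of metrics is never treated as a manifold. Only smooth families with finitely many
  parameters occur: closedness is the symmetry of the mixed derivatives of a two-parameter family,
  and Stokes on a square yields both path independence and the first variation. Localising an
  integral in a chart requires the change of variables formula without absolute values, that is,
  holomorphic transitions with positive real Jacobian.\<close>

abbreviation (input) swp :: "'v \<Rightarrow> 'v \<Rightarrow> 'v \<Rightarrow> 'v" where "swp \<equiv> Transposition.transpose"
abbreviation (input) ev :: "(nat \<Rightarrow> 'v) \<Rightarrow> nat \<Rightarrow> 'v" where "ev w i \<equiv> w (2 * i)"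
abbreviation (input) od :: "(nat \<Rightarrow> 'v) \<Rightarrow> nat \<Rightarrow> 'v" where "od w i \<equiv> w (Suc (2 * i))"
type_synonym 'r mtx = "complex^'r^'r"
type_synonym 'n pt = "complex^'n"
type_synonym ('n, 'a) bil = "'n pt \<Rightarrow> 'n pt \<Rightarrow> 'a"
text \<open>The circle about 0 in the parametrisation of \<open>circlepath\<close>.\<close>

abbreviation (input) circ :: "real \<Rightarrow> real \<Rightarrow> complex" where "circ r t \<equiv> of_real r * exp (2 * of_real pi * \<i> * of_real t)"
text \<open>The slot layout of all charge words: the first j pairs of slots belong to the curvature
  factors, the next d pairs to \<omega>, and all later slots to \<open>u\<close>.\<close>

abbreviation (input) spart :: "('v \<Rightarrow> 'v \<Rightarrow> complex) \<Rightarrow> ((nat \<Rightarrow> 'v) \<Rightarrow> complex) \<Rightarrow> nat \<Rightarrow> nat \<Rightarrow> (nat \<Rightarrow> 'v) \<Rightarrow> complex" where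
  "spart om u j d w \<equiv> (\<Prod>i<d. om (w (2 * (j + i))) (w (Suc (2 * (j + i))))) * u (\<lambda>k. w (2 * (j + d) + k))"

section \<open>Calculus of smooth functions\<close>

abbreviation dd :: "'a::real_normed_vector \<Rightarrow> ('a \<Rightarrow> 'b::real_normed_vector) \<Rightarrow> 'a \<Rightarrow> 'b" where
  "dd v f x \<equiv> frechet_derivative f (at x) v"

lemma dd_cong_open:
  assumes "open S" "x \<in> S" "\<And>y. y \<in> S \<Longrightarrow> f y = g y"
  shows "frechet_derivative f (at x) = frechet_derivative g (at x)"
proof -
  have "(f has_derivative D) (at x) \<longleftrightarrow> (g has_derivative D) (at x)" for D
    using assms has_derivative_transform_within_open by metis
  then show ?thesis by (simp add: frechet_derivative_def)
qed

lemma dd_eq: "(f has_derivative D) (at x) \<Longrightarrow> dd v f x = D v"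
  by (metis frechet_derivative_at)

lemma Ck_on_cong:
  assumes "open S" "\<And>x. x \<in> S \<Longrightarrow> f x = g x"
  shows "Ck_on k f S \<longleftrightarrow> Ck_on k g S"
  using assms(2)
proof (induction k arbitrary: f g)
  case 0
  then show ?case by (auto intro: continuous_on_cong)
next
  case (Suc k)
  have "f differentiable_on S \<longleftrightarrow> g differentiable_on S"
    using Suc.prems by (simp add: differentiable_on_def differentiable_def)
      (metis (no_types, lifting) has_derivative_transform)
  moreover have "Ck_on k (dd v f) S \<longleftrightarrow> Ck_on k (dd v g) S" for v
    by (rule Suc.IH) (metis dd_cong_open Suc.prems assms(1))
  ultimately show ?case by simp
qed

lemma smooth_on_cong:
  assumes "open S" "\<And>x. x \<in> S \<Longrightarrow> f x = g x"
  shows "smooth_on f S \<longleftrightarrow> smooth_on g S"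
  using Ck_on_cong[OF assms] by (simp add: smooth_on_def)

lemma Ck_on_Suc_D: "Ck_on (Suc k) f S \<Longrightarrow> Ck_on k f S"
proof (induction k arbitrary: f)
  case 0
  then show ?case by (auto intro: differentiable_imp_continuous_on)
next
  case (Suc k)
  then show ?case by (metis Ck_on.simps(2))
qed

lemma smooth_on_iff:
  "smooth_on f S \<longleftrightarrow> f differentiable_on S \<and> (\<forall>v. smooth_on (dd v f) S)"
  unfolding smooth_on_def by (metis Ck_on.simps(2) Ck_on_Suc_D)

lemma smooth_on_dd: "smooth_on f S \<Longrightarrow> smooth_on (dd v f) S"
  by (metis smooth_on_iff)

lemma smooth_on_continuous: "smooth_on f S \<Longrightarrow> continuous_on S f"
  using smooth_on_def Ck_on.simps(1) by blast

lemma smooth_on_has_derivative: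
  assumes "smooth_on f S" "open S" "x \<in> S"
  shows "(f has_derivative (\<lambda>v. dd v f x)) (at x)"
  using assms smooth_on_iff[of f S]
  by (simp add: differentiable_on_eq_differentiable_at frechet_derivative_works)

lemma Ck_on_has_derivative:
  assumes "Ck_on (Suc k) f S" "open S" "x \<in> S"
  shows "(f has_derivative (\<lambda>v. dd v f x)) (at x)"
  using assms by (simp add: differentiable_on_eq_differentiable_at frechet_derivative_works)

lemma differentiable_onI_at:
  "(\<And>x. x \<in> S \<Longrightarrow> \<exists>D. (f has_derivative D) (at x)) \<Longrightarrow> f differentiable_on S"
  by (meson differentiable_at_imp_differentiable_on differentiable_def)

lemma Ck_on_SucI:
  assumes "open S" "\<And>x. x \<in> S \<Longrightarrow> (f has_derivative D x) (at x)" "\<And>v. Ck_on k (\<lambda>x. D x v) S"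
  shows "Ck_on (Suc k) f S"
  using assms differentiable_onI_at[of S f] Ck_on_cong[OF assms(1), of "dd _ f" "\<lambda>x. D x _" k]
  by (simp add: dd_eq[OF assms(2)]) blast

text \<open>A class of functions closed under directional derivatives consists of smooth functions:
  the C^k property is proved by induction on k for the whole class at once. It is applied to
  multiples of powers of the inverse, to polynomials in 1/x times exp(-1/x), and to holomorphic
  functions.\<close>

lemma smooth_on_coinduct:
  assumes S: "open S" and P: "P f"
    and step: "\<And>f. P f \<Longrightarrow> \<exists>D. (\<forall>x\<in>S. (f has_derivative D x) (at x)) \<and> (\<forall>v. P (\<lambda>x. D x v))"
  shows "smooth_on f S"
proof -
  have "\<forall>f. P f \<longrightarrow> Ck_on k f S" for k
  proof (induction k)
    case 0
    show ?case using step
      by (metis Ck_on.simps(1) has_derivative_at_withinI has_derivative_continuous_on)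
  next
    case (Suc k)
    then show ?case using step Ck_on_SucI[OF S] by metis
  qed
  then show ?thesis using P by (simp add: smooth_on_def)
qed

lemma smooth_on_subset: "smooth_on f T \<Longrightarrow> S \<subseteq> T \<Longrightarrow> smooth_on f S"
proof -
  assume "S \<subseteq> T"
  then have "Ck_on k f T \<longrightarrow> Ck_on k f S" for k
    by (induction k arbitrary: f) (auto intro: continuous_on_subset differentiable_on_subset)
  then show "smooth_on f T \<Longrightarrow> smooth_on f S" by (auto simp: smooth_on_def)
qed

lemma Ck_on_UN:
  assumes "\<And>S. S \<in> \<S> \<Longrightarrow> open S" "\<And>S. S \<in> \<S> \<Longrightarrow> Ck_on k f S"
  shows "Ck_on k f (\<Union>\<S>)"
  using assms(2)
proof (induction k arbitrary: f)
  case 0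
  then show ?case using assms(1) by (simp add: continuous_on_open_Union)
next
  case (Suc k)
  then have "f differentiable_on \<Union>\<S>"
    using assms(1) by (auto simp: differentiable_on_eq_differentiable_at open_Union)
  then show ?case using Suc by simp
qed

lemma smooth_on_locally:
  assumes "\<And>x. x \<in> S \<Longrightarrow> \<exists>T. open T \<and> x \<in> T \<and> smooth_on f T"
  shows "smooth_on f S"
proof -
  let ?\<S> = "{T. open T \<and> smooth_on f T}"
  have "smooth_on f (\<Union>?\<S>)"
    unfolding smooth_on_def using Ck_on_UN[of ?\<S>] by (auto simp: smooth_on_def)
  moreover have "S \<subseteq> \<Union>?\<S>" using assms by blast
  ultimately show ?thesis by (rule smooth_on_subset)
qed

section \<open>Closure properties of smooth functions\<close>

lemma Ck_on_const: "Ck_on k (\<lambda>x. c) S"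
  by (induction k arbitrary: c) (auto simp: frechet_derivative_const)

lemma smooth_on_const [simp, intro]: "smooth_on (\<lambda>x. c) S"
  by (simp add: smooth_on_def Ck_on_const)

lemma smooth_on_linear:
  assumes "bounded_linear f"
  shows "smooth_on f S"
proof -
  have "dd v f = (\<lambda>x. f v)" for v
    using assms bounded_linear_imp_has_derivative dd_eq by blast
  moreover have "f differentiable_on S"
    using assms bounded_linear_imp_differentiable differentiable_at_imp_differentiable_on by blast
  ultimately show ?thesis using smooth_on_iff[of f S] by simp
qed

lemma smooth_on_ident [simp, intro]: "smooth_on (\<lambda>x. x) S"
  by (rule smooth_on_linear) (rule bounded_linear_ident)

lemma Ck_on_bounded_linear:
  assumes L: "bounded_linear L" and S: "open S" and f: "Ck_on k f S"
  shows "Ck_on k (\<lambda>x. L (f x)) S"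
  using f
proof (induction k arbitrary: f)
  case 0
  then show ?case using L by (simp add: bounded_linear.continuous_on)
next
  case (Suc k)
  show ?case
    by (rule Ck_on_SucI[OF S, where D = "\<lambda>x v. L (dd v f x)"],
        rule bounded_linear.has_derivative[OF L Ck_on_has_derivative[OF Suc.prems S]])
      (use Suc in auto)
qed

lemma Ck_on_add:
  assumes S: "open S" and f: "Ck_on k f S" and g: "Ck_on k g S"
  shows "Ck_on k (\<lambda>x. f x + g x) S"
  using f g
proof (induction k arbitrary: f g)
  case 0
  then show ?case by (auto intro: continuous_intros)
next
  case (Suc k)
  show ?case
  proof (rule Ck_on_SucI[OF S, where D = "\<lambda>x v. dd v f x + dd v g x"])
    show "((\<lambda>x. f x + g x) has_derivative (\<lambda>v. dd v f x + dd v g x)) (at x)" if "x \<in> S" for x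
      by (intro has_derivative_add Ck_on_has_derivative[OF _ S that, where k = k] Suc.prems)
    show "Ck_on k (\<lambda>x. dd v f x + dd v g x) S" for v
      by (rule Suc.IH) (use Suc.prems in auto)
  qed
qed

lemma Ck_on_bilinear:
  assumes B: "bounded_bilinear B" and S: "open S" and f: "Ck_on k f S" and g: "Ck_on k g S"
  shows "Ck_on k (\<lambda>x. B (f x) (g x)) S"
  using f g
proof (induction k arbitrary: f g)
  case 0
  then show ?case using B by (simp add: bounded_bilinear.continuous_on)
next
  case (Suc k)
  show ?case
  proof (rule Ck_on_SucI[OF S, where D = "\<lambda>x v. B (f x) (dd v g x) + B (dd v f x) (g x)"])
    show "((\<lambda>x. B (f x) (g x)) has_derivative (\<lambda>v. B (f x) (dd v g x) + B (dd v f x) (g x))) (at x)"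
      if "x \<in> S" for x
      by (intro bounded_bilinear.FDERIV[OF B] Ck_on_has_derivative[OF _ S that, where k = k] Suc.prems)
    show "Ck_on k (\<lambda>x. B (f x) (dd v g x) + B (dd v f x) (g x)) S" for v
      by (intro Ck_on_add[OF S] Suc.IH Suc.prems[THEN Ck_on_Suc_D]) (use Suc.prems in auto)
  qed
qed

lemma smooth_on_bounded_linear:
  "bounded_linear L \<Longrightarrow> open S \<Longrightarrow> smooth_on f S \<Longrightarrow> smooth_on (\<lambda>x. L (f x)) S"
  by (simp add: smooth_on_def Ck_on_bounded_linear)

lemma smooth_on_bilinear:
  "bounded_bilinear B \<Longrightarrow> open S \<Longrightarrow> smooth_on f S \<Longrightarrow> smooth_on g S \<Longrightarrow> smooth_on (\<lambda>x. B (f x) (g x)) S"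
  by (simp add: smooth_on_def Ck_on_bilinear)

lemma smooth_on_add: "open S \<Longrightarrow> smooth_on f S \<Longrightarrow> smooth_on g S \<Longrightarrow> smooth_on (\<lambda>x. f x + g x) S"
  by (simp add: smooth_on_def Ck_on_add)

lemma smooth_on_minus: "open S \<Longrightarrow> smooth_on f S \<Longrightarrow> smooth_on (\<lambda>x. - f x) S"
  using smooth_on_bounded_linear[OF bounded_linear_minus[OF bounded_linear_ident]] by blast

lemma smooth_on_diff: "open S \<Longrightarrow> smooth_on f S \<Longrightarrow> smooth_on g S \<Longrightarrow> smooth_on (\<lambda>x. f x - g x) S"
  using smooth_on_add[of S f "\<lambda>x. - g x"] smooth_on_minus[of S g] by simp

lemma smooth_on_sum:
  "open S \<Longrightarrow> (\<And>i. i \<in> I \<Longrightarrow> smooth_on (f i) S) \<Longrightarrow> smooth_on (\<lambda>x. \<Sum>i\<in>I. f i x) S"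
  by (induction I rule: infinite_finite_induct) (auto intro: smooth_on_add)

lemma smooth_on_mult:
  fixes f g :: "'a::real_normed_vector \<Rightarrow> 'b::real_normed_algebra"
  shows "open S \<Longrightarrow> smooth_on f S \<Longrightarrow> smooth_on g S \<Longrightarrow> smooth_on (\<lambda>x. f x * g x) S"
  by (rule smooth_on_bilinear[OF bounded_bilinear_mult])

lemma smooth_on_scaleR:
  "open S \<Longrightarrow> smooth_on f S \<Longrightarrow> smooth_on g S \<Longrightarrow> smooth_on (\<lambda>x. f x *\<^sub>R g x) S"
  by (rule smooth_on_bilinear[OF bounded_bilinear_scaleR])

lemma smooth_on_prod:
  fixes f :: "'i \<Rightarrow> 'a::real_normed_vector \<Rightarrow> 'b::{real_normed_algebra,comm_ring_1}"
  shows "open S \<Longrightarrow> (\<And>i. i \<in> I \<Longrightarrow> smooth_on (f i) S) \<Longrightarrow> smooth_on (\<lambda>x. \<Prod>i\<in>I. f i x) S"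
  by (induction I rule: infinite_finite_induct) (auto intro: smooth_on_mult)

lemma smooth_on_power:
  fixes f :: "'a::real_normed_vector \<Rightarrow> 'b::{real_normed_algebra,comm_ring_1}"
  shows "open S \<Longrightarrow> smooth_on f S \<Longrightarrow> smooth_on (\<lambda>x. f x ^ k) S"
  by (induction k) (auto intro: smooth_on_mult)

text \<open>The chain rule differentiates \<open>f\<close> in the direction \<open>dd v g x\<close>,
  which varies with x, while \<open>Ck_on\<close> speaks about fixed directions. Expanding this
  direction in \<open>Basis\<close> leaves derivatives of \<open>f\<close> in fixed directions, to
  which the induction hypothesis applies.\<close>

lemma Ck_on_compose:
  fixes f :: "'b::euclidean_space \<Rightarrow> 'c::real_normed_vector"
  assumes S: "open S" and T: "open T" and gT: "\<And>x. x \<in> S \<Longrightarrow> g x \<in> T"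
    and f: "Ck_on k f T" and g: "smooth_on g S"
  shows "Ck_on k (\<lambda>x. f (g x)) S"
  using f
proof (induction k arbitrary: f)
  case 0
  then show ?case using smooth_on_continuous[OF g] gT by (auto intro: continuous_on_compose2)
next
  case (Suc k)
  show ?case
  proof (rule Ck_on_SucI[OF S, where D = "\<lambda>x v. \<Sum>b\<in>Basis. (dd v g x \<bullet> b) *\<^sub>R dd b f (g x)"])
    fix x assume x: "x \<in> S"
    have f': "(f has_derivative (\<lambda>v. dd v f (g x))) (at (g x))"
      using Ck_on_has_derivative[OF Suc.prems T gT[OF x]] .
    have *: "dd w f (g x) = (\<Sum>b\<in>Basis. (w \<bullet> b) *\<^sub>R dd b f (g x))" for w
    proof -
      interpret linear "\<lambda>v. dd v f (g x)" using f' by (rule has_derivative_linear)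
      have "dd w f (g x) = dd (\<Sum>b\<in>Basis. (w \<bullet> b) *\<^sub>R b) f (g x)" by (simp add: euclidean_representation)
      then show ?thesis by (simp add: sum scale)
    qed
    have "((\<lambda>x. f (g x)) has_derivative (\<lambda>v. dd (dd v g x) f (g x))) (at x)"
      using has_derivative_compose[OF smooth_on_has_derivative[OF g S x] f'] by simp
    moreover have "(\<lambda>v. dd (dd v g x) f (g x)) = (\<lambda>v. \<Sum>b\<in>Basis. (dd v g x \<bullet> b) *\<^sub>R dd b f (g x))"
      by (rule ext) (rule *)
    ultimately show "((\<lambda>x. f (g x)) has_derivative (\<lambda>v. \<Sum>b\<in>Basis. (dd v g x \<bullet> b) *\<^sub>R dd b f (g x))) (at x)"
      by simp
  next
    have *: "Ck_on k (\<lambda>x. \<Sum>b\<in>B. h b x) S" if "\<And>b. b \<in> B \<Longrightarrow> Ck_on k (h b) S" for B :: "'b set" and h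
      using that by (induction B rule: infinite_finite_induct) (auto intro: Ck_on_add[OF S] simp: Ck_on_const)
    fix v
    have "Ck_on k (dd v g) S" "Ck_on k (dd b f) T" for b
      using smooth_on_dd[OF g] Suc.prems by (auto simp: smooth_on_def)
    then show "Ck_on k (\<lambda>x. \<Sum>b\<in>Basis. (dd v g x \<bullet> b) *\<^sub>R dd b f (g x)) S"
      by (intro * Ck_on_bilinear[OF bounded_bilinear_scaleR S]
          Ck_on_bounded_linear[OF bounded_linear_inner_left S] Suc.IH) auto
  qed
qed

lemma smooth_on_compose:
  fixes f :: "'b::euclidean_space \<Rightarrow> 'c::real_normed_vector"
  assumes "open S" "open T" "\<And>x. x \<in> S \<Longrightarrow> g x \<in> T" "smooth_on f T" "smooth_on g S"
  shows "smooth_on (\<lambda>x. f (g x)) S"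
  using Ck_on_compose[OF assms(1-3) _ assms(5)] assms(4) unfolding smooth_on_def by blast

text \<open>The functions c x^-n form a class closed under differentiation.\<close>

lemma smooth_on_inverse_field: "smooth_on (inverse :: 'a::real_normed_field \<Rightarrow> 'a) (- {0})"
proof (rule smooth_on_coinduct[where P = "\<lambda>f. \<exists>c n. f = (\<lambda>x. c * inverse x ^ n)"])
  show "\<exists>c n. (inverse :: 'a \<Rightarrow> 'a) = (\<lambda>x. c * inverse x ^ n)"
    by (rule exI[of _ 1], rule exI[of _ 1]) auto
next
  fix f :: "'a \<Rightarrow> 'a" assume "\<exists>c n. f = (\<lambda>x. c * inverse x ^ n)"
  then obtain c n where f: "f = (\<lambda>x. c * inverse x ^ n)" by blast
  have d: "(f has_derivative (\<lambda>v. - (c * of_nat n * v) * inverse x ^ (n + 1))) (at x)" if "x \<noteq> 0" for x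
    unfolding f by (rule derivative_eq_intros refl that | simp)+
      (cases n; simp add: fun_eq_iff field_simps)
  show "\<exists>D. (\<forall>x\<in>- {0}. (f has_derivative D x) (at x)) \<and> (\<forall>v. \<exists>c n. (\<lambda>x. D x v) = (\<lambda>x. c * inverse x ^ n))"
    by (rule exI[of _ "\<lambda>x v. - (c * of_nat n * v) * inverse x ^ (n + 1)"]) (use d in blast)
qed auto

lemma smooth_on_inverse:
  fixes f :: "'a::real_normed_vector \<Rightarrow> 'b::{real_normed_field,euclidean_space}"
  assumes "open S" "smooth_on f S" "\<And>x. x \<in> S \<Longrightarrow> f x \<noteq> 0"
  shows "smooth_on (\<lambda>x. inverse (f x)) S"
  by (rule smooth_on_compose[OF assms(1) _ _ smooth_on_inverse_field assms(2)]) (use assms in auto)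

lemma smooth_on_divide:
  fixes f :: "'a::real_normed_vector \<Rightarrow> 'b::{real_normed_field,euclidean_space}"
  assumes "open S" "smooth_on f S" "smooth_on g S" "\<And>x. x \<in> S \<Longrightarrow> g x \<noteq> 0"
  shows "smooth_on (\<lambda>x. f x / g x) S"
  unfolding divide_inverse by (intro smooth_on_mult smooth_on_inverse assms)

lemma bounded_linear_axis: "bounded_linear (axis i :: 'b::real_normed_vector \<Rightarrow> 'b^'n::finite)"
proof (rule bounded_linear_intro[where K = 1])
  show "axis i (x + y) = axis i x + axis i y" for x y :: 'b
    by (simp add: axis_def vec_eq_iff)
  show "axis i (r *\<^sub>R x) = r *\<^sub>R axis i x" for r and x :: 'b
    by (simp add: axis_def vec_eq_iff)
  show "norm (axis i x) \<le> norm x * 1" for x :: 'b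
    by (simp add: norm_vec_def L2_set_def axis_def if_distrib[where f = norm] if_distrib[where f = "\<lambda>x. x ^ 2"] sum.delta cong: if_cong)
qed

lemma vec_eq_sum_axis: "(x::'b::real_normed_vector^'n::finite) = (\<Sum>i\<in>UNIV. axis i (x $ i))"
  by (simp add: vec_eq_iff axis_def if_distrib sum.delta cong: if_cong)

lemma smooth_on_vec_nth: "open S \<Longrightarrow> smooth_on f S \<Longrightarrow> smooth_on (\<lambda>x. f x $ i) S"
  by (rule smooth_on_bounded_linear[OF bounded_linear_vec_nth])

lemma smooth_on_vecI:
  fixes f :: "'a::real_normed_vector \<Rightarrow> 'b::real_normed_vector^'n::finite"
  assumes "open S" "\<And>i. smooth_on (\<lambda>x. f x $ i) S"
  shows "smooth_on f S"
proof -
  have "smooth_on (\<lambda>x. \<Sum>i\<in>UNIV. axis i (f x $ i)) S"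
    by (intro smooth_on_sum smooth_on_bounded_linear[OF bounded_linear_axis] assms)
  then show ?thesis by (simp flip: vec_eq_sum_axis)
qed

lemma smooth_on_fst: "open S \<Longrightarrow> smooth_on f S \<Longrightarrow> smooth_on (\<lambda>x. fst (f x)) S"
  by (rule smooth_on_bounded_linear[OF bounded_linear_fst])

lemma smooth_on_snd: "open S \<Longrightarrow> smooth_on f S \<Longrightarrow> smooth_on (\<lambda>x. snd (f x)) S"
  by (rule smooth_on_bounded_linear[OF bounded_linear_snd])

lemma smooth_on_Pair:
  assumes "open S" "smooth_on f S" "smooth_on g S"
  shows "smooth_on (\<lambda>x. (f x, g x)) S"
proof -
  have "smooth_on (\<lambda>x. (f x, 0) + (0, g x)) S"
    by (intro smooth_on_add smooth_on_bounded_linear[where L = "\<lambda>y. (y, 0)"]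
        smooth_on_bounded_linear[where L = "\<lambda>y. (0, y)"] assms bounded_linear_Pair
        bounded_linear_ident bounded_linear_zero)
  then show ?thesis by simp
qed

text \<open>The mean value theorem twice: in the direction u for the difference \<phi> of two
  parallel segments, then in the direction v. The second difference is symmetric in u and v up to
  the order of two terms, so it computes both mixed derivatives.\<close>

lemma second_difference:
  fixes f :: "'a::euclidean_space \<Rightarrow> real"
  assumes S: "open S" and f: "smooth_on f S" and h: "0 < h"
    and box: "\<And>a b. 0 \<le> a \<Longrightarrow> a \<le> h \<Longrightarrow> 0 \<le> b \<Longrightarrow> b \<le> h \<Longrightarrow> x + a *\<^sub>R u + b *\<^sub>R v \<in> S"
  shows "\<exists>a b. 0 < a \<and> a < h \<and> 0 < b \<and> b < h \<and>
    f (x + h *\<^sub>R u + h *\<^sub>R v) - f (x + h *\<^sub>R u) - f (x + h *\<^sub>R v) + f x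
      = h * (h * dd v (dd u f) (x + a *\<^sub>R u + b *\<^sub>R v))"
proof -
  have d: "((\<lambda>s. g (p + s *\<^sub>R w)) has_field_derivative dd w g (p + s *\<^sub>R w)) (at s)"
    if "smooth_on g S" "p + s *\<^sub>R w \<in> S" for g :: "'a \<Rightarrow> real" and p w s
  proof -
    have D: "(g has_derivative (\<lambda>v. dd v g (p + s *\<^sub>R w))) (at (p + s *\<^sub>R w))"
      using smooth_on_has_derivative[OF that(1) S that(2)] .
    have "((\<lambda>s. g (p + s *\<^sub>R w)) has_derivative (\<lambda>r. dd (r *\<^sub>R w) g (p + s *\<^sub>R w))) (at s)"
      by (rule has_derivative_compose[where f = "\<lambda>s. p + s *\<^sub>R w" and x = s, OF _ D])
        (auto intro!: derivative_eq_intros)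
    moreover have "dd (r *\<^sub>R w) g (p + s *\<^sub>R w) = r * dd w g (p + s *\<^sub>R w)" for r
      using linear_scale[OF has_derivative_linear[OF D]] by simp
    ultimately show ?thesis by (simp add: has_field_derivative_def mult.commute[of _ "dd w g _"])
  qed
  define \<phi> where "\<phi> s = f (x + h *\<^sub>R v + s *\<^sub>R u) - f (x + s *\<^sub>R u)" for s
  have in1: "x + h *\<^sub>R v + s *\<^sub>R u \<in> S" "x + s *\<^sub>R u \<in> S" if "0 \<le> s" "s \<le> h" for s
    using box[of s h] box[of s 0] that h by (auto simp: algebra_simps)
  have "\<exists>a. 0 < a \<and> a < h \<and> \<phi> h - \<phi> 0 = (h - 0) * (dd u f (x + h *\<^sub>R v + a *\<^sub>R u) - dd u f (x + a *\<^sub>R u))"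
    unfolding \<phi>_def by (rule MVT2[OF h]) (intro DERIV_diff d f in1; simp)
  then obtain a where a: "0 < a" "a < h"
    and *: "\<phi> h - \<phi> 0 = h * (dd u f (x + h *\<^sub>R v + a *\<^sub>R u) - dd u f (x + a *\<^sub>R u))" by auto
  have "\<exists>b. 0 < b \<and> b < h \<and> dd u f ((x + a *\<^sub>R u) + h *\<^sub>R v) - dd u f ((x + a *\<^sub>R u) + 0 *\<^sub>R v)
      = (h - 0) * dd v (dd u f) (x + a *\<^sub>R u + b *\<^sub>R v)"
    by (rule MVT2[OF h]) (rule d, rule smooth_on_dd[OF f], rule box; use a in simp)
  then obtain b where b: "0 < b" "b < h"
    and **: "dd u f ((x + a *\<^sub>R u) + h *\<^sub>R v) - dd u f (x + a *\<^sub>R u)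
      = h * dd v (dd u f) (x + a *\<^sub>R u + b *\<^sub>R v)" by auto
  have e: "x + h *\<^sub>R v + a *\<^sub>R u = (x + a *\<^sub>R u) + h *\<^sub>R v" "x + h *\<^sub>R v + h *\<^sub>R u = x + h *\<^sub>R u + h *\<^sub>R v" by auto
  show ?thesis using a b * ** unfolding \<phi>_def e
    by (intro exI[of _ a] exI[of _ b]) (simp add: algebra_simps)
qed

text \<open>If the two mixed derivatives differed at x, continuity would separate their values near
  x; but a small second difference equals h^2 times a nearby value of either one.\<close>

lemma dd_commute_real:
  fixes f :: "'a::euclidean_space \<Rightarrow> real"
  assumes S: "open S" and f: "smooth_on f S" and x: "x \<in> S"
  shows "dd v (dd u f) x = dd u (dd v f) x"
proof (rule ccontr)
  assume ne: "\<not> ?thesis"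
  define e where "e = \<bar>dd v (dd u f) x - dd u (dd v f) x\<bar> / 2"
  have e: "e > 0" using ne by (simp add: e_def)
  have c: "isCont (dd v (dd u f)) x" "isCont (dd u (dd v f)) x"
    using smooth_on_continuous[OF smooth_on_dd[OF smooth_on_dd[OF f]]] S x
    by (auto simp: continuous_on_eq_continuous_at)
  obtain r where r: "r > 0" "ball x r \<subseteq> S"
    "\<And>y. dist y x < r \<Longrightarrow> dist (dd v (dd u f) y) (dd v (dd u f) x) < e"
    "\<And>y. dist y x < r \<Longrightarrow> dist (dd u (dd v f) y) (dd u (dd v f) x) < e"
  proof -
    obtain r1 where "r1 > 0" "ball x r1 \<subseteq> S" using S x open_contains_ball by blast
    moreover obtain r2 where "r2 > 0" "\<And>y. dist y x < r2 \<Longrightarrow> dist (dd v (dd u f) y) (dd v (dd u f) x) < e"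
      using c(1) e unfolding continuous_at_eps_delta by metis
    moreover obtain r3 where "r3 > 0" "\<And>y. dist y x < r3 \<Longrightarrow> dist (dd u (dd v f) y) (dd u (dd v f) x) < e"
      using c(2) e unfolding continuous_at_eps_delta by metis
    ultimately show thesis by (intro that[of "min r1 (min r2 r3)"]) auto
  qed
  \<comment> \<open>Small enough that the parallelogram spanned by h u and h v at x stays in the
    ball of radius r; the summand 1 keeps the denominator positive when u and v vanish.\<close>
  define h where "h = r / (2 * (norm u + norm v + 1))"
  have h: "h > 0" using r by (simp add: h_def add_nonneg_pos)
  have near: "dist (x + a *\<^sub>R u + b *\<^sub>R v) x < r" if "0 \<le> a" "a \<le> h" "0 \<le> b" "b \<le> h" for a b
  proof -
    have "dist (x + a *\<^sub>R u + b *\<^sub>R v) x \<le> norm (a *\<^sub>R u) + norm (b *\<^sub>R v)"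
      by (simp add: dist_norm) (metis norm_scaleR norm_triangle_ineq)
    also have "\<dots> \<le> h * norm u + h * norm v" using that by (simp add: add_mono mult_right_mono)
    also have "\<dots> < 2 * h * (norm u + norm v + 1)" using h
      by (simp add: algebra_simps) (smt (verit) mult_nonneg_nonneg norm_ge_zero)
    also have "\<dots> = r"
    proof -
      have "norm u + norm v + 1 \<noteq> 0" by (smt (verit) norm_ge_zero)
      then show ?thesis by (simp add: h_def del: distrib_left_numeral)
    qed
    finally show ?thesis .
  qed
  have near': "x + a *\<^sub>R u + b *\<^sub>R v \<in> S" if "0 \<le> a" "a \<le> h" "0 \<le> b" "b \<le> h" for a b
    using near[OF that] r(2) by (auto simp: dist_commute)
  obtain a b where ab: "0 < a" "a < h" "0 < b" "b < h"
    "f (x + h *\<^sub>R u + h *\<^sub>R v) - f (x + h *\<^sub>R u) - f (x + h *\<^sub>R v) + f x = h * (h * dd v (dd u f) (x + a *\<^sub>R u + b *\<^sub>R v))"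
    using second_difference[OF S f h near'] by blast
  have "x + a *\<^sub>R v + b *\<^sub>R u \<in> S" if "0 \<le> a" "a \<le> h" "0 \<le> b" "b \<le> h" for a b
    using near'[of b a] that by (simp add: add_ac)
  then obtain a' b' where ab': "0 < a'" "a' < h" "0 < b'" "b' < h"
    "f (x + h *\<^sub>R v + h *\<^sub>R u) - f (x + h *\<^sub>R v) - f (x + h *\<^sub>R u) + f x = h * (h * dd u (dd v f) (x + a' *\<^sub>R v + b' *\<^sub>R u))"
    using second_difference[OF S f h, of x v u] by blast
  have "h * (h * dd v (dd u f) (x + a *\<^sub>R u + b *\<^sub>R v)) = h * (h * dd u (dd v f) (x + a' *\<^sub>R v + b' *\<^sub>R u))"
    using ab(5) ab'(5) by (simp add: add_ac algebra_simps)
  then have eq: "dd v (dd u f) (x + a *\<^sub>R u + b *\<^sub>R v) = dd u (dd v f) (x + b' *\<^sub>R u + a' *\<^sub>R v)"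
    using h by (simp add: add_ac)
  have 1: "dist (dd v (dd u f) (x + a *\<^sub>R u + b *\<^sub>R v)) (dd v (dd u f) x) < e"
    using ab by (intro r near) auto
  have 2: "dist (dd u (dd v f) (x + b' *\<^sub>R u + a' *\<^sub>R v)) (dd u (dd v f) x) < e"
    using ab' by (intro r near) auto
  have "dist (dd v (dd u f) x) (dd u (dd v f) x) < e + e"
    using dist_triangle_less_add[OF 1[unfolded dist_commute[of _ "dd v (dd u f) x"] eq] 2[unfolded dist_commute[of _ "dd u (dd v f) x"]]] .
  then show False by (simp add: e_def dist_real_def)
qed

lemma dd_bounded_linear:
  assumes "bounded_linear L" "open S" "smooth_on f S" "x \<in> S"
  shows "dd v (\<lambda>x. L (f x)) x = L (dd v f x)"
  using bounded_linear.has_derivative[OF assms(1) smooth_on_has_derivative[OF assms(3,2,4)]]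
  by (rule dd_eq)

lemma dd_commute:
  fixes f :: "'a::euclidean_space \<Rightarrow> 'b::euclidean_space"
  assumes S: "open S" and f: "smooth_on f S" and x: "x \<in> S"
  shows "dd v (dd u f) x = dd u (dd v f) x"
proof (rule euclidean_eqI)
  fix b :: 'b assume "b \<in> Basis"
  have L: "bounded_linear (\<lambda>y::'b. y \<bullet> b)" by (rule bounded_linear_inner_left)
  have *: "dd u (dd v f) x \<bullet> b = dd u (dd v (\<lambda>x. f x \<bullet> b)) x" for u v
  proof -
    have "dd u (dd v f) x \<bullet> b = dd u (\<lambda>x. dd v f x \<bullet> b) x"
      using dd_bounded_linear[OF L S smooth_on_dd[OF f] x] by simp
    also have "\<dots> = dd u (dd v (\<lambda>x. f x \<bullet> b)) x"
      using dd_cong_open[OF S x, of "\<lambda>x. dd v f x \<bullet> b" "dd v (\<lambda>x. f x \<bullet> b)"]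
        dd_bounded_linear[OF L S f] by simp
    finally show ?thesis .
  qed
  show "dd v (dd u f) x \<bullet> b = dd u (dd v f) x \<bullet> b"
    unfolding * by (rule dd_commute_real[OF S smooth_on_bounded_linear[OF L S f] x])
qed

section \<open>Holomorphic functions are smooth\<close>

lemma holo_on_has_derivative:
  assumes "holo_on f S" "z \<in> S"
  shows "(f has_derivative (\<lambda>v. dd v f z)) (at z)" "dd (c *s v) f z = c * dd v f z"
  using assms unfolding holo_on_def by (metis frechet_derivative_at)+

lemma holo_on_continuous: "holo_on f S \<Longrightarrow> continuous_on S f"
  by (meson has_derivative_at_withinI has_derivative_continuous_on holo_on_has_derivative(1))

lemma norm_vector_smult: "norm (c *s v) = norm c * norm (v :: 'n::finite pt)"
  unfolding norm_vec_def L2_set_def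
  by (simp add: norm_mult power_mult_distrib real_sqrt_mult flip: sum_distrib_left)

lemma holo_on_line:
  assumes f: "holo_on f S" and z: "z + l *s v \<in> S"
  shows "((\<lambda>l. f (z + l *s v)) has_field_derivative dd v f (z + l *s v)) (at l)"
proof -
  have bl: "bounded_linear (\<lambda>l::complex. l *s v)"
    by (rule bounded_linear_intro[where K = "norm v"])
      (auto simp: vec_eq_iff algebra_simps norm_vector_smult scaleR_conv_of_real[where 'a = complex])
  have "((\<lambda>l. f (z + l *s v)) has_derivative (\<lambda>m. dd (m *s v) f (z + l *s v))) (at l)"
    by (rule has_derivative_compose[where f = "\<lambda>l. z + l *s v" and x = l, OF _ holo_on_has_derivative(1)[OF f z]])
      (auto intro!: derivative_eq_intros bounded_linear_imp_has_derivative[OF bl])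
  then show ?thesis
    unfolding has_field_derivative_def holo_on_has_derivative(2)[OF f z] by (simp add: mult.commute[of _ "dd v f _"])
qed

text \<open>Cauchy's formula for the derivative on the complex line through z in direction v. It
  expresses a derivative by values of \<open>f\<close>, which is what turns mere pointwise
  differentiability into continuity and then smoothness.\<close>

lemma holo_on_dd_integral:
  fixes f :: "'n::finite pt \<Rightarrow> complex"
  assumes f: "holo_on f S" and r: "r > 0" and z: "\<And>l. norm l \<le> r \<Longrightarrow> z + l *s v \<in> S"
  shows "dd v f z = integral {0..1}
    (\<lambda>t. f (z + circ r t *s v) / circ r t)"
proof -
  let ?g = "\<lambda>l. f (z + l *s v)"
  have d: "(?g has_field_derivative dd v f (z + l *s v)) (at l)" if "norm l \<le> r" for l
    by (rule holo_on_line[OF f z[OF that]])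
  have "continuous_on (cball 0 r) ?g" "?g holomorphic_on ball 0 r"
  proof -
    show "continuous_on (cball 0 r) ?g"
      by (rule DERIV_continuous_on, rule has_field_derivative_at_within, rule d) simp
    show "?g holomorphic_on ball 0 r"
      unfolding holomorphic_on_def field_differentiable_def
    proof
      fix l :: complex assume "l \<in> ball 0 r"
      then have "norm l \<le> r" by simp
      from has_field_derivative_at_within[OF d[OF this]]
      show "\<exists>f'. (?g has_field_derivative f') (at l within ball 0 r)" ..
    qed
  qed
  then have "(?g has_field_derivative 1 / (2 * of_real pi * \<i>) * contour_integral (circlepath 0 r) (\<lambda>u. ?g u / (u - 0)^2)) (at 0)"
    using r by (intro Cauchy_derivative_integral_circlepath(2)) auto
  then have "dd v f z = 1 / (2 * of_real pi * \<i>) * contour_integral (circlepath 0 r) (\<lambda>u. ?g u / u^2)"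
    using d[of 0] r DERIV_unique by fastforce
  \<comment> \<open>The derivative of the path, 2 pi i times \<open>circ r t\<close>, cancels one of
    the two factors of u^2.\<close>
  also have "contour_integral (circlepath 0 r) (\<lambda>u. ?g u / u^2) =
     integral {0..1} (\<lambda>t. 2 * of_real pi * \<i> * (?g (circ r t) / circ r t))"
    unfolding contour_integral_integral vector_derivative_circlepath
    using r by (intro integral_cong) (simp add: circlepath power2_eq_square field_simps)
  finally show ?thesis by (simp del: times_divide_eq_right)
qed

text \<open>One radius serves all base points near \<open>z0\<close>, so the Cauchy integral runs
  over a fixed circle while the base point moves.\<close>

lemma holo_on_line_nhd:
  fixes S :: "('n::finite pt) set"
  assumes "open S" "z0 \<in> S"
  obtains d r where "d > 0" "r > 0" "ball z0 d \<subseteq> S"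
    "\<And>z l. z \<in> ball z0 d \<Longrightarrow> norm l \<le> r \<Longrightarrow> z + l *s v \<in> S"
proof -
  obtain e where e: "e > 0" "ball z0 e \<subseteq> S" using assms open_contains_ball by blast
  let ?r = "e / (2 * (norm v + 1))"
  have "z + l *s v \<in> S" if "z \<in> ball z0 (e/2)" "norm l \<le> ?r" for z l
  proof -
    have "dist z0 (z + l *s v) \<le> dist z0 z + norm l * norm v"
    proof -
      have "norm (l *s v) = norm l * norm v" by (rule norm_vector_smult)
      then show ?thesis
        using norm_triangle_ineq4[of "z0 - z" "l *s v"] by (simp add: dist_norm diff_diff_eq)
    qed
    also have "norm l * norm v \<le> ?r * norm v" using that by (intro mult_right_mono) auto
    also have "?r * norm v \<le> e/2" using e by (simp add: divide_simps add_pos_nonneg add_nonneg_pos)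
    finally have "z + l *s v \<in> ball z0 e" using that by auto
    then show ?thesis using e by blast
  qed
  then show thesis using e by (intro that[of "e/2" ?r]) (auto simp: add_nonneg_pos)
qed

lemma holo_on_integrand_continuous:
  fixes f :: "'n::finite pt \<Rightarrow> complex"
  assumes f: "continuous_on S f" and r: "r > 0"
    and z: "\<And>z l. z \<in> V \<Longrightarrow> norm l \<le> r \<Longrightarrow> z + l *s v \<in> S"
  shows "continuous_on (V \<times> cbox 0 1) (\<lambda>(z, t). f (z + circ r t *s v) / circ r t)"
proof -
  have "continuous_on (V \<times> cbox 0 1) (\<lambda>p. fst p + circ r (snd p) *s v)"
    unfolding vector_scalar_mult_def
    by (intro continuous_intros continuous_on_vec_lambda)
  then have "continuous_on (V \<times> cbox 0 1) (\<lambda>p. f (fst p + circ r (snd p) *s v))"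
    by (rule continuous_on_compose2[OF f]) (use r in \<open>auto intro!: z simp: norm_mult\<close>)
  then show ?thesis unfolding case_prod_beta using r
    by (intro continuous_on_divide) (auto intro!: continuous_intros)
qed

text \<open>\<open>holo_on\<close> demands only a derivative at each point; its continuity is read
  off from the Cauchy integral, whose integrand is jointly continuous.\<close>

lemma holo_on_dd_continuous:
  fixes f :: "'n::finite pt \<Rightarrow> complex"
  assumes S: "open S" and f: "holo_on f S"
  shows "continuous_on S (dd v f)"
  unfolding continuous_on_eq_continuous_at[OF S]
proof
  fix z0 assume "z0 \<in> S"
  then obtain d r where d: "d > 0" "r > 0" "ball z0 d \<subseteq> S"
    "\<And>z l. z \<in> ball z0 d \<Longrightarrow> norm l \<le> r \<Longrightarrow> z + l *s v \<in> S"
    using holo_on_line_nhd[OF S] by metis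
  have "continuous_on (ball z0 d) (\<lambda>z. integral (cbox 0 1)
    (\<lambda>t. f (z + circ r t *s v) / circ r t))"
    by (rule integral_continuous_on_param)
      (rule holo_on_integrand_continuous[OF holo_on_continuous[OF f] d(2) d(4)])
  then have "continuous_on (ball z0 d) (dd v f)"
    by (rule continuous_on_eq) (simp add: holo_on_dd_integral[OF f d(2) d(4)])
  then show "isCont (dd v f) z0" using d(1) by (auto simp: continuous_on_eq_continuous_at)
qed

text \<open>Differentiation under the Cauchy integral: the integrand involves \<open>f\<close> only,
  so its derivative involves \<open>dd w f\<close>, which is already known to be continuous. Complex
  linearity in the direction passes through the integral.\<close>

lemma holo_on_dd:
  fixes f :: "'n::finite pt \<Rightarrow> complex"
  assumes S: "open S" and f: "holo_on f S"
  shows "holo_on (dd v f) S"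
  unfolding holo_on_def
proof
  fix z0 assume "z0 \<in> S"
  then obtain d r where d: "d > 0" "r > 0" "ball z0 d \<subseteq> S"
    "\<And>z l. z \<in> ball z0 d \<Longrightarrow> norm l \<le> r \<Longrightarrow> z + l *s v \<in> S"
    using holo_on_line_nhd[OF S] by metis
  define E where "E t = circ r t" for t :: real
  have E: "E t \<noteq> 0" "norm (E t) \<le> r" for t using d(2) by (auto simp: E_def norm_mult)
  \<comment> \<open>The Leibniz rule takes the derivative as a continuous family of bounded linear
    maps; its continuity is checked direction by direction.\<close>
  define fx where "fx z t = Blinfun (\<lambda>w. dd w f (z + E t *s v) / E t)" for z t
  have bl: "bounded_linear (\<lambda>w. dd w f (z + E t *s v) / E t)" if "z \<in> ball z0 d" for z t
    using has_derivative_bounded_linear[OF holo_on_has_derivative(1)[OF f d(4)[OF that E(2)]]]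
    by (rule bounded_linear_compose[OF bounded_linear_divide])
  have fx: "blinfun_apply (fx z t) = (\<lambda>w. dd w f (z + E t *s v) / E t)" if "z \<in> ball z0 d" for z t
    unfolding fx_def using bounded_linear_Blinfun_apply[OF bl[OF that]] .
  have cont: "continuous_on (ball z0 d \<times> cbox 0 1) (\<lambda>(z, t). g (z + E t *s v) / E t)"
    if "continuous_on S g" for g
    using holo_on_integrand_continuous[OF that d(2) d(4), of "ball z0 d"] by (simp add: E_def)
  have contfx: "continuous_on (ball z0 d \<times> cbox 0 1) (\<lambda>(z, t). fx z t)"
  proof (rule continuous_on_blinfun_componentwise)
    fix i :: "'n pt"
    have "continuous_on (ball z0 d \<times> cbox 0 1) (\<lambda>(z, t). dd i f (z + E t *s v) / E t)"
      by (rule cont[OF holo_on_dd_continuous[OF S f]])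
    then show "continuous_on (ball z0 d \<times> cbox 0 1) (\<lambda>p. blinfun_apply (case p of (z, t) \<Rightarrow> fx z t) i)"
      by (rule continuous_on_eq) (auto simp: fx)
  qed
  have "((\<lambda>z. integral (cbox 0 1) (\<lambda>t. f (z + E t *s v) / E t)) has_derivative
      blinfun_apply (integral (cbox 0 1) (fx z0))) (at z0 within ball z0 d)"
  proof (rule leibniz_rule[OF _ _ contfx])
    fix z t assume z: "z \<in> ball z0 d"
    have "((\<lambda>z. f (z + E t *s v)) has_derivative (\<lambda>w. dd w f (z + E t *s v))) (at z within ball z0 d)"
      by (rule has_derivative_compose[where f = "\<lambda>z. z + E t *s v" and x = z, OF _ holo_on_has_derivative(1)[OF f d(4)[OF z E(2)]]])
        (auto intro!: derivative_eq_intros)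
    then show "((\<lambda>z. f (z + E t *s v) / E t) has_derivative blinfun_apply (fx z t)) (at z within ball z0 d)"
      unfolding fx[OF z] by (rule bounded_linear.has_derivative[OF bounded_linear_divide])
  next
    fix z assume z: "z \<in> ball z0 d"
    have "continuous_on (cbox 0 1) (\<lambda>t. (\<lambda>(z, t). f (z + E t *s v) / E t) (z, t))"
      by (rule continuous_on_compose2[OF cont[OF holo_on_continuous[OF f]]]) (use z in \<open>auto intro!: continuous_intros\<close>)
    then show "(\<lambda>t. f (z + E t *s v) / E t) integrable_on cbox 0 1"
      using integrable_continuous by fastforce
  qed (use d in auto)
  moreover have "at z0 within ball z0 d = at z0" by (rule at_within_open) (use d(1) in auto)
  ultimately have "((\<lambda>z. integral (cbox 0 1) (\<lambda>t. f (z + E t *s v) / E t)) has_derivative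
      blinfun_apply (integral (cbox 0 1) (fx z0))) (at z0)" by (simp only:)
  then have D: "(dd v f has_derivative blinfun_apply (integral (cbox 0 1) (fx z0))) (at z0)"
    by (rule has_derivative_transform_within_open[of _ _ _ _ "ball z0 d"])
      (use d in \<open>auto simp: holo_on_dd_integral[OF f d(2) d(4)] E_def\<close>)
  have z0: "z0 \<in> ball z0 d" using d by simp
  have int: "fx z0 integrable_on cbox 0 1"
  proof (rule integrable_continuous)
    have "continuous_on (cbox 0 1) (\<lambda>t. (\<lambda>(z, t). fx z t) (z0, t))"
      by (rule continuous_on_compose2[OF contfx]) (use z0 in \<open>auto intro!: continuous_intros\<close>)
    then show "continuous_on (cbox 0 1) (fx z0)" by simp
  qed
  have ev: "blinfun_apply (integral (cbox 0 1) (fx z0)) w = integral (cbox 0 1) (\<lambda>t. dd w f (z0 + E t *s v) / E t)" for w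
    using integral_linear[OF int, of "\<lambda>b. blinfun_apply b w"] fx[OF z0]
    by (simp add: o_def blinfun.bounded_linear_left)
  have "(\<lambda>t. dd (c *s w) f (z0 + E t *s v) / E t) = (\<lambda>t. c * (dd w f (z0 + E t *s v) / E t))" for c w
    using holo_on_has_derivative(2)[OF f d(4)[OF z0 E(2)]] by simp
  then have "blinfun_apply (integral (cbox 0 1) (fx z0)) (c *s w) = c * blinfun_apply (integral (cbox 0 1) (fx z0)) w" for c w
    unfolding ev by (simp only: integral_mult_right)
  then show "\<exists>f'. (dd v f has_derivative f') (at z0) \<and> (\<forall>c w. f' (c *s w) = c * f' w)"
    using D by blast
qed

lemma holo_on_imp_smooth_on:
  fixes f :: "'n::finite pt \<Rightarrow> complex"
  assumes "open S" "holo_on f S"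
  shows "smooth_on f S"
proof (rule smooth_on_coinduct[where P = "\<lambda>f. holo_on f S", OF assms])
  fix f :: "'n pt \<Rightarrow> complex" assume f: "holo_on f S"
  show "\<exists>D. (\<forall>x\<in>S. (f has_derivative D x) (at x)) \<and> (\<forall>v. holo_on (\<lambda>x. D x v) S)"
    by (rule exI[of _ "\<lambda>x v. dd v f x"])
      (simp add: holo_on_has_derivative(1)[OF f] holo_on_dd[OF assms(1) f])
qed

section \<open>Partitions of unity\<close>

definition flat :: "real \<Rightarrow> real" where "flat x = (if 0 < x then exp (- (1 / x)) else 0)"

lemma tendsto_poly_exp_0: "((\<lambda>y::real. poly p y * exp (- y)) \<longlongrightarrow> 0) at_top"
proof (induction p)
  case 0
  then show ?case by simp
next
  case (pCons a p)
  have *: "((\<lambda>y::real. y ^ k * exp (- y)) \<longlongrightarrow> 0) at_top" for k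
    using tendsto_power_div_exp_0[of k] by (simp add: exp_minus divide_inverse)
  have "((\<lambda>y::real. poly p y * y * exp (- y)) \<longlongrightarrow> 0) at_top" for p :: "real poly"
  proof -
    have "((\<lambda>y::real. \<Sum>i\<le>degree p. coeff p i * (y ^ Suc i * exp (- y))) \<longlongrightarrow> (\<Sum>i\<le>degree p. coeff p i * 0)) at_top"
      by (intro tendsto_sum tendsto_mult * tendsto_const)
    then show ?thesis by (simp add: poly_altdef sum_distrib_right sum_distrib_left mult_ac)
  qed
  from tendsto_add[OF tendsto_mult[OF tendsto_const[of a] *[of 0]] this[of p]]
  show ?case by (simp add: algebra_simps)
qed

text \<open>The class of functions p(1/x) exp(-1/x), p a polynomial, extended by 0 to the left, is
  closed under differentiation; only the point 0 needs a limit.\<close>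

lemma smooth_on_flat: "smooth_on flat UNIV"
proof (rule smooth_on_coinduct[where P = "\<lambda>f. \<exists>p. f = (\<lambda>x. if 0 < x then poly p (1 / x) * exp (- (1 / x)) else 0)"])
  show "\<exists>p. flat = (\<lambda>x. if 0 < x then poly p (1 / x) * exp (- (1 / x)) else 0)"
    by (rule exI[of _ 1]) (auto simp: flat_def)
next
  fix f :: "real \<Rightarrow> real"
  define g where "g p x = (if 0 < x then poly p (1 / x) * exp (- (1 / x)) else 0)" for p and x :: real
  assume "\<exists>p. f = (\<lambda>x. if 0 < x then poly p (1 / x) * exp (- (1 / x)) else 0)"
  then obtain p where f: "f = g p" unfolding g_def by blast
  \<comment> \<open>From (p(1/x) exp(-1/x))' = x^-2 (p - p')(1/x) exp(-1/x).\<close>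
  define q where "q = [:0, 0, 1:] * (p - pderiv p)"
  have "(g p has_field_derivative g q x) (at x)" for x
  proof -
    consider "x > 0" | "x < 0" | "x = 0" by linarith
    then show ?thesis
    proof cases
      case 1
      have "((\<lambda>x. poly p (1 / x) * exp (- (1 / x))) has_field_derivative
         (poly p (1 / x) * (exp (- (1 / x)) * (1 / x^2)) + poly (pderiv p) (1 / x) * (- (1 / x^2)) * exp (- (1 / x)))) (at x)"
        by (rule derivative_eq_intros DERIV_chain2[OF poly_DERIV] refl | use 1 in \<open>simp add: field_simps power2_eq_square\<close>)+
      then have "((\<lambda>x. poly p (1 / x) * exp (- (1 / x))) has_field_derivative g q x) (at x)"
        using 1 by (simp add: g_def q_def algebra_simps power2_eq_square)
      then show ?thesis
        by (rule has_field_derivative_transform_within_open[of _ _ _ "{0<..}"]) (use 1 in \<open>auto simp: g_def\<close>)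
    next
      case 2
      have "((\<lambda>x. 0) has_field_derivative 0) (at x)" by simp
      then have "(g p has_field_derivative 0) (at x)"
        by (rule has_field_derivative_transform_within_open[of _ _ _ "{..<0}"]) (use 2 in \<open>auto simp: g_def\<close>)
      then show ?thesis using 2 by (simp add: g_def)
    next
      case 3
      \<comment> \<open>With y = 1/h the difference quotient from the right is y p(y) exp(-y), which
        explains \<open>pCons 0 p\<close>.\<close>
      have "((\<lambda>h. (g p (0 + h) - g p 0) / h) \<longlongrightarrow> 0) (at_right 0)"
      proof (rule Lim_transform_eventually)
        show "((\<lambda>h. poly (pCons 0 p) (inverse h) * exp (- inverse h)) \<longlongrightarrow> 0) (at_right (0::real))"
          by (rule filterlim_compose[OF tendsto_poly_exp_0 filterlim_inverse_at_top_right])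
        show "\<forall>\<^sub>F h in at_right 0. poly (pCons 0 p) (inverse h) * exp (- inverse h) = (g p (0 + h) - g p 0) / h"
          by (auto simp: eventually_at_filter g_def field_simps)
      qed
      moreover have "((\<lambda>h. (g p (0 + h) - g p 0) / h) \<longlongrightarrow> 0) (at_left 0)"
        by (rule tendsto_eventually) (auto simp: eventually_at_filter g_def)
      ultimately show ?thesis
        using 3 by (auto simp: g_def DERIV_def filterlim_at_split)
    qed
  qed
  then have d: "(f has_derivative (\<lambda>v. g (smult v q) x)) (at x)" for x
    unfolding f has_field_derivative_def
    by (rule has_derivative_eq_rhs) (auto simp: g_def)
  show "\<exists>D. (\<forall>x\<in>UNIV. (f has_derivative D x) (at x)) \<and>
    (\<forall>v. \<exists>p. (\<lambda>x. D x v) = (\<lambda>x. if 0 < x then poly p (1 / x) * exp (- (1 / x)) else 0))"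
    by (rule exI[of _ "\<lambda>x v. g (smult v q) x"]) (use d in \<open>auto simp: g_def\<close>)
qed simp

lemma flat_nonneg: "0 \<le> flat x" and flat_pos_iff: "0 < flat x \<longleftrightarrow> 0 < x" and flat_eq_0_iff: "flat x = 0 \<longleftrightarrow> x \<le> 0"
  by (auto simp: flat_def)

text \<open>The squared norm is smooth also at the centre, and the function is positive exactly on
  the open ball.\<close>

definition bump :: "'a::euclidean_space \<Rightarrow> real \<Rightarrow> 'a \<Rightarrow> real" where
  "bump c r z = flat (r^2 - (z - c) \<bullet> (z - c))"

lemma smooth_on_bump: "smooth_on (bump c r) UNIV"
  unfolding bump_def
  by (rule smooth_on_compose[OF open_UNIV open_UNIV _ smooth_on_flat]) (auto intro!: smooth_on_diff smooth_on_bilinear[OF bounded_bilinear_inner])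

lemma bump_nonneg: "0 \<le> bump c r z"
  by (simp add: bump_def flat_nonneg)

lemma bump_eq_0_iff: "0 < r \<Longrightarrow> bump c r z = 0 \<longleftrightarrow> z \<notin> ball c r"
proof -
  assume "0 < r"
  then have "r^2 \<le> (norm (z - c))^2 \<longleftrightarrow> r \<le> norm (z - c)" by (simp add: power_mono_iff)
  then show ?thesis
    using dist_commute[of c z] by (simp add: bump_def flat_eq_0_iff power2_norm_eq_inner dist_norm not_less)
qed

section \<open>Charts, overlaps and functions supported in one chart\<close>

locale cmanifold =
  fixes X :: "('a::t2_space, 'i, 'n::finite) atlas"
  assumes manifold: "compact_complex_manifold X"
begin

lemma compact_space: "compact (UNIV :: 'a set)"
  and dom_cover: "(\<Union>i\<in>charts X. dom X i) = UNIV"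
  and open_dom: "i \<in> charts X \<Longrightarrow> open (dom X i)"
  and open_img: "i \<in> charts X \<Longrightarrow> open (img X i)"
  and homeo: "i \<in> charts X \<Longrightarrow> homeomorphism (dom X i) (img X i) (chart X i) (chart_inv X i)"
  and holo_transition: "i \<in> charts X \<Longrightarrow> j \<in> charts X \<Longrightarrow> holo_on (\<lambda>z. transition X i j z $ a) (overlap X i j)"
  using manifold unfolding compact_complex_manifold_def by auto

lemma homeo_facts:
  assumes "i \<in> charts X"
  shows "\<forall>x\<in>dom X i. chart_inv X i (chart X i x) = x" "\<forall>z\<in>img X i. chart X i (chart_inv X i z) = z"
    "chart_inv X i ` img X i = dom X i" "chart X i ` dom X i = img X i"
    "continuous_on (dom X i) (chart X i)" "continuous_on (img X i) (chart_inv X i)"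
  using homeo[OF assms] unfolding homeomorphism_def by blast+

lemma chart_inv_chart: "i \<in> charts X \<Longrightarrow> x \<in> dom X i \<Longrightarrow> chart_inv X i (chart X i x) = x"
  and chart_chart_inv: "i \<in> charts X \<Longrightarrow> z \<in> img X i \<Longrightarrow> chart X i (chart_inv X i z) = z"
  and chart_inv_dom: "i \<in> charts X \<Longrightarrow> z \<in> img X i \<Longrightarrow> chart_inv X i z \<in> dom X i"
  and chart_img: "i \<in> charts X \<Longrightarrow> x \<in> dom X i \<Longrightarrow> chart X i x \<in> img X i"
  and continuous_chart: "i \<in> charts X \<Longrightarrow> continuous_on (dom X i) (chart X i)"
  and continuous_chart_inv: "i \<in> charts X \<Longrightarrow> continuous_on (img X i) (chart_inv X i)"
  by (use homeo_facts in \<open>fast+\<close>)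

lemma overlap_iff:
  assumes i: "i \<in> charts X"
  shows "z \<in> overlap X i j \<longleftrightarrow> z \<in> img X i \<and> chart_inv X i z \<in> dom X j"
proof
  assume "z \<in> overlap X i j"
  then obtain x where "x \<in> dom X i" "x \<in> dom X j" "z = chart X i x" by (auto simp: overlap_def)
  then show "z \<in> img X i \<and> chart_inv X i z \<in> dom X j" using i by (simp add: chart_inv_chart chart_img)
next
  assume z: "z \<in> img X i \<and> chart_inv X i z \<in> dom X j"
  then have "z = chart X i (chart_inv X i z)" "chart_inv X i z \<in> dom X i \<inter> dom X j"
    using i by (simp_all add: chart_chart_inv chart_inv_dom)
  then show "z \<in> overlap X i j" unfolding overlap_def by (rule image_eqI)
qed

lemma overlap_subset: "i \<in> charts X \<Longrightarrow> overlap X i j \<subseteq> img X i"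
  by (auto simp: overlap_iff)

lemma open_vimage_chart_inv: "i \<in> charts X \<Longrightarrow> open V \<Longrightarrow> open {z \<in> img X i. chart_inv X i z \<in> V}"
proof -
  assume "i \<in> charts X" "open V"
  then have "open (img X i \<inter> chart_inv X i -` V)"
    using continuous_open_preimage[OF continuous_chart_inv open_img] by blast
  moreover have "img X i \<inter> chart_inv X i -` V = {z \<in> img X i. chart_inv X i z \<in> V}" by auto
  ultimately show ?thesis by simp
qed

lemma open_overlap: "i \<in> charts X \<Longrightarrow> j \<in> charts X \<Longrightarrow> open (overlap X i j)"
proof -
  assume i: "i \<in> charts X" "j \<in> charts X"
  have "overlap X i j = {z \<in> img X i. chart_inv X i z \<in> dom X j}" using overlap_iff[OF i(1)] by auto
  then show ?thesis using open_vimage_chart_inv[OF i(1) open_dom[OF i(2)]] by simp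
qed

lemma transition_overlap:
  assumes "i \<in> charts X" "j \<in> charts X" "z \<in> overlap X i j"
  shows "transition X i j z \<in> overlap X j i" "chart_inv X j (transition X i j z) = chart_inv X i z"
    "transition X j i (transition X i j z) = z"
  using assms by (auto simp: overlap_iff transition_def chart_inv_chart chart_img chart_inv_dom chart_chart_inv)

lemma smooth_transition:
  assumes "i \<in> charts X" "j \<in> charts X"
  shows "smooth_on (transition X i j) (overlap X i j)"
  by (intro smooth_on_vecI open_overlap holo_on_imp_smooth_on holo_transition assms)

lemma has_derivative_transition:
  assumes "i \<in> charts X" "j \<in> charts X" "z \<in> overlap X i j"
  shows "(transition X i j has_derivative (\<lambda>v. dd v (transition X i j) z)) (at z)"
  using smooth_on_has_derivative[OF smooth_transition open_overlap] assms by blast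

lemma dd_transition_nth:
  assumes "i \<in> charts X" "j \<in> charts X" "z \<in> overlap X i j"
  shows "dd v (transition X i j) z $ a = dd v (\<lambda>z. transition X i j z $ a) z"
  using bounded_linear.has_derivative[OF bounded_linear_vec_nth has_derivative_transition[OF assms]]
  by (metis frechet_derivative_at)

lemma dd_transition_smult:
  assumes "i \<in> charts X" "j \<in> charts X" "z \<in> overlap X i j"
  shows "dd (c *s v) (transition X i j) z = c *s dd v (transition X i j) z"
  by (simp add: vec_eq_iff dd_transition_nth[OF assms] holo_on_has_derivative(2)[OF holo_transition assms(3)] assms)

lemma closed_chart_inv_image:
  assumes "i \<in> charts X" "compact L" "L \<subseteq> img X i"
  shows "closed (chart_inv X i ` L)" "chart_inv X i ` L \<subseteq> dom X i"
  using compact_imp_closed[OF compact_continuous_image[OF continuous_on_subset[OF continuous_chart_inv]]] chart_inv_dom assms by auto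

text \<open>The image of the compact set \<open>L\<close> is closed because the space is Hausdorff.
  So its complement, where \<open>f\<close> is zero, and the overlap form an open cover of the
  chart, and smoothness is local.\<close>

lemma smooth_on_extension:
  assumes i: "i \<in> charts X" and L: "compact L" "L \<subseteq> img X i" and j: "j \<in> charts X"
    and f: "smooth_on f (overlap X j i)" and 0: "\<And>z. z \<in> img X j \<Longrightarrow> chart_inv X j z \<notin> chart_inv X i ` L \<Longrightarrow> f z = 0"
  shows "smooth_on f (img X j)"
proof (rule smooth_on_locally)
  fix z assume z: "z \<in> img X j"
  let ?T = "{z \<in> img X j. chart_inv X j z \<in> - chart_inv X i ` L}"
  have o: "open ?T" by (rule open_vimage_chart_inv[OF j]) (use closed_chart_inv_image[OF i L] in auto)
  then have "smooth_on f ?T" using smooth_on_cong[OF o, of f "\<lambda>z. 0"] 0 by simp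
  moreover have "z \<in> overlap X j i \<or> z \<in> ?T" using z overlap_iff[OF j] closed_chart_inv_image(2)[OF i L] by auto
  ultimately show "\<exists>T. open T \<and> z \<in> T \<and> smooth_on f T" using o f open_overlap[OF j i] by blast
qed

lemma bump_chart_0:
  assumes i: "i \<in> charts X" and r: "0 < r" and y: "y \<notin> chart_inv X i ` cball c r"
  shows "(if y \<in> dom X i then bump c r (chart X i y) else 0) = 0"
proof (rule ccontr)
  assume "(if y \<in> dom X i then bump c r (chart X i y) else 0) \<noteq> 0"
  then have "y \<in> dom X i" "chart X i y \<in> cball c r"
    using bump_eq_0_iff[OF r, of c "chart X i y"] by (auto split: if_splits)
  then show False using y chart_inv_chart[OF i] by (metis imageI)
qed

lemma smooth_in_charts_bump:
  assumes i: "i \<in> charts X" and r: "0 < r" "cball c r \<subseteq> img X i" and j: "j \<in> charts X"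
  shows "smooth_on (\<lambda>z. if chart_inv X j z \<in> dom X i then bump c r (chart X i (chart_inv X j z)) else 0) (img X j)"
    (is "smooth_on ?f _")
proof (rule smooth_on_extension[OF i compact_cball r(2) j _ bump_chart_0[OF i r(1)]])
  have "smooth_on (\<lambda>z. bump c r (transition X j i z)) (overlap X j i)"
    by (rule smooth_on_compose[OF open_overlap[OF j i] open_UNIV _ smooth_on_bump smooth_transition[OF j i]]) auto
  then show "smooth_on ?f (overlap X j i)"
    using smooth_on_cong[OF open_overlap[OF j i], of ?f "\<lambda>z. bump c r (transition X j i z)"] j
    by (simp add: overlap_iff transition_def)
qed

lemma bump_support:
  assumes i: "i \<in> charts X" and r: "0 < r" "cball c r \<subseteq> img X i"
  shows "closure {x. (if x \<in> dom X i then bump c r (chart X i x) else 0) \<noteq> 0} \<subseteq> dom X i"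
proof -
  have "closure {x. (if x \<in> dom X i then bump c r (chart X i x) else 0) \<noteq> 0} \<subseteq> chart_inv X i ` cball c r"
    by (rule closure_minimal[OF _ closed_chart_inv_image(1)[OF i compact_cball r(2)]]) (use bump_chart_0[OF i r(1)] in blast)
  then show ?thesis using closed_chart_inv_image(2)[OF i compact_cball r(2)] by blast
qed

text \<open>Bumps on small balls in charts around every point, finitely many of them by compactness,
  divided by their sum.\<close>

lemma partition_of_unity_exists: "\<exists>\<psi>. partition_of_unity X \<psi>"
proof -
  have "\<exists>i r. i \<in> charts X \<and> x \<in> dom X i \<and> 0 < r \<and> cball (chart X i x) r \<subseteq> img X i" for x
  proof -
    obtain i where "i \<in> charts X" "x \<in> dom X i" using dom_cover by blast
    then show ?thesis using open_img[of i] chart_img open_contains_cball by metis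
  qed
  then obtain I r where I: "\<And>x. I x \<in> charts X" "\<And>x. x \<in> dom X (I x)" "\<And>x. 0 < r x"
    "\<And>x. cball (chart X (I x) x) (r x) \<subseteq> img X (I x)" by metis
  define b where "b x y = (if y \<in> dom X (I x) then bump (chart X (I x) x) (r x) (chart X (I x) y) else 0)" for x y
  have b0: "0 \<le> b x y" for x y by (simp add: b_def bump_nonneg)
  define V where "V x = {y \<in> dom X (I x). chart X (I x) y \<in> ball (chart X (I x) x) (r x)}" for x
  have V: "y \<in> V x \<longleftrightarrow> b x y \<noteq> 0" for x y
    unfolding V_def b_def using bump_eq_0_iff[OF I(3)] by auto
  have "open (V x)" for x
  proof -
    have "V x = dom X (I x) \<inter> chart X (I x) -` ball (chart X (I x) x) (r x)" by (auto simp: V_def)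
    then show ?thesis
      using continuous_open_preimage[OF continuous_chart[OF I(1)] open_dom[OF I(1)] open_ball] by simp
  qed
  moreover have "x \<in> V x" for x using I by (simp add: V_def)
  ultimately obtain F where F: "finite F" "(\<Union>x\<in>F. V x) = UNIV"
    using compactE_image[OF compact_space, of UNIV V] by (metis UNIV_I UN_I subsetI top.extremum_unique)
  define s where "s y = (\<Sum>x\<in>F. b x y)" for y
  have s: "s y > 0" for y
  proof -
    obtain x where "x \<in> F" "b x y \<noteq> 0" using F V by blast
    then show ?thesis unfolding s_def using b0 F(1) by (metis less_eq_real_def sum_nonneg sum_nonneg_eq_0_iff)
  qed
  \<comment> \<open>Several of the chosen centres may use the same chart, and the partition is
    indexed by charts; so the bumps are grouped by chart.\<close>
  define \<psi> where "\<psi> i y = (\<Sum>x | x \<in> F \<and> I x = i. b x y) / s y" for i y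
  have nz: "\<exists>x\<in>F. I x = i \<and> b x y \<noteq> 0" if "\<psi> i y \<noteq> 0" for i y
    using that unfolding \<psi>_def by (metis (mono_tags, lifting) div_0 mem_Collect_eq sum.neutral)
  have smooth_b: "smooth_on (\<lambda>z. b x (chart_inv X j z)) (img X j)" if "j \<in> charts X" for x j
    unfolding b_def by (rule smooth_in_charts_bump[OF I(1) I(3) I(4) that])
  have "finite {i \<in> charts X. \<exists>x. \<psi> i x \<noteq> 0}"
    by (rule finite_subset[of _ "I ` F"]) (use nz F(1) in auto)
  moreover have "0 \<le> \<psi> i x" for i x
    unfolding \<psi>_def using s[of x] by (intro divide_nonneg_pos sum_nonneg b0)
  moreover have "closure {x. \<psi> i x \<noteq> 0} \<subseteq> dom X i" for i
  proof -
    have "{x. \<psi> i x \<noteq> 0} \<subseteq> (\<Union>x\<in>{x\<in>F. I x = i}. closure {y. b x y \<noteq> 0})"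
    proof
      fix y assume "y \<in> {x. \<psi> i x \<noteq> 0}"
      then obtain x where x: "x \<in> F" "I x = i" "b x y \<noteq> 0" using nz[of i y] by auto
      then have "y \<in> closure {y. b x y \<noteq> 0}" by (intro subsetD[OF closure_subset]) simp
      then show "y \<in> (\<Union>x\<in>{x\<in>F. I x = i}. closure {y. b x y \<noteq> 0})" using x by blast
    qed
    then have "closure {x. \<psi> i x \<noteq> 0} \<subseteq> (\<Union>x\<in>{x\<in>F. I x = i}. closure {y. b x y \<noteq> 0})"
      using F(1) by (intro closure_minimal closed_UN) auto
    also have "\<dots> \<subseteq> dom X i"
    proof -
      have "closure {y. b x y \<noteq> 0} \<subseteq> dom X (I x)" for x
        unfolding b_def by (rule bump_support[OF I(1) I(3) I(4)])
      then show ?thesis by blast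
    qed
    finally show ?thesis .
  qed
  moreover have "smooth_on (\<lambda>z. \<psi> i (chart_inv X j z)) (img X j)" if "j \<in> charts X" for i j
    unfolding \<psi>_def s_def
    by (intro smooth_on_divide smooth_on_sum smooth_b that open_img)
      (use s in \<open>simp add: s_def less_imp_neq[THEN not_sym]\<close>)
  moreover have "(\<Sum>i | i \<in> charts X \<and> \<psi> i x \<noteq> 0. \<psi> i x) = 1" for x
  proof -
    have "(\<Sum>i | i \<in> charts X \<and> \<psi> i x \<noteq> 0. \<psi> i x) = (\<Sum>i\<in>I ` F. \<psi> i x)"
      by (rule sum.mono_neutral_left) (use F(1) nz I(1) in auto)
    also have "\<dots> = (\<Sum>i\<in>I ` F. \<Sum>y | y \<in> F \<and> I y = i. b y x) / s x"
      by (simp add: \<psi>_def sum_divide_distrib)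
    also have "(\<Sum>i\<in>I ` F. \<Sum>y | y \<in> F \<and> I y = i. b y x) = s x"
      unfolding s_def by (rule sum.group) (use F(1) in auto)
    finally show ?thesis using s[of x] by simp
  qed
  ultimately show ?thesis unfolding partition_of_unity_def by blast
qed

end

section \<open>Antisymmetrisation\<close>

text \<open>Unnormalised: the factorials are carried along separately, as in
  \<open>wedge\<close>.\<close>

definition altz :: "nat \<Rightarrow> ((nat \<Rightarrow> 'v) \<Rightarrow> 'b::real_vector) \<Rightarrow> (nat \<Rightarrow> 'v) \<Rightarrow> 'b" where
  "altz N T v = (\<Sum>\<sigma> | \<sigma> permutes {..<N}. of_int (sign \<sigma>) *\<^sub>R T (\<lambda>k. v (\<sigma> k)))"

lemma altz_cong: "(\<And>w. T w = T' w) \<Longrightarrow> altz N T v = altz N T' v"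
  by (simp add: altz_def)

lemma altz_add: "altz N (\<lambda>w. T w + T' w) v = altz N T v + altz N T' v"
  by (simp add: altz_def scaleR_add_right sum.distrib)

lemma altz_scaleR: "altz N (\<lambda>w. c *\<^sub>R T w) v = c *\<^sub>R altz N T v"
  by (simp add: altz_def scaleR_sum_right mult.commute)

lemma altz_minus: "altz N (\<lambda>w. - T w) v = - altz N T v"
  by (simp add: altz_def sum_negf)

lemma altz_diff: "altz N (\<lambda>w. T w - T' w) v = altz N T v - altz N T' v"
  by (simp add: altz_def scaleR_diff_right sum_subtractf)

lemma altz_zero [simp]: "altz N (\<lambda>w. 0) v = 0"
  by (simp add: altz_def)

lemma altz_sum: "altz N (\<lambda>w. \<Sum>i\<in>I. T i w) v = (\<Sum>i\<in>I. altz N (T i) v)"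
  by (induction I rule: infinite_finite_induct) (auto simp: altz_add)

lemma altz_linear: "linear L \<Longrightarrow> altz N (\<lambda>w. L (T w)) v = L (altz N T v)"
  by (simp add: altz_def linear_sum linear_scale)

lemma altz_mult_left:
  fixes c :: "'b::real_algebra" shows "altz N (\<lambda>w. c * T w) v = c * altz N T v"
  by (simp add: altz_def sum_distrib_left)

lemma of_int_sign_square: "(of_int (sign p) :: real) * of_int (sign p) = 1"
  by (metis of_int_1 of_int_mult sign_idempotent)

lemma altz_permute:
  assumes "\<pi> permutes {..<N}"
  shows "altz N (\<lambda>w. T (\<lambda>k. w (\<pi> k))) v = of_int (sign \<pi>) *\<^sub>R altz N T v"
proof -
  have p: "permutation \<sigma>" if "\<sigma> permutes {..<N}" for \<sigma>
    using that permutation_permutes by blast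
  have "altz N (\<lambda>w. T (\<lambda>k. w (\<pi> k))) v
     = (\<Sum>\<sigma> | \<sigma> permutes {..<N}. of_int (sign \<pi>) *\<^sub>R of_int (sign (\<sigma> \<circ> \<pi>)) *\<^sub>R T (\<lambda>k. v ((\<sigma> \<circ> \<pi>) k)))"
    unfolding altz_def
  proof (intro sum.cong refl)
    fix \<sigma> assume "\<sigma> \<in> {\<sigma>. \<sigma> permutes {..<N}}"
    then have "(of_int (sign \<sigma>) :: real) = of_int (sign \<pi>) * of_int (sign (\<sigma> \<circ> \<pi>))"
      using sign_compose[OF p p[OF assms]] of_int_sign_square[of \<pi>] by (simp add: mult.left_commute)
    then show "of_int (sign \<sigma>) *\<^sub>R T (\<lambda>k. v (\<sigma> (\<pi> k))) = of_int (sign \<pi>) *\<^sub>R of_int (sign (\<sigma> \<circ> \<pi>)) *\<^sub>R T (\<lambda>k. v ((\<sigma> \<circ> \<pi>) k))"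
      by simp
  qed
  also have "\<dots> = of_int (sign \<pi>) *\<^sub>R altz N T v"
    unfolding altz_def scaleR_sum_right
    by (rule sum.reindex_bij_witness[where i = "\<lambda>\<sigma>. \<sigma> \<circ> inv \<pi>" and j = "\<lambda>\<sigma>. \<sigma> \<circ> \<pi>"])
      (use assms in \<open>auto simp: o_assoc[symmetric] permutes_inv_o permutes_compose permutes_inv\<close>)
  finally show ?thesis .
qed

lemma altz_swap:
  assumes "a < N" "b < N" "a \<noteq> b"
  shows "altz N (\<lambda>w. T (\<lambda>k. w (swp a b k))) v = - altz N T v"
  using altz_permute[of "swp a b" N T v] assms
  by (simp add: permutes_swap_id sign_swap_id)

lemma altz_swap_eq:
  assumes "a < N" "b < N" "a \<noteq> b" "\<And>w. T' w = T (\<lambda>k. w (swp a b k))"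
  shows "altz N T' v = - altz N T v"
  unfolding altz_cong[of T', OF assms(4)] by (rule altz_swap[OF assms(1-3)])

lemma map_permutation_outside: "x \<notin> f ` A \<Longrightarrow> map_permutation A f p x = x"
  by (simp add: map_permutation_def restrict_id_def)

lemma map_permutation_permutes_superset:
  assumes "inj_on f A" "p permutes A" "f ` A \<subseteq> B"
  shows "map_permutation A f p permutes B"
  using map_permutation_permutes[OF inj_on_imp_bij_betw[OF assms(1)] assms(2)] permutes_subset assms(3) by blast

text \<open>The permutation of \<open>2 J\<close> slots that moves the blocks \<open>{2 i, 2 i + 1}\<close> is always even.\<close>
definition lift2 :: "(nat \<Rightarrow> nat) \<Rightarrow> nat \<Rightarrow> nat" where
  "lift2 \<pi> k = 2 * \<pi> (k div 2) + k mod 2"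

lemma lift2_simps [simp]: "lift2 \<pi> (2 * i) = 2 * \<pi> i" "lift2 \<pi> (Suc (2 * i)) = Suc (2 * \<pi> i)"
  by (auto simp: lift2_def)

text \<open>\<open>lift2 \<pi>\<close> is the composite of a copy of \<pi> on the even slots with a
  copy on the odd slots; both have the sign of \<pi>, and the signs cancel. This is the
  commutativity of forms of even degree.\<close>

lemma altz_lift2:
  assumes \<pi>: "\<pi> permutes {..<J}" and N: "2 * J \<le> N"
  shows "altz N (\<lambda>w. T (\<lambda>k. w (lift2 \<pi> k))) v = altz N T v"
proof -
  let ?f = "\<lambda>i::nat. 2 * i" and ?g = "\<lambda>i::nat. Suc (2 * i)"
  let ?F = "map_permutation {..<J} ?f \<pi>" and ?G = "map_permutation {..<J} ?g \<pi>"
  have inj: "inj_on ?f {..<J}" "inj_on ?g {..<J}" by (auto simp: inj_on_def)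
  have F: "?F permutes {..<N}" and G: "?G permutes {..<N}"
    by (rule map_permutation_permutes_superset[OF _ \<pi>]; use inj N in auto)+
  have eq: "lift2 \<pi> = ?F \<circ> ?G"
  proof
    fix k
    show "lift2 \<pi> k = (?F \<circ> ?G) k"
    proof (cases "even k")
      case True
      then obtain i where k: "k = ?f i" by blast
      have "?G k = k" by (rule map_permutation_outside) (use k in \<open>auto, presburger\<close>)
      moreover have "?F (?f i) = ?f (\<pi> i)"
      proof (cases "i < J")
        case True then show ?thesis by (intro map_permutation_apply inj) auto
      next
        case False
        then have "?F (?f i) = ?f i" by (intro map_permutation_outside) auto
        then show ?thesis using False permutes_not_in[OF \<pi>] by simp
      qed
      ultimately show ?thesis by (simp add: k)
    next
      case False
      then obtain i where k: "k = ?g i" by (metis Suc_eq_plus1 oddE)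
      have "?F (?g j) = ?g j" for j by (rule map_permutation_outside) (auto, presburger)
      moreover have "?G (?g i) = ?g (\<pi> i)"
      proof (cases "i < J")
        case True then show ?thesis by (intro map_permutation_apply inj) auto
      next
        case False
        then have "?G (?g i) = ?g i" by (intro map_permutation_outside) auto
        then show ?thesis using False permutes_not_in[OF \<pi>] by simp
      qed
      ultimately show ?thesis by (simp add: k)
    qed
  qed
  have "sign (lift2 \<pi>) = 1"
    unfolding eq using F G inj \<pi>
    by (subst sign_compose) (auto simp: sign_map_permutation permutation_permutes)
  moreover have "lift2 \<pi> permutes {..<N}" unfolding eq using G F by (rule permutes_compose)
  ultimately show ?thesis using altz_permute[of "lift2 \<pi>" N T v] by simp
qed

lemma altz_lift2_eq:
  assumes "\<pi> permutes {..<J}" "2 * J \<le> N" "\<And>w. T' w = T (\<lambda>k. w (lift2 \<pi> k))"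
  shows "altz N T' v = altz N T v"
  unfolding altz_cong[of T', OF assms(3)] by (rule altz_lift2[OF assms(1,2)])

lemma card_permutes_fact: "card {\<sigma>. \<sigma> permutes {..<p::nat}} = fact p"
  using card_permutations[of "{..<p}" p] by simp

text \<open>Each permutation of the inner antisymmetrisation is absorbed into the outer one, where
  its sign cancels against the inner sign; this happens p! times.\<close>

lemma altz_absorb_left:
  assumes m: "\<And>y. linear (\<lambda>x. m x y)" and N: "p \<le> N"
    and \<beta>: "\<And>w \<tau>. \<tau> permutes {..<p} \<Longrightarrow> \<beta> (\<lambda>k. w (\<tau> k)) = \<beta> w"
  shows "altz N (\<lambda>w. m (altz p \<alpha> w) (\<beta> w)) v = fact p *\<^sub>R altz N (\<lambda>w. m (\<alpha> w) (\<beta> w)) v"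
proof -
  have "altz N (\<lambda>w. m (altz p \<alpha> w) (\<beta> w)) v
    = altz N (\<lambda>w. \<Sum>\<tau> | \<tau> permutes {..<p}. of_int (sign \<tau>) *\<^sub>R m (\<alpha> (\<lambda>k. w (\<tau> k))) (\<beta> w)) v"
    by (simp add: altz_def[of p] linear_sum[OF m] linear_scale[OF m])
  also have "\<dots> = (\<Sum>\<tau> | \<tau> permutes {..<p}. of_int (sign \<tau>) *\<^sub>R altz N (\<lambda>w. m (\<alpha> (\<lambda>k. w (\<tau> k))) (\<beta> w)) v)"
    by (simp only: altz_sum altz_scaleR)
  also have "\<dots> = (\<Sum>\<tau> | \<tau> permutes {..<p}. altz N (\<lambda>w. m (\<alpha> w) (\<beta> w)) v)"
  proof (intro sum.cong refl)
    fix \<tau> assume "\<tau> \<in> {\<tau>. \<tau> permutes {..<p}}"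
    then have t: "\<tau> permutes {..<p}" "\<tau> permutes {..<N}"
      using permutes_subset[of \<tau> "{..<p}" "{..<N}"] N by auto
    have "altz N (\<lambda>w. m (\<alpha> (\<lambda>k. w (\<tau> k))) (\<beta> w)) v = of_int (sign \<tau>) *\<^sub>R altz N (\<lambda>w. m (\<alpha> w) (\<beta> w)) v"
      using altz_permute[OF t(2), of "\<lambda>w. m (\<alpha> w) (\<beta> w)" v] by (simp add: \<beta>[OF t(1)])
    then show "of_int (sign \<tau>) *\<^sub>R altz N (\<lambda>w. m (\<alpha> (\<lambda>k. w (\<tau> k))) (\<beta> w)) v = altz N (\<lambda>w. m (\<alpha> w) (\<beta> w)) v"
      by (simp add: of_int_sign_square)
  qed
  also have "\<dots> = fact p *\<^sub>R altz N (\<lambda>w. m (\<alpha> w) (\<beta> w)) v"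
    by (simp add: sum_constant_scaleR card_permutes_fact)
  finally show ?thesis .
qed

text \<open>The argument of \<open>altz_absorb_left\<close> with the inner permutations shifted by
  p. The other factor must not look at the slots p, ..., p + q - 1, but it may use later
  ones.\<close>

lemma altz_absorb_right:
  assumes m: "\<And>x. linear (m x)" and N: "p + q \<le> N"
    and \<alpha>: "\<And>w w'. (\<forall>k. k < p \<or> p + q \<le> k \<longrightarrow> w k = w' k) \<Longrightarrow> \<alpha> w = \<alpha> w'"
  shows "altz N (\<lambda>w. m (\<alpha> w) (altz q \<beta> (\<lambda>k. w (p + k)))) v
    = fact q *\<^sub>R altz N (\<lambda>w. m (\<alpha> w) (\<beta> (\<lambda>k. w (p + k)))) v"
proof -
  let ?T = "\<lambda>w. m (\<alpha> w) (\<beta> (\<lambda>k. w (p + k)))"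
  have "altz N (\<lambda>w. m (\<alpha> w) (altz q \<beta> (\<lambda>k. w (p + k)))) v
    = altz N (\<lambda>w. \<Sum>\<tau> | \<tau> permutes {..<q}. of_int (sign \<tau>) *\<^sub>R m (\<alpha> w) (\<beta> (\<lambda>k. w (p + \<tau> k)))) v"
    by (simp add: altz_def[of q] linear_sum[OF m] linear_scale[OF m])
  also have "\<dots> = (\<Sum>\<tau> | \<tau> permutes {..<q}. of_int (sign \<tau>) *\<^sub>R altz N (\<lambda>w. m (\<alpha> w) (\<beta> (\<lambda>k. w (p + \<tau> k)))) v)"
    by (simp only: altz_sum altz_scaleR)
  also have "\<dots> = (\<Sum>\<tau> | \<tau> permutes {..<q}. altz N ?T v)"
  proof (intro sum.cong refl)
    fix \<tau> assume "\<tau> \<in> {\<tau>. \<tau> permutes {..<q}}"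
    then have t: "\<tau> permutes {..<q}" by simp
    let ?t = "map_permutation {..<q} ((+) p) \<tau>"
    have inj: "inj_on ((+) p) {..<q}" by (auto simp: inj_on_def)
    have t': "?t permutes {..<N}"
      by (rule map_permutation_permutes_superset[OF inj t]) (use N in auto)
    have 1: "?t k = k" if "k < p \<or> p + q \<le> k" for k
      by (rule map_permutation_outside) (use that in auto)
    have 2: "?t (p + k) = p + \<tau> k" for k
    proof (cases "k < q")
      case True then show ?thesis by (intro map_permutation_apply inj) auto
    next
      case False then show ?thesis using 1[of "p + k"] permutes_not_in[OF t] by simp
    qed
    have "altz N (\<lambda>w. ?T (\<lambda>k. w (?t k))) v = of_int (sign \<tau>) *\<^sub>R altz N ?T v"
      using altz_permute[OF t', of ?T v] sign_map_permutation[OF inj t] by simp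
    moreover have "\<alpha> (\<lambda>k. w (?t k)) = \<alpha> w" for w by (rule \<alpha>) (simp add: 1)
    ultimately have "altz N (\<lambda>w. m (\<alpha> w) (\<beta> (\<lambda>k. w (p + \<tau> k)))) v = of_int (sign \<tau>) *\<^sub>R altz N ?T v"
      by (simp add: 2)
    then show "of_int (sign \<tau>) *\<^sub>R altz N (\<lambda>w. m (\<alpha> w) (\<beta> (\<lambda>k. w (p + \<tau> k)))) v = altz N ?T v"
      by (simp add: of_int_sign_square)
  qed
  also have "\<dots> = fact q *\<^sub>R altz N ?T v"
    by (simp add: sum_constant_scaleR card_permutes_fact)
  finally show ?thesis .
qed

lemma wedge_altz:
  "wedge m p q \<alpha> \<beta> z v = (1 / (fact p * fact q)) *\<^sub>R altz (p + q) (\<lambda>w. m (\<alpha> z w) (\<beta> z (\<lambda>k. w (p + k)))) v"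
  by (simp add: wedge_def altz_def)

text \<open>What remains of \<open>wedge_list\<close> once all antisymmetrisations are pulled out;
  each factor takes its slots from the front.\<close>

primrec tensor_list :: "('b \<Rightarrow> 'b \<Rightarrow> 'b) \<Rightarrow> 'b \<Rightarrow> (nat \<times> ('n, 'b) lform) list \<Rightarrow> ('n, 'b) lform" where
  "tensor_list m e [] z w = e"
| "tensor_list m e (a # as) z w = m (snd a z w) (tensor_list m e as z (\<lambda>k. w (fst a + k)))"

text \<open>The antisymmetrisation of the tail is absorbed by the outer one. The factor q! that this
  produces cancels the 1/q! of the outer wedge, so only the factorials of the individual degrees
  survive.\<close>

lemma wedge_list_altz:
  fixes m :: "'b \<Rightarrow> 'b \<Rightarrow> 'b::real_vector"
  assumes m: "\<And>x. linear (m x)"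
    and loc: "\<And>a w w'. a \<in> set as \<Longrightarrow> (\<forall>k<fst a. w k = w' k) \<Longrightarrow> snd a z w = snd a z w'"
  shows "wedge_list m e as z v
    = (1 / prod_list (map (\<lambda>a. fact (fst a)) as)) *\<^sub>R altz (sum_list (map fst as)) (tensor_list m e as z) v"
  using loc
proof (induction as arbitrary: v)
  case Nil
  have "{\<sigma>. \<sigma> permutes {..<0::nat}} = {id}" by auto
  then show ?case by (simp add: altz_def)
next
  case (Cons a as)
  let ?p = "fst a" and ?q = "sum_list (map fst as)" and ?c = "1 / prod_list (map (\<lambda>a. fact (fst a)) as) :: real"
  have IH: "wedge_list m e as z v = ?c *\<^sub>R altz ?q (tensor_list m e as z) v" for v
    by (rule Cons.IH) (use Cons.prems in auto)
  have "wedge_list m e (a # as) z v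
    = (1 / (fact ?p * fact ?q)) *\<^sub>R altz (?p + ?q) (\<lambda>w. m (snd a z w) (?c *\<^sub>R altz ?q (tensor_list m e as z) (\<lambda>k. w (?p + k)))) v"
    by (simp add: wedge_altz IH)
  also have "\<dots> = (?c / (fact ?p * fact ?q)) *\<^sub>R altz (?p + ?q) (\<lambda>w. m (snd a z w) (altz ?q (tensor_list m e as z) (\<lambda>k. w (?p + k)))) v"
    by (simp add: linear_scale[OF m] altz_scaleR)
  also have "altz (?p + ?q) (\<lambda>w. m (snd a z w) (altz ?q (tensor_list m e as z) (\<lambda>k. w (?p + k)))) v
    = fact ?q *\<^sub>R altz (?p + ?q) (\<lambda>w. m (snd a z w) (tensor_list m e as z (\<lambda>k. w (?p + k)))) v"
    by (rule altz_absorb_right[OF m]) (use Cons.prems[of a] in auto)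
  also have "altz (?p + ?q) (\<lambda>w. m (snd a z w) (tensor_list m e as z (\<lambda>k. w (?p + k)))) v
    = altz (?p + ?q) (tensor_list m e (a # as) z) v"
    by (rule altz_cong) simp
  finally show ?case by (simp add: mult.commute altz_def)
qed

section \<open>Products of matrices\<close>

lemma matrix_distribs:
  fixes A B C :: "'r::finite mtx"
  shows "A ** (B + C) = A ** B + A ** C" "(A + B) ** C = A ** C + B ** C"
    "A ** (B - C) = A ** B - A ** C" "(A - B) ** C = A ** C - B ** C"
  by (simp_all add: matrix_matrix_mult_def vec_eq_iff algebra_simps sum.distrib sum_subtractf)

primrec mprod :: "('r::finite mtx) list \<Rightarrow> 'r mtx" where
  "mprod [] = mat 1"
| "mprod (A # As) = A ** mprod As"

lemma mprod_append: "mprod (As @ Bs) = mprod As ** mprod Bs"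
  by (induction As) (auto simp: matrix_mul_assoc)

lemma cscale_simps [simp]:
  "cscale 1 A = A" "cscale 0 A = 0" "cscale c 0 = 0" "cscale c (cscale d A) = cscale (c * d) A"
  "cscale c (- A) = - cscale c A"
  by (auto simp: cscale_def vec_eq_iff mult.assoc)

lemma cscale_add: "cscale c (A + B) = cscale c A + cscale c B" "cscale (c + d) A = cscale c A + cscale d A"
  and cscale_diff: "cscale c (A - B) = cscale c A - cscale c B" "cscale (c - d) A = cscale c A - cscale d A"
  by (auto simp: cscale_def vec_eq_iff algebra_simps)

lemma cscale_scaleR: "cscale c (r *\<^sub>R A) = r *\<^sub>R cscale c A" "cscale (r *\<^sub>R c) A = r *\<^sub>R cscale c A"
  "cscale (of_real r) A = r *\<^sub>R A"
  by (auto simp: cscale_def vec_eq_iff scaleR_conv_of_real[where 'a = complex])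

lemma linear_cscale: "linear (cscale c)" "linear (\<lambda>c. cscale c A)"
  by (auto simp: linear_iff cscale_add cscale_scaleR)

lemma cscale_mult: "cscale c A ** B = cscale c (A ** B)" "A ** cscale c B = cscale c (A ** B)"
  by (simp_all add: cscale_def matrix_matrix_mult_def vec_eq_iff sum_distrib_left mult_ac)

lemma trace_cscale [simp]: "trace (cscale c A) = c * trace A"
  by (simp add: cscale_def trace_def sum_distrib_left)

lemma trace_scaleR: "trace (r *\<^sub>R A) = r *\<^sub>R trace (A :: 'r::finite mtx)"
  by (simp add: trace_def scaleR_sum_right)

lemma linear_trace: "linear (trace :: 'r::finite mtx \<Rightarrow> complex)"
  by (auto simp: linear_iff trace_add trace_scaleR)

lemma scaleR_matrix_mult: "(r *\<^sub>R A) ** B = r *\<^sub>R (A ** B)" "A ** (r *\<^sub>R B) = r *\<^sub>R (A ** B)"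
  for A B :: "'r::finite mtx"
  by (simp_all flip: cscale_scaleR(3) add: cscale_mult)

lemma linear_matrix_mult: "linear (\<lambda>Y :: 'r mtx. A ** Y)" "linear (\<lambda>Y :: 'r mtx. Y ** B)"
  for A B :: "'r::finite mtx"
  by (auto simp: linear_iff matrix_distribs scaleR_matrix_mult)

lemma mat_minus_mult: "(- A) ** B = - (A ** B)" "A ** (- B) = - (A ** B)"
  for A B :: "'r::finite mtx"
  using linear_neg[OF linear_matrix_mult(2)] linear_neg[OF linear_matrix_mult(1)] by blast+

lemma bounded_bilinear_matrix_mult: "bounded_bilinear ((**) :: 'r::finite mtx \<Rightarrow> 'r mtx \<Rightarrow> 'r mtx)"
  by (rule bilinear_conv_bounded_bilinear[THEN iffD1]) (simp add: bilinear_def linear_matrix_mult)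

lemma bounded_bilinear_cscale: "bounded_bilinear (cscale :: complex \<Rightarrow> 'r::finite mtx \<Rightarrow> 'r mtx)"
  by (rule bilinear_conv_bounded_bilinear[THEN iffD1]) (simp add: bilinear_def linear_cscale)

lemma bounded_linear_trace: "bounded_linear (trace :: 'r::finite mtx \<Rightarrow> complex)"
  using linear_trace linear_conv_bounded_linear by blast

lemma trace_mult_commute3: "trace (A ** B ** C) = trace (B ** C ** A)"
  for A B C :: "'r::finite mtx"
  by (metis matrix_mul_assoc trace_mul_sym)

text \<open>Stated for an abstract derivation \<open>D\<close> on a class \<open>P\<close>, because
  the same rule serves (0,1)-derivatives, covariant (1,0)-derivatives, parameter derivatives and
  commutators. Distinctness of the indices lets a function update mark the differentiated
  factor.\<close>

lemma mprod_leibniz: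
  fixes D :: "('x \<Rightarrow> 'r::finite mtx) \<Rightarrow> 'r mtx"
  assumes D: "\<And>f g. P f \<Longrightarrow> P g \<Longrightarrow> D (\<lambda>z. f z ** g z) = D f ** g x + f x ** D g"
    and P: "\<And>f g. P f \<Longrightarrow> P g \<Longrightarrow> P (\<lambda>z. f z ** g z)" "P (\<lambda>z. mat 1)"
    and D1: "D (\<lambda>z. mat 1) = 0"
    and M: "\<And>i. i \<in> set is \<Longrightarrow> P (M i)" and dist: "distinct is"
  shows "P (\<lambda>z. mprod (map (\<lambda>i. M i z) is))"
    "D (\<lambda>z. mprod (map (\<lambda>i. M i z) is)) = (\<Sum>a\<in>set is. mprod (map ((\<lambda>i. M i x)(a := D (M a))) is))"
proof -
  have PP: "P (\<lambda>z. mprod (map (\<lambda>i. M i z) is))" if "\<And>i. i \<in> set is \<Longrightarrow> P (M i)" for "is"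
    using that by (induction "is") (auto simp: P)
  then show "P (\<lambda>z. mprod (map (\<lambda>i. M i z) is))" using M by blast
  show "D (\<lambda>z. mprod (map (\<lambda>i. M i z) is)) = (\<Sum>a\<in>set is. mprod (map ((\<lambda>i. M i x)(a := D (M a))) is))"
    using M dist
  proof (induction "is")
    case Nil
    then show ?case by (simp add: D1)
  next
    case (Cons b bs)
    have "D (\<lambda>z. mprod (map (\<lambda>i. M i z) (b # bs))) = D (M b) ** mprod (map (\<lambda>i. M i x) bs)
        + M b x ** D (\<lambda>z. mprod (map (\<lambda>i. M i z) bs))"
      using D[of "M b" "\<lambda>z. mprod (map (\<lambda>i. M i z) bs)"] PP[of bs] Cons.prems by simp
    also have "D (\<lambda>z. mprod (map (\<lambda>i. M i z) bs)) = (\<Sum>a\<in>set bs. mprod (map ((\<lambda>i. M i x)(a := D (M a))) bs))"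
      by (rule Cons.IH) (use Cons.prems in auto)
    also have "M b x ** (\<Sum>a\<in>set bs. mprod (map ((\<lambda>i. M i x)(a := D (M a))) bs))
       = (\<Sum>a\<in>set bs. mprod (map ((\<lambda>i. M i x)(a := D (M a))) (b # bs)))"
      unfolding linear_sum[OF linear_matrix_mult(1)]
      using Cons.prems by (intro sum.cong) auto
    also have "D (M b) ** mprod (map (\<lambda>i. M i x) bs) = mprod (map ((\<lambda>i. M i x)(b := D (M b))) (b # bs))"
    proof -
      have "map ((\<lambda>i. M i x)(b := D (M b))) bs = map (\<lambda>i. M i x) bs"
        using Cons.prems by (intro map_cong) auto
      then show ?thesis by (simp only: mprod.simps list.map fun_upd_same)
    qed
    finally show ?case
      using Cons.prems by (simp only: list.set sum.insert List.finite_set distinct.simps not_False_eq_True simp_thms)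
  qed
qed

text \<open>The commutator with \<open>A\<close> is a derivation of the matrix algebra; matrices are
  regarded as functions on the one-point type.\<close>

lemma commutator_mprod:
  assumes "distinct is"
  shows "mprod (map M is) ** A - A ** mprod (map M is)
    = (\<Sum>a\<in>set is. mprod (map (M(a := M a ** A - A ** M a)) is))"
  using mprod_leibniz(2)[where P = "\<lambda>f. True" and D = "\<lambda>f. f () ** A - A ** f ()" and x = "()"
      and M = "\<lambda>i u. M i", of "is"] assms
  by (simp add: matrix_distribs matrix_mul_assoc fun_upd_def)

lemma mprod_split:
  assumes "a < J"
  shows "mprod (map (M(a := X)) [0..<J]) = mprod (map M [0..<a]) ** X ** mprod (map M [Suc a..<J])"
proof -
  have "[0..<J] = [0..<a] @ a # [Suc a..<J]"
    using assms upt_add_eq_append[of 0 a "J - a"] upt_conv_Cons[of a J] by simp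
  moreover have "map (M(a := X)) [0..<a] = map M [0..<a]" "map (M(a := X)) [Suc a..<J] = map M [Suc a..<J]"
    by (auto intro: map_cong)
  ultimately show ?thesis by (simp add: mprod_append matrix_mul_assoc)
qed

lemma mprod_scalars: "mprod (map (\<lambda>i. cscale (s i) (mat 1)) is) = cscale (prod_list (map s is)) (mat 1)"
  by (induction "is") (auto simp: cscale_mult mult.commute)

lemma mprod_smooth:
  assumes "open S" "\<And>i. i \<in> set is \<Longrightarrow> smooth_on (M i) S"
  shows "smooth_on (\<lambda>z. mprod (map (\<lambda>i. M i z) is)) S"
  using assms(2) by (induction "is") (auto intro!: smooth_on_bilinear[OF bounded_bilinear_matrix_mult assms(1)])

section \<open>Charge forms as antisymmetrised products\<close>

definition pairprod :: "(nat \<Rightarrow> 'v \<Rightarrow> 'v \<Rightarrow> 'r::finite mtx) \<Rightarrow> nat \<Rightarrow> (nat \<Rightarrow> 'v) \<Rightarrow> 'r mtx" where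
  "pairprod Fs J w = mprod (map (\<lambda>i. Fs i (ev w i) (od w i)) [0..<J])"

text \<open>A summand of tr(A D_Z) before antisymmetrisation. The factor with index i owns the slots
  2 i and 2 i + 1, so that block permutations of slots are the same as moves of factors.\<close>

definition tword ::
  "'r::finite mtx \<Rightarrow> (nat \<Rightarrow> 'v \<Rightarrow> 'v \<Rightarrow> 'r mtx) \<Rightarrow> nat \<Rightarrow> ((nat \<Rightarrow> 'v) \<Rightarrow> complex) \<Rightarrow> (nat \<Rightarrow> 'v) \<Rightarrow> complex" where
  "tword A Fs J u w = trace (A ** pairprod Fs J w) * u (\<lambda>k. w (2 * J + k))"

text \<open>The factors of \<open>F\<^sup>j \<and> \<omega>\<^sup>d\<close>.\<close>
definition factors :: "('v \<Rightarrow> 'v \<Rightarrow> 'r::finite mtx) \<Rightarrow> ('v \<Rightarrow> 'v \<Rightarrow> complex) \<Rightarrow> nat \<Rightarrow> nat \<Rightarrow> 'v \<Rightarrow> 'v \<Rightarrow> 'r mtx" where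
  "factors F om j i = (if i < j then F else (\<lambda>a b. cscale (om a b) (mat 1)))"

text \<open>The 1/j! comes from the Chern character, each of the d + j factors of degree 2 brings
  1/2! from the wedge products, and U brings 1/(2 l)!.\<close>

definition charge_coeff :: "(nat \<Rightarrow> complex) \<Rightarrow> nat \<Rightarrow> nat \<Rightarrow> nat \<Rightarrow> complex" where
  "charge_coeff c d j l = c d / (fact j * 2 ^ d * 2 ^ j * fact (2 * l))"

text \<open>The trace of \<open>A\<close> times a charge form, with its nested wedge products
  collapsed; \<open>trace_charge_form\<close> makes the connection.\<close>

definition charge_density ::
  "(nat \<Rightarrow> complex) \<Rightarrow> ('v \<Rightarrow> 'v \<Rightarrow> complex) \<Rightarrow> (nat \<Rightarrow> (nat \<Rightarrow> 'v) \<Rightarrow> complex) \<Rightarrow> nat \<Rightarrow>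
   ('v \<Rightarrow> 'v \<Rightarrow> 'r::finite mtx) \<Rightarrow> 'r mtx \<Rightarrow> (nat \<Rightarrow> 'v) \<Rightarrow> complex" where
  "charge_density c om u n F A v = (\<Sum>(d, j, l)\<in>degree_triples n.
     charge_coeff c d j l * altz (2 * n) (tword A (factors F om j) (j + d) (u (2 * l))) v)"

lemma pairprod_local: "(\<And>k. k < 2 * J \<Longrightarrow> w k = w' k) \<Longrightarrow> pairprod Fs J w = pairprod Fs J w'"
  unfolding pairprod_def by (intro arg_cong[of _ _ mprod] map_cong) auto

lemma altz_local:
  assumes "\<And>w w'. (\<And>k. k < N \<Longrightarrow> w k = w' k) \<Longrightarrow> T w = T w'" "\<And>k. k < N \<Longrightarrow> v k = v' k"
  shows "altz N T v = altz N T v'"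
  unfolding altz_def
proof (intro sum.cong refl arg_cong2[where f = scaleR] assms(1))
  fix \<sigma> k assume "\<sigma> \<in> {\<sigma>. \<sigma> permutes {..<N}}" "k < N"
  then show "v (\<sigma> k) = v' (\<sigma> k)" using permutes_in_image[of \<sigma> "{..<N}" k] assms(2) by simp
qed

lemma wedge_list_local:
  fixes m :: "'b \<Rightarrow> 'b \<Rightarrow> 'b::real_vector"
  assumes m: "\<And>x. linear (m x)"
    and loc: "\<And>a w w'. a \<in> set as \<Longrightarrow> (\<forall>k<fst a. w k = w' k) \<Longrightarrow> snd a z w = snd a z w'"
    and w: "\<And>k. k < sum_list (map fst as) \<Longrightarrow> w k = w' k"
  shows "wedge_list m e as z w = wedge_list m e as z w'"
proof -
  have t: "tensor_list m e as z w = tensor_list m e as z w'"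
    if "\<And>k. k < sum_list (map fst as) \<Longrightarrow> w k = w' k" for w w'
    using that loc
  proof (induction as arbitrary: w w')
    case (Cons a as)
    have "snd a z w = snd a z w'" by (rule Cons.prems(2)) (use Cons.prems(1) in auto)
    moreover have "tensor_list m e as z (\<lambda>k. w (fst a + k)) = tensor_list m e as z (\<lambda>k. w' (fst a + k))"
      by (rule Cons.IH) (use Cons.prems in auto)
    ultimately show ?case by simp
  qed simp
  have A: "wedge_list m e as z v
    = (1 / prod_list (map (\<lambda>a. fact (fst a)) as)) *\<^sub>R altz (sum_list (map fst as)) (tensor_list m e as z) v" for v
    by (rule wedge_list_altz[OF m]) (rule loc)
  have "altz (sum_list (map fst as)) (tensor_list m e as z) w = altz (sum_list (map fst as)) (tensor_list m e as z) w'"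
    by (rule altz_local) (rule t, simp, rule w)
  then show ?thesis unfolding A by simp
qed

lemma linear_times: "linear (\<lambda>y. x * y :: complex)" "linear (\<lambda>y. y * x :: complex)"
  by (auto simp: linear_iff algebra_simps)

lemma tensor_list_replicate:
  fixes F :: "('n, 'r::finite mtx) lform"
  assumes "\<And>w. F z w = F2 (w 0) (w (Suc 0))"
  shows "tensor_list (\<lambda>A B. A ** B) e (replicate j (2, F) @ as) z w
    = mprod (map (\<lambda>i. F2 (ev w i) (od w i)) [0..<j]) ** tensor_list (\<lambda>A B. A ** B) e as z (\<lambda>k. w (2 * j + k))"
proof (induction j arbitrary: w)
  case (Suc j)
  have e: "[0..<Suc j] = 0 # map Suc [0..<j]" by (simp only: map_Suc_upt) (rule upt_conv_Cons, simp)
  show ?case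
    unfolding e list.map map_map o_def mprod.simps replicate_Suc append_Cons tensor_list.simps fst_conv snd_conv Suc.IH
    using assms by (simp add: matrix_mul_assoc)
qed simp

lemma sum_list_replicate2: "sum_list (map fst (replicate j (2::nat, x))) = 2 * j"
  by (simp add: sum_list_replicate)

lemma prod_list_replicate_fact2: "prod_list (map (\<lambda>a. fact (fst a)) (replicate j (2::nat, x))) = (2 ^ j :: real)"
  by (induction j) (auto simp: fact_numeral)

lemma wedge_power_matrix:
  fixes F :: "('n, 'r::finite mtx) lform"
  assumes F: "\<And>w. F z w = F2 (w 0) (w (Suc 0))"
  shows "wedge_power (\<lambda>A B. A ** B) (mat 1) 2 F j z v = (1 / 2 ^ j) *\<^sub>R altz (2 * j) (pairprod (\<lambda>i. F2) j) v"
proof -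
  have "wedge_power (\<lambda>A B. A ** B) (mat 1) 2 F j z v
    = (1 / 2 ^ j) *\<^sub>R altz (2 * j) (tensor_list (\<lambda>A B. A ** B) (mat 1) (replicate j (2, F)) z) v"
    by (subst wedge_list_altz)
      (auto simp: linear_matrix_mult F sum_list_replicate2 prod_list_replicate_fact2 simp del: map_replicate)
  then show ?thesis using tensor_list_replicate[of F z F2 "mat 1" j "[]", OF F] by (simp add: pairprod_def altz_def)
qed

lemma wedge_power_scalar:
  fixes om :: "('n, complex) lform"
  assumes om: "\<And>w. om z w = om2 (w 0) (w (Suc 0))"
  shows "wedge_power times 1 2 om d z v = (1 / 2 ^ d) *\<^sub>R altz (2 * d) (\<lambda>w. \<Prod>i<d. om2 (ev w i) (od w i)) v"
proof -
  have t: "tensor_list times 1 (replicate d (2, om)) z w = (\<Prod>i<d. om2 (ev w i) (od w i))" for w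
    by (induction d arbitrary: w) (auto simp: om prod.lessThan_Suc_shift simp del: prod.lessThan_Suc)
  have "wedge_power times 1 2 om d z v
    = (1 / 2 ^ d) *\<^sub>R altz (2 * d) (tensor_list times 1 (replicate d (2, om)) z) v"
    by (subst wedge_list_altz)
      (auto simp: linear_times om sum_list_replicate2 prod_list_replicate_fact2 simp del: map_replicate)
  then show ?thesis using t by (simp add: altz_def)
qed

text \<open>Both wedges collapse, and the powers of \<omega> are then moved behind \<open>P\<close>.
  Since \<open>P\<close> is only assumed to depend on its own slots, the factor 1/(2 j)! remains; it
  disappears when \<open>P\<close> is itself an antisymmetrisation.\<close>

lemma wedge_charge_term:
  fixes P :: "('n::finite, 'r::finite mtx) lform"
  assumes om: "\<And>w. om z w = om2 (w 0) (w (Suc 0))"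
    and U: "\<And>w w'. (\<And>k. k < 2 * l \<Longrightarrow> w k = w' k) \<Longrightarrow> U z w = U z w'"
    and P: "\<And>w w'. (\<And>k. k < 2 * j \<Longrightarrow> w k = w' k) \<Longrightarrow> P z w = P z w'"
  shows "wedge cscale (2 * d) (2 * j + 2 * l) (wedge_power times 1 2 om d)
      (wedge (\<lambda>A s. cscale s A) (2 * j) (2 * l) P U) z v
    = (1 / (2 ^ d * fact (2 * j) * fact (2 * l))) *\<^sub>R altz (2 * (d + j + l))
        (\<lambda>w. cscale (spart om2 (U z) j d w) (P z w)) v"
proof -
  let ?N = "2 * (d + j + l)"
  define B where "B u = cscale (U z (\<lambda>k. u (2 * j + k))) (P z u)" for u
  define Om where "Om w = (\<Prod>i<d. om2 (ev w i) (od w i))" for w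
  have N: "2 * d + (2 * j + 2 * l) = ?N" by simp
  have Omd: "wedge_power times 1 2 om d z w = (1 / 2 ^ d) *\<^sub>R altz (2 * d) Om w" for w
    unfolding wedge_power_scalar[of om z om2, OF om] Om_def ..
  have Om_local: "wedge_power times 1 2 om d z w = wedge_power times 1 2 om d z w'"
    if "\<And>k. k < 2 * d \<Longrightarrow> w k = w' k" for w w'
    unfolding Omd by (subst altz_local[of _ _ w w']) (auto intro!: that prod.cong simp: Om_def)
  have "wedge cscale (2 * d) (2 * j + 2 * l) (wedge_power times 1 2 om d)
      (wedge (\<lambda>A s. cscale s A) (2 * j) (2 * l) P U) z v
    = (1 / (fact (2 * d) * fact (2 * j + 2 * l) * (fact (2 * j) * fact (2 * l)))) *\<^sub>R
      altz ?N (\<lambda>w. cscale (wedge_power times 1 2 om d z w) (altz (2 * j + 2 * l) B (\<lambda>k. w (2 * d + k)))) v"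
    by (simp add: wedge_altz[of _ _ _ _ _ z] B_def[abs_def] cscale_scaleR altz_scaleR N del: distrib_left_numeral)
  also have "altz ?N (\<lambda>w. cscale (wedge_power times 1 2 om d z w) (altz (2 * j + 2 * l) B (\<lambda>k. w (2 * d + k)))) v
    = fact (2 * j + 2 * l) *\<^sub>R altz ?N (\<lambda>w. cscale (wedge_power times 1 2 om d z w) (B (\<lambda>k. w (2 * d + k)))) v"
    by (rule altz_absorb_right[OF linear_cscale(1)]) (auto intro: Om_local)
  also have "altz ?N (\<lambda>w. cscale (wedge_power times 1 2 om d z w) (B (\<lambda>k. w (2 * d + k)))) v
    = (1 / 2 ^ d) *\<^sub>R altz ?N (\<lambda>w. cscale (altz (2 * d) Om w) (B (\<lambda>k. w (2 * d + k)))) v"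
    by (simp add: Omd cscale_scaleR altz_scaleR)
  also have "altz ?N (\<lambda>w. cscale (altz (2 * d) Om w) (B (\<lambda>k. w (2 * d + k)))) v
    = fact (2 * d) *\<^sub>R altz ?N (\<lambda>w. cscale (Om w) (B (\<lambda>k. w (2 * d + k)))) v"
  proof (rule altz_absorb_left[OF linear_cscale(2)])
    fix w :: "nat \<Rightarrow> 'n pt" and \<tau> assume "\<tau> permutes {..<2 * d}"
    then have "\<tau> (2 * d + k) = 2 * d + k" for k by (simp add: permutes_not_in)
    then show "B (\<lambda>k. w (\<tau> (2 * d + k))) = B (\<lambda>k. w (2 * d + k))" by simp
  qed simp
  also have "altz ?N (\<lambda>w. cscale (Om w) (B (\<lambda>k. w (2 * d + k)))) v = altz ?N (\<lambda>w. cscale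
     (spart om2 (U z) j d w) (P z w)) v"
  proof (rule altz_lift2_eq)
    \<comment> \<open>Exchanges the leading block of d pairs with the following block of j pairs.
      Pairs are moved as a whole, hence no sign.\<close>
    let ?\<pi> = "\<lambda>i. if i < j then d + i else if i < j + d then i - j else i"
    show p: "?\<pi> permutes {..<j + d}"
      by (rule bij_imp_permutes, rule bij_betw_byWitness[where f' = "\<lambda>i. if i < d then j + i else i - d"]) auto
    show "2 * (j + d) \<le> ?N" by simp
    fix w :: "nat \<Rightarrow> 'n pt"
    have 1: "lift2 ?\<pi> k = 2 * d + k" if "k < 2 * j" for k
    proof -
      have "k div 2 < j" using that by auto
      then show ?thesis by (simp add: lift2_def)
    qed
    have 2: "lift2 ?\<pi> (2 * (j + d) + k) = 2 * (j + d) + k" for k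
    proof -
      have "(2 * (j + d) + k) div 2 = j + d + k div 2" "(2 * (j + d) + k) mod 2 = k mod 2" by presburger+
      then show ?thesis by (simp add: lift2_def)
    qed
    have "P z (\<lambda>k. w (lift2 ?\<pi> k)) = P z (\<lambda>k. w (2 * d + k))" by (rule P) (simp add: 1)
    moreover have "(\<lambda>k. w (lift2 ?\<pi> (2 * (j + d) + k))) = (\<lambda>k. w (2 * d + (2 * j + k)))"
      unfolding 2 by (simp add: algebra_simps)
    moreover have "(\<Prod>i<d. om2 (w (lift2 ?\<pi> (2 * (j + i)))) (w (lift2 ?\<pi> (Suc (2 * (j + i)))))) = Om w"
      unfolding lift2_simps Om_def by (intro prod.cong) auto
    ultimately show "cscale (Om w) (B (\<lambda>k. w (2 * d + k))) = cscale
      ((\<Prod>i<d. om2 (w (lift2 ?\<pi> (2 * (j + i)))) (w (lift2 ?\<pi> (Suc (2 * (j + i)))))) * U z (\<lambda>k. w (lift2 ?\<pi> (2 * (j + d) + k))))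
      (P z (\<lambda>k. w (lift2 ?\<pi> k)))"
      unfolding B_def by simp
  qed
  finally show ?thesis by (simp add: field_simps)
qed

lemma mprod_factors:
  "pairprod (factors F om j) (j + d) w
    = cscale (\<Prod>i<d. om (w (2 * (j + i))) (w (Suc (2 * (j + i))))) (pairprod (\<lambda>i. F) j w)"
proof -
  have 1: "[0..<j + d] = [0..<j] @ map ((+) j) [0..<d]"
    by (rule nth_equalityI) (auto simp: nth_append)
  have 2: "map (\<lambda>i. factors F om j i (ev w i) (od w i)) [0..<j] = map (\<lambda>i. F (ev w i) (od w i)) [0..<j]"
    by (intro map_cong) (auto simp: factors_def)
  have 3: "map (\<lambda>i. factors F om j i (ev w i) (od w i)) (map ((+) j) [0..<d])
     = map (\<lambda>i. cscale (om (w (2 * (j + i))) (w (Suc (2 * (j + i))))) (mat 1)) [0..<d]"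
    by (simp add: factors_def)
  have 4: "prod_list (map f [0..<d]) = prod f {..<d}" for f :: "nat \<Rightarrow> complex"
    by (simp add: prod.list_conv_set_nth flip: prod.distinct_set_conv_list atLeast0LessThan)
  show ?thesis
    unfolding pairprod_def 1 map_append mprod_append 2 3 mprod_scalars 4 by (simp add: cscale_mult)
qed

lemma tword_factors:
  "tword A (factors F om j) (j + d) u w =
    (spart om u j d w)
      * trace (A ** pairprod (\<lambda>i. F) j w)"
  by (simp add: tword_def mprod_factors cscale_mult mult_ac)

text \<open>The scalar factor of a charge form is invariant under permutations of the slots of \<open>P\<^sub>j\<close>.\<close>
lemma altz_absorb_trace:
  fixes T :: "(nat \<Rightarrow> 'v) \<Rightarrow> 'r::finite mtx" and om :: "'v \<Rightarrow> 'v \<Rightarrow> complex"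
  assumes "2 * j \<le> N"
  shows "altz N (\<lambda>w. (spart om u j d w)
      * trace (A ** altz (2 * j) T w)) v
    = fact (2 * j) *\<^sub>R altz N (\<lambda>w. (spart om u j d w)
      * trace (A ** T w)) v"
proof -
  define s where "s w = spart om u j d w" for w
  have "linear (\<lambda>X. y * trace (A ** X))" for y
    using linear_compose[OF linear_compose[OF linear_matrix_mult(1) linear_trace] linear_times(1)] by (simp add: o_def)
  then have "altz N (\<lambda>w. s w * trace (A ** altz (2 * j) T w)) v = fact (2 * j) *\<^sub>R altz N (\<lambda>w. s w * trace (A ** T w)) v"
  proof (rule altz_absorb_left[where m = "\<lambda>X y. y * trace (A ** X)"])
    fix w :: "nat \<Rightarrow> 'v" and \<tau> assume "\<tau> permutes {..<2 * j}"
    then have "\<tau> k = k" if "k \<ge> 2 * j" for k using that by (simp add: permutes_not_in)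
    then show "s (\<lambda>k. w (\<tau> k)) = s w" by (simp add: s_def)
  qed (rule assms)
  then show ?thesis unfolding s_def .
qed

text \<open>Here \<open>P\<close> is a curvature power, that is 2^-j times an antisymmetrisation
  over 2 j slots. Absorbing it into the outer one produces (2 j)!, which cancels the remaining 1/(2
  j)!.\<close>

lemma trace_charge_form:
  fixes F :: "('n::finite, 'r::finite mtx) lform"
  assumes om: "\<And>w. om z w = om2 (w 0) (w (Suc 0))"
    and U: "\<And>k w w'. (\<And>m. m < k \<Longrightarrow> w m = w' m) \<Longrightarrow> U k z w = U k z w'"
    and F: "\<And>w. F z w = F2 (w 0) (w (Suc 0))"
  shows "trace (A ** charge_form c om U (wedge_power (\<lambda>A B. A ** B) (mat 1) 2 F) z v)
    = charge_density c om2 (\<lambda>k. U k z) CARD('n) F2 A v"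
proof -
  have trm: "trace (A ** cscale (c d / fact j) (wedge cscale (2 * d) (2 * j + 2 * l) (wedge_power times 1 2 om d)
      (wedge (\<lambda>A s. cscale s A) (2 * j) (2 * l) (wedge_power (\<lambda>A B. A ** B) (mat 1) 2 F j) (U (2 * l))) z v))
    = charge_coeff c d j l * altz (2 * CARD('n)) (tword A (factors F2 om2 j) (j + d) (U (2 * l) z)) v"
    if n: "d + j + l = CARD('n)" for d j l
  proof -
    let ?P = "wedge_power (\<lambda>A B. A ** B) (mat 1) 2 F j"
    let ?s = "\<lambda>w. spart om2 (U (2 * l) z) j d w"
    have "trace (A ** cscale (c d / fact j) (wedge cscale (2 * d) (2 * j + 2 * l) (wedge_power times 1 2 om d)
        (wedge (\<lambda>A s. cscale s A) (2 * j) (2 * l) ?P (U (2 * l))) z v))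
      = (c d / fact j) * (1 / (2 ^ d * fact (2 * j) * fact (2 * l))) *\<^sub>R
         trace (A ** altz (2 * (d + j + l)) (\<lambda>w. cscale (?s w) (?P z w)) v)"
      by (subst wedge_charge_term[of om z om2])
        (auto simp: om intro!: U wedge_list_local simp: linear_matrix_mult F sum_list_replicate2
          cscale_mult scaleR_matrix_mult trace_scaleR simp del: map_replicate)
    also have "trace (A ** altz (2 * (d + j + l)) (\<lambda>w. cscale (?s w) (?P z w)) v)
      = altz (2 * CARD('n)) (\<lambda>w. ?s w * trace (A ** ?P z w)) v"
      using altz_linear[OF linear_compose[OF linear_matrix_mult(1) linear_trace], of "2 * CARD('n)" A "\<lambda>w. cscale (?s w) (?P z w)" v]
      by (simp add: o_def cscale_mult n del: distrib_left_numeral)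
    also have "\<dots> = (1 / 2 ^ j) *\<^sub>R altz (2 * CARD('n)) (\<lambda>w. ?s w * trace (A ** altz (2 * j) (pairprod (\<lambda>i. F2) j) w)) v"
      by (simp add: wedge_power_matrix[of F z F2, OF F] scaleR_matrix_mult trace_scaleR altz_scaleR)
    also have "altz (2 * CARD('n)) (\<lambda>w. ?s w * trace (A ** altz (2 * j) (pairprod (\<lambda>i. F2) j) w)) v
      = fact (2 * j) *\<^sub>R altz (2 * CARD('n)) (\<lambda>w. ?s w * trace (A ** pairprod (\<lambda>i. F2) j w)) v"
      by (rule altz_absorb_trace) (use n in auto)
    also have "altz (2 * CARD('n)) (\<lambda>w. ?s w * trace (A ** pairprod (\<lambda>i. F2) j w)) v
      = altz (2 * CARD('n)) (tword A (factors F2 om2 j) (j + d) (U (2 * l) z)) v" (is "_ = ?X")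
      by (rule altz_cong) (rule tword_factors[symmetric])
    also have "c d / fact j * (1 / (2 ^ d * fact (2 * j) * fact (2 * l))) *\<^sub>R (1 / 2 ^ j) *\<^sub>R fact (2 * j) *\<^sub>R ?X
      = charge_coeff c d j l * ?X"
      by (simp add: charge_coeff_def scaleR_conv_of_real)
    finally show ?thesis .
  qed
  have "trace (A ** charge_form c om U (wedge_power (\<lambda>A B. A ** B) (mat 1) 2 F) z v)
    = (\<Sum>x\<in>degree_triples CARD('n). trace (A ** (case x of (d, j, l) \<Rightarrow> cscale (c d / fact j)
        (wedge cscale (2 * d) (2 * j + 2 * l) (wedge_power times 1 2 om d)
      (wedge (\<lambda>A s. cscale s A) (2 * j) (2 * l) (wedge_power (\<lambda>A B. A ** B) (mat 1) 2 F j) (U (2 * l))) z v))))"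
    using linear_sum[OF linear_compose[OF linear_matrix_mult(1) linear_trace], of A]
    by (simp add: charge_form_def o_def)
  also have "\<dots> = charge_density c om2 (\<lambda>k. U k z) CARD('n) F2 A v"
    unfolding charge_density_def by (intro sum.cong refl) (auto simp: degree_triples_def trm)
  finally show ?thesis .
qed

section \<open>Symmetrised products\<close>

text \<open>All entries but one agree, so only the new place of the marked entry matters; it is
  \<open>inv \<sigma> 0\<close>.\<close>

lemma permute_list_marked:
  assumes \<sigma>: "\<sigma> permutes {..<Suc j}"
  shows "\<exists>a\<le>j. permute_list \<sigma> (x # replicate j y) = replicate a y @ x # replicate (j - a) y"
proof (intro exI conjI)
  let ?a = "inv \<sigma> 0"
  have "?a < Suc j" using permutes_in_image[OF permutes_inv[OF \<sigma>], of 0] by simp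
  then show a: "?a \<le> j" by simp
  have i: "\<sigma> i = 0 \<longleftrightarrow> i = ?a" for i by (metis \<sigma> permutes_inv_eq)
  show "permute_list \<sigma> (x # replicate j y) = replicate ?a y @ x # replicate (j - ?a) y"
  proof (rule nth_equalityI)
    fix k assume "k < length (permute_list \<sigma> (x # replicate j y))"
    then have k: "k < Suc j" by simp
    have s: "\<sigma> k < Suc j" using permutes_in_image[OF \<sigma>, of k] k by simp
    have "permute_list \<sigma> (x # replicate j y) ! k = (x # replicate j y) ! \<sigma> k"
      by (rule permute_list_nth) (use \<sigma> k in auto)
    also have "\<dots> = (if k = ?a then x else y)" using s i[of k] by (auto simp: nth_Cons')
    also have "\<dots> = (replicate ?a y @ x # replicate (j - ?a) y) ! k"
      using k by (auto simp: nth_append nth_Cons')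
    finally show "permute_list \<sigma> (x # replicate j y) ! k = (replicate ?a y @ x # replicate (j - ?a) y) ! k" .
  qed (use a in auto)
qed

text \<open>The marked factor has degree 0 and consumes no slots, so the factors after it continue
  with the pair a.\<close>

lemma wedge_list_marked:
  fixes F :: "('n::finite, 'r::finite mtx) lform"
  assumes F: "\<And>w. F z w = F2 (w 0) (w (Suc 0))" and a: "a \<le> j"
  shows "wedge_list (\<lambda>A B. A ** B) (mat 1) (replicate a (2, F) @ (0, \<lambda>y w. V y) # replicate (j - a) (2, F)) z v
    = (1 / 2 ^ j) *\<^sub>R altz (2 * j) (\<lambda>w. mprod (map (\<lambda>i. F2 (ev w i) (od w i)) [0..<a]) ** V z **
        mprod (map (\<lambda>i. F2 (w (2 * (a + i))) (w (Suc (2 * (a + i))))) [0..<j - a])) v"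
proof -
  let ?as = "replicate a (2::nat, F) @ (0, \<lambda>y w. V y) # replicate (j - a) (2, F)"
  have s: "sum_list (map fst ?as) = 2 * j" using a by (simp add: sum_list_replicate)
  have "prod_list (map (\<lambda>a. fact (fst a)) ?as) = (2 ^ a * 2 ^ (j - a) :: real)"
    using prod_list_replicate_fact2[of a F] prod_list_replicate_fact2[of "j - a" F] by (simp del: map_replicate)
  also have "\<dots> = 2 ^ j" using a by (simp flip: power_add)
  finally have p: "prod_list (map (\<lambda>a. fact (fst a)) ?as) = (2 ^ j :: real)" .
  have t: "tensor_list (\<lambda>A B. A ** B) (mat 1) ?as z w = mprod (map (\<lambda>i. F2 (ev w i) (od w i)) [0..<a]) ** V z **
        mprod (map (\<lambda>i. F2 (w (2 * (a + i))) (w (Suc (2 * (a + i))))) [0..<j - a])" for w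
    using tensor_list_replicate[of F z F2 "mat 1" a _ w, OF F] tensor_list_replicate[of F z F2 "mat 1" "j - a" "[]", OF F]
    by (simp add: matrix_mul_assoc)
  have "wedge_list (\<lambda>A B. A ** B) (mat 1) ?as z v = (1 / 2 ^ j) *\<^sub>R altz (2 * j) (tensor_list (\<lambda>A B. A ** B) (mat 1) ?as z) v"
    by (subst wedge_list_altz) (auto simp: linear_matrix_mult F s p simp del: map_append list.map map_replicate)
  also have "altz (2 * j) (tensor_list (\<lambda>A B. A ** B) (mat 1) ?as z) v = altz (2 * j)
      (\<lambda>w. mprod (map (\<lambda>i. F2 (ev w i) (od w i)) [0..<a]) ** V z **
        mprod (map (\<lambda>i. F2 (w (2 * (a + i))) (w (Suc (2 * (a + i))))) [0..<j - a])) v"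
    by (rule altz_cong) (rule t)
  finally show ?thesis .
qed

text \<open>Under the trace each ordering F^a V F^(j-a) can be rotated to V F^j, and renumbering the
  pairs of slots accordingly is even. So all (j + 1)! orderings contribute equally and the average
  is invisible.\<close>

lemma trace_sym_product:
  fixes F :: "('n::finite, 'r::finite mtx) lform" and om :: "('n, complex) bil"
    and u :: "(nat \<Rightarrow> 'n pt) \<Rightarrow> complex"
  assumes F: "\<And>w. F z w = F2 (w 0) (w (Suc 0))" and N: "2 * (j + d) \<le> N"
  defines "s w \<equiv> spart om u j d w"
  shows "altz N (\<lambda>w. s w * trace (sym_product ((0, \<lambda>y w. V y) # replicate j (2, F)) z w)) v
    = (fact (2 * j) / 2 ^ j) *\<^sub>R altz N (\<lambda>w. s w * trace (V z ** pairprod (\<lambda>i. F2) j w)) v"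
proof -
  let ?as = "(0, \<lambda>y w. V y) # replicate j (2::nat, F)"
  let ?W = "\<lambda>\<sigma>. wedge_list (\<lambda>A B. A ** B) (mat 1) (permute_list \<sigma> ?as) z"
  have one: "altz N (\<lambda>w. s w * trace (?W \<sigma> w)) v = (fact (2 * j) / 2 ^ j) *\<^sub>R altz N (\<lambda>w. s w * trace (V z ** pairprod (\<lambda>i. F2) j w)) v"
    if \<sigma>: "\<sigma> permutes {..<Suc j}" for \<sigma>
  proof -
    obtain a where a: "a \<le> j" "permute_list \<sigma> ?as = replicate a (2, F) @ (0, \<lambda>y w. V y) # replicate (j - a) (2, F)"
      using permute_list_marked[OF \<sigma>, of "(0, \<lambda>y w. V y)" "(2, F)"] by (elim exE conjE) (rule that)
    define f where "f w i = F2 (ev w i) (od w i)" for w :: "nat \<Rightarrow> 'n pt" and i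
    \<comment> \<open>The factor \<open>mat 1\<close> brings the trace into the shape of
      \<open>altz_absorb_trace\<close>.\<close>
    have "altz N (\<lambda>w. s w * trace (?W \<sigma> w)) v = (1 / 2 ^ j) *\<^sub>R altz N (\<lambda>w. s w * trace (mat 1 **
        altz (2 * j) (\<lambda>w. mprod (map (f w) [0..<a]) ** V z ** mprod (map (\<lambda>i. f w (a + i)) [0..<j - a])) w)) v"
      by (simp add: a(2) wedge_list_marked[of F z F2, OF F a(1)] trace_scaleR altz_scaleR f_def[abs_def])
    also have "\<dots> = (1 / 2 ^ j) *\<^sub>R fact (2 * j) *\<^sub>R altz N (\<lambda>w. s w * trace (mat 1 **
        (mprod (map (f w) [0..<a]) ** V z ** mprod (map (\<lambda>i. f w (a + i)) [0..<j - a])))) v"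
      unfolding s_def by (subst altz_absorb_trace) (use N in auto)
    also have "altz N (\<lambda>w. s w * trace (mat 1 **
        (mprod (map (f w) [0..<a]) ** V z ** mprod (map (\<lambda>i. f w (a + i)) [0..<j - a])))) v
      = altz N (\<lambda>w. s w * trace (V z ** pairprod (\<lambda>i. F2) j w)) v"
    proof (rule sym, rule altz_lift2_eq[where J = "j + d"])
      \<comment> \<open>The rotation of the j curvature pairs by which the factors behind V come
        first; the later slots stay fixed.\<close>
      let ?\<pi> = "\<lambda>i. if i < j then (if i < a then j - a + i else i - a) else i"
      have "?\<pi> permutes {..<j}"
        by (rule bij_imp_permutes, rule bij_betw_byWitness[where f' = "\<lambda>i. if i < j - a then a + i else i - (j - a)"]) (use a(1) in auto)
      then show "?\<pi> permutes {..<j + d}" by (rule permutes_subset) auto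
      show "2 * (j + d) \<le> N" by (rule N)
      fix w :: "nat \<Rightarrow> 'n pt"
      let ?w = "\<lambda>k. w (lift2 ?\<pi> k)"
      have "lift2 ?\<pi> (2 * (j + d) + k) = 2 * (j + d) + k" for k
      proof -
        have "(2 * (j + d) + k) div 2 = j + d + k div 2" "(2 * (j + d) + k) mod 2 = k mod 2" by presburger+
        then show ?thesis by (simp add: lift2_def)
      qed
      then have 1: "s ?w = s w" unfolding s_def lift2_simps by simp
      have f: "f ?w i = f w (?\<pi> i)" for i by (simp add: f_def)
      have "[0..<j] = [0..<j - a] @ map (\<lambda>i. j - a + i) [0..<a]"
        by (rule nth_equalityI) (use a(1) in \<open>auto simp: nth_append\<close>)
      then have pp: "pairprod (\<lambda>i. F2) j w = mprod (map (f w) [0..<j - a]) ** mprod (map (\<lambda>i. f w (j - a + i)) [0..<a])"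
        unfolding pairprod_def f_def[symmetric] by (simp only: map_append mprod_append map_map o_def)
      have m1: "map (\<lambda>i. f ?w (a + i)) [0..<j - a] = map (f w) [0..<j - a]"
        unfolding f by (intro map_cong) auto
      have m2: "map (f ?w) [0..<a] = map (\<lambda>i. f w (j - a + i)) [0..<a]"
        unfolding f using a(1) by (intro map_cong) auto
      show "s w * trace (V z ** pairprod (\<lambda>i. F2) j w) = s ?w * trace (mat 1 **
        (mprod (map (f ?w) [0..<a]) ** V z ** mprod (map (\<lambda>i. f ?w (a + i)) [0..<j - a])))"
        unfolding 1 m1 m2 pp by (simp add: trace_mult_commute3[of "mprod _" "V z"] matrix_mul_assoc)
    qed
    finally show ?thesis by simp
  qed
  have "altz N (\<lambda>w. s w * trace (sym_product ?as z w)) v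
    = altz N (\<lambda>w. \<Sum>\<sigma> | \<sigma> permutes {..<Suc j}. (1 / fact (Suc j)) *\<^sub>R (s w * trace (?W \<sigma> w))) v"
    by (rule altz_cong) (simp add: sym_product_def trace_scaleR linear_sum[OF linear_trace] sum_distrib_left scaleR_sum_right)
  also have "\<dots> = (\<Sum>\<sigma> | \<sigma> permutes {..<Suc j}. (1 / fact (Suc j)) *\<^sub>R
      ((fact (2 * j) / 2 ^ j) *\<^sub>R altz N (\<lambda>w. s w * trace (V z ** pairprod (\<lambda>i. F2) j w)) v))"
    by (simp only: altz_sum altz_scaleR) (intro sum.cong refl, simp only: one mem_Collect_eq)
  also have "\<dots> = (fact (2 * j) / 2 ^ j) *\<^sub>R altz N (\<lambda>w. s w * trace (V z ** pairprod (\<lambda>i. F2) j w)) v"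
    by (simp add: sum_constant_scaleR card_permutes_fact scaleR_conv_of_real del: fact_Suc)
  finally show ?thesis .
qed

lemma continuous_on_mprod:
  assumes "\<And>i. i \<in> set is \<Longrightarrow> continuous_on T (M i)"
  shows "continuous_on T (\<lambda>t. mprod (map (\<lambda>i. M i t) is))"
  using assms by (induction "is") (auto intro!: bounded_bilinear.continuous_on[OF bounded_bilinear_matrix_mult])

lemma continuous_on_altz:
  fixes A :: "'t::topological_space \<Rightarrow> (nat \<Rightarrow> 'v) \<Rightarrow> 'b::real_normed_vector"
  assumes "\<And>w. continuous_on T (\<lambda>t. A t w)"
  shows "continuous_on T (\<lambda>t. altz N (A t) v)"
  unfolding altz_def by (intro continuous_on_sum continuous_on_scaleR continuous_on_const assms)

lemma continuous_on_sym_product: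
  fixes F :: "'t::topological_space \<Rightarrow> ('n::finite, 'r::finite mtx) lform"
  assumes F: "\<And>t w. F t z w = F2 t (w 0) (w (Suc 0))"
    and cF: "\<And>a b. continuous_on T (\<lambda>t. F2 t a b)" and cV: "continuous_on T (\<lambda>t. V t z)"
  shows "continuous_on T (\<lambda>t. sym_product ((0, \<lambda>y w. V t y) # replicate j (2, F t)) z v)"
proof -
  have "continuous_on T (\<lambda>t. wedge_list (\<lambda>A B. A ** B) (mat 1) (permute_list \<sigma> ((0, \<lambda>y w. V t y) # replicate j (2, F t))) z v)"
    if \<sigma>: "\<sigma> permutes {..<Suc j}" for \<sigma>
  proof -
    let ?a = "inv \<sigma> 0"
    \<comment> \<open>The position is determined on a list of booleans, so that it does not depend
      on t.\<close>
    obtain a where a: "a \<le> j" and eq: "permute_list \<sigma> (True # replicate j False) = replicate a False @ True # replicate (j - a) False"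
      using permute_list_marked[OF \<sigma>, of True False] by (elim exE conjE) (rule that)
    have "permute_list \<sigma> (x # replicate j y) = replicate a y @ x # replicate (j - a) y" for x y :: "nat \<times> ('n, 'r mtx) lform"
    proof -
      have "permute_list \<sigma> (map (\<lambda>b. if b then x else y) (True # replicate j False))
        = map (\<lambda>b. if b then x else y) (replicate a False @ True # replicate (j - a) False)"
        using permute_list_map[of \<sigma> "True # replicate j False" "\<lambda>b. if b then x else y"] \<sigma> eq by simp
      then show ?thesis by simp
    qed
    then show ?thesis
      by (simp only: wedge_list_marked[of "F _" z "F2 _", OF F a])
        (intro continuous_intros continuous_on_altz continuous_on_mprod cF cV
          bounded_bilinear.continuous_on[OF bounded_bilinear_matrix_mult])
  qed
  then show ?thesis unfolding sym_product_def length_Cons length_replicate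
    by (intro continuous_on_scaleR continuous_on_const continuous_on_sum) simp
qed

lemma continuous_on_tword:
  assumes "continuous_on T A" "\<And>i a b. continuous_on T (\<lambda>t. Fs t i a b)"
  shows "continuous_on T (\<lambda>t. tword (A t) (Fs t) J u w)"
  unfolding tword_def pairprod_def
  by (intro continuous_intros continuous_on_mprod bounded_linear.continuous_on[OF bounded_linear_trace]
      bounded_bilinear.continuous_on[OF bounded_bilinear_matrix_mult] assms)

text \<open>The counterpart of \<open>trace_charge_form\<close> for Bott-Chern forms. The t-integral
  commutes with the finite sum over permutations, and \<open>trace_sym_product\<close> supplies the
  factor (2 j)! / 2^j that turns the coefficients into those of
  \<open>charge_density\<close>.\<close>

lemma trace_charge_form_integral:
  fixes F :: "real \<Rightarrow> ('n::finite, 'r::finite mtx) lform"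
  assumes om: "\<And>w. om z w = om2 (w 0) (w (Suc 0))"
    and U: "\<And>k w w'. (\<And>m. m < k \<Longrightarrow> w m = w' m) \<Longrightarrow> U k z w = U k z w'"
    and F: "\<And>t w. F t z w = F2 t (w 0) (w (Suc 0))"
    and cF: "\<And>a b. continuous_on {0..1} (\<lambda>t. F2 t a b)" and cV: "continuous_on {0..1} (\<lambda>t. V t z)"
    and P: "\<And>j w. P j z w = integral {0..1} (\<lambda>t. sym_product ((0, \<lambda>y w. V t y) # replicate j (2, F t)) z w)"
  shows "trace (charge_form c om U P z v)
    = integral {0..1} (\<lambda>t. charge_density c om2 (\<lambda>k. U k z) CARD('n) (F2 t) (V t z) v)"
proof -
  have cont: "continuous_on {0..1} (\<lambda>t. altz (2 * CARD('n)) (tword (V t z) (factors (F2 t) om2 j) J u) v)" for j J u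
  proof (intro continuous_on_altz continuous_on_tword cV)
    show "continuous_on {0..1} (\<lambda>t. factors (F2 t) om2 j i a b)" for i a b
      by (cases "i < j") (simp_all add: factors_def cF)
  qed
  have trm: "trace (cscale (c d / fact j) (wedge cscale (2 * d) (2 * j + 2 * l) (wedge_power times 1 2 om d)
      (wedge (\<lambda>A s. cscale s A) (2 * j) (2 * l) (P j) (U (2 * l))) z v))
    = integral {0..1} (\<lambda>t. charge_coeff c d j l * altz (2 * CARD('n)) (tword (V t z) (factors (F2 t) om2 j) (j + d) (U (2 * l) z)) v)"
    if n: "d + j + l = CARD('n)" for d j l
  proof -
    let ?S = "\<lambda>t w. sym_product ((0, \<lambda>y w. V t y) # replicate j (2, F t)) z w"
    let ?s = "\<lambda>w. spart om2 (U (2 * l) z) j d w"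
    have cS: "continuous_on {0..1} (\<lambda>t. ?S t w)" for w
      by (rule continuous_on_sym_product[of F z F2 _ V, OF F cF cV])
    have S_local: "?S t w = ?S t w'" if "\<And>k. k < 2 * j \<Longrightarrow> w k = w' k" for t w w'
      unfolding sym_product_def
    proof (intro arg_cong[where f = "scaleR _"] sum.cong refl)
      fix \<sigma> assume "\<sigma> \<in> {\<sigma>. \<sigma> permutes {..<length ((0::nat, \<lambda>y w. V t y) # replicate j (2, F t))}}"
      then have "\<sigma> permutes {..<Suc j}" by simp
      then obtain a where a: "a \<le> j" and "permute_list \<sigma> ((0, \<lambda>y w. V t y) # replicate j (2::nat, F t))
          = replicate a (2, F t) @ (0, \<lambda>y w. V t y) # replicate (j - a) (2, F t)"
        using permute_list_marked[OF \<open>\<sigma> permutes {..<Suc j}\<close>, of "(0, \<lambda>y w. V t y)" "(2, F t)"] by (elim exE conjE) (rule that)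
      then show "wedge_list (\<lambda>A B. A ** B) (mat 1) (permute_list \<sigma> ((0, \<lambda>y w. V t y) # replicate j (2, F t))) z w
        = wedge_list (\<lambda>A B. A ** B) (mat 1) (permute_list \<sigma> ((0, \<lambda>y w. V t y) # replicate j (2, F t))) z w'"
        using that by (simp only:) (rule wedge_list_local, auto simp: linear_matrix_mult F sum_list_replicate)
    qed
    have "trace (cscale (c d / fact j) (wedge cscale (2 * d) (2 * j + 2 * l) (wedge_power times 1 2 om d)
        (wedge (\<lambda>A s. cscale s A) (2 * j) (2 * l) (P j) (U (2 * l))) z v))
      = (c d / fact j) * (1 / (2 ^ d * fact (2 * j) * fact (2 * l))) *\<^sub>R
         trace (altz (2 * (d + j + l)) (\<lambda>w. cscale (?s w) (P j z w)) v)"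
    proof -
      have Pl: "P j z w = P j z w'" if "\<And>k. k < 2 * j \<Longrightarrow> w k = w' k" for w w'
        unfolding P using S_local[OF that] by simp
      have "wedge cscale (2 * d) (2 * j + 2 * l) (wedge_power times 1 2 om d)
          (wedge (\<lambda>A s. cscale s A) (2 * j) (2 * l) (P j) (U (2 * l))) z v
        = (1 / (2 ^ d * fact (2 * j) * fact (2 * l))) *\<^sub>R altz (2 * (d + j + l)) (\<lambda>w. cscale (?s w) (P j z w)) v"
      proof (rule wedge_charge_term[of om z om2])
        show "om z w = om2 (w 0) (w (Suc 0))" for w by (rule om)
        show "U (2 * l) z w = U (2 * l) z w'" if "\<And>k. k < 2 * l \<Longrightarrow> w k = w' k" for w w'
          using that by (rule U)
        show "P j z w = P j z w'" if "\<And>k. k < 2 * j \<Longrightarrow> w k = w' k" for w w'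
          using that by (rule Pl)
      qed
      then show ?thesis by (simp only: trace_cscale trace_scaleR)
    qed
    also have "trace (altz (2 * (d + j + l)) (\<lambda>w. cscale (?s w) (P j z w)) v)
      = altz (2 * CARD('n)) (\<lambda>w. trace (cscale (?s w) (P j z w))) v"
      unfolding n by (rule altz_linear[OF linear_trace, symmetric])
    also have "\<dots> = altz (2 * CARD('n)) (\<lambda>w. integral {0..1} (\<lambda>t. ?s w * trace (?S t w))) v"
    proof (rule altz_cong)
      fix w
      have "((\<lambda>t. trace (cscale (?s w) (?S t w))) has_integral trace (cscale (?s w) (integral {0..1} (\<lambda>t. ?S t w)))) {0..1}"
        by (intro has_integral_linear[OF _ bounded_linear_compose[OF bounded_linear_trace
            bounded_bilinear.bounded_linear_right[OF bounded_bilinear_cscale]], unfolded o_def]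
            integrable_integral integrable_continuous_real cS)
      then show "trace (cscale (?s w) (P j z w)) = integral {0..1} (\<lambda>t. ?s w * trace (?S t w))"
        by (simp only: trace_cscale P integral_unique)
    qed
    also have "\<dots> = integral {0..1} (\<lambda>t. altz (2 * CARD('n)) (\<lambda>w. ?s w * trace (?S t w)) v)"
      unfolding altz_def
      by (subst integral_sum)
        (auto intro!: integrable_continuous_real continuous_intros bounded_linear.continuous_on[OF bounded_linear_trace] cS
          simp: finite_permutations)
    also have "(\<lambda>t. altz (2 * CARD('n)) (\<lambda>w. ?s w * trace (?S t w)) v)
      = (\<lambda>t. (fact (2 * j) / 2 ^ j) *\<^sub>R altz (2 * CARD('n)) (tword (V t z) (factors (F2 t) om2 j) (j + d) (U (2 * l) z)) v)"
    proof
      fix t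
      have "altz (2 * CARD('n)) (\<lambda>w. ?s w * trace (?S t w)) v
        = (fact (2 * j) / 2 ^ j) *\<^sub>R altz (2 * CARD('n)) (\<lambda>w. ?s w * trace (V t z ** pairprod (\<lambda>i. F2 t) j w)) v"
        by (rule trace_sym_product[of "F t", OF F]) (use n in auto)
      also have "altz (2 * CARD('n)) (\<lambda>w. ?s w * trace (V t z ** pairprod (\<lambda>i. F2 t) j w)) v
        = altz (2 * CARD('n)) (tword (V t z) (factors (F2 t) om2 j) (j + d) (U (2 * l) z)) v"
        by (rule altz_cong) (rule tword_factors[symmetric])
      finally show "altz (2 * CARD('n)) (\<lambda>w. ?s w * trace (?S t w)) v
        = (fact (2 * j) / 2 ^ j) *\<^sub>R altz (2 * CARD('n)) (tword (V t z) (factors (F2 t) om2 j) (j + d) (U (2 * l) z)) v" .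
    qed
    finally show ?thesis
      by (simp add: charge_coeff_def scaleR_conv_of_real)
  qed
  have "trace (charge_form c om U P z v) = (\<Sum>(d, j, l)\<in>degree_triples CARD('n).
     integral {0..1} (\<lambda>t. charge_coeff c d j l * altz (2 * CARD('n)) (tword (V t z) (factors (F2 t) om2 j) (j + d) (U (2 * l) z)) v))"
    unfolding charge_form_def linear_sum[OF linear_trace]
    by (intro sum.cong refl) (auto simp: degree_triples_def trm simp del: trace_cscale)
  also have "\<dots> = integral {0..1} (\<lambda>t. charge_density c om2 (\<lambda>k. U k z) CARD('n) (F2 t) (V t z) v)"
  proof -
    have "finite (degree_triples CARD('n))"
      by (rule finite_subset[of _ "{..CARD('n)} \<times> {..CARD('n)} \<times> {..CARD('n)}"]) (auto simp: degree_triples_def)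
    then show ?thesis
      unfolding charge_density_def case_prod_beta
      by (subst integral_sum) (auto intro!: integrable_continuous_real continuous_intros cont)
  qed
  finally show ?thesis .
qed

section \<open>Real coordinates on \<open>complex^'n\<close>\<close>

text \<open>
  The change of variables formula of the library is stated for a well-ordered index type, hence this
  copy of \<open>'n \<times> bool\<close>.
\<close>
typedef (overloaded) 'n slot = "UNIV :: ('n \<times> bool) set" by simp

lemma bij_Abs_slot: "bij_betw Abs_slot UNIV UNIV"
  by (metis Abs_slot_inject Rep_slot_inverse UNIV_I bij_betw_def injI surjI)

instance slot :: (finite) finite
proof
  have "finite (Abs_slot ` (UNIV :: ('a \<times> bool) set))" by simp
  then show "finite (UNIV :: 'a slot set)" using bij_Abs_slot unfolding bij_betw_def by metis
qed

instantiation slot :: (finite) wellorder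
begin

definition less_eq_slot :: "'a slot \<Rightarrow> 'a slot \<Rightarrow> bool" where
  "less_eq_slot x y \<longleftrightarrow> to_nat_on UNIV x \<le> to_nat_on UNIV y"

definition less_slot :: "'a slot \<Rightarrow> 'a slot \<Rightarrow> bool" where
  "less_slot x y \<longleftrightarrow> to_nat_on UNIV x < to_nat_on UNIV y"

instance
proof
  fix x y z :: "'a slot" and P :: "'a slot \<Rightarrow> bool"
  show "x < y \<longleftrightarrow> x \<le> y \<and> \<not> y \<le> x" by (auto simp: less_eq_slot_def less_slot_def)
  show "x \<le> x" by (simp add: less_eq_slot_def)
  show "x \<le> y \<Longrightarrow> y \<le> z \<Longrightarrow> x \<le> z" by (simp add: less_eq_slot_def)
  have inj: "inj (to_nat_on (UNIV :: 'a slot set))" by (rule inj_on_to_nat_on) (simp add: countable_finite)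
  show "x \<le> y \<Longrightarrow> y \<le> x \<Longrightarrow> x = y" using inj by (auto simp: less_eq_slot_def dest: injD)
  show "x \<le> y \<or> y \<le> x" by (auto simp: less_eq_slot_def)
  show "P x" if "\<And>x. (\<And>y. y < x \<Longrightarrow> P y) \<Longrightarrow> P x" for P and x :: "'a slot"
    using that by (rule measure_induct_rule[of "to_nat_on UNIV"]) (simp add: less_slot_def)
qed

end

abbreviation slot :: "'n \<Rightarrow> bool \<Rightarrow> 'n slot" where "slot a b \<equiv> Abs_slot (a, b)"

lemma slot_eq_iff [simp]: "slot a b = slot a' b' \<longleftrightarrow> a = a' \<and> b = b'"
  by (simp add: Abs_slot_inject)

lemma slot_cases [case_names slot]: obtains a b where "s = slot a b"
  by (metis Rep_slot_inverse surj_pair)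

lemma all_slot: "(\<forall>s. P s) \<longleftrightarrow> (\<forall>a b. P (slot a b))"
  by (metis slot_cases)

definition toC :: "real^'n slot \<Rightarrow> 'n::finite pt" where
  "toC x = (\<chi> a. Complex (x $ slot a False) (x $ slot a True))"

definition ofC :: "'n::finite pt \<Rightarrow> real^'n slot" where
  "ofC z = (\<chi> s. if snd (Rep_slot s) then Im (z $ fst (Rep_slot s)) else Re (z $ fst (Rep_slot s)))"

lemma ofC_nth [simp]: "ofC z $ slot a b = (if b then Im (z $ a) else Re (z $ a))"
  by (simp add: ofC_def Abs_slot_inverse)

lemma toC_nth [simp]: "toC x $ a = Complex (x $ slot a False) (x $ slot a True)"
  by (simp add: toC_def)

lemma toC_ofC [simp]: "toC (ofC z) = z"
  by (simp add: vec_eq_iff complex_eq_iff)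

lemma ofC_toC [simp]: "ofC (toC x) = x"
  by (auto simp: vec_eq_iff all_slot)

lemma linear_toC: "linear toC" and linear_ofC: "linear ofC"
  by (auto simp: linear_iff vec_eq_iff all_slot complex_eq_iff)

lemma bounded_linear_toC: "bounded_linear toC" and bounded_linear_ofC: "bounded_linear ofC"
  using linear_toC linear_ofC linear_conv_bounded_linear by blast+

lemma toC_axis: "toC (axis (slot a b) 1) = axis a (if b then \<i> else 1)"
  by (auto simp: vec_eq_iff axis_def complex_eq_iff)

lemma inner_ofC: "ofC z \<bullet> axis (slot a b) 1 = z \<bullet> axis a (if b then \<i> else 1)"
  by (simp add: inner_axis inner_complex_def)

lemma bij_betw_toC_Basis: "bij_betw (toC :: real^'a slot \<Rightarrow> complex^'a::finite) Basis Basis"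
proof (rule bij_betw_imageI)
  show "inj_on (toC :: real^'a slot \<Rightarrow> complex^'a) Basis" by (metis inj_onI ofC_toC)
  show "toC ` (Basis :: (real^'a slot) set) = (Basis :: (complex^'a) set)"
  proof
    show "toC ` (Basis :: (real^'a slot) set) \<subseteq> (Basis :: (complex^'a) set)"
    proof
      fix y assume "y \<in> toC ` (Basis :: (real^'a slot) set)"
      then obtain s where "y = toC (axis s (1::real))" by (auto simp: Basis_vec_def)
      then show "y \<in> Basis" by (cases s rule: slot_cases) (auto simp: toC_axis Basis_vec_def Basis_complex_def)
    qed
    show "(Basis :: (complex^'a) set) \<subseteq> toC ` (Basis :: (real^'a slot) set)"
    proof
      fix y :: "complex^'a" assume "y \<in> Basis"
      then obtain a where "y = axis a 1 \<or> y = axis a \<i>" by (auto simp: Basis_vec_def Basis_complex_def)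
      then have "y = toC (axis (slot a False) 1) \<or> y = toC (axis (slot a True) 1)" by (simp add: toC_axis)
      then show "y \<in> toC ` (Basis :: (real^'a slot) set)" by (auto simp: Basis_vec_def)
    qed
  qed
qed

lemma inner_toC_Basis: "b \<in> Basis \<Longrightarrow> z \<bullet> toC b = ofC z \<bullet> b"
  by (auto simp: Basis_vec_def, metis inner_ofC slot_cases toC_axis)

lemma borel_measurable_toC: "toC \<in> borel_measurable borel"
  by (rule borel_measurable_continuous_onI) (rule linear_continuous_on[OF bounded_linear_toC])

text \<open>\<open>toC\<close> maps the standard basis bijectively onto the standard basis, so it
  preserves boxes and their volumes.\<close>

lemma lborel_toC: "(lborel :: (complex^'a::finite) measure) = distr lborel lborel toC"
proof (rule lborel_eqI)
  fix l u :: "complex^'a" assume lu: "\<And>b. b \<in> Basis \<Longrightarrow> l \<bullet> b \<le> u \<bullet> b"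
  have meas: "(toC :: real^'a slot \<Rightarrow> complex^'a) \<in> borel_measurable lborel"
    using borel_measurable_toC by simp
  have T: "toC b \<in> Basis" if "b \<in> Basis" for b :: "real^'a slot"
    using bij_betw_toC_Basis that by (auto simp: bij_betw_def)
  have "toC -` box l u = box (ofC l) (ofC u)"
  proof -
    have "toC x \<in> box l u \<longleftrightarrow> x \<in> box (ofC l) (ofC u)" for x
    proof -
      have "toC x \<in> box l u \<longleftrightarrow> (\<forall>c\<in>toC ` Basis. l \<bullet> c < toC x \<bullet> c \<and> toC x \<bullet> c < u \<bullet> c)"
        unfolding mem_box bij_betw_imp_surj_on[OF bij_betw_toC_Basis] ..
      also have "\<dots> \<longleftrightarrow> x \<in> box (ofC l) (ofC u)" by (simp add: mem_box inner_toC_Basis)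
      finally show ?thesis .
    qed
    then show ?thesis by auto
  qed
  then have "emeasure (distr lborel lborel toC) (box l u) = emeasure lborel (box (ofC l) (ofC u))"
    using meas by (simp add: emeasure_distr)
  also have "\<dots> = ennreal (\<Prod>b\<in>Basis. (ofC u - ofC l) \<bullet> b)"
    by (rule emeasure_lborel_box) (metis T inner_toC_Basis lu)
  also have "(\<Prod>b\<in>Basis. (ofC u - ofC l) \<bullet> b) = (\<Prod>b\<in>Basis. (u - l) \<bullet> toC b)"
    by (intro prod.cong refl) (simp add: inner_toC_Basis inner_diff_left linear_diff[OF linear_ofC])
  also have "\<dots> = (\<Prod>c\<in>Basis. (u - l) \<bullet> c)"
    by (rule prod.reindex_bij_betw[OF bij_betw_toC_Basis])
  finally show "emeasure (distr lborel lborel toC) (box l u) = ennreal (\<Prod>b\<in>Basis. (u - l) \<bullet> b)" .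
qed simp

lemma integrable_toC: "integrable lborel f \<longleftrightarrow> integrable lborel (\<lambda>x. f (toC x))"
  if "f \<in> borel_measurable borel" for f :: "'n::finite pt \<Rightarrow> complex"
  by (subst lborel_toC) (simp add: integrable_distr_eq borel_measurable_toC that)

lemma integral_toC: "integral\<^sup>L lborel f = integral\<^sup>L lborel (\<lambda>x. f (toC x))"
  if "f \<in> borel_measurable borel" for f :: "'n::finite pt \<Rightarrow> complex"
  by (subst lborel_toC) (simp add: integral_distr borel_measurable_toC that)

definition rmat :: "('n::finite pt \<Rightarrow> 'n pt) \<Rightarrow> real^'n slot^'n slot" where
  "rmat A = matrix (\<lambda>x. ofC (A (toC x)))"

text \<open>The function \<open>f\<close> vanishes outside the image of \<open>S\<close> and
  \<open>g\<close> outside \<open>S\<close>, so the formula for the open set becomes an identity of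
  integrals over the whole space.\<close>

lemma change_of_variables:
  fixes f g :: "'n::finite pt \<Rightarrow> complex"
  assumes S: "open S" and T: "\<And>z. z \<in> S \<Longrightarrow> (T has_derivative T' z) (at z)" and inj: "inj_on T S"
    and f: "integrable lborel f" and f0: "\<And>y. y \<notin> T ` S \<Longrightarrow> f y = 0"
    and g: "integrable lborel g" and g0: "\<And>z. z \<notin> S \<Longrightarrow> g z = 0"
    and fg: "\<And>z. z \<in> S \<Longrightarrow> g z = of_real \<bar>det (rmat (T' z))\<bar> * f (T z)"
  shows "integral\<^sup>L lborel f = integral\<^sup>L lborel g"
proof -
  \<comment> \<open>Complex values are read as vectors in \<open>real^2\<close>, the format in which
    the formula is applied; injectivity of \<open>L\<close> leads back at the end.\<close>
  define L :: "complex \<Rightarrow> real^2" where "L z = (\<chi> i. if i = 1 then Re z else Im z)" for z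
  have L: "bounded_linear L"
    unfolding linear_conv_bounded_linear[symmetric] by (auto simp: linear_iff L_def vec_eq_iff)
  have L_inj: "L a = L b \<Longrightarrow> a = b" for a b
    by (simp add: L_def vec_eq_iff complex_eq_iff) (metis exhaust_2 zero_neq_one)
  define S' where "S' = toC -` S"
  define T2 where "T2 x = ofC (T (toC x))" for x
  define f2 where "f2 x = f (toC x)" for x
  define g2 where "g2 x = g (toC x)" for x
  have fm: "f \<in> borel_measurable borel" and gm: "g \<in> borel_measurable borel"
    using borel_measurable_integrable[OF f] borel_measurable_integrable[OF g] by simp_all
  have if2: "integrable lborel f2" and ig2: "integrable lborel g2"
    using f g integrable_toC[OF fm] integrable_toC[OF gm] by (simp_all add: f2_def[abs_def] g2_def[abs_def])
  have S': "open S'"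
    unfolding S'_def by (rule open_vimage[OF S linear_continuous_on[OF bounded_linear_toC]])
  have T2: "(T2 has_derivative (\<lambda>x. ofC (T' (toC z) (toC x)))) (at z within S')" if "z \<in> S'" for z
  proof -
    have "toC z \<in> S" using that by (simp add: S'_def)
    then have "((\<lambda>x. T (toC x)) has_derivative (\<lambda>x. T' (toC z) (toC x))) (at z)"
      by (intro has_derivative_compose[where f = toC, OF bounded_linear_imp_has_derivative[OF bounded_linear_toC] T])
    then show ?thesis
      unfolding T2_def by (rule bounded_linear.has_derivative[OF bounded_linear_ofC, THEN has_derivative_at_withinI])
  qed
  have inj2: "inj_on T2 S'"
    unfolding T2_def S'_def using inj by (auto simp: inj_on_def) (metis ofC_toC toC_ofC)
  have T2S: "x \<notin> T2 ` S' \<Longrightarrow> f2 x = 0" for x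
  proof -
    assume x: "x \<notin> T2 ` S'"
    have "toC x \<notin> T ` S"
    proof
      assume "toC x \<in> T ` S"
      then obtain z where z: "z \<in> S" "toC x = T z" by blast
      then have "x = T2 (ofC z)" "ofC z \<in> S'" by (simp_all add: T2_def S'_def flip: z(2))
      then show False using x by blast
    qed
    then show "f2 x = 0" by (simp add: f2_def f0)
  qed
  have i1: "integrable lebesgue (\<lambda>x. L (f2 x))"
    using if2 L by (simp add: integrable_completion integrable_bounded_linear borel_measurable_integrable)
  have eq: "(\<lambda>x. L (f2 x)) = (\<lambda>x. indicator (T2 ` S') x *\<^sub>R L (f2 x))"
    using T2S linear_0[OF bounded_linear.linear[OF L]] by (auto simp: indicator_def fun_eq_iff)
  have abs: "(\<lambda>x. L (f2 x)) absolutely_integrable_on T2 ` S'"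
    unfolding set_integrable_def using i1 by (subst (asm) eq)
  have D: "g2 x = \<bar>det (matrix (\<lambda>y. ofC (T' (toC x) (toC y))))\<bar> *\<^sub>R f2 (T2 x)" if "x \<in> S'" for x
    using fg[of "toC x"] that by (simp add: g2_def f2_def T2_def S'_def rmat_def scaleR_conv_of_real)
  have "integral S' (\<lambda>x. \<bar>det (matrix (\<lambda>y. ofC (T' (toC x) (toC y))))\<bar> *\<^sub>R L (f2 (T2 x))) = integral (T2 ` S') (\<lambda>x. L (f2 x))"
    using has_absolute_integral_change_of_variables[of S' T2 "\<lambda>z x. ofC (T' (toC z) (toC x))" "\<lambda>x. L (f2 x)" "integral (T2 ` S') (\<lambda>x. L (f2 x))",
        OF borel_open[OF S', THEN sets_completionI_sets[of _ lborel, simplified]] T2 inj2] abs by simp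
  also have "integral S' (\<lambda>x. \<bar>det (matrix (\<lambda>y. ofC (T' (toC x) (toC y))))\<bar> *\<^sub>R L (f2 (T2 x))) = integral S' (\<lambda>x. L (g2 x))"
    by (intro integral_cong) (simp add: D linear_scale[OF bounded_linear.linear[OF L]])
  also have "\<dots> = integral UNIV (\<lambda>x. L (g2 x))"
  proof -
    have "(\<lambda>x. if x \<in> S' then L (g2 x) else 0) = (\<lambda>x. L (g2 x))"
      using g0 linear_0[OF bounded_linear.linear[OF L]] by (auto simp: g2_def S'_def)
    then show ?thesis using integral_restrict_UNIV[of S' "\<lambda>x. L (g2 x)"] by simp
  qed
  also have "\<dots> = L (integral\<^sup>L lborel g2)"
    using ig2 L by (simp add: integral_lborel integrable_bounded_linear integral_bounded_linear)
  also have "integral (T2 ` S') (\<lambda>x. L (f2 x)) = integral UNIV (\<lambda>x. L (f2 x))"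
  proof -
    have "(\<lambda>x. if x \<in> T2 ` S' then L (f2 x) else 0) = (\<lambda>x. L (f2 x))"
      using T2S linear_0[OF bounded_linear.linear[OF L]] by auto
    then show ?thesis using integral_restrict_UNIV[of "T2 ` S'" "\<lambda>x. L (f2 x)"] by simp
  qed
  also have "\<dots> = L (integral\<^sup>L lborel f2)"
    using if2 L by (simp add: integral_lborel integrable_bounded_linear integral_bounded_linear)
  finally have "integral\<^sup>L lborel g2 = integral\<^sup>L lborel f2" by (rule L_inj)
  then show ?thesis using integral_toC[OF fm] integral_toC[OF gm] by (simp add: f2_def[abs_def] g2_def[abs_def])
qed

section \<open>Top-degree alternating forms and determinants\<close>

text \<open>Numbers the real coordinates in the order of \<open>std_frame\<close>: even numbers are
  real parts, odd ones imaginary parts.\<close>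

definition slot_of :: "nat \<Rightarrow> 'n::finite slot" where
  "slot_of k = slot (from_nat_into UNIV (k div 2)) (odd k)"

lemma std_frame_slot: "std_frame k = toC (axis (slot_of k) 1)"
  by (simp add: std_frame_def slot_of_def toC_axis)

lemma bij_betw_slot_of: "bij_betw (slot_of :: nat \<Rightarrow> 'n::finite slot) {..<2 * CARD('n)} UNIV"
proof (rule bij_betw_imageI)
  have b: "bij_betw (from_nat_into (UNIV :: 'n set)) {..<CARD('n)} UNIV"
    by (rule bij_betw_from_nat_into_finite) simp
  show "inj_on (slot_of :: nat \<Rightarrow> 'n slot) {..<2 * CARD('n)}"
  proof (rule inj_onI)
    fix k l assume kl: "k \<in> {..<2 * CARD('n)}" "l \<in> {..<2 * CARD('n)}" "slot_of k = (slot_of l :: 'n slot)"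
    then have "k div 2 = l div 2" "even k = even l"
      using inj_onD[OF bij_betw_imp_inj_on[OF b], of "k div 2" "l div 2"] by (auto simp: slot_of_def)
    then show "k = l" by (metis dvd_mult_div_cancel odd_two_times_div_two_succ)
  qed
  show "slot_of ` {..<2 * CARD('n)} = (UNIV :: 'n slot set)"
  proof -
    have "s \<in> slot_of ` {..<2 * CARD('n)}" for s :: "'n slot"
    proof (cases s rule: slot_cases)
      case (slot a c)
      obtain m where m: "m < CARD('n)" "a = from_nat_into UNIV m"
        using b by (auto simp: bij_betw_def)
      have "s = slot_of (2 * m + (if c then 1 else 0))" "2 * m + (if c then 1 else 0) < 2 * CARD('n)"
        using m slot by (auto simp: slot_of_def)
      then show ?thesis by blast
    qed
    then show ?thesis by blast
  qed
qed

definition index_of :: "'n::finite slot \<Rightarrow> nat" where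
  "index_of = inv_into {..<2 * CARD('n)} slot_of"

lemma index_of [simp]: "slot_of (index_of s) = s" "index_of (s :: 'n::finite slot) < 2 * CARD('n)"
  using bij_betw_slot_of[where 'n = 'n]
  by (auto simp: index_of_def bij_betw_def f_inv_into_f) (metis UNIV_I inv_into_into lessThan_iff)

lemma index_of_slot_of [simp]: "k < 2 * CARD('n) \<Longrightarrow> index_of (slot_of k :: 'n::finite slot) = k"
  using bij_betw_slot_of[where 'n = 'n] by (simp add: index_of_def bij_betw_def)

lemma index_of_inj: "index_of s = index_of t \<longleftrightarrow> s = t"
  by (metis index_of(1))

lemma alternating_swap:
  assumes alt: "alternating N A" and ab: "a < N" "b < N" "a \<noteq> b"
  shows "A (\<lambda>k. v (swp a b k)) = - A v"
proof -
  have lin: "linear (\<lambda>x. A (v(m := x)))" if "m < N" for v m using alt that by (auto simp: alternating_def)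
  have eq0: "A (v(a := x, b := x)) = 0" for v x
  proof -
    have *: "A w = 0" if "l < m" "m < N" "w l = w m" for l m w
      using alt that unfolding alternating_def by blast
    show ?thesis by (cases "a < b") (use *[of a b "v(a := x, b := x)"] *[of b a "v(a := x, b := x)"] ab in auto)
  qed
  define x y where "x = v a" and "y = v b"
  have add_a: "A (v(a := p + q, b := r)) = A (v(a := p, b := r)) + A (v(a := q, b := r))" for p q r
    using linear_add[OF lin[OF ab(1), of "v(b := r)"], of p q] ab(3) by (simp add: fun_upd_twist)
  have add_b: "A (v(a := r, b := p + q)) = A (v(a := r, b := p)) + A (v(a := r, b := q))" for p q r
    using linear_add[OF lin[OF ab(2), of "v(a := r)"], of p q] by simp
  have "A (v(a := x + y, b := x + y)) = 0" by (rule eq0)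
  then have "A (v(a := x, b := y)) + A (v(a := y, b := x)) = 0"
    unfolding add_a add_b using eq0[of v x] eq0[of v y] by (simp add: add.commute)
  moreover have "v(a := x, b := y) = v" by (simp add: x_def y_def)
  moreover have "v(a := y, b := x) = (\<lambda>k. v (swp a b k))"
    by (auto simp: fun_eq_iff x_def y_def Transposition.transpose_def)
  ultimately show ?thesis by (simp add: eq_neg_iff_add_eq_0 add.commute)
qed

lemma alternating_scale:
  assumes alt: "alternating N A" and "F \<subseteq> {..<N}"
  shows "A (\<lambda>k. if k \<in> F then c k *\<^sub>R v k else v k) = (\<Prod>k\<in>F. c k) *\<^sub>R A v"
proof -
  have "finite F" using assms(2) finite_subset by blast
  then show ?thesis using assms(2)
  proof (induction F)
    case (insert m F)
    let ?w = "\<lambda>k. if k \<in> F then c k *\<^sub>R v k else v k"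
    have lin: "linear (\<lambda>x. A (?w(m := x)))" using alt insert.prems by (auto simp: alternating_def)
    have "(\<lambda>k. if k \<in> insert m F then c k *\<^sub>R v k else v k) = ?w(m := c m *\<^sub>R v m)"
      using insert.hyps by (auto simp: fun_eq_iff)
    moreover have "?w(m := v m) = ?w" using insert.hyps by (auto simp: fun_eq_iff)
    ultimately have "A (\<lambda>k. if k \<in> insert m F then c k *\<^sub>R v k else v k) = c m *\<^sub>R A ?w"
      using linear_scale[OF lin, of "c m" "v m"] by simp
    then show ?case using insert by simp
  qed simp
qed

definition mact :: "real^'n slot^'n slot \<Rightarrow> (nat \<Rightarrow> 'n::finite pt) \<Rightarrow> nat \<Rightarrow> 'n pt" where
  "mact M v k = (\<Sum>s\<in>UNIV. (M $ slot_of k $ s) *\<^sub>R v (index_of s))"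

text \<open>By decomposition into elementary matrices: a zero row gives 0, a diagonal matrix scales
  the arguments, a transposition changes the sign, a row operation adds a term with two equal
  arguments, and both sides are multiplicative.\<close>

lemma alternating_mact:
  fixes A :: "(nat \<Rightarrow> 'n::finite pt) \<Rightarrow> 'b::real_vector"
  assumes alt: "alternating (2 * CARD('n)) A"
  shows "A (mact M v) = det M *\<^sub>R A v"
proof -
  let ?N = "2 * CARD('n)"
  have loc: "A v = A w" if "\<And>k. k < ?N \<Longrightarrow> v k = w k" for v w using alt that by (auto simp: alternating_def)
  have lin: "linear (\<lambda>x. A (v(m := x)))" if "m < ?N" for v m using alt that by (auto simp: alternating_def)
  have "\<forall>v. A (mact M v) = det M *\<^sub>R A v"
  proof (induction M rule: induct_matrix_elementary)
    case (1 M M')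
    have "mact (M ** M') v = mact M (mact M' v)" for v
    proof
      fix k
      have "mact (M ** M') v k = (\<Sum>s\<in>UNIV. \<Sum>t\<in>UNIV. (M $ slot_of k $ t * M' $ t $ s) *\<^sub>R v (index_of s))"
        by (simp add: mact_def matrix_matrix_mult_def scaleR_sum_left)
      also have "\<dots> = mact M (mact M' v) k"
        unfolding mact_def by (subst sum.swap) (simp add: scaleR_sum_right)
      finally show "mact (M ** M') v k = mact M (mact M' v) k" .
    qed
    then show ?case using 1 by (simp add: det_mul)
  next
    case (2 M i)
    show ?case
    proof
      fix v
      have "M $ i $ s = 0" for s using 2 by (simp add: row_def vec_eq_iff)
      then have z: "mact M v (index_of i) = 0" by (simp add: mact_def)
      then have "mact M v = (mact M v)(index_of i := 0)" by auto
      then have "A (mact M v) = 0" using linear_0[OF lin[of "index_of i" "mact M v"]] by simp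
      moreover have "det M = 0" using 2 by (rule det_zero_row)
      ultimately show "A (mact M v) = det M *\<^sub>R A v" by simp
    qed
  next
    case (3 M)
    show ?case
    proof
      fix v
      have "mact M v k = (M $ slot_of k $ slot_of k) *\<^sub>R v k" if "k < ?N" for k
      proof -
        have "mact M v k = (\<Sum>s\<in>(UNIV :: 'n slot set). if s = slot_of k then (M $ slot_of k $ slot_of k) *\<^sub>R v k else 0)"
          unfolding mact_def by (intro sum.cong refl) (use 3[of "slot_of k"] that in auto)
        then show ?thesis by simp
      qed
      then have "A (mact M v) = A (\<lambda>k. if k \<in> {..<?N} then (M $ slot_of k $ slot_of k) *\<^sub>R v k else v k)"
        by (intro loc) simp
      also have "\<dots> = (\<Prod>k<?N. M $ slot_of k $ slot_of k) *\<^sub>R A v"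
        by (rule alternating_scale[OF alt]) simp
      also have "(\<Prod>k<?N. M $ slot_of k $ slot_of k) = (\<Prod>s\<in>UNIV. M $ s $ s)"
        by (rule prod.reindex_bij_betw[OF bij_betw_slot_of])
      also have "\<dots> = det M" using det_diagonal[of M] 3 by simp
      finally show "A (mact M v) = det M *\<^sub>R A v" .
    qed
  next
    case (4 m n)
    let ?M = "(\<chi> i j. mat 1 $ i $ swp m n j) :: real^'n slot^'n slot"
    show ?case
    proof
      fix v
      have "mact ?M v k = v (swp (index_of m) (index_of n) k)" if "k < ?N" for k
      proof -
        have "mact ?M v k = (\<Sum>s\<in>UNIV. if s = swp m n (slot_of k) then v (index_of s) else 0)"
          unfolding mact_def by (intro sum.cong) (auto simp: mat_def)
        also have "\<dots> = v (index_of (swp m n (slot_of k)))" by simp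
        also have "index_of (swp m n (slot_of k)) = swp (index_of m) (index_of n) k"
          using that by (auto simp: Transposition.transpose_def)
        finally show ?thesis .
      qed
      then have "A (mact ?M v) = A (\<lambda>k. v (swp (index_of m) (index_of n) k))" by (intro loc)
      also have "\<dots> = - A v" by (rule alternating_swap[OF alt]) (use 4 in \<open>auto simp: index_of_inj\<close>)
      also have "- A v = det ?M *\<^sub>R A v"
        using det_permute_columns[of "swp m n" "mat 1 :: real^'n slot^'n slot"] 4
        by (simp add: permutes_swap_id sign_swap_id)
      finally show "A (mact ?M v) = det ?M *\<^sub>R A v" .
    qed
  next
    case (5 m n c)
    let ?M = "(\<chi> i j. if i = m \<and> j = n then c else of_bool (i = j)) :: real^'n slot^'n slot"
    let ?m = "index_of m" and ?n = "index_of n"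
    show ?case
    proof
      fix v
      have "mact ?M v k = (v(?m := v ?m + c *\<^sub>R v ?n)) k" if "k < ?N" for k
      proof -
        have "mact ?M v k = (\<Sum>s\<in>UNIV. (if s = slot_of k then v (index_of s) else 0) + (if s = n then if slot_of k = m then c *\<^sub>R v ?n else 0 else 0))"
          unfolding mact_def by (intro sum.cong) (use 5 in auto)
        also have "\<dots> = v k + (if slot_of k = m then c *\<^sub>R v ?n else 0)"
          using that by (simp add: sum.distrib)
        also have "slot_of k = m \<longleftrightarrow> k = ?m" using that by auto
        finally show ?thesis by simp
      qed
      then have "A (mact ?M v) = A (v(?m := v ?m + c *\<^sub>R v ?n))" by (rule loc)
      also have "\<dots> = A v + c *\<^sub>R A (v(?m := v ?n))"
        using linear_add[OF lin[of ?m v]] linear_scale[OF lin[of ?m v]] by simp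
      also have "A (v(?m := v ?n)) = 0"
      proof -
        have *: "A w = 0" if "k < l" "l < ?N" "w k = w l" for k l w
          using alt that unfolding alternating_def by blast
        have "?m \<noteq> ?n" using 5 by (simp add: index_of_inj)
        then show ?thesis
          by (cases "?m < ?n") (use *[of ?m ?n "v(?m := v ?n)"] *[of ?n ?m "v(?m := v ?n)"] in auto)
      qed
      also have "det ?M = 1"
      proof -
        have "?M = (\<chi> k. if k = m then row m (mat 1) + c *s row n (mat 1) else row k (mat 1 :: real^'n slot^'n slot))"
          using 5 by (auto simp: vec_eq_iff row_def mat_def)
        then show ?thesis using det_row_operation[of m n "mat 1" c] 5 by simp
      qed
      ultimately show "A (mact ?M v) = det ?M *\<^sub>R A v" by simp
    qed
  qed
  then show ?thesis by blast
qed

lemma mact_std_frame: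
  assumes "k < 2 * CARD('n)"
  shows "mact (\<chi> s. ofC (v (index_of s))) std_frame k = (v k :: 'n::finite pt)"
proof -
  have "mact (\<chi> s. ofC (v (index_of s))) std_frame k = (\<Sum>s\<in>UNIV. (ofC (v k) $ s) *\<^sub>R toC (axis s 1))"
    using assms by (simp add: mact_def std_frame_slot)
  also have "\<dots> = toC (\<Sum>s\<in>UNIV. (ofC (v k) $ s) *\<^sub>R axis s 1)"
    by (simp add: linear_sum[OF linear_toC] linear_scale[OF linear_toC])
  also have "(\<Sum>s\<in>UNIV. (ofC (v k) $ s) *\<^sub>R axis s 1) = ofC (v k)"
    using basis_expansion[of "ofC (v k)"] by (simp add: scalar_mult_eq_scaleR)
  finally show ?thesis by simp
qed

lemma top_form_eq:
  fixes A :: "(nat \<Rightarrow> 'n::finite pt) \<Rightarrow> 'b::real_vector"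
  assumes alt: "alternating (2 * CARD('n)) A"
  shows "A v = det (\<chi> s. ofC (v (index_of s))) *\<^sub>R A std_frame"
proof -
  have "A v = A (mact (\<chi> s. ofC (v (index_of s))) std_frame)"
    using alt mact_std_frame[of _ v] by (simp add: alternating_def)
  then show ?thesis by (simp add: alternating_mact[OF alt])
qed

text \<open>In \<open>top_form_eq\<close> the coordinates of the vectors are the rows of the matrix,
  whereas \<open>rmat\<close> has the images of the basis as columns; the transpose has the same
  determinant.\<close>

lemma top_form_linear:
  fixes \<eta> :: "(nat \<Rightarrow> 'n::finite pt) \<Rightarrow> 'b::real_vector"
  assumes alt: "alternating (2 * CARD('n)) \<eta>"
  shows "\<eta> (\<lambda>k. A (std_frame k)) = det (rmat A) *\<^sub>R \<eta> std_frame"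
proof -
  have "(\<chi> s. ofC (A (std_frame (index_of s)))) = Finite_Cartesian_Product.transpose (rmat A)"
    by (simp add: vec_eq_iff rmat_def matrix_def transpose_def std_frame_slot)
  then show ?thesis using top_form_eq[OF alt, of "\<lambda>k. A (std_frame k)"] by simp
qed

text \<open>The map is joined to the identity through the complex line of maps (1 - s) id + s A. The
  complex determinant vanishes for countably many s only, and the complement of a countable set in
  the plane is connected; there the real determinant is continuous, nonzero, and 1 at s = 0.\<close>

lemma det_rmat_pos:
  fixes A :: "'n::finite pt \<Rightarrow> 'n pt"
  assumes A: "\<And>v w. A (v + w) = A v + A w" "\<And>c v. A (c *s v) = c *s A v" and inj: "inj A"
  shows "det (rmat A) > 0"
proof -
  define h where "h s v = (1 - s) *s v + s *s A v" for s v
  have h_lin: "Vector_Spaces.linear (*s) (*s) (h s)" for s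
    by (simp add: Vector_Spaces.linear_iff vec.vector_space_axioms h_def A vec_eq_iff algebra_simps)
  have h_real: "linear (\<lambda>x. ofC (h s (toC x)))" for s
  proof -
    have A_real: "A (r *\<^sub>R v) = r *\<^sub>R A v" for r v
    proof -
      have "r *\<^sub>R w = of_real r *s w" for w :: "'n pt"
        by (simp add: vec_eq_iff scaleR_conv_of_real[where 'a = complex])
      then show ?thesis by (simp add: A(2))
    qed
    have "linear (h s)"
      by (auto simp: linear_iff h_def A A_real vec_eq_iff algebra_simps scaleR_conv_of_real[where 'a = complex])
    from linear_compose[OF linear_compose[OF linear_toC this] linear_ofC] show ?thesis by (simp add: o_def)
  qed
  define g where "g s = det (rmat (h s))" for s
  have g_nz: "g s \<noteq> 0" if "inj (h s)" for s
  proof -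
    have "rmat (h s) *v x = ofC (h s (toC x))" for x
      unfolding rmat_def using h_real by (simp add: matrix_works linear_matrix_vector_mul_eq)
    then have "inj ((*v) (rmat (h s)))"
      using that by (auto simp: inj_def) (metis ofC_toC toC_ofC)
    then show ?thesis
      unfolding g_def using matrix_left_invertible_injective invertible_left_inverse invertible_det_nz by blast
  qed
  \<comment> \<open>The complex determinant of \<open>h s\<close>, a polynomial in s; where it is
    nonzero, \<open>h s\<close> is injective and its real determinant is nonzero as well.\<close>
  define p where "p s = det (\<chi> i j. (1 - s) * (if i = j then 1 else 0) + s * (A (axis j 1) $ i))" for s
  have p_nz: "inj (h s)" if "p s \<noteq> 0" for s
  proof -
    have "matrix (h s) = (\<chi> i j. (1 - s) * (if i = j then 1 else 0) + s * (A (axis j 1) $ i))"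
      by (simp add: matrix_def h_def vec_eq_iff axis_def)
    then have "det (matrix (h s)) \<noteq> 0" using that by (simp add: p_def)
    then have "inj ((*v) (matrix (h s)))"
      using matrix_left_invertible_injective invertible_left_inverse invertible_det_nz by blast
    then show ?thesis using matrix_works[OF h_lin] by (simp add: inj_def)
  qed
  have p0: "p 0 = 1"
  proof -
    have "(\<chi> i j. (1 - 0) * (if i = j then 1 else 0) + 0 * (A (axis j 1) $ i)) = mat 1" by (simp add: mat_def)
    then show ?thesis unfolding p_def by (simp only: det_I)
  qed
  have p1: "p 1 \<noteq> 0"
  proof -
    have lin: "Vector_Spaces.linear (*s) (*s) A" by (simp add: Vector_Spaces.linear_iff vec.vector_space_axioms A)
    have "(\<chi> i j. (1 - 1) * (if i = j then 1 else 0) + 1 * (A (axis j 1) $ i)) = matrix A" by (simp add: matrix_def)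
    then have "p 1 = det (matrix A)" unfolding p_def by (simp only:)
    moreover have "inj ((*v) (matrix A))" using inj matrix_works[OF lin] by (simp add: inj_def)
    ultimately show ?thesis
      using matrix_left_invertible_injective invertible_left_inverse invertible_det_nz by metis
  qed
  define Z where "Z = {s. p s = 0}"
  have "countable Z"
  proof (cases "p constant_on UNIV")
    case True
    then have "Z = {}" using p0 by (auto simp: Z_def constant_on_def)
    then show ?thesis by simp
  next
    case False
    have "p holomorphic_on UNIV" unfolding p_def det_def by (intro holomorphic_intros) (auto intro!: holomorphic_intros)
    then show ?thesis
      using holomorphic_countable_zeros[of p UNIV] False convex_connected[OF convex_UNIV] by (simp add: Z_def)
  qed
  then have "connected (- Z)"
    by (intro path_connected_imp_connected path_connected_complement_countable) auto
  moreover have "continuous_on (- Z) g"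
  proof -
    have "continuous_on (- Z) (\<lambda>s. rmat (h s) $ i $ j)" for i j
    proof (cases i rule: slot_cases)
      case (slot a b)
      then show ?thesis
        by (cases b) (auto simp: rmat_def matrix_def h_def intro!: continuous_intros)
    qed
    then show ?thesis
      unfolding g_def det_def by (intro continuous_on_sum continuous_on_mult continuous_on_const continuous_on_prod)
  qed
  ultimately have "connected (g ` (- Z))" by (rule connected_continuous_image[rotated])
  then have iv: "is_interval (g ` (- Z))" by (simp add: is_interval_connected_1)
  have "rmat (h 0) = mat 1"
    by (auto simp: rmat_def matrix_def h_def vec_eq_iff mat_def axis_def)
  then have "g 0 = 1" by (simp add: g_def)
  moreover have "0 \<in> - Z" "1 \<in> - Z" using p0 p1 by (auto simp: Z_def)
  ultimately have in1: "1 \<in> g ` (- Z)" "g 1 \<in> g ` (- Z)" by force+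
  have "0 \<notin> g ` (- Z)"
  proof
    assume "0 \<in> g ` (- Z)"
    then obtain s where "0 = g s" "s \<notin> Z" by (elim imageE) simp
    moreover from this(2) have "p s \<noteq> 0" unfolding Z_def by blast
    ultimately show False using g_nz[OF p_nz] by metis
  qed
  then have "\<not> g 1 \<le> 0" using mem_is_interval_1_I[OF iv in1(2,1), of 0] by auto
  moreover have "h 1 = A" by (auto simp: h_def)
  ultimately show ?thesis by (simp add: g_def)
qed

section \<open>Integration over the manifold\<close>

lemma continuous_on_extend_by_zero:
  fixes f :: "'a::t2_space \<Rightarrow> 'b::real_normed_vector"
  assumes S: "open S" and f: "continuous_on S f" and C: "closed C" "C \<subseteq> S" and f0: "\<And>z. z \<in> S \<Longrightarrow> z \<notin> C \<Longrightarrow> f z = 0"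
  shows "continuous_on UNIV (\<lambda>z. if z \<in> S then f z else 0)"
proof -
  have "continuous_on (S \<union> - C) (\<lambda>z. if z \<in> S then f z else 0)"
    by (rule continuous_on_open_Un)
      (use S C f f0 in \<open>auto cong: continuous_on_cong_simp intro: continuous_on_eq[of _ "\<lambda>z. 0"] continuous_on_eq[of _ f]\<close>)
  moreover have "S \<union> - C = UNIV" using C by auto
  ultimately show ?thesis by simp
qed

lemma integrable_compact_support:
  fixes f :: "'a::euclidean_space \<Rightarrow> 'b::{banach, second_countable_topology}"
  assumes f: "continuous_on UNIV f" and C: "compact C" and f0: "\<And>z. z \<notin> C \<Longrightarrow> f z = 0"
  shows "integrable lborel f"
proof -
  have "(\<lambda>z. indicator C z *\<^sub>R f z) = f" using f0 by (auto simp: indicator_def fun_eq_iff)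
  then show ?thesis
    using borel_integrable_compact[OF C continuous_on_subset[OF f]] by simp
qed

context cmanifold
begin

text \<open>The very choice made inside \<open>integral_over\<close>, so that the integral unfolds
  to this partition.\<close>

definition pou :: "'i \<Rightarrow> 'a \<Rightarrow> real" where "pou = (SOME \<psi>. partition_of_unity X \<psi>)"

definition pouset :: "'i set" where "pouset = {i \<in> charts X. \<exists>x. pou i x \<noteq> 0}"

lemma pou: "partition_of_unity X pou"
  unfolding pou_def by (rule someI_ex[OF partition_of_unity_exists])

lemma finite_pouset: "finite pouset" and pouset_charts: "i \<in> pouset \<Longrightarrow> i \<in> charts X"
  using pou by (auto simp: partition_of_unity_def pouset_def)

lemma pou_support: "i \<in> charts X \<Longrightarrow> closure {x. pou i x \<noteq> 0} \<subseteq> dom X i"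
  and smooth_pou: "i \<in> charts X \<Longrightarrow> j \<in> charts X \<Longrightarrow> smooth_on (\<lambda>z. pou i (chart_inv X j z)) (img X j)"
  using pou by (auto simp: partition_of_unity_def)

lemma pou_sum: "(\<Sum>i\<in>pouset. pou i x) = 1"
proof -
  have "(\<Sum>i\<in>pouset. pou i x) = (\<Sum>i | i \<in> charts X \<and> pou i x \<noteq> 0. pou i x)"
    by (rule sum.mono_neutral_right) (use finite_pouset in \<open>auto simp: pouset_def\<close>)
  then show ?thesis using pou by (simp add: partition_of_unity_def)
qed

lemma integral_over_pou:
  "integral_over X \<eta> = (\<Sum>i\<in>pouset. LINT z|lborel. (if z \<in> img X i then pou i (chart_inv X i z) *\<^sub>R \<eta> i z std_frame else 0))"
  unfolding integral_over_def pou_def[symmetric] pouset_def Let_def set_lebesgue_integral_def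
  by (intro sum.cong refl Bochner_Integration.integral_cong) (auto simp: indicator_def)

lemma compact_chart_image:
  assumes "i \<in> charts X" "closed K" "K \<subseteq> dom X i"
  shows "compact (chart X i ` K)" "chart X i ` K \<subseteq> img X i"
proof -
  have "compact K" using compact_space closed_Int_compact[OF assms(2), of UNIV] by simp
  then show "compact (chart X i ` K)"
    using compact_continuous_image continuous_on_subset[OF continuous_chart[OF assms(1)] assms(3)] by blast
  show "chart X i ` K \<subseteq> img X i" using chart_img assms by auto
qed

lemma chart_image_iff:
  assumes "i \<in> charts X" "K \<subseteq> dom X i" "z \<in> img X i"
  shows "z \<in> chart X i ` K \<longleftrightarrow> chart_inv X i z \<in> K"
proof
  assume "z \<in> chart X i ` K"
  then obtain x where "x \<in> K" "z = chart X i x" by blast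
  then show "chart_inv X i z \<in> K" using assms chart_inv_chart[of i x] by auto
next
  assume "chart_inv X i z \<in> K"
  then show "z \<in> chart X i ` K" using chart_chart_inv[OF assms(1,3)] by (metis imageI)
qed

lemma continuous_cutoff:
  fixes f :: "'n pt \<Rightarrow> 'b::real_normed_vector"
  assumes i: "i \<in> charts X" and f: "continuous_on (img X i) f" and K: "closed K" "K \<subseteq> dom X i"
    and f0: "\<And>z. z \<in> img X i \<Longrightarrow> chart_inv X i z \<notin> K \<Longrightarrow> f z = 0"
  shows "continuous_on UNIV (\<lambda>z. if z \<in> img X i then f z else 0)"
    "\<And>z. z \<notin> chart X i ` K \<Longrightarrow> (if z \<in> img X i then f z else 0) = 0"
proof -
  show "continuous_on UNIV (\<lambda>z. if z \<in> img X i then f z else 0)"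
    by (rule continuous_on_extend_by_zero[OF open_img[OF i] f compact_imp_closed[OF compact_chart_image(1)[OF i K]]
          compact_chart_image(2)[OF i K]]) (use f0 chart_image_iff[OF i K(2)] in auto)
  show "\<And>z. z \<notin> chart X i ` K \<Longrightarrow> (if z \<in> img X i then f z else 0) = 0"
    using f0 chart_image_iff[OF i K(2)] by auto
qed

lemma inj_dd_transition:
  assumes "i \<in> charts X" "j \<in> charts X" "z \<in> overlap X i j"
  shows "inj (\<lambda>v. dd v (transition X i j) z)"
proof -
  let ?T = "transition X i j" and ?T' = "transition X j i"
  have "((\<lambda>y. ?T' (?T y)) has_derivative (\<lambda>v. dd (dd v ?T z) ?T' (?T z))) (at z)"
    using has_derivative_compose[OF has_derivative_transition[OF assms]
        has_derivative_transition[OF assms(2,1) transition_overlap(1)[OF assms]]] .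
  moreover have "((\<lambda>y. ?T' (?T y)) has_derivative (\<lambda>v. v)) (at z)"
    by (rule has_derivative_transform_within_open[OF has_derivative_ident open_overlap[OF assms(1,2)] assms(3)])
      (use transition_overlap(3)[OF assms(1,2)] in auto)
  ultimately have "(\<lambda>v. dd (dd v ?T z) ?T' (?T z)) = (\<lambda>v. v)" by (rule has_derivative_unique)
  then show ?thesis by (metis (no_types, lifting) injI)
qed

lemma det_transition_pos:
  assumes "i \<in> charts X" "j \<in> charts X" "z \<in> overlap X i j"
  shows "det (rmat (\<lambda>v. dd v (transition X i j) z)) > 0"
  by (rule det_rmat_pos)
    (use linear_add[OF has_derivative_linear[OF has_derivative_transition[OF assms]]]
      dd_transition_smult[OF assms] inj_dd_transition[OF assms] in auto)

text \<open>Coefficients of continuous top forms against \<open>std_frame\<close>. The Jacobian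
  enters without absolute value; by \<open>det_transition_pos\<close> this is also the law required
  by integration.\<close>

definition density :: "('i \<Rightarrow> 'n pt \<Rightarrow> complex) \<Rightarrow> bool" where
  "density \<delta> \<longleftrightarrow> (\<forall>i\<in>charts X. continuous_on (img X i) (\<delta> i)) \<and>
     (\<forall>i\<in>charts X. \<forall>j\<in>charts X. \<forall>z\<in>overlap X i j.
        \<delta> i z = det (rmat (\<lambda>v. dd v (transition X i j) z)) *\<^sub>R \<delta> j (transition X i j z))"

text \<open>The summand of chart i is supported in the overlap with \<open>i0\<close>: on one side
  by the partition of unity, on the other by \<open>K\<close>. It is transported to the chart
  \<open>i0\<close>, and there the partition functions sum to 1.\<close>

lemma integral_over_local:
  assumes \<delta>: "density (\<lambda>i z. \<eta> i z std_frame)" and i0: "i0 \<in> charts X"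
    and K: "closed K" "K \<subseteq> dom X i0"
    and \<delta>0: "\<And>j z. j \<in> charts X \<Longrightarrow> z \<in> img X j \<Longrightarrow> chart_inv X j z \<notin> K \<Longrightarrow> \<eta> j z std_frame = 0"
  shows "integral_over X \<eta> = (LINT z|lborel. (if z \<in> img X i0 then \<eta> i0 z std_frame else 0))"
proof -
  define D where "D i z = \<eta> i z std_frame" for i z
  have cD: "continuous_on (img X i) (D i)" if "i \<in> charts X" for i
    using \<delta> that by (auto simp: density_def D_def)
  have D0: "D j z = 0" if "j \<in> charts X" "z \<in> img X j" "chart_inv X j z \<notin> K" for j z
    unfolding D_def by (rule \<delta>0[OF that])
  define f where "f i z = (if z \<in> img X i then pou i (chart_inv X i z) *\<^sub>R D i z else 0)" for i z
  define g where "g i z = (if z \<in> img X i0 then pou i (chart_inv X i0 z) *\<^sub>R D i0 z else 0)" for i z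
  have c: "continuous_on (img X j) (\<lambda>z. pou i (chart_inv X j z) *\<^sub>R D j z)" if "i \<in> charts X" "j \<in> charts X" for i j
    by (intro continuous_on_scaleR smooth_on_continuous smooth_pou cD that)
  have gi: "integrable lborel (g i)" if "i \<in> charts X" for i
    unfolding g_def
    by (rule integrable_compact_support[OF continuous_cutoff(1)[OF i0 c[OF that i0] K] compact_chart_image(1)[OF i0 K]
          continuous_cutoff(2)[OF i0 c[OF that i0] K]]) (auto simp: D0 i0)
  have "integral\<^sup>L lborel (f i) = integral\<^sup>L lborel (g i)" if i: "i \<in> charts X" for i
  proof (rule change_of_variables[OF open_overlap[OF i0 i] has_derivative_transition[OF i0 i]])
    show "inj_on (transition X i0 i) (overlap X i0 i)"
      by (rule inj_onI) (metis transition_overlap(3)[OF i0 i])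
    define Ci where "Ci = closure {x. pou i x \<noteq> 0}"
    have Ki: "closed Ci" "Ci \<subseteq> dom X i" unfolding Ci_def using pou_support[OF i] by auto
    have z: "pou i x = 0" if "x \<notin> Ci" for x
      using that closure_subset[of "{x. pou i x \<noteq> 0}"] unfolding Ci_def by auto
    show "integrable lborel (f i)"
      unfolding f_def
      by (rule integrable_compact_support[OF continuous_cutoff(1)[OF i c[OF i i] Ki] compact_chart_image(1)[OF i Ki]
          continuous_cutoff(2)[OF i c[OF i i] Ki]]) (auto simp: z)
    show "integrable lborel (g i)" by (rule gi[OF i])
    show "f i y = 0" if y: "y \<notin> transition X i0 i ` overlap X i0 i" for y
    proof (rule ccontr)
      assume "f i y \<noteq> 0"
      then have "y \<in> img X i" "D i y \<noteq> 0" by (auto simp: f_def split: if_splits)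
      then have "y \<in> overlap X i i0" using D0[OF i] K(2) i by (auto simp: overlap_iff)
      then have "y = transition X i0 i (transition X i i0 y)" "transition X i i0 y \<in> overlap X i0 i"
        using transition_overlap[OF i i0] by auto
      then show False using y by blast
    qed
    show "g i y = 0" if y: "y \<notin> overlap X i0 i" for y
    proof (rule ccontr)
      assume "g i y \<noteq> 0"
      then have "y \<in> img X i0" "pou i (chart_inv X i0 y) \<noteq> 0" by (auto simp: g_def split: if_splits)
      moreover from this(2) have "chart_inv X i0 y \<in> dom X i" using z Ki(2) by blast
      ultimately have "y \<in> overlap X i0 i" using i0 by (simp add: overlap_iff)
      then show False using y by blast
    qed
    show "g i y = of_real \<bar>det (rmat (\<lambda>v. dd v (transition X i0 i) y))\<bar> * f i (transition X i0 i y)"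
      if y: "y \<in> overlap X i0 i" for y
    proof -
      have "D i0 y = det (rmat (\<lambda>v. dd v (transition X i0 i) y)) *\<^sub>R D i (transition X i0 i y)"
        using \<delta> i i0 y by (auto simp: density_def D_def)
      moreover have "y \<in> img X i0" "transition X i0 i y \<in> img X i"
        using y transition_overlap(1)[OF i0 i y] i i0 by (auto simp: overlap_iff)
      ultimately show ?thesis
        using det_transition_pos[OF i0 i y] transition_overlap(2)[OF i0 i y]
        by (simp add: g_def f_def scaleR_conv_of_real)
    qed
  qed
  moreover have "(\<lambda>z. if z \<in> img X i then pou i (chart_inv X i z) *\<^sub>R \<eta> i z std_frame else 0) = f i" for i
    by (simp add: fun_eq_iff f_def D_def)
  ultimately have "integral_over X \<eta> = (\<Sum>i\<in>pouset. integral\<^sup>L lborel (g i))"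
    unfolding integral_over_pou using pouset_charts by (intro sum.cong refl) simp
  also have "\<dots> = (LINT z|lborel. (\<Sum>i\<in>pouset. g i z))"
    by (rule Bochner_Integration.integral_sum[symmetric]) (rule gi[OF pouset_charts])
  also have "(\<lambda>z. \<Sum>i\<in>pouset. g i z) = (\<lambda>z. if z \<in> img X i0 then \<eta> i0 z std_frame else 0)"
    by (auto simp: g_def fun_eq_iff D_def pou_sum simp flip: scaleR_sum_left)
  finally show ?thesis .
qed

end

section \<open>Operators of type (1,0) and (0,1) on matrix-valued functions\<close>

lemma smooth_on_matrix_mult:
  fixes f g :: "'a::real_normed_vector \<Rightarrow> 'r::finite mtx"
  shows "open S \<Longrightarrow> smooth_on f S \<Longrightarrow> smooth_on g S \<Longrightarrow> smooth_on (\<lambda>z. f z ** g z) S"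
  by (rule smooth_on_bilinear[OF bounded_bilinear_matrix_mult])

lemma smooth_on_cscale:
  fixes f :: "'a::real_normed_vector \<Rightarrow> 'r::finite mtx"
  shows "open S \<Longrightarrow> smooth_on c S \<Longrightarrow> smooth_on f S \<Longrightarrow> smooth_on (\<lambda>z. cscale (c z) (f z)) S"
  by (rule smooth_on_bilinear[OF bounded_bilinear_cscale])

lemma smooth_on_trace:
  fixes f :: "'a::real_normed_vector \<Rightarrow> 'r::finite mtx"
  shows "open S \<Longrightarrow> smooth_on f S \<Longrightarrow> smooth_on (\<lambda>z. trace (f z)) S"
  by (rule smooth_on_bounded_linear[OF bounded_linear_trace])

lemma dd_bilinear:
  assumes "bounded_bilinear B" "open S" "smooth_on f S" "smooth_on g S" "z \<in> S"
  shows "dd v (\<lambda>z. B (f z) (g z)) z = B (f z) (dd v g z) + B (dd v f z) (g z)"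
  by (rule dd_eq) (rule bounded_bilinear.FDERIV[OF assms(1) smooth_on_has_derivative[OF assms(3,2,5)] smooth_on_has_derivative[OF assms(4,2,5)]])

lemma dd_add:
  assumes "open S" "smooth_on f S" "smooth_on g S" "z \<in> S"
  shows "dd v (\<lambda>z. f z + g z) z = dd v f z + dd v g z"
  by (rule dd_eq) (rule has_derivative_add[OF smooth_on_has_derivative[OF assms(2,1,4)] smooth_on_has_derivative[OF assms(3,1,4)]])

lemma dd_const: "dd v (\<lambda>z. c) z = 0"
  by (simp add: frechet_derivative_const)

lemma dd_linear:
  assumes "open S" "smooth_on f S" "z \<in> S"
  shows "linear (\<lambda>v. dd v f z)"
  using has_derivative_linear[OF smooth_on_has_derivative[OF assms(2,1,3)]] .

text \<open>The values \<partial>f(v) and \<partial>-bar f(v) on a real tangent vector v, for scalar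
  functions; \<open>D1\<close> and \<open>D2\<close> are the same for matrices.\<close>

definition sd1 :: "'n::finite pt \<Rightarrow> ('n pt \<Rightarrow> complex) \<Rightarrow> 'n pt \<Rightarrow> complex" where
  "sd1 v f z = (dd v f z - \<i> * dd (\<i> *s v) f z) / 2"
definition sd2 :: "'n::finite pt \<Rightarrow> ('n pt \<Rightarrow> complex) \<Rightarrow> 'n pt \<Rightarrow> complex" where
  "sd2 v f z = (dd v f z + \<i> * dd (\<i> *s v) f z) / 2"

definition D1 :: "'n::finite pt \<Rightarrow> ('n pt \<Rightarrow> 'r::finite mtx) \<Rightarrow> 'n pt \<Rightarrow> 'r mtx" where
  "D1 v f z = (1/2) *\<^sub>R (dd v f z - cscale \<i> (dd (\<i> *s v) f z))"
definition D2 :: "'n::finite pt \<Rightarrow> ('n pt \<Rightarrow> 'r::finite mtx) \<Rightarrow> 'n pt \<Rightarrow> 'r mtx" where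
  "D2 v f z = (1/2) *\<^sub>R (dd v f z + cscale \<i> (dd (\<i> *s v) f z))"

lemma del_dir_eq_sd1: "del_dir f z v = sd1 v f z"
  by (simp add: del_dir_def sd1_def)

lemma dd_eq_D1_D2: "dd v f z = D1 v f z + D2 v f z"
  by (simp add: D1_def D2_def flip: scaleR_add_right scaleR_2)

lemma dd_eq_sd1_sd2: "dd v f z = sd1 v f z + sd2 v f z"
  by (simp add: sd1_def sd2_def field_simps)

lemma D_cong:
  assumes "open S" "z \<in> S" "\<And>y. y \<in> S \<Longrightarrow> f y = g y"
  shows "D1 v f z = D1 v g z" "D2 v f z = D2 v g z"
  unfolding D1_def D2_def using dd_cong_open[OF assms] by simp_all

lemma D_const [simp]: "D1 v (\<lambda>z. A) z = 0" "D2 v (\<lambda>z. A) z = 0"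
  by (simp_all add: D1_def D2_def dd_const)

context
  fixes S :: "('n::finite pt) set"
  assumes S: "open S"
begin

lemma smooth_D1: "smooth_on f S \<Longrightarrow> smooth_on (D1 v f) S"
  and smooth_D2: "smooth_on f S \<Longrightarrow> smooth_on (D2 v f) S"
  for f :: "'n pt \<Rightarrow> 'r::finite mtx"
  unfolding D1_def[abs_def] D2_def[abs_def]
  by (intro smooth_on_scaleR smooth_on_add smooth_on_diff smooth_on_cscale smooth_on_dd smooth_on_const S; assumption)+

context
  fixes f g :: "'n pt \<Rightarrow> 'r::finite mtx" and z
  assumes f: "smooth_on f S" and g: "smooth_on g S" and z: "z \<in> S"
begin

lemma D_mult: "D1 v (\<lambda>z. f z ** g z) z = D1 v f z ** g z + f z ** D1 v g z"
  "D2 v (\<lambda>z. f z ** g z) z = D2 v f z ** g z + f z ** D2 v g z"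
  by (simp_all add: D1_def D2_def dd_bilinear[OF bounded_bilinear_matrix_mult S f g z] matrix_distribs
      scaleR_matrix_mult cscale_mult cscale_add cscale_diff algebra_simps scaleR_add_right scaleR_diff_right)

lemma D_add: "D1 v (\<lambda>z. f z + g z) z = D1 v f z + D1 v g z" "D2 v (\<lambda>z. f z + g z) z = D2 v f z + D2 v g z"
  by (simp_all add: D1_def D2_def dd_add[OF S f g z] cscale_add scaleR_add_right scaleR_diff_right algebra_simps)

end

lemma D_bounded_linear:
  fixes f :: "'n pt \<Rightarrow> 'r::finite mtx" and L :: "'r mtx \<Rightarrow> 'r mtx"
  assumes L: "bounded_linear L" "\<And>c A. L (cscale c A) = cscale c (L A)" and f: "smooth_on f S" and z: "z \<in> S"
  shows "D1 v (\<lambda>z. L (f z)) z = L (D1 v f z)" "D2 v (\<lambda>z. L (f z)) z = L (D2 v f z)"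
  by (simp_all add: D1_def D2_def dd_bounded_linear[OF L(1) S f z] L(2)
      linear_scale[OF bounded_linear.linear[OF L(1)]] linear_diff[OF bounded_linear.linear[OF L(1)]] linear_add[OF bounded_linear.linear[OF L(1)]])

lemma bounded_linear_cscale: "bounded_linear (cscale c :: 'r::finite mtx \<Rightarrow> 'r mtx)"
  using linear_cscale(1) linear_conv_bounded_linear by blast

lemma D_cscale:
  fixes f :: "'n pt \<Rightarrow> 'r::finite mtx"
  assumes f: "smooth_on f S" and z: "z \<in> S"
  shows "D1 v (\<lambda>z. cscale c (f z)) z = cscale c (D1 v f z)" "D2 v (\<lambda>z. cscale c (f z)) z = cscale c (D2 v f z)"
  using D_bounded_linear[OF bounded_linear_cscale _ f z] by (simp_all add: mult.commute)

lemma D_uminus: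
  fixes f :: "'n pt \<Rightarrow> 'r::finite mtx"
  assumes f: "smooth_on f S" and z: "z \<in> S"
  shows "D1 v (\<lambda>z. - f z) z = - D1 v f z" "D2 v (\<lambda>z. - f z) z = - D2 v f z"
  using D_bounded_linear[OF bounded_linear_minus[OF bounded_linear_ident] _ f z] by simp_all

lemma D_diff:
  fixes f g :: "'n pt \<Rightarrow> 'r::finite mtx"
  assumes f: "smooth_on f S" and g: "smooth_on g S" and z: "z \<in> S"
  shows "D1 v (\<lambda>z. f z - g z) z = D1 v f z - D1 v g z" "D2 v (\<lambda>z. f z - g z) z = D2 v f z - D2 v g z"
  using D_add[OF f smooth_on_minus[OF S g] z] D_uminus[OF g z] by simp_all

lemma sd_trace:
  fixes f :: "'n pt \<Rightarrow> 'r::finite mtx"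
  assumes f: "smooth_on f S" and z: "z \<in> S"
  shows "sd1 v (\<lambda>z. trace (f z)) z = trace (D1 v f z)" "sd2 v (\<lambda>z. trace (f z)) z = trace (D2 v f z)"
  by (simp_all add: sd1_def sd2_def D1_def D2_def dd_bounded_linear[OF bounded_linear_trace S f z] trace_scaleR
      trace_sub trace_add scaleR_conv_of_real[where 'a = complex])

lemma sd_mult:
  fixes f g :: "'n pt \<Rightarrow> complex"
  assumes f: "smooth_on f S" and g: "smooth_on g S" and z: "z \<in> S"
  shows "sd1 v (\<lambda>z. f z * g z) z = sd1 v f z * g z + f z * sd1 v g z"
    "sd2 v (\<lambda>z. f z * g z) z = sd2 v f z * g z + f z * sd2 v g z"
  by (simp_all add: sd1_def sd2_def dd_bilinear[OF bounded_bilinear_mult S f g z] field_simps)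

lemma D_scalar:
  fixes f :: "'n pt \<Rightarrow> complex"
  assumes f: "smooth_on f S" and z: "z \<in> S"
  shows "D1 v (\<lambda>z. cscale (f z) (mat 1 :: 'r::finite mtx)) z = cscale (sd1 v f z) (mat 1)"
    "D2 v (\<lambda>z. cscale (f z) (mat 1 :: 'r::finite mtx)) z = cscale (sd2 v f z) (mat 1)"
proof -
  have "bounded_linear (\<lambda>c. cscale c (mat 1 :: 'r::finite mtx))"
    using linear_cscale(2) linear_conv_bounded_linear by blast
  from dd_bounded_linear[OF this S f z]
  have "dd v (\<lambda>z. cscale (f z) (mat 1 :: 'r::finite mtx)) z = cscale (dd v f z) (mat 1)" for v .
  then show "D1 v (\<lambda>z. cscale (f z) (mat 1 :: 'r::finite mtx)) z = cscale (sd1 v f z) (mat 1)"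
    "D2 v (\<lambda>z. cscale (f z) (mat 1 :: 'r::finite mtx)) z = cscale (sd2 v f z) (mat 1)"
    by (simp_all add: D1_def D2_def sd1_def sd2_def flip: cscale_diff cscale_add cscale_scaleR(2))
      (simp_all add: scaleR_conv_of_real)
qed

text \<open>The directions are constant vector fields in the chart, so everything reduces to the
  symmetry of second derivatives.\<close>

lemma D_commute:
  fixes f :: "'n pt \<Rightarrow> 'r::finite mtx"
  assumes f: "smooth_on f S" and z: "z \<in> S"
  shows "D1 u (D1 v f) z = D1 v (D1 u f) z" "D2 u (D2 v f) z = D2 v (D2 u f) z" "D1 u (D2 v f) z = D2 v (D1 u f) z"
proof -
  have c: "dd u (\<lambda>z. cscale c (g z)) z = cscale c (dd u g z)" if "smooth_on g S" for u c and g :: "'n pt \<Rightarrow> 'r mtx"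
    by (rule dd_bounded_linear[OF bounded_linear_cscale S that z])
  have r: "dd u (\<lambda>z. r *\<^sub>R g z) z = r *\<^sub>R dd u g z" if "smooth_on g S" for u r and g :: "'n pt \<Rightarrow> 'r mtx"
    by (rule dd_bounded_linear[OF bounded_linear_scaleR_right S that z])
  have m: "dd u (\<lambda>z. g z - k z) z = dd u g z - dd u k z" if "smooth_on g S" "smooth_on k S" for u and g k :: "'n pt \<Rightarrow> 'r mtx"
    by (rule dd_eq) (rule has_derivative_diff[OF smooth_on_has_derivative[OF that(1) S z] smooth_on_has_derivative[OF that(2) S z]])
  note a = dd_add[OF S _ _ z]
  note sm = smooth_on_dd[OF f] smooth_on_cscale[OF S smooth_on_const smooth_on_dd[OF f]]
  note sm2 = smooth_on_diff[OF S sm] smooth_on_add[OF S sm]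
  note swap = dd_commute[OF S f z]
  show "D1 u (D1 v f) z = D1 v (D1 u f) z"
    unfolding D1_def[abs_def] r[OF sm2(1)] m[OF sm] c[OF sm(1)]
    by (simp add: swap[of u v] swap[of u "\<i> *s v"] swap[of "\<i> *s u" v] swap[of "\<i> *s u" "\<i> *s v"] cscale_diff cscale_scaleR scaleR_diff_right)
  show "D2 u (D2 v f) z = D2 v (D2 u f) z"
    unfolding D2_def[abs_def] r[OF sm2(2)] a[OF sm] c[OF sm(1)]
    by (simp add: swap[of u v] swap[of u "\<i> *s v"] swap[of "\<i> *s u" v] swap[of "\<i> *s u" "\<i> *s v"] cscale_add cscale_scaleR scaleR_add_right)
  show "D1 u (D2 v f) z = D2 v (D1 u f) z"
    unfolding D1_def[abs_def] D2_def[abs_def] r[OF sm2(1)] r[OF sm2(2)] a[OF sm] m[OF sm] c[OF sm(1)]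
    by (simp add: swap[of u v] swap[of u "\<i> *s v"] swap[of "\<i> *s u" v] swap[of "\<i> *s u" "\<i> *s v"] cscale_add cscale_diff cscale_scaleR scaleR_add_right scaleR_diff_right)
qed

lemma D_linear_dir:
  fixes f :: "'n pt \<Rightarrow> 'r::finite mtx"
  assumes f: "smooth_on f S" and z: "z \<in> S"
  shows "linear (\<lambda>v. D1 v f z)" "linear (\<lambda>v. D2 v f z)"
    "D1 (c *s v) f z = cscale c (D1 v f z)" "D2 (c *s v) f z = cscale (cnj c) (D2 v f z)"
proof -
  have lin: "linear (\<lambda>v. dd v f z)" by (rule dd_linear[OF S f z])
  have li: "linear (\<lambda>v::'n pt. \<i> *s v)"
    by (auto simp: linear_iff vec_eq_iff algebra_simps)
  have ci: "linear (\<lambda>v. cscale \<i> (dd (\<i> *s v) f z))"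
    using linear_compose[OF linear_compose[OF li lin] linear_cscale(1)] by (simp add: o_def)
  show "linear (\<lambda>v. D1 v f z)" "linear (\<lambda>v. D2 v f z)"
    unfolding D1_def D2_def by (intro linear_compose_scale_right linear_compose_sub linear_compose_add lin ci)+
  have "c *s w = Re c *\<^sub>R w + Im c *\<^sub>R (\<i> *s w)" for w :: "'n pt"
    by (simp add: vec_eq_iff complex_eq_iff)
  then have d: "dd (c *s w) f z = Re c *\<^sub>R dd w f z + Im c *\<^sub>R dd (\<i> *s w) f z" for w
    by (simp only: linear_add[OF lin] linear_scale[OF lin])
  have "dd (\<i> *s (\<i> *s v)) f z = - dd v f z"
    using linear_neg[OF lin, of v] by (simp add: vector_smult_assoc)
  then have d': "dd (\<i> *s (c *s v)) f z = Re c *\<^sub>R dd (\<i> *s v) f z - Im c *\<^sub>R dd v f z"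
    using d[of "\<i> *s v"] by (simp add: vector_smult_assoc mult.commute)
  show "D1 (c *s v) f z = cscale c (D1 v f z)" "D2 (c *s v) f z = cscale (cnj c) (D2 v f z)"
    unfolding D1_def D2_def d d' by (simp_all add: vec_eq_iff cscale_def complex_eq_iff algebra_simps)
qed

end

section \<open>Inverse matrices\<close>

lemma matrix_inv:
  fixes A :: "'r::finite mtx"
  assumes "invertible A"
  shows "A ** matrix_inv A = mat 1" "matrix_inv A ** A = mat 1"
  using someI_ex[OF assms[unfolded invertible_def]] by (auto simp: matrix_inv_def)

lemma matrix_inv_cancel:
  fixes A B :: "'r::finite mtx"
  assumes "invertible A"
  shows "A ** (matrix_inv A ** B) = B" "matrix_inv A ** (A ** B) = B"
    "B ** A ** matrix_inv A = B" "B ** matrix_inv A ** A = B"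
  using matrix_inv[OF assms] by (simp_all add: matrix_mul_assoc) (simp_all flip: matrix_mul_assoc)

lemma matrix_inv_unique:
  fixes A B :: "'r::finite mtx"
  assumes "A ** B = mat 1"
  shows "invertible A" "matrix_inv A = B"
proof -
  have "B ** A = mat 1" using assms matrix_left_right_inverse by blast
  then show i: "invertible A" using assms invertible_def by blast
  show "matrix_inv A = B" using matrix_inv_cancel(2)[OF i, of B] assms by simp
qed

lemma smooth_on_det:
  fixes M :: "'a::real_normed_vector \<Rightarrow> 'r::finite mtx"
  assumes "open S" "\<And>i j. smooth_on (\<lambda>z. M z $ i $ j) S"
  shows "smooth_on (\<lambda>z. det (M z)) S"
  unfolding det_def by (intro smooth_on_sum smooth_on_mult smooth_on_prod smooth_on_const assms)

text \<open>Exhibits the entries of the inverse as quotients of polynomials in the entries, which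
  makes the inverse smooth.\<close>

lemma matrix_inv_cramer:
  fixes A :: "'r::finite mtx"
  assumes "invertible A"
  shows "matrix_inv A $ k $ j = det (\<chi> i l. if l = k then axis j 1 $ i else A $ i $ l) / det A"
proof -
  have "A *v (matrix_inv A *v axis j 1) = axis j 1"
    using matrix_inv(1)[OF assms] by (simp add: matrix_vector_mul_assoc)
  then have "matrix_inv A *v axis j 1 = (\<chi> k. det (\<chi> i l. if l = k then axis j 1 $ i else A $ i $ l) / det A)"
    using cramer[of A] assms by (simp add: invertible_det_nz)
  moreover have "(matrix_inv A *v axis j 1) $ k = matrix_inv A $ k $ j"
    by (simp add: matrix_vector_mult_def axis_def if_distrib cong: if_cong)
  ultimately show ?thesis by simp
qed

lemma smooth_on_matrix_inv:
  fixes M :: "'a::real_normed_vector \<Rightarrow> 'r::finite mtx"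
  assumes S: "open S" and M: "smooth_on M S" and inv: "\<And>z. z \<in> S \<Longrightarrow> invertible (M z)"
  shows "smooth_on (\<lambda>z. matrix_inv (M z)) S"
proof (intro smooth_on_vecI S)
  fix k j
  have e: "smooth_on (\<lambda>z. M z $ i $ l) S" for i l by (intro smooth_on_vec_nth S M)
  have "smooth_on (\<lambda>z. det (\<chi> i l. if l = k then axis j 1 $ i else M z $ i $ l) / det (M z)) S"
  proof (intro smooth_on_divide smooth_on_det S e)
    show "smooth_on (\<lambda>z. (\<chi> i l. if l = k then axis j 1 $ i else M z $ i $ l) $ i $ l) S" for i l
      by (cases "l = k") (simp_all add: e)
  qed (use inv invertible_det_nz in blast)
  then show "smooth_on (\<lambda>z. matrix_inv (M z) $ k $ j) S"
    by (subst smooth_on_cong[OF S matrix_inv_cramer[OF inv]])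
qed

section \<open>The Chern connection and its curvature\<close>

definition theta :: "('n::finite pt \<Rightarrow> 'r::finite mtx) \<Rightarrow> ('n, 'r mtx) bil" where
  "theta H v z = matrix_inv (H z) ** D1 v H z"

text \<open>The (1,0)-part of the induced connection on endomorphisms.\<close>
definition cov :: "('n::finite pt \<Rightarrow> 'r::finite mtx) \<Rightarrow> 'n pt \<Rightarrow> ('n pt \<Rightarrow> 'r mtx) \<Rightarrow> 'n pt \<Rightarrow> 'r mtx" where
  "cov H v B z = D1 v B z + theta H v z ** B z - B z ** theta H v z"

text \<open>\<partial>-bar of the connection form before antisymmetrisation: \<open>u\<close> is the
  slot of type (0,1) and \<open>v\<close> that of type (1,0). The two types are kept apart because
  they are integrated by parts separately.\<close>

definition gcurv :: "('n::finite pt \<Rightarrow> 'r::finite mtx) \<Rightarrow> 'n pt \<Rightarrow> ('n, 'r mtx) bil" where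
  "gcurv H u v z = D2 u (theta H v) z"

abbreviation (input) kap :: complex where "kap \<equiv> \<i> / (2 * complex_of_real pi)"

definition ncurv :: "('n::finite pt \<Rightarrow> 'r::finite mtx) \<Rightarrow> 'n pt \<Rightarrow> ('n, 'r mtx) bil" where
  "ncurv H u v z = cscale kap (gcurv H u v z - gcurv H v u z)"

text \<open>The derivative of \<open>ncurv H u v\<close> in the direction of \<open>H B\<close>.\<close>
definition dcurv :: "('n::finite pt \<Rightarrow> 'r::finite mtx) \<Rightarrow> ('n pt \<Rightarrow> 'r mtx) \<Rightarrow> 'n pt \<Rightarrow> ('n, 'r mtx) bil" where
  "dcurv H B u v z = cscale kap (D2 u (cov H v B) z - D2 v (cov H u B) z)"

lemma ncurv_antisym: "ncurv H v u z = - ncurv H u v z"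
  unfolding ncurv_def by (simp flip: cscale_simps(5))

locale local_metric =
  fixes S :: "('n::finite pt) set" and H :: "'n pt \<Rightarrow> 'r::finite mtx"
  assumes S: "open S" and smooth_H: "smooth_on H S" and inv_H: "\<And>z. z \<in> S \<Longrightarrow> invertible (H z)"
begin

lemmas smooth_intros = smooth_on_matrix_mult[OF S] smooth_on_add[OF S] smooth_on_diff[OF S] smooth_on_cscale[OF S]
  smooth_on_const smooth_D1[OF S] smooth_D2[OF S] smooth_on_minus[OF S]

lemma smooth_inv_H: "smooth_on (\<lambda>z. matrix_inv (H z)) S"
  by (rule smooth_on_matrix_inv[OF S smooth_H inv_H])

lemma smooth_theta: "smooth_on (theta H v) S"
  unfolding theta_def[abs_def] by (intro smooth_intros smooth_inv_H smooth_H)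

lemma smooth_cov: "smooth_on B S \<Longrightarrow> smooth_on (cov H v B) S"
  unfolding cov_def[abs_def] by (intro smooth_intros smooth_theta)

lemma smooth_gcurv: "smooth_on (gcurv H u v) S"
  unfolding gcurv_def[abs_def] by (intro smooth_intros smooth_theta)

lemma smooth_ncurv: "smooth_on (ncurv H u v) S"
  unfolding ncurv_def[abs_def] by (intro smooth_intros smooth_gcurv)

lemma smooth_dcurv: "smooth_on B S \<Longrightarrow> smooth_on (dcurv H B u v) S"
  unfolding dcurv_def[abs_def] by (intro smooth_intros smooth_cov)

lemma D_matrix_inv:
  assumes z: "z \<in> S"
  shows "D1 v (\<lambda>z. matrix_inv (H z)) z = - matrix_inv (H z) ** D1 v H z ** matrix_inv (H z)"
    "D2 v (\<lambda>z. matrix_inv (H z)) z = - matrix_inv (H z) ** D2 v H z ** matrix_inv (H z)"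
proof -
  have 1: "D1 v (\<lambda>z. matrix_inv (H z) ** H z) z = 0" "D2 v (\<lambda>z. matrix_inv (H z) ** H z) z = 0"
    using D_cong[OF S z, of "\<lambda>z. matrix_inv (H z) ** H z" "\<lambda>z. mat 1"] matrix_inv(2)[OF inv_H] by simp_all
  have "D1 v (\<lambda>z. matrix_inv (H z)) z ** H z = - (matrix_inv (H z) ** D1 v H z)"
    "D2 v (\<lambda>z. matrix_inv (H z)) z ** H z = - (matrix_inv (H z) ** D2 v H z)"
    using 1 unfolding D_mult[OF S smooth_inv_H smooth_H z] by (simp_all add: add_eq_0_iff2)
  then show "D1 v (\<lambda>z. matrix_inv (H z)) z = - matrix_inv (H z) ** D1 v H z ** matrix_inv (H z)"
    "D2 v (\<lambda>z. matrix_inv (H z)) z = - matrix_inv (H z) ** D2 v H z ** matrix_inv (H z)"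
    using matrix_inv_cancel(3)[OF inv_H[OF z]] by (metis mat_minus_mult(1))+
qed

lemma D1_theta:
  assumes z: "z \<in> S"
  shows "D1 u (theta H v) z = matrix_inv (H z) ** D1 u (D1 v H) z - theta H u z ** theta H v z"
  unfolding theta_def[abs_def] D_mult[OF S smooth_inv_H smooth_D1[OF S smooth_H] z] D_matrix_inv[OF z]
  by (simp add: mat_minus_mult matrix_mul_assoc)

text \<open>The vanishing of the (2,0)-part of the curvature of h^-1 \<partial>h: the second
  derivatives of h are symmetric, and differentiating h^-1 gives the products.\<close>

lemma flat:
  assumes z: "z \<in> S"
  shows "D1 u (theta H v) z - D1 v (theta H u) z = theta H v z ** theta H u z - theta H u z ** theta H v z"
  unfolding D1_theta[OF z] by (simp add: D_commute(1)[OF S smooth_H z, of u v])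

lemma D2_gcurv_sym: "z \<in> S \<Longrightarrow> D2 x (gcurv H u v) z = D2 u (gcurv H x v) z"
  unfolding gcurv_def[abs_def] by (rule D_commute(2)[OF S smooth_theta])

text \<open>The \<partial>-bar derivative of \<open>flat\<close>. The products on its right-hand
  side become the terms by which \<open>cov\<close> differs from \<open>D1\<close>.\<close>

lemma cov_gcurv_sym:
  assumes z: "z \<in> S"
  shows "cov H y (gcurv H u v) z = cov H v (gcurv H u y) z"
proof -
  have "D1 y (gcurv H u v) z - D1 v (gcurv H u y) z = D2 u (\<lambda>z. D1 y (theta H v) z - D1 v (theta H y) z) z"
    unfolding gcurv_def[abs_def] D_diff[OF S smooth_D1[OF S smooth_theta] smooth_D1[OF S smooth_theta] z]
    by (simp add: D_commute(3)[OF S smooth_theta z])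
  also have "\<dots> = D2 u (\<lambda>z. theta H v z ** theta H y z - theta H y z ** theta H v z) z"
    by (rule D_cong(2)[OF S z flat])
  also have "\<dots> = gcurv H u v z ** theta H y z + theta H v z ** gcurv H u y z
      - (gcurv H u y z ** theta H v z + theta H y z ** gcurv H u v z)"
    unfolding D_diff[OF S smooth_on_matrix_mult[OF S smooth_theta smooth_theta] smooth_on_matrix_mult[OF S smooth_theta smooth_theta] z]
      D_mult[OF S smooth_theta smooth_theta z] gcurv_def ..
  finally show ?thesis by (simp add: cov_def algebra_simps)
qed

lemma cov_mult:
  assumes "smooth_on B S" "smooth_on C S" "z \<in> S"
  shows "cov H y (\<lambda>z. B z ** C z) z = cov H y B z ** C z + B z ** cov H y C z"
  unfolding cov_def D_mult[OF S assms] by (simp add: matrix_distribs matrix_mul_assoc)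

lemma cov_diff:
  assumes "smooth_on B S" "smooth_on C S" "z \<in> S"
  shows "cov H y (\<lambda>z. B z - C z) z = cov H y B z - cov H y C z"
  unfolding cov_def D_diff[OF S assms] by (simp add: matrix_distribs)

lemma cov_cscale:
  assumes "smooth_on B S" "z \<in> S"
  shows "cov H y (\<lambda>z. cscale c (B z)) z = cscale c (cov H y B z)"
  unfolding cov_def D_cscale[OF S assms] by (simp add: cscale_mult cscale_add cscale_diff)

lemma cov_scalar:
  assumes "smooth_on f S" "z \<in> S"
  shows "cov H y (\<lambda>z. cscale (f z) (mat 1)) z = cscale (sd1 y f z) (mat 1)"
  unfolding cov_def D_scalar[OF S assms] by (simp add: cscale_mult)

lemma trace_cov:
  assumes "smooth_on B S" "z \<in> S"
  shows "trace (cov H y B z) = sd1 y (\<lambda>z. trace (B z)) z"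
  unfolding cov_def sd_trace(1)[OF S assms] by (simp add: trace_add trace_sub trace_mul_sym[of "B z"])

text \<open>The commutator of \<partial>-bar and \<partial>_h on endomorphisms is the commutator
  with the curvature, since \<partial>-bar also hits the connection form inside
  \<open>cov\<close>.\<close>

lemma D2_cov:
  assumes B: "smooth_on B S" and z: "z \<in> S"
  shows "D2 x (cov H y B) z = cov H y (D2 x B) z + (gcurv H x y z ** B z - B z ** gcurv H x y z)"
  unfolding cov_def[abs_def]
    D_diff[OF S smooth_on_add[OF S smooth_D1[OF S B] smooth_on_matrix_mult[OF S smooth_theta B]] smooth_on_matrix_mult[OF S B smooth_theta] z]
    D_add[OF S smooth_D1[OF S B] smooth_on_matrix_mult[OF S smooth_theta B] z]
    D_mult[OF S smooth_theta B z] D_mult[OF S B smooth_theta z] D_commute(3)[OF S B z]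
  by (simp add: gcurv_def algebra_simps)

text \<open>The two types of the Bianchi identity. The unsymmetrised derivatives are symmetric in
  their two slots of equal type, so they cancel in pairs in the cyclic sum.\<close>

lemma ncurv_bianchi:
  assumes z: "z \<in> S"
  shows "D2 x (ncurv H u v) z + D2 u (ncurv H v x) z + D2 v (ncurv H x u) z = 0"
    "cov H x (ncurv H u v) z + cov H u (ncurv H v x) z + cov H v (ncurv H x u) z = 0"
proof -
  have 1: "D2 x (ncurv H u v) z = cscale kap (D2 x (gcurv H u v) z - D2 x (gcurv H v u) z)" for x u v
    unfolding ncurv_def[abs_def] D_cscale[OF S smooth_on_diff[OF S smooth_gcurv smooth_gcurv] z]
      D_diff[OF S smooth_gcurv smooth_gcurv z] ..
  show "D2 x (ncurv H u v) z + D2 u (ncurv H v x) z + D2 v (ncurv H x u) z = 0"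
    unfolding 1 using D2_gcurv_sym[OF z, of x u v] D2_gcurv_sym[OF z, of u v x] D2_gcurv_sym[OF z, of v x u]
    by (simp flip: cscale_add(1))
  have 2: "cov H x (ncurv H u v) z = cscale kap (cov H x (gcurv H u v) z - cov H x (gcurv H v u) z)" for x u v
    unfolding ncurv_def[abs_def] cov_cscale[OF smooth_on_diff[OF S smooth_gcurv smooth_gcurv] z]
      cov_diff[OF smooth_gcurv smooth_gcurv z] ..
  show "cov H x (ncurv H u v) z + cov H u (ncurv H v x) z + cov H v (ncurv H x u) z = 0"
    unfolding 2 using cov_gcurv_sym[OF z, of x u v] cov_gcurv_sym[OF z, of u v x] cov_gcurv_sym[OF z, of v x u]
    by (simp flip: cscale_add(1))
qed

lemma dd_nth:
  fixes f :: "'n pt \<Rightarrow> 'r mtx"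
  assumes f: "smooth_on f S" and z: "z \<in> S"
  shows "dd v (\<lambda>y. f y $ a $ b) z = dd v f z $ a $ b"
proof -
  have "bounded_linear (\<lambda>A :: 'r mtx. A $ a $ b)"
    by (rule bounded_linear_compose[OF bounded_linear_vec_nth bounded_linear_vec_nth])
  from dd_bounded_linear[OF this S f z] show ?thesis .
qed

lemma chern_connection_eq:
  assumes z: "z \<in> S"
  shows "chern_connection H z w = theta H (w 0) z"
proof -
  have "(\<chi> a b. del_dir (\<lambda>y. H y $ a $ b) z (w 0)) = D1 (w 0) H z"
    by (simp add: del_dir_def dd_nth[OF smooth_H z] D1_def vec_eq_iff cscale_def complex_eq_iff)
  then show ?thesis by (simp add: chern_connection_def theta_def)
qed

text \<open>In d\<theta> + \<theta> \<and> \<theta> the \<partial>-derivatives of \<theta> cancel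
  against \<theta> \<and> \<theta> by \<open>flat\<close>; only \<partial>-bar \<theta> is
  left.\<close>

lemma normalized_curvature_eq:
  assumes z: "z \<in> S"
  shows "normalized_curvature H z w = ncurv H (w 0) (w (Suc 0)) z"
proof -
  let ?u = "w 0" and ?v = "w (Suc 0)"
  have d: "dd x (\<lambda>y. chern_connection H y s) z = D1 x (theta H (s 0)) z + D2 x (theta H (s 0)) z" for x s
    unfolding dd_eq_D1_D2[symmetric]
    using dd_cong_open[OF S z, of "\<lambda>y. chern_connection H y s" "theta H (s 0)"] chern_connection_eq by simp
  have "{..Suc 0} = {0, Suc 0}" by auto
  then have e: "ext_deriv 1 (chern_connection H) z w = D1 ?u (theta H ?v) z + D2 ?u (theta H ?v) z - (D1 ?v (theta H ?u) z + D2 ?v (theta H ?u) z)"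
    by (simp add: ext_deriv_def d omit_def)
  have p2: "{\<sigma>. \<sigma> permutes {..<Suc (Suc 0)}} = {id, swp 0 (Suc 0)}"
  proof -
    have "{..<Suc (Suc 0)} = {0, Suc 0}" by auto
    then show ?thesis by (auto simp: permutes_doubleton_iff)
  qed
  have W: "wedge (\<lambda>A B. A ** B) 1 1 (chern_connection H) (chern_connection H) z w
    = theta H ?u z ** theta H ?v z - theta H ?v z ** theta H ?u z"
  proof -
    have "id \<noteq> swp 0 (Suc 0)" by (metis id_apply n_not_Suc_n transpose_apply_first)
    then show ?thesis by (simp add: wedge_def chern_connection_eq[OF z] p2 sign_swap_id)
  qed
  have "chern_curvature H z w = gcurv H ?u ?v z - gcurv H ?v ?u z"
    unfolding chern_curvature_def Let_def e W gcurv_def using flat[OF z, of ?u ?v] by (simp add: algebra_simps)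
  then show ?thesis by (simp add: normalized_curvature_def ncurv_def)
qed

end

section \<open>Cancellations under antisymmetrisation\<close>

text \<open>The differentiating slot \<open>s\<close> lies in the factor \<open>a\<close>, which
  ignores it. So \<open>s\<close> can be exchanged with either slot of the factor i without
  affecting the rest of the word. Under antisymmetrisation the three cyclic arrangements in
  \<open>cyc\<close> then agree, and as their sum is zero each of them is.\<close>

lemma altz_bianchi_factor:
  fixes X :: "'v \<Rightarrow> 'v \<Rightarrow> 'v \<Rightarrow> 'r::finite mtx"
  assumes i: "i < J" and a: "a < J" "i \<noteq> a" and s: "s \<in> {2 * a, Suc (2 * a)}" and N: "2 * J \<le> N"
    and Fs: "\<And>x x' y y'. Fs a x y = Fs a (if s = 2 * a then x' else x) (if s = 2 * a then y else y')"
    and anti: "\<And>x u v. X x v u = - X x u v" and cyc: "\<And>x u v. X x u v + X u v x + X v x u = 0"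
  shows "altz N (\<lambda>w. trace (A ** mprod (map ((\<lambda>k. Fs k (ev w k) (od w k))(i := X (w s) (ev w i) (od w i))) [0..<J]))
    * u (\<lambda>k. w (2 * J + k))) e = 0"
proof -
  define f where "f w k = Fs k (ev w k) (od w k)" for w :: "nat \<Rightarrow> 'v" and k
  define L where "L w Y = trace (A ** mprod (map ((f w)(i := Y)) [0..<J])) * u (\<lambda>k. w (2 * J + k))" for w Y
  define T where "T x y z = altz N (\<lambda>w. L w (X (w x) (w y) (w z))) e" for x y z
  let ?p = "2 * i" and ?q = "Suc (2 * i)"
  \<comment> \<open>The remaining word sees neither \<open>s\<close> nor the slots of the factor
    i.\<close>
  have inv: "L (\<lambda>k. w (swp s r k)) Y = L w Y" if r: "r \<in> {?p, ?q}" for w Y r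
  proof -
    have "f (\<lambda>k. w (swp s r k)) k = f w k" if k: "k \<noteq> i" for k
    proof (cases "k = a")
      case True
      have r': "2 * a \<noteq> r" "Suc (2 * a) \<noteq> r" using r a(2) by (auto; presburger)+
      show ?thesis
      proof (cases "s = 2 * a")
        case True
        then show ?thesis
          using Fs[of "w (swp s r (2 * a))" "w (Suc (2 * a))" "w (2 * a)"] \<open>k = a\<close> r'
          by (simp add: f_def Transposition.transpose_def)
      next
        case False
        then have "s = Suc (2 * a)" using s by simp
        then show ?thesis
          using Fs[of "w (2 * a)" "w (swp s r (Suc (2 * a)))" _ "w (Suc (2 * a))"] \<open>k = a\<close> r' False
          by (simp add: f_def Transposition.transpose_def)
      qed
    next
      case False
      have "2 * k \<noteq> s" "Suc (2 * k) \<noteq> s" "2 * k \<noteq> r" "Suc (2 * k) \<noteq> r"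
        using s r k False by (auto; presburger)+
      then show ?thesis by (simp add: f_def Transposition.transpose_def)
    qed
    then have "(f (\<lambda>k. w (swp s r k)))(i := Y) = (f w)(i := Y)" by (auto simp: fun_eq_iff)
    moreover have "2 * J + k \<noteq> s" "2 * J + k \<noteq> r" for k using s r i a by auto
    then have "(\<lambda>k. w (swp s r (2 * J + k))) = (\<lambda>k. w (2 * J + k))"
      by (auto simp: Transposition.transpose_def)
    ultimately show ?thesis by (simp only: L_def)
  qed
  have L_lin: "linear (L w)" for w
  proof -
    have "L w Y = trace (A ** (mprod (map (f w) [0..<i]) ** Y ** mprod (map (f w) [Suc i..<J]))) * u (\<lambda>k. w (2 * J + k))" for Y
      by (simp add: L_def mprod_split[OF i])
    then show ?thesis
      by (auto simp: linear_iff matrix_distribs scaleR_matrix_mult trace_add trace_scaleR algebra_simps)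
  qed
  have ne: "s \<noteq> ?p" "s \<noteq> ?q" using s a(2) by (auto; presburger)+
  have lt: "s < N" "?p < N" "?q < N" using s a i N by auto
  have "T ?p ?q s = T s ?p ?q"
  proof -
    have "altz N (\<lambda>w. L w (X (w ?p) (w ?q) (w s))) e = - altz N (\<lambda>w. L w (- X (w ?p) (w ?q) (w s))) e"
      unfolding linear_neg[OF L_lin] altz_minus by simp
    also have "altz N (\<lambda>w. L w (- X (w ?p) (w ?q) (w s))) e = - altz N (\<lambda>w. L w (X (w s) (w ?p) (w ?q))) e"
    proof (rule altz_swap_eq[OF lt(1,2) ne(1)])
      fix w
      show "L w (- X (w ?p) (w ?q) (w s)) = L (\<lambda>k. w (swp s ?p k))
         (X (w (swp s ?p s)) (w (swp s ?p ?p)) (w (swp s ?p ?q)))"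
        using ne by (subst inv) (auto simp: Transposition.transpose_def anti[of _ _ "w ?q"])
    qed
    finally show ?thesis by (simp add: T_def)
  qed
  moreover have "T ?q s ?p = T s ?p ?q"
  proof -
    have "altz N (\<lambda>w. L w (X (w ?q) (w s) (w ?p))) e = - altz N (\<lambda>w. L w (- X (w ?q) (w s) (w ?p))) e"
      unfolding linear_neg[OF L_lin] altz_minus by simp
    also have "altz N (\<lambda>w. L w (- X (w ?q) (w s) (w ?p))) e = - altz N (\<lambda>w. L w (X (w s) (w ?p) (w ?q))) e"
    proof (rule altz_swap_eq[OF lt(1,3) ne(2)])
      fix w
      show "L w (- X (w ?q) (w s) (w ?p)) = L (\<lambda>k. w (swp s ?q k))
         (X (w (swp s ?q s)) (w (swp s ?q ?p)) (w (swp s ?q ?q)))"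
        using ne by (subst inv) (auto simp: Transposition.transpose_def anti[of _ "w s" "w ?p"])
    qed
    finally show ?thesis by (simp add: T_def)
  qed
  moreover have "T s ?p ?q + T ?p ?q s + T ?q s ?p = 0"
    unfolding T_def altz_add[symmetric] linear_add[OF L_lin, symmetric] cyc
    by (simp add: linear_0[OF L_lin])
  ultimately have "T s ?p ?q = 0" by simp
  then show ?thesis by (simp add: T_def L_def f_def[abs_def])
qed

text \<open>The analogue for a factor of arbitrary degree. Neighbouring terms of the exterior
  derivative differ by an exchange of slots to which \<open>L\<close> is blind, so after
  antisymmetrisation all q + 1 of them are equal, sign included; their sum is 0. The function
  \<open>pos\<close> lists the slots, the differentiating one first.\<close>

lemma altz_closed_form:
  fixes Y :: "'v \<Rightarrow> (nat \<Rightarrow> 'v) \<Rightarrow> complex"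
  assumes L: "\<And>w k r. k \<in> insert s {M..} \<Longrightarrow> r \<in> insert s {M..} \<Longrightarrow> L (\<lambda>m. w (swp k r m)) = L w"
    and s: "s < M" and N: "M + q \<le> N"
    and Y: "\<And>w. (\<Sum>t\<le>q. (- 1) ^ t * Y (w t) (omit t w)) = 0"
  shows "altz N (\<lambda>w. L w * Y (w s) (\<lambda>k. w (M + k))) e = 0"
proof -
  define pos where "pos t = (if t = 0 then s else M + (t - 1))" for t
  define T where "T t = altz N (\<lambda>w. L w * Y (w (pos t)) (omit t (\<lambda>k. w (pos k)))) e" for t
  have pos_inj: "pos k = pos t \<longleftrightarrow> k = t" for k t using s by (auto simp: pos_def)
  have pos_in: "pos t \<in> insert s {M..}" for t by (auto simp: pos_def)
  have pos_lt: "t \<le> q \<Longrightarrow> pos t < N" for t using s N by (auto simp: pos_def)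
  have step: "T (Suc t) = - T t" if "Suc t \<le> q" for t
    unfolding T_def
  proof (rule altz_swap_eq[OF pos_lt pos_lt])
    show "Suc t \<le> q" "t \<le> q" "pos (Suc t) \<noteq> pos t" using that by (auto simp: pos_inj)
    fix w :: "nat \<Rightarrow> 'v"
    let ?\<tau> = "swp (pos (Suc t)) (pos t)"
    have "?\<tau> (pos k) = pos (swp (Suc t) t k)" for k
      by (auto simp: Transposition.transpose_def pos_inj)
    then have "omit t (\<lambda>k. w (?\<tau> (pos k))) = omit (Suc t) (\<lambda>k. w (pos k))"
      by (auto simp: omit_def fun_eq_iff Transposition.transpose_def less_Suc_eq)
    moreover have "?\<tau> (pos t) = pos (Suc t)" by simp
    ultimately show "L w * Y (w (pos (Suc t))) (omit (Suc t) (\<lambda>k. w (pos k)))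
      = L (\<lambda>k. w (?\<tau> k)) * Y (w (?\<tau> (pos t))) (omit t (\<lambda>k. w (?\<tau> (pos k))))"
      using L[OF pos_in pos_in] by simp
  qed
  have T: "T t = (- 1) ^ t * T 0" if "t \<le> q" for t
    using that by (induction t) (simp_all add: step)
  have "0 = altz N (\<lambda>w. L w * (\<Sum>t\<le>q. (- 1) ^ t * Y (w (pos t)) (omit t (\<lambda>k. w (pos k))))) e"
    unfolding Y[of "\<lambda>k. _ (pos k)"] by simp
  also have "\<dots> = (\<Sum>t\<le>q. (- 1) ^ t * T t)"
    unfolding T_def sum_distrib_left altz_sum altz_mult_left[symmetric]
    by (intro sum.cong refl altz_cong) (simp only: mult_ac)
  also have "\<dots> = (\<Sum>t\<le>q. T 0)"   proof (rule sum.cong)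
    fix t assume "t \<in> {..q}"
    moreover have "(- 1) ^ t * ((- 1) ^ t * c) = c" for c :: complex
      by (simp flip: mult.assoc power_mult_distrib)
    ultimately show "(- 1) ^ t * T t = T 0" using T[of t] by (simp only: atMost_iff)
  qed simp
  finally have "of_nat (Suc q) * T 0 = 0" by (simp del: of_nat_Suc)
  then have "T 0 = 0" by (simp only: mult_eq_0_iff of_nat_eq_0_iff nat.distinct simp_thms)
  moreover have "T 0 = altz N (\<lambda>w. L w * Y (w s) (\<lambda>k. w (M + k))) e"
    by (simp add: T_def pos_def omit_def)
  ultimately show ?thesis by simp
qed

lemma tword_upd:
  assumes "a < J"
  shows "tword A (Fs(a := K)) J u w = trace (A ** (mprod (map (\<lambda>i. Fs i (ev w i) (od w i)) [0..<a]) **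
     K (ev w a) (od w a) ** mprod (map (\<lambda>i. Fs i (ev w i) (od w i)) [Suc a..<J]))) * u (\<lambda>k. w (2 * J + k))"
proof -
  have "(\<lambda>i. (Fs(a := K)) i (ev w i) (od w i)) = (\<lambda>i. Fs i (ev w i) (od w i))(a := K (ev w a) (od w a))"
    by auto
  then show ?thesis unfolding tword_def pairprod_def by (simp only: mprod_split[OF assms])
qed

lemma tword_upd_linear:
  assumes "a < J"
  shows "tword A (Fs(a := \<lambda>x y. K x y - K' x y)) J u w = tword A (Fs(a := K)) J u w - tword A (Fs(a := K')) J u w"
    "tword A (Fs(a := \<lambda>x y. K x y + K' x y)) J u w = tword A (Fs(a := K)) J u w + tword A (Fs(a := K')) J u w"
    "tword A (Fs(a := \<lambda>x y. cscale c (K x y))) J u w = c * tword A (Fs(a := K)) J u w"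
  unfolding tword_upd[OF assms]
  by (simp_all add: matrix_distribs cscale_mult trace_add trace_sub algebra_simps)

text \<open>Exchanging the two slots of the factor costs a sign, so both halves contribute
  equally.\<close>

lemma altz_antisym_factor:
  fixes K :: "'v \<Rightarrow> 'v \<Rightarrow> 'r::finite mtx"
  assumes a: "a < J" and N: "2 * J \<le> N"
  shows "altz N (tword A (Fs(a := \<lambda>x y. K x y - K y x)) J u) e = 2 * altz N (tword A (Fs(a := K)) J u) e"
proof -
  have "altz N (tword A (Fs(a := \<lambda>x y. K y x)) J u) e = - altz N (tword A (Fs(a := K)) J u) e"
  proof (rule altz_swap_eq)
    show "2 * a < N" "Suc (2 * a) < N" "2 * a \<noteq> Suc (2 * a)" using a N by auto
    fix w :: "nat \<Rightarrow> 'v"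
    let ?\<tau> = "swp (2 * a) (Suc (2 * a))"
    have "?\<tau> (2 * k) = 2 * k" "?\<tau> (Suc (2 * k)) = Suc (2 * k)" if "k \<noteq> a" for k
      using that by (auto simp: Transposition.transpose_def; presburger)+
    then have "map (\<lambda>i. Fs i (w (?\<tau> (2 * i))) (w (?\<tau> (Suc (2 * i))))) [0..<a] = map (\<lambda>i. Fs i (ev w i) (od w i)) [0..<a]"
      "map (\<lambda>i. Fs i (w (?\<tau> (2 * i))) (w (?\<tau> (Suc (2 * i))))) [Suc a..<J] = map (\<lambda>i. Fs i (ev w i) (od w i)) [Suc a..<J]"
      by auto
    moreover have "(\<lambda>k. w (?\<tau> (2 * J + k))) = (\<lambda>k. w (2 * J + k))"
      using a by (auto simp: Transposition.transpose_def fun_eq_iff)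
    ultimately show "tword A (Fs(a := \<lambda>x y. K y x)) J u w = tword A (Fs(a := K)) J u (\<lambda>k. w (?\<tau> k))"
      unfolding tword_upd[OF a] by (simp only: transpose_apply_first transpose_apply_second)
  qed
  moreover have "altz N (tword A (Fs(a := \<lambda>x y. K x y - K y x)) J u) e
    = altz N (tword A (Fs(a := K)) J u) e - altz N (tword A (Fs(a := \<lambda>x y. K y x)) J u) e"
    unfolding altz_diff[symmetric] by (rule altz_cong) (rule tword_upd_linear(1)[OF a])
  ultimately show ?thesis by simp
qed

text \<open>By cyclicity, tr(Y F^a X F^(j-1-a)) = tr(X F^(j-1-a) Y F^a): the two distinguished
  matrices exchange their roles, and Y ends up in place b = j - 1 - a. The pair of slots they share
  moves along.\<close>

lemma altz_rotate:
  fixes F :: "'v \<Rightarrow> 'v \<Rightarrow> 'r::finite mtx"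
  assumes a: "a < j" and b: "b = j - 1 - a" and N: "2 * (j + d) \<le> N"
  shows "altz N (\<lambda>w. tword (Y (w (Suc (2 * a)))) ((factors F om j)(a := \<lambda>x y. X x)) (j + d) u w) e
    = altz N (\<lambda>w. tword (X (w (2 * b))) ((factors F om j)(b := \<lambda>x y. Y y)) (j + d) u w) e"
proof (rule altz_lift2_eq)
  \<comment> \<open>The corresponding renumbering of pairs: those behind X come first, then the
    shared pair, then those that preceded X.\<close>
  let ?\<pi> = "\<lambda>i. if i < j then (if i < b then a + 1 + i else if i = b then a else i - b - 1) else i"
  have "?\<pi> permutes {..<j}"
    by (rule bij_imp_permutes, rule bij_betw_byWitness[where f' = "\<lambda>i. if i < a then b + 1 + i else if i = a then b else i - a - 1"])
      (use a b in auto)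
  then show "?\<pi> permutes {..<j + d}" by (rule permutes_subset) auto
  show "2 * (j + d) \<le> N" by (rule N)
  fix w :: "nat \<Rightarrow> 'v"
  let ?w = "\<lambda>k. w (lift2 ?\<pi> k)"
  define f where "f w k = F (ev w k) (od w k)" for w :: "nat \<Rightarrow> 'v" and k
  define sc where "sc w = prod_list (map (\<lambda>i. om (ev w i) (od w i)) [j..<j + d])" for w :: "nat \<Rightarrow> 'v"
  have split: "tword Z ((factors F om j)(c := K)) (j + d) u w = sc w * trace (Z ** (mprod (map (f w) [0..<c]) **
      K (ev w c) (od w c) ** mprod (map (f w) [Suc c..<j]))) * u (\<lambda>k. w (2 * (j + d) + k))" if c: "c < j" for Z c K w
  proof -
    have 1: "[Suc c..<j + d] = [Suc c..<j] @ [j..<j + d]" using upt_add_eq_append[of "Suc c" j d] c by simp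
    have 2: "map (\<lambda>i. factors F om j i (ev w i) (od w i)) [0..<c] = map (f w) [0..<c]"
      "map (\<lambda>i. factors F om j i (ev w i) (od w i)) [Suc c..<j] = map (f w) [Suc c..<j]"
      using c by (auto simp: factors_def f_def)
    have 3: "map (\<lambda>i. factors F om j i (ev w i) (od w i)) [j..<j + d]
      = map (\<lambda>i. cscale (om (ev w i) (od w i)) (mat 1)) [j..<j + d]"
      by (auto simp: factors_def)
    have "c < j + d" using c by simp
    then show ?thesis
      unfolding tword_upd[OF \<open>c < j + d\<close>] 1 map_append mprod_append 2 3 mprod_scalars sc_def
      by (simp add: cscale_mult matrix_mul_assoc)
  qed
  have f: "f ?w i = f w (?\<pi> i)" for i by (simp add: f_def)
  have 1: "map (f ?w) [0..<b] = map (f w) [Suc a..<j]"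
    by (rule nth_equalityI) (use a b in \<open>auto simp: f\<close>)
  have 2: "map (f ?w) [Suc b..<j] = map (f w) [0..<a]"
    by (rule nth_equalityI) (use a b in \<open>auto simp: f\<close>)
  have 3: "sc ?w = sc w"
    unfolding sc_def by (intro arg_cong[of _ _ prod_list] map_cong) auto
  have "lift2 ?\<pi> (2 * (j + d) + k) = 2 * (j + d) + k" for k
  proof -
    have "(2 * (j + d) + k) div 2 = j + d + k div 2" "(2 * (j + d) + k) mod 2 = k mod 2" by presburger+
    then show ?thesis by (simp add: lift2_def)
  qed
  then have 4: "(\<lambda>k. ?w (2 * (j + d) + k)) = (\<lambda>k. w (2 * (j + d) + k))" by simp
  have bj: "b < j" using a b by simp
  have 5: "?w (2 * b) = w (2 * a)" "?w (Suc (2 * b)) = w (Suc (2 * a))" using bj by simp_all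
  have "trace (Y y ** (P ** X x ** Q)) = trace (X x ** (Q ** Y y ** P))" for x y and P Q :: "'r mtx"
    using trace_mul_sym[of "Y y ** P" "X x ** Q"] by (simp add: matrix_mul_assoc)
  then show "tword (Y (w (Suc (2 * a)))) ((factors F om j)(a := \<lambda>x y. X x)) (j + d) u w
     = tword (X (?w (2 * b))) ((factors F om j)(b := \<lambda>x y. Y y)) (j + d) u ?w"
    unfolding split[OF a] split[OF bj] 1 2 3 4 5 by simp
qed

section \<open>The local integration by parts identity\<close>

lemma sum_fun_upd_other: "i \<noteq> a \<Longrightarrow> (f(a := x)) i = f i"
  by simp

text \<open>Closedness is required for both types separately, since a word is differentiated either
  by \<partial> or by \<partial>-bar.\<close>

locale local_forms = local_metric S H
  for S :: "('n::finite pt) set" and H :: "'n pt \<Rightarrow> 'r::finite mtx" +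
  fixes om :: "'n pt \<Rightarrow> ('n, complex) bil"
    and U :: "'n pt \<Rightarrow> (nat \<Rightarrow> 'n pt) \<Rightarrow> complex" and l :: nat
  assumes smooth_om: "smooth_on (om a b) S"
    and om_antisym: "z \<in> S \<Longrightarrow> om b a z = - om a b z"
    and om_closed: "z \<in> S \<Longrightarrow> sd1 x (om a b) z + sd1 a (om b x) z + sd1 b (om x a) z = 0"
      "z \<in> S \<Longrightarrow> sd2 x (om a b) z + sd2 a (om b x) z + sd2 b (om x a) z = 0"
    and smooth_U: "smooth_on (\<lambda>z. U z w) S"
    and U_closed: "z \<in> S \<Longrightarrow> (\<Sum>s\<le>2 * l. (- 1) ^ s * sd1 (w s) (\<lambda>y. U y (omit s w)) z) = 0"
      "z \<in> S \<Longrightarrow> (\<Sum>s\<le>2 * l. (- 1) ^ s * sd2 (w s) (\<lambda>y. U y (omit s w)) z) = 0"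
begin

abbreviation fac :: "nat \<Rightarrow> 'n pt \<Rightarrow> nat \<Rightarrow> ('n, 'r mtx) bil" where
  "fac j z \<equiv> factors (\<lambda>a b. ncurv H a b z) (\<lambda>a b. om a b z) j"

lemma smooth_fac: "smooth_on (\<lambda>z. fac j z i a b) S"
  by (cases "i < j") (simp_all add: factors_def smooth_ncurv smooth_on_cscale[OF S smooth_om])

lemma fac_antisym: "z \<in> S \<Longrightarrow> fac j z i b a = - fac j z i a b"
  using ncurv_antisym[of H b a z] om_antisym[of z b a] by (auto simp: factors_def cscale_def vec_eq_iff)

lemma fac_closed:
  assumes z: "z \<in> S"
  shows "D2 x (\<lambda>z. fac j z i a b) z + D2 a (\<lambda>z. fac j z i b x) z + D2 b (\<lambda>z. fac j z i x a) z = 0"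
    "cov H x (\<lambda>z. fac j z i a b) z + cov H a (\<lambda>z. fac j z i b x) z + cov H b (\<lambda>z. fac j z i x a) z = 0"
proof -
  have "D2 x (\<lambda>z. cscale (om a b z) (mat 1 :: 'r mtx)) z + D2 a (\<lambda>z. cscale (om b x z) (mat 1)) z + D2 b (\<lambda>z. cscale (om x a z) (mat 1)) z = 0"
    unfolding D_scalar[OF S smooth_om z] cscale_add(2)[symmetric] om_closed[OF z] by simp
  then show "D2 x (\<lambda>z. fac j z i a b) z + D2 a (\<lambda>z. fac j z i b x) z + D2 b (\<lambda>z. fac j z i x a) z = 0"
    using ncurv_bianchi(1)[OF z] by (cases "i < j") (simp_all add: factors_def)
  have "cov H x (\<lambda>z. cscale (om a b z) (mat 1)) z + cov H a (\<lambda>z. cscale (om b x z) (mat 1)) z + cov H b (\<lambda>z. cscale (om x a z) (mat 1)) z = 0"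
    unfolding cov_scalar[OF smooth_om z] cscale_add(2)[symmetric] om_closed[OF z] by simp
  then show "cov H x (\<lambda>z. fac j z i a b) z + cov H a (\<lambda>z. fac j z i b x) z + cov H b (\<lambda>z. fac j z i x a) z = 0"
    using ncurv_bianchi(2)[OF z] by (cases "i < j") (simp_all add: factors_def)
qed

lemma fac_deriv_antisym:
  assumes z: "z \<in> S"
  shows "D2 x (\<lambda>z. fac j z i b a) z = - D2 x (\<lambda>z. fac j z i a b) z"
    "cov H x (\<lambda>z. fac j z i b a) z = - cov H x (\<lambda>z. fac j z i a b) z"
proof -
  show 1: "D2 x (\<lambda>z. fac j z i b a) z = - D2 x (\<lambda>z. fac j z i a b) z"
    unfolding D_uminus(2)[OF S smooth_fac z, symmetric] by (rule D_cong(2)[OF S z fac_antisym])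
  have "D1 x (\<lambda>z. fac j z i b a) z = - D1 x (\<lambda>z. fac j z i a b) z"
    unfolding D_uminus(1)[OF S smooth_fac z, symmetric] by (rule D_cong(1)[OF S z fac_antisym])
  then show "cov H x (\<lambda>z. fac j z i b a) z = - cov H x (\<lambda>z. fac j z i a b) z"
    by (simp add: cov_def fac_antisym[OF z, of j i b a] mat_minus_mult)
qed

text \<open>Used with \<open>Dop\<close>, \<open>sdop\<close> the (0,1)-derivatives and with the (1,0)-derivatives, where \<open>Dop\<close> is covariant.\<close>
lemma tword_leibniz:
  fixes Dop :: "('n pt \<Rightarrow> 'r mtx) \<Rightarrow> 'r mtx" and sdop :: "('n pt \<Rightarrow> complex) \<Rightarrow> complex"
  assumes Dm: "\<And>f g. smooth_on f S \<Longrightarrow> smooth_on g S \<Longrightarrow> Dop (\<lambda>z. f z ** g z) = Dop f ** g z + f z ** Dop g"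
    and D1: "Dop (\<lambda>z. mat 1) = 0"
    and tr: "\<And>f c. smooth_on f S \<Longrightarrow> smooth_on c S \<Longrightarrow> sdop (\<lambda>z. trace (f z) * c z) = trace (Dop f) * c z + trace (f z) * sdop c"
    and A: "smooth_on A S" and Fs: "\<And>i a b. smooth_on (\<lambda>z. Fs z i a b) S"
  shows "sdop (\<lambda>z. tword (A z) (Fs z) J (U z) w) = tword (Dop A) (Fs z) J (U z) w
    + (\<Sum>i<J. trace (A z ** mprod (map ((\<lambda>k. Fs z k (ev w k) (od w k))
          (i := Dop (\<lambda>z. Fs z i (ev w i) (od w i)))) [0..<J])) * U z (\<lambda>k. w (2 * J + k)))
    + trace (A z ** pairprod (Fs z) J w) * sdop (\<lambda>z. U z (\<lambda>k. w (2 * J + k)))"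
proof -
  let ?M = "\<lambda>i z. Fs z i (ev w i) (od w i)"
  have P: "smooth_on (\<lambda>z. mprod (map (\<lambda>i. ?M i z) [0..<J])) S"
    and D: "Dop (\<lambda>z. mprod (map (\<lambda>i. ?M i z) [0..<J])) = (\<Sum>i\<in>set [0..<J]. mprod (map ((\<lambda>k. ?M k z)(i := Dop (?M i))) [0..<J]))"
    using mprod_leibniz[of "\<lambda>f. smooth_on f S" Dop z "[0..<J]" ?M]
      Dm D1 smooth_on_matrix_mult[OF S] Fs by auto
  have e: "(\<lambda>z. tword (A z) (Fs z) J (U z) w) = (\<lambda>z. trace (A z ** mprod (map (\<lambda>i. ?M i z) [0..<J])) * U z (\<lambda>k. w (2 * J + k)))"
    by (simp add: tword_def pairprod_def)
  have "sdop (\<lambda>z. tword (A z) (Fs z) J (U z) w)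
     = trace (Dop A ** mprod (map (\<lambda>i. ?M i z) [0..<J])) * U z (\<lambda>k. w (2 * J + k))
       + trace (A z ** (\<Sum>i\<in>set [0..<J]. mprod (map ((\<lambda>k. ?M k z)(i := Dop (?M i))) [0..<J]))) * U z (\<lambda>k. w (2 * J + k))
       + trace (A z ** mprod (map (\<lambda>i. ?M i z) [0..<J])) * sdop (\<lambda>z. U z (\<lambda>k. w (2 * J + k)))"
    unfolding e tr[OF smooth_on_matrix_mult[OF S A P] smooth_U] Dm[OF A P] D
    by (simp add: trace_add algebra_simps)
  then show ?thesis
    by (simp add: tword_def pairprod_def linear_sum[OF linear_matrix_mult(1)] linear_sum[OF linear_trace] sum_distrib_right
        atLeast0LessThan)
qed

lemma sd_word:
  fixes f :: "'n pt \<Rightarrow> 'r mtx"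
  assumes f: "smooth_on f S" and c: "smooth_on c S" and z: "z \<in> S"
  shows "sd1 x (\<lambda>z. trace (f z) * c z) z = trace (cov H x f z) * c z + trace (f z) * sd1 x c z"
    "sd2 x (\<lambda>z. trace (f z) * c z) z = trace (D2 x f z) * c z + trace (f z) * sd2 x c z"
  unfolding sd_mult[OF S smooth_on_trace[OF S f] c z] trace_cov[OF f z] sd_trace(2)[OF S f z] by simp_all

text \<open>
  Differentiating in one of the two slots of the factor \<open>a\<close>: all terms in which another factor is
  differentiated vanish under antisymmetrisation.
\<close>
lemma altz_deriv_word:
  fixes Dop :: "'n pt \<Rightarrow> ('n pt \<Rightarrow> 'r mtx) \<Rightarrow> 'r mtx" and sdop :: "'n pt \<Rightarrow> ('n pt \<Rightarrow> complex) \<Rightarrow> complex"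
  assumes z: "z \<in> S" and N: "2 * J + 2 * l \<le> N" and a: "a < J" and s: "s \<in> {2 * a, Suc (2 * a)}"
    and Dm: "\<And>x f g. smooth_on f S \<Longrightarrow> smooth_on g S \<Longrightarrow> Dop x (\<lambda>z. f z ** g z) = Dop x f ** g z + f z ** Dop x g"
    and D1: "\<And>x. Dop x (\<lambda>z. mat 1) = 0"
    and tr: "\<And>x f c. smooth_on f S \<Longrightarrow> smooth_on c S \<Longrightarrow> sdop x (\<lambda>z. trace (f z) * c z) = trace (Dop x f) * c z + trace (f z) * sdop x c"
    and anti: "\<And>x i a b. Dop x (\<lambda>z. fac j z i b a) = - Dop x (\<lambda>z. fac j z i a b)"
    and cyc: "\<And>x i a b. Dop x (\<lambda>z. fac j z i a b) + Dop a (\<lambda>z. fac j z i b x) + Dop b (\<lambda>z. fac j z i x a) = 0"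
    and Uc: "\<And>w. (\<Sum>t\<le>2 * l. (- 1) ^ t * sdop (w t) (\<lambda>y. U y (omit t w))) = 0"
    and A: "smooth_on A S" and K: "\<And>x y. smooth_on (\<lambda>z. K z x y) S"
    and Ks: "\<And>z x x' y y'. K z x y = K z (if s = 2 * a then x' else x) (if s = 2 * a then y else y')"
  shows "altz N (\<lambda>w. sdop (w s) (\<lambda>z. tword (A z) ((fac j z)(a := K z)) J (U z) w)) e
    = altz N (\<lambda>w. tword (Dop (w s) A) ((fac j z)(a := K z)) J (U z) w) e
      + altz N (\<lambda>w. tword (A z) ((fac j z)(a := \<lambda>x y. Dop (w s) (\<lambda>z. K z x y))) J (U z) w) e"
proof -
  let ?Fs = "\<lambda>z. (fac j z)(a := K z)"
  let ?g = "\<lambda>w i. trace (A z ** mprod (map ((\<lambda>k. ?Fs z k (ev w k) (od w k))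
          (i := Dop (w s) (\<lambda>z. ?Fs z i (ev w i) (od w i)))) [0..<J])) * U z (\<lambda>k. w (2 * J + k))"
  let ?h = "\<lambda>w. trace (A z ** pairprod (?Fs z) J w) * sdop (w s) (\<lambda>z. U z (\<lambda>k. w (2 * J + k)))"
  have smF: "smooth_on (\<lambda>z. ?Fs z i x y) S" for i x y
    by (cases "i = a") (simp_all add: K smooth_fac)
  have "sdop (w s) (\<lambda>z. tword (A z) (?Fs z) J (U z) w) = tword (Dop (w s) A) (?Fs z) J (U z) w + (\<Sum>i<J. ?g w i) + ?h w" for w
    by (rule tword_leibniz[OF Dm D1 tr A smF])
  then have "altz N (\<lambda>w. sdop (w s) (\<lambda>z. tword (A z) (?Fs z) J (U z) w)) e
    = altz N (\<lambda>w. tword (Dop (w s) A) (?Fs z) J (U z) w) e + (\<Sum>i<J. altz N (\<lambda>w. ?g w i) e) + altz N ?h e"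
    by (simp only: altz_add altz_sum)
  \<comment> \<open>The derivative of U. The matrix part of the word sees neither the slot
    \<open>s\<close>, by \<open>Ks\<close>, nor the slots from 2 J on, as
    \<open>altz_closed_form\<close> demands.\<close>
  also have "altz N ?h e = 0"
  proof (rule altz_closed_form[where Y = "\<lambda>x v. sdop x (\<lambda>z. U z v)" and q = "2 * l"])
    show "s < 2 * J" using s a by auto
    show "2 * J + 2 * l \<le> N" by (rule N)
    show "(\<Sum>t\<le>2 * l. (- 1) ^ t * sdop (w t) (\<lambda>z. U z (omit t w))) = 0" for w by (rule Uc)
    fix w :: "nat \<Rightarrow> 'n pt" and k r assume kr: "k \<in> insert s {2 * J..}" "r \<in> insert s {2 * J..}"
    let ?\<tau> = "swp k r"
    have "?Fs z i (w (?\<tau> (2 * i))) (w (?\<tau> (Suc (2 * i)))) = ?Fs z i (ev w i) (od w i)" if "i < J" for i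
    proof (cases "i = a")
      case True
      show ?thesis
      proof (cases "s = 2 * a")
        case True
        have "?\<tau> (Suc (2 * a)) = Suc (2 * a)" using kr a True by (auto simp: Transposition.transpose_def)
        then show ?thesis using \<open>i = a\<close> Ks[of z "w (?\<tau> (2 * a))" "w (Suc (2 * a))" "w (2 * a)"] True by simp
      next
        case False
        then have "?\<tau> (2 * a) = 2 * a" using kr a s by (auto simp: Transposition.transpose_def)
        then show ?thesis using \<open>i = a\<close> Ks[of z "w (2 * a)" "w (?\<tau> (Suc (2 * a)))" _ "w (Suc (2 * a))"] False by simp
      qed
    next
      case False
      then have "?\<tau> (2 * i) = 2 * i" "?\<tau> (Suc (2 * i)) = Suc (2 * i)"
        using kr that s by (auto simp: Transposition.transpose_def; presburger)+
      then show ?thesis by simp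
    qed
    then have "map (\<lambda>i. ?Fs z i (w (?\<tau> (2 * i))) (w (?\<tau> (Suc (2 * i))))) [0..<J] = map (\<lambda>i. ?Fs z i (ev w i) (od w i)) [0..<J]"
      by (intro map_cong) auto
    then show "trace (A z ** pairprod (?Fs z) J (\<lambda>m. w (?\<tau> m))) = trace (A z ** pairprod (?Fs z) J w)"
      by (simp only: pairprod_def)
  qed
  also have "(\<Sum>i<J. altz N (\<lambda>w. ?g w i) e) = (\<Sum>i<J. if i = a then altz N (\<lambda>w. tword (A z) ((fac j z)(a := \<lambda>x y. Dop (w s) (\<lambda>z. K z x y))) J (U z) w) e else 0)"
  proof (rule sum.cong)
    fix i assume i: "i \<in> {..<J}"
    show "altz N (\<lambda>w. ?g w i) e = (if i = a then altz N (\<lambda>w. tword (A z) ((fac j z)(a := \<lambda>x y. Dop (w s) (\<lambda>z. K z x y))) J (U z) w) e else 0)"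
    proof (cases "i = a")
      case True
      have "?g w i = tword (A z) ((fac j z)(a := \<lambda>x y. Dop (w s) (\<lambda>z. K z x y))) J (U z) w" for w
      proof -
        have "(\<lambda>k. ?Fs z k (ev w k) (od w k))(i := Dop (w s) (\<lambda>z. ?Fs z i (ev w i) (od w i)))
          = (\<lambda>k. ((fac j z)(a := \<lambda>x y. Dop (w s) (\<lambda>z. K z x y))) k (ev w k) (od w k))"
          using True by auto
        then show ?thesis by (simp only: tword_def pairprod_def)
      qed
      then show ?thesis using True by simp
    next
      case False
      have "altz N (\<lambda>w. ?g w i) e = 0"
        unfolding sum_fun_upd_other[OF False]
      proof (rule altz_bianchi_factor[where X = "\<lambda>x p q. Dop x (\<lambda>z. fac j z i p q)" and a = a and s = s, OF _ a False s _ _ anti cyc])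
        show "i < J" "2 * J \<le> N" using i N by auto
        show "?Fs z a x y = ?Fs z a (if s = 2 * a then x' else x) (if s = 2 * a then y else y')" for x x' y y'
          unfolding fun_upd_same by (rule Ks)
      qed
      then show ?thesis using False by simp
    qed
  qed simp
  finally show ?thesis
    using a by (simp only: sum.delta finite_lessThan lessThan_iff add_0_right if_True)
qed

text \<open>One word of the exterior derivative of A \<mapsto> \<integral> tr(A D_Z) at (A, B). The
  commutator arises because A and B stand for h^-1 dh, whose mixed derivatives do not commute; the
  sum is the variation of the curvature factors.\<close>

definition cword :: "nat \<Rightarrow> nat \<Rightarrow> ('n pt \<Rightarrow> 'r mtx) \<Rightarrow> ('n pt \<Rightarrow> 'r mtx) \<Rightarrow> 'n pt \<Rightarrow> (nat \<Rightarrow> 'n pt) \<Rightarrow> complex" where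
  "cword j d A B z w = tword (A z ** B z - B z ** A z) (fac j z) (j + d) (U z) w
    + (\<Sum>a<j. tword (A z) ((fac j z)(a := \<lambda>x y. dcurv H B x y z)) (j + d) (U z) w
            - tword (B z) ((fac j z)(a := \<lambda>x y. dcurv H A x y z)) (j + d) (U z) w)"

text \<open>Two divergences are compared. The \<partial>-bar derivative of the word with
  \<open>A\<close> and \<partial>_h B yields \<partial>-bar A, \<partial>_h B and A, \<partial>-bar
  \<partial>_h B. The \<partial> derivative of the word with \<open>B\<close> and \<partial>-bar A
  yields \<partial>_h B, \<partial>-bar A and B, \<partial>_h \<partial>-bar A. The first-order
  products agree after rotation, and reordering \<partial>-bar \<partial>_h A costs commutators with
  the curvature, which cancel the commutator of \<open>A\<close> and \<open>B\<close>. The factor 2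
  \<open>kap\<close> comes from the antisymmetrised definition of \<open>dcurv\<close>.\<close>

lemma cword_exact:
  assumes z: "z \<in> S" and A: "smooth_on A S" and B: "smooth_on B S" and N: "2 * (j + d) + 2 * l \<le> N"
  shows "altz N (cword j d A B z) e = (\<Sum>a<j. 2 * kap *
     (altz N (\<lambda>w. sd2 (w (2 * a)) (\<lambda>z. tword (A z) ((fac j z)(a := \<lambda>x y. cov H y B z)) (j + d) (U z) w) z) e
      - altz N (\<lambda>w. sd1 (w (Suc (2 * a))) (\<lambda>z. tword (B z) ((fac j z)(a := \<lambda>x y. D2 x A z)) (j + d) (U z) w) z) e))"
proof -
  let ?J = "j + d"
  define E where "E T = altz N T e" for T :: "(nat \<Rightarrow> 'n pt) \<Rightarrow> complex"
  define t where "t M a K = tword M ((fac j z)(a := K)) ?J (U z)" for M a K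
  have al: "E (\<lambda>w. sd2 (w (2 * a)) (\<lambda>z. tword (A z) ((fac j z)(a := \<lambda>x y. cov H y B z)) ?J (U z) w) z)
     = E (\<lambda>w. t (D2 (w (2 * a)) A z) a (\<lambda>x y. cov H y B z) w) + E (t (A z) a (\<lambda>x y. D2 x (cov H y B) z))" if a: "a < j" for a
  proof -
    have "E (\<lambda>w. sd2 (w (2 * a)) (\<lambda>z. tword (A z) ((fac j z)(a := \<lambda>x y. cov H y B z)) ?J (U z) w) z)
     = E (\<lambda>w. t (D2 (w (2 * a)) A z) a (\<lambda>x y. cov H y B z) w)
      + E (\<lambda>w. t (A z) a (\<lambda>x y. D2 (w (2 * a)) (cov H y B) z) w)"
      unfolding E_def t_def
    proof (rule altz_deriv_word[where Dop = "\<lambda>x f. D2 x f z" and sdop = "\<lambda>x f. sd2 x f z", OF z N _ _ D_mult(2)[OF S _ _ z]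
          _ sd_word(2)[OF _ _ z] fac_deriv_antisym(1)[OF z] fac_closed(1)[OF z] U_closed(2)[OF z] A smooth_cov[OF B]])
      show "a < ?J" using a by simp
    qed simp_all
    also have "E (\<lambda>w. t (A z) a (\<lambda>x y. D2 (w (2 * a)) (cov H y B) z) w) = E (t (A z) a (\<lambda>x y. D2 x (cov H y B) z))"
      unfolding E_def t_def by (rule altz_cong) (use a in \<open>simp add: tword_upd\<close>)
    finally show ?thesis .
  qed
  have be: "E (\<lambda>w. sd1 (w (Suc (2 * a))) (\<lambda>z. tword (B z) ((fac j z)(a := \<lambda>x y. D2 x A z)) ?J (U z) w) z)
     = E (\<lambda>w. t (cov H (w (Suc (2 * a))) B z) a (\<lambda>x y. D2 x A z) w) + E (t (B z) a (\<lambda>x y. cov H y (D2 x A) z))" if a: "a < j" for a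
  proof -
    have "E (\<lambda>w. sd1 (w (Suc (2 * a))) (\<lambda>z. tword (B z) ((fac j z)(a := \<lambda>x y. D2 x A z)) ?J (U z) w) z)
     = E (\<lambda>w. t (cov H (w (Suc (2 * a))) B z) a (\<lambda>x y. D2 x A z) w)
      + E (\<lambda>w. t (B z) a (\<lambda>x y. cov H (w (Suc (2 * a))) (D2 x A) z) w)"
      unfolding E_def t_def
    proof (rule altz_deriv_word[where Dop = "\<lambda>x f. cov H x f z" and sdop = "\<lambda>x f. sd1 x f z", OF z N _ _ cov_mult[OF _ _ z]
          _ sd_word(1)[OF _ _ z] fac_deriv_antisym(2)[OF z] fac_closed(2)[OF z] U_closed(1)[OF z] B smooth_D2[OF S A]])
      show "a < ?J" using a by simp
      show "cov H x (\<lambda>z. mat 1) z = 0" for x by (simp add: cov_def)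
    qed simp_all
    also have "E (\<lambda>w. t (B z) a (\<lambda>x y. cov H (w (Suc (2 * a))) (D2 x A) z) w) = E (t (B z) a (\<lambda>x y. cov H y (D2 x A) z))"
      unfolding E_def t_def by (rule altz_cong) (use a in \<open>simp add: tword_upd\<close>)
    finally show ?thesis .
  qed
  have sc: "E (t M a (\<lambda>x y. cscale c (K x y))) = c * E (t M a K)" if "a < j" for M a c K
  proof -
    have "t M a (\<lambda>x y. cscale c (K x y)) = (\<lambda>w. c * t M a K w)"
      unfolding t_def using that by (intro ext tword_upd_linear(3)) simp
    then show ?thesis by (simp only: E_def altz_mult_left)
  qed
  have ad: "E (t M a (\<lambda>x y. K x y + K' x y)) = E (t M a K) + E (t M a K')" if "a < j" for M a K K'
  proof -
    have "t M a (\<lambda>x y. K x y + K' x y) = (\<lambda>w. t M a K w + t M a K' w)"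
      unfolding t_def using that by (intro ext tword_upd_linear(2)) simp
    then show ?thesis by (simp only: E_def altz_add)
  qed
  have an: "E (t M a (\<lambda>x y. K x y - K y x)) = 2 * E (t M a K)" if "a < j" for M a K
    unfolding E_def t_def by (rule altz_antisym_factor) (use that N in auto)
  have dc: "E (t M a (\<lambda>x y. dcurv H C x y z)) = 2 * kap * E (t M a (\<lambda>x y. D2 x (cov H y C) z))" if "a < j" for M C a
    unfolding dcurv_def sc[OF that] an[OF that] by simp
  have d2c: "E (t (B z) a (\<lambda>x y. D2 x (cov H y A) z)) = E (t (B z) a (\<lambda>x y. cov H y (D2 x A) z))
     + E (t (B z) a (\<lambda>x y. gcurv H x y z ** A z - A z ** gcurv H x y z))" if "a < j" for a
    unfolding D2_cov[OF A z] ad[OF that] ..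
  \<comment> \<open>Under antisymmetrisation \<open>gcurv\<close> is half of its antisymmetric part,
    which up to \<open>kap\<close> is the curvature itself.\<close>
  have gc: "2 * kap * E (t (B z) a (\<lambda>x y. gcurv H x y z ** A z - A z ** gcurv H x y z))
     = E (t (B z) a (\<lambda>x y. ncurv H x y z ** A z - A z ** ncurv H x y z))" if a: "a < j" for a
  proof -
    have "(\<lambda>x y. ncurv H x y z ** A z - A z ** ncurv H x y z)
       = (\<lambda>x y. cscale kap ((gcurv H x y z ** A z - A z ** gcurv H x y z) - (gcurv H y x z ** A z - A z ** gcurv H y x z)))"
      by (simp only: ncurv_def matrix_distribs cscale_mult cscale_diff) (simp add: algebra_simps)
    then show ?thesis
      using sc[OF a] an[OF a] by simp
  qed
  \<comment> \<open>Rotation sends place a to place j - 1 - a, so the identity holds only for the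
    sums over all places.\<close>
  have rot: "(\<Sum>a<j. E (\<lambda>w. t (cov H (w (Suc (2 * a))) B z) a (\<lambda>x y. D2 x A z) w))
     = (\<Sum>a<j. E (\<lambda>w. t (D2 (w (2 * a)) A z) a (\<lambda>x y. cov H y B z) w))"
  proof -
    have "E (\<lambda>w. t (cov H (w (Suc (2 * a))) B z) a (\<lambda>x y. D2 x A z) w)
      = E (\<lambda>w. t (D2 (w (2 * (j - 1 - a))) A z) (j - 1 - a) (\<lambda>x y. cov H y B z) w)" if "a < j" for a
      unfolding E_def t_def
      by (rule altz_rotate[where X = "\<lambda>x. D2 x A z" and Y = "\<lambda>y. cov H y B z"]) (use that N in auto)
    then have "(\<Sum>a<j. E (\<lambda>w. t (cov H (w (Suc (2 * a))) B z) a (\<lambda>x y. D2 x A z) w))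
      = (\<Sum>a<j. E (\<lambda>w. t (D2 (w (2 * (j - 1 - a))) A z) (j - 1 - a) (\<lambda>x y. cov H y B z) w))" by simp
    also have "\<dots> = (\<Sum>a<j. E (\<lambda>w. t (D2 (w (2 * a)) A z) a (\<lambda>x y. cov H y B z) w))"
      using sum.nat_diff_reindex[of "\<lambda>a. E (\<lambda>w. t (D2 (w (2 * a)) A z) a (\<lambda>x y. cov H y B z) w)" j] by simp
    finally show ?thesis .
  qed
  \<comment> \<open>tr([A, B] P) = tr(B [P, A]), and the commutator with \<open>A\<close> is
    distributed over the factors of P. The scalar factors coming from \<omega> commute with
    \<open>A\<close> and drop out.\<close>
  have comm: "E (tword (A z ** B z - B z ** A z) (fac j z) ?J (U z))
     = (\<Sum>a<j. E (t (B z) a (\<lambda>x y. ncurv H x y z ** A z - A z ** ncurv H x y z)))"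
  proof -
    have "tword (A z ** B z - B z ** A z) (fac j z) ?J (U z) w
       = (\<Sum>a<j. t (B z) a (\<lambda>x y. ncurv H x y z ** A z - A z ** ncurv H x y z) w)" for w
    proof -
      let ?M = "\<lambda>i. fac j z i (ev w i) (od w i)"
      let ?P = "mprod (map ?M [0..<?J])"
      have "trace ((A z ** B z - B z ** A z) ** ?P) = trace (B z ** (?P ** A z - A z ** ?P))"
        using trace_mul_sym[of "A z" "B z ** ?P"] by (simp add: matrix_distribs trace_sub matrix_mul_assoc)
      also have "\<dots> = (\<Sum>a\<in>set [0..<?J]. trace (B z ** mprod (map (?M(a := ?M a ** A z - A z ** ?M a)) [0..<?J])))"
        by (subst commutator_mprod) (simp_all add: linear_sum[OF linear_matrix_mult(1)] linear_sum[OF linear_trace])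
      also have "\<dots> = (\<Sum>a<j. trace (B z ** mprod (map (?M(a := ?M a ** A z - A z ** ?M a)) [0..<?J])))"
      proof (rule sum.mono_neutral_right)
        show "\<forall>a\<in>set [0..<?J] - {..<j}. trace (B z ** mprod (map (?M(a := ?M a ** A z - A z ** ?M a)) [0..<?J])) = 0"
        proof
          fix a assume "a \<in> set [0..<?J] - {..<j}"
          then have a: "a < ?J" "\<not> a < j" by auto
          have "?M a ** A z - A z ** ?M a = 0" using a by (simp add: factors_def cscale_mult)
          then show "trace (B z ** mprod (map (?M(a := ?M a ** A z - A z ** ?M a)) [0..<?J])) = 0"
            unfolding mprod_split[OF a(1)] by (simp add: linear_0[OF linear_trace])
        qed
      qed auto
      also have "\<dots> = (\<Sum>a<j. trace (B z ** mprod (map (\<lambda>i. ((fac j z)(a := \<lambda>x y. ncurv H x y z ** A z - A z ** ncurv H x y z)) i (ev w i) (od w i)) [0..<?J])))"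
      proof (intro sum.cong refl)
        fix a assume "a \<in> {..<j}"
        then have "?M(a := ?M a ** A z - A z ** ?M a) = (\<lambda>i. ((fac j z)(a := \<lambda>x y. ncurv H x y z ** A z - A z ** ncurv H x y z)) i (ev w i) (od w i))"
          by (auto simp: factors_def)
        then show "trace (B z ** mprod (map (?M(a := ?M a ** A z - A z ** ?M a)) [0..<?J]))
          = trace (B z ** mprod (map (\<lambda>i. ((fac j z)(a := \<lambda>x y. ncurv H x y z ** A z - A z ** ncurv H x y z)) i (ev w i) (od w i)) [0..<?J]))"
          by (simp only:)
      qed
      finally show ?thesis
        unfolding tword_def t_def pairprod_def by (simp only: sum_distrib_right)
    qed
    then show ?thesis unfolding E_def altz_sum[symmetric] by (rule altz_cong)
  qed
  have "altz N (cword j d A B z) e = E (tword (A z ** B z - B z ** A z) (fac j z) ?J (U z))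
      + (\<Sum>a<j. E (t (A z) a (\<lambda>x y. dcurv H B x y z)) - E (t (B z) a (\<lambda>x y. dcurv H A x y z)))"
    unfolding E_def t_def altz_diff[symmetric] altz_sum[symmetric] altz_add[symmetric] by (rule altz_cong) (simp add: cword_def)
  also have "\<dots> = (\<Sum>a<j. 2 * kap * E (t (A z) a (\<lambda>x y. D2 x (cov H y B) z)) - 2 * kap * E (t (B z) a (\<lambda>x y. cov H y (D2 x A) z)))"
    unfolding comm sum.distrib[symmetric]
    by (intro sum.cong refl) (simp add: dc d2c gc[symmetric] algebra_simps)
  \<comment> \<open>A zero is added, by \<open>rot\<close>; it completes both terms to full
    derivatives of words.\<close>
  also have "\<dots> = (\<Sum>a<j. 2 * kap * E (t (A z) a (\<lambda>x y. D2 x (cov H y B) z)) - 2 * kap * E (t (B z) a (\<lambda>x y. cov H y (D2 x A) z)))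
     + 2 * kap * ((\<Sum>a<j. E (\<lambda>w. t (D2 (w (2 * a)) A z) a (\<lambda>x y. cov H y B z) w))
        - (\<Sum>a<j. E (\<lambda>w. t (cov H (w (Suc (2 * a))) B z) a (\<lambda>x y. D2 x A z) w)))"
    using rot by simp
  also have "\<dots> = (\<Sum>a<j. 2 * kap * (E (\<lambda>w. sd2 (w (2 * a)) (\<lambda>z. tword (A z) ((fac j z)(a := \<lambda>x y. cov H y B z)) ?J (U z) w) z)
      - E (\<lambda>w. sd1 (w (Suc (2 * a))) (\<lambda>z. tword (B z) ((fac j z)(a := \<lambda>x y. D2 x A z)) ?J (U z) w) z)))"
    unfolding sum_subtractf[symmetric] sum_distrib_left sum.distrib[symmetric]
    by (intro sum.cong refl) (simp only: al be lessThan_iff, simp only: ring_distribs add_diff_eq diff_add_eq diff_diff_eq2 diff_diff_eq add_ac)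
  finally show ?thesis unfolding E_def .
qed

end

section \<open>Integrals of derivatives of compactly supported functions\<close>

lemma smooth_on_extend_by_zero:
  assumes S: "open S" and f: "smooth_on f S" and K: "closed K" "K \<subseteq> S" and f0: "\<And>z. z \<in> S - K \<Longrightarrow> f z = 0"
  shows "smooth_on (\<lambda>z. if z \<in> S then f z else 0) UNIV"
proof (rule smooth_on_locally)
  fix z
  let ?g = "\<lambda>z. if z \<in> S then f z else 0"
  show "\<exists>T. open T \<and> z \<in> T \<and> smooth_on ?g T"
  proof (cases "z \<in> S")
    case True
    then show ?thesis using smooth_on_cong[OF S, of f ?g] f S by auto
  next
    case False
    have "open (- K)" using K by auto
    moreover have "smooth_on ?g (- K)"
      using smooth_on_cong[OF \<open>open (- K)\<close>, of ?g "\<lambda>z. 0"] f0 by auto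
    ultimately show ?thesis using False K by blast
  qed
qed

lemma integral_translate:
  fixes g :: "'a::euclidean_space \<Rightarrow> 'b::euclidean_space"
  assumes "integrable lborel g"
  shows "integrable lborel (\<lambda>z. g (c + z))" "(LINT z|lborel. g (c + z)) = (LINT z|lborel. g z)"
proof -
  have "integrable (distr lborel borel ((+) c)) g" using assms lborel_distr_plus[of c] by simp
  then show "integrable lborel (\<lambda>z. g (c + z))" using borel_measurable_integrable[OF assms] by (subst (asm) integrable_distr_eq) auto
  have "(LINT z|lborel. g z) = (LINT z|distr lborel borel ((+) c). g z)" by (simp add: lborel_distr_plus)
  also have "\<dots> = (LINT z|lborel. g (c + z))" using borel_measurable_integrable[OF assms] by (subst integral_distr) auto
  finally show "(LINT z|lborel. g (c + z)) = (LINT z|lborel. g z)" by simp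
qed

text \<open>The difference quotients in direction v have integral 0 by translation invariance, and
  they converge to the derivative with an integrable bound.\<close>

lemma integral_dd_UNIV:
  fixes g :: "'a::euclidean_space \<Rightarrow> 'b::euclidean_space"
  assumes g: "smooth_on g UNIV" and K: "compact K" and g0: "\<And>z. z \<notin> K \<Longrightarrow> g z = 0"
  shows "has_bochner_integral lborel (dd v g) 0"
proof -
  have cg: "continuous_on UNIV g" and cd: "continuous_on UNIV (dd v g)"
    using smooth_on_continuous g smooth_on_dd[OF g] by auto
  have d0: "dd v g z = 0" if "z \<notin> K" for z
    using dd_cong_open[of "- K" z g "\<lambda>z. 0"] that g0 open_Compl[OF compact_imp_closed[OF K]] by auto
  have ig: "integrable lborel g" and id: "integrable lborel (dd v g)"
    using integrable_compact_support[OF cg K g0] integrable_compact_support[OF cd K d0] by auto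
  obtain B where B: "0 < B" "\<forall>x\<in>dd v g ` K. norm x \<le> B"
    using compact_imp_bounded[OF compact_continuous_image[OF continuous_on_subset[OF cd] K]] unfolding bounded_pos by blast
  then have B: "norm (dd v g z) \<le> B" for z using d0[of z] by (cases "z \<in> K") auto
  obtain r where "\<forall>z\<in>K. norm z \<le> r" using compact_imp_bounded[OF K] unfolding bounded_iff by blast
  then have r: "K \<subseteq> cball 0 r" by auto
  let ?R = "r + norm v"
  define s where "s n z = of_nat (Suc n) *\<^sub>R (g (inverse (of_nat (Suc n)) *\<^sub>R v + z) - g z)" for n :: nat and z
  have is_: "integrable lborel (s n)" and s0: "(LINT z|lborel. s n z) = 0" for n
    unfolding s_def[abs_def] using integral_translate[OF ig, of "inverse (of_nat (Suc n)) *\<^sub>R v"] ig by auto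
  have gd: "(g has_derivative (\<lambda>u. dd u g z)) (at z)" for z by (rule smooth_on_has_derivative[OF g]) auto
  have line: "((\<lambda>t. g (t *\<^sub>R v + z)) has_vector_derivative dd v g (t *\<^sub>R v + z)) (at t)" for t z
  proof -
    have "((\<lambda>t. t *\<^sub>R v + z) has_derivative (\<lambda>h. h *\<^sub>R v)) (at t)" by (auto intro!: derivative_eq_intros)
    from has_derivative_compose[OF this gd] show ?thesis
      using linear_scale[OF has_derivative_linear[OF gd]] by (simp add: has_vector_derivative_def)
  qed
  have lim: "(\<lambda>n. s n z) \<longlonglongrightarrow> dd v g z" for z
  proof -
    define L where "L t = norm (g (t *\<^sub>R v + z) - g z - t *\<^sub>R dd v g z) / norm t" for t :: real
    have "(L \<longlongrightarrow> 0) (at 0)"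
      using line[of z 0] by (simp add: has_vector_derivative_def has_derivative_at L_def[abs_def])
    moreover have "filterlim (\<lambda>n. inverse (of_nat (Suc n)) :: real) (at 0) sequentially"
      unfolding filterlim_at using LIMSEQ_inverse_real_of_nat by auto
    ultimately have "(\<lambda>n. L (inverse (of_nat (Suc n)))) \<longlonglongrightarrow> 0"
      by (rule filterlim_compose)
    moreover have "(\<lambda>n. L (inverse (of_nat (Suc n)))) = (\<lambda>n. norm (s n z - dd v g z))"
    proof
      fix n
      define t :: real where "t = inverse (of_nat (Suc n))"
      have t: "0 < t" "of_nat (Suc n) = 1 / t" by (simp_all add: t_def inverse_eq_divide del: of_nat_Suc)
      have "s n z - dd v g z = (1 / t) *\<^sub>R (g (t *\<^sub>R v + z) - g z - t *\<^sub>R dd v g z)"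
        using t(1) unfolding s_def t_def[symmetric] t(2) by (simp add: scaleR_diff_right)
      then show "L (inverse (of_nat (Suc n))) = norm (s n z - dd v g z)" using t(1) unfolding t_def[symmetric] L_def by simp
    qed
    ultimately show ?thesis using LIM_zero_cancel[of "\<lambda>n. s n z"] tendsto_norm_zero_iff[of "\<lambda>n. s n z - dd v g z"] by simp
  qed
  \<comment> \<open>Steps have length at most |v|, so outside the ball of radius r + |v| both values
    vanish; inside, the mean value inequality bounds the quotient by the maximum of the
    derivative.\<close>
  have bound: "norm (s n z) \<le> B * indicator (cball 0 ?R) z" for n z
  proof (cases "z \<in> cball 0 ?R")
    case True
    define t :: real where "t = inverse (of_nat (Suc n))"
    have t: "0 < t" by (simp add: t_def)
    have "norm (g (t *\<^sub>R v + z) - g (0 *\<^sub>R v + z)) \<le> B * norm (t - 0)"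
    proof (rule differentiable_bound[of UNIV "\<lambda>t. g (t *\<^sub>R v + z)" "\<lambda>t h. h *\<^sub>R dd v g (t *\<^sub>R v + z)"])
      show "onorm (\<lambda>h. h *\<^sub>R dd v g (x *\<^sub>R v + z)) \<le> B" for x :: real
        by (rule onorm_le) (simp add: mult.commute[of B] mult_left_mono[OF B])
    qed (use line in \<open>auto simp: has_vector_derivative_def\<close>)
    then have "norm (g (t *\<^sub>R v + z) - g z) \<le> B * t" using t by simp
    then have "of_nat (Suc n) * norm (g (t *\<^sub>R v + z) - g z) \<le> of_nat (Suc n) * (B * t)" by (rule mult_left_mono) simp
    also have "\<dots> = B" by (simp add: t_def del: of_nat_Suc)
    finally show ?thesis using True by (simp add: s_def t_def del: of_nat_Suc)
  next
    case False
    define t :: real where "t = inverse (of_nat (Suc n))"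
    have t: "0 < t" "t \<le> 1" by (auto simp: t_def field_simps)
    have "norm z > r" using False norm_ge_zero[of v] unfolding mem_cball_0 by linarith
    moreover have "norm (t *\<^sub>R v + z) > r"
    proof -
      have "norm (t *\<^sub>R v) \<le> norm v" using t by (simp add: mult_left_le_one_le)
      moreover have "norm z \<le> norm (t *\<^sub>R v + z) + norm (t *\<^sub>R v)" using norm_triangle_ineq4[of "t *\<^sub>R v + z" "t *\<^sub>R v"] by simp
      ultimately show ?thesis using False unfolding mem_cball_0 by linarith
    qed
    ultimately have "z \<notin> K" "t *\<^sub>R v + z \<notin> K" using r by auto
    then show ?thesis using False g0 by (simp add: s_def t_def del: of_nat_Suc)
  qed
  have "(\<lambda>n. LINT z|lborel. s n z) \<longlonglongrightarrow> (LINT z|lborel. dd v g z)"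
  proof (rule integral_dominated_convergence[where w = "\<lambda>z. B * indicator (cball 0 ?R) z"])
    show "integrable lborel (\<lambda>z. B * indicator (cball 0 ?R) z :: real)"
      by (intro integrable_mult_right integrable_real_indicator) (use emeasure_lborel_cball_finite[of 0 ?R] in auto)
  qed (use is_ id lim bound in auto)
  then have "(LINT z|lborel. dd v g z) = 0" using s0 LIMSEQ_unique[OF _ tendsto_const] by simp
  then show ?thesis using has_bochner_integral_integrable[OF id] by simp
qed

text \<open>Integrability is part of the notion, which makes it stable under sums.\<close>

definition null_integral :: "'a::euclidean_space set \<Rightarrow> ('a \<Rightarrow> complex) \<Rightarrow> bool" where
  "null_integral S f \<longleftrightarrow> has_bochner_integral lborel (\<lambda>z. if z \<in> S then f z else 0) 0"

lemma null_integral_add: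
  assumes "null_integral S f" "null_integral S g" shows "null_integral S (\<lambda>z. f z + g z)"
proof -
  have "(\<lambda>z. if z \<in> S then f z + g z else 0) = (\<lambda>z. (if z \<in> S then f z else 0) + (if z \<in> S then g z else 0))" by auto
  then show ?thesis using has_bochner_integral_add[OF assms[unfolded null_integral_def]] by (simp add: null_integral_def)
qed

lemma null_integral_mult:
  assumes "null_integral S f" shows "null_integral S (\<lambda>z. c * f z)"
proof -
  have "(\<lambda>z. if z \<in> S then c * f z else 0) = (\<lambda>z. c * (if z \<in> S then f z else 0))" by auto
  then show ?thesis using has_bochner_integral_mult_right[OF assms[unfolded null_integral_def], of c] by (simp add: null_integral_def)
qed

lemma null_integral_diff:
  assumes "null_integral S f" "null_integral S g" shows "null_integral S (\<lambda>z. f z - g z)"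
  using null_integral_add[OF assms(1) null_integral_mult[OF assms(2), of "-1"]] by simp

lemma null_integral_scaleR:
  assumes "null_integral S f" shows "null_integral S (\<lambda>z. c *\<^sub>R f z)"
  using null_integral_mult[OF assms, of "of_real c"] by (simp add: scaleR_conv_of_real)

lemma null_integral_sum:
  assumes "\<And>i. i \<in> I \<Longrightarrow> null_integral S (f i)" shows "null_integral S (\<lambda>z. \<Sum>i\<in>I. f i z)"
proof -
  have "null_integral S (\<lambda>z. 0)" unfolding null_integral_def by (simp add: has_bochner_integral_zero)
  then show ?thesis using assms by (induction I rule: infinite_finite_induct) (auto intro: null_integral_add)
qed

lemma null_integral_cong: "null_integral S f \<Longrightarrow> (\<And>z. z \<in> S \<Longrightarrow> f z = g z) \<Longrightarrow> null_integral S g"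
  unfolding null_integral_def by (rule subst[of _ _ "\<lambda>h. has_bochner_integral lborel h 0"]) auto

lemma null_integral_altz:
  assumes "\<And>w. null_integral S (\<lambda>z. T z w)" shows "null_integral S (\<lambda>z. altz N (T z) v)"
  unfolding altz_def by (intro null_integral_sum null_integral_scaleR assms)

lemma null_integral_sd:
  fixes f :: "'n::finite pt \<Rightarrow> complex"
  assumes S: "open S" and f: "smooth_on f S" and K: "compact K" "K \<subseteq> S" and f0: "\<And>z. z \<in> S - K \<Longrightarrow> f z = 0"
  shows "null_integral S (sd1 v f)" "null_integral S (sd2 v f)"
proof -
  have dd: "null_integral S (dd v f)" for v
  proof -
    let ?g = "\<lambda>z. if z \<in> S then f z else 0"
    have g: "smooth_on ?g UNIV" by (rule smooth_on_extend_by_zero[OF S f compact_imp_closed[OF K(1)] K(2) f0])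
    have "dd v ?g = (\<lambda>z. if z \<in> S then dd v f z else 0)"
    proof
      fix z show "dd v ?g z = (if z \<in> S then dd v f z else 0)"
      proof (cases "z \<in> S")
        case True then show ?thesis using dd_cong_open[OF S True, of ?g f] by simp
      next
        case False
        have o: "open (- K)" using compact_imp_closed[OF K(1)] by auto
        have "z \<in> - K" using False K by auto
        then show ?thesis using dd_cong_open[OF o, of z ?g "\<lambda>z. 0"] f0 False by auto
      qed
    qed
    then show ?thesis using integral_dd_UNIV[OF g K(1), of v] f0 K by (auto simp: null_integral_def)
  qed
  have "null_integral S (\<lambda>z. (1/2) * (dd v f z - \<i> * dd (\<i> *s v) f z))" "null_integral S (\<lambda>z. (1/2) * (dd v f z + \<i> * dd (\<i> *s v) f z))"
    by (intro null_integral_mult null_integral_diff null_integral_add dd)+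
  then show "null_integral S (sd1 v f)" "null_integral S (sd2 v f)" by (simp_all add: sd1_def[abs_def] sd2_def[abs_def])
qed

text \<open>Of the two words in \<open>cword_exact\<close> one contains \<open>A\<close> and the
  other \<partial>-bar A. Both vanish off \<open>K\<close>, so \<open>B\<close> may be
  arbitrary.\<close>

lemma (in local_forms) null_integral_cword:
  assumes A: "smooth_on A S" and B: "smooth_on B S" and N: "2 * (j + d) + 2 * l \<le> N"
    and K: "compact K" "K \<subseteq> S" and A0: "\<And>z. z \<in> S - K \<Longrightarrow> A z = 0"
  shows "null_integral S (\<lambda>z. altz N (cword j d A B z) e)"
proof (rule null_integral_cong[OF _ cword_exact[OF _ A B N, symmetric]])
  have sw: "smooth_on (\<lambda>z. tword (C z) ((fac j z)(a := \<lambda>x y. M x y z)) (j + d) (U z) w) S"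
    if C: "smooth_on C S" and M: "\<And>x y. smooth_on (M x y) S" for C M a w
  proof -
    have "smooth_on (\<lambda>z. ((fac j z)(a := \<lambda>x y. M x y z)) i x y) S" for i x y
      by (cases "i = a") (simp_all add: M smooth_fac)
    then show ?thesis
      unfolding tword_def pairprod_def
      by (intro smooth_on_mult[OF S] smooth_on_trace[OF S] smooth_on_matrix_mult[OF S] C mprod_smooth[OF S] smooth_U)
  qed
  have "D2 x A z = 0" if "z \<in> S - K" for x z
    using D_cong(2)[of "S - K" z A "\<lambda>z. 0"] that A0 open_Diff[OF S compact_imp_closed[OF K(1)]] by auto
  then have z2: "tword (B z) ((fac j z)(a := \<lambda>x y. D2 x A z)) (j + d) (U z) w = 0" if "z \<in> S - K" "a < j" for a w z
    using that by (simp add: tword_upd linear_0[OF linear_trace])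
  have z1: "tword (A z) Fs J u w = 0" if "z \<in> S - K" for Fs J u w z
    using A0[OF that] by (simp add: tword_def linear_0[OF linear_trace])
  show "null_integral S (\<lambda>z. \<Sum>a<j. 2 * kap *
     (altz N (\<lambda>w. sd2 (w (2 * a)) (\<lambda>z. tword (A z) ((fac j z)(a := \<lambda>x y. cov H y B z)) (j + d) (U z) w) z) e
      - altz N (\<lambda>w. sd1 (w (Suc (2 * a))) (\<lambda>z. tword (B z) ((fac j z)(a := \<lambda>x y. D2 x A z)) (j + d) (U z) w) z) e))"
    by (intro null_integral_sum null_integral_mult null_integral_diff null_integral_altz null_integral_sd[OF S _ K] sw A B
        smooth_cov smooth_D2[OF S] z1) (auto intro: z2)
qed

section \<open>Change of frame and coordinates\<close>

lemma linear_conj_transpose: "linear (conj_transpose :: complex^'r::finite^'s::finite \<Rightarrow> complex^'s^'r)"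
  by (auto simp: linear_iff conj_transpose_def vec_eq_iff)

lemma bounded_linear_conj_transpose: "bounded_linear (conj_transpose :: complex^'r::finite^'s::finite \<Rightarrow> complex^'s^'r)"
  using linear_conj_transpose linear_conv_bounded_linear by blast

lemma conj_transpose_cscale: "conj_transpose (cscale c A) = cscale (cnj c) (conj_transpose A)"
  by (simp add: conj_transpose_def cscale_def vec_eq_iff)

lemma conj_transpose_mult: "conj_transpose (A ** B) = conj_transpose B ** conj_transpose (A :: 'r::finite mtx)"
  by (simp add: conj_transpose_def matrix_matrix_mult_def vec_eq_iff mult.commute)

lemma conj_transpose_mat_1 [simp]: "conj_transpose (mat 1 :: 'r::finite mtx) = mat 1"
  by (auto simp: conj_transpose_def mat_def vec_eq_iff)

lemma conj_transpose_idem [simp]: "conj_transpose (conj_transpose A) = A"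
  by (simp add: conj_transpose_def vec_eq_iff)

lemma D2_eq_0:
  assumes "\<And>c. dd (c *s v) f z = cscale c (dd v f z)"
  shows "D2 v f z = 0"
  by (simp add: D2_def assms) (simp add: cscale_def vec_eq_iff)

lemma D2_sum:
  fixes f :: "'b \<Rightarrow> 'n::finite pt \<Rightarrow> 'r::finite mtx"
  assumes S: "open S" and f: "\<And>a. a \<in> I \<Longrightarrow> smooth_on (f a) S" and z: "z \<in> S"
  shows "D2 v (\<lambda>z. \<Sum>a\<in>I. f a z) z = (\<Sum>a\<in>I. D2 v (f a) z)"
  using f by (induction I rule: infinite_finite_induct) (simp_all add: D_add[OF S _ smooth_on_sum[OF S] z])

lemma D2_cscale_fun:
  fixes f :: "'n::finite pt \<Rightarrow> 'r::finite mtx"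
  assumes S: "open S" and c: "smooth_on c S" and f: "smooth_on f S" and z: "z \<in> S"
  shows "D2 v (\<lambda>z. cscale (c z) (f z)) z = cscale (sd2 v c z) (f z) + cscale (c z) (D2 v f z)"
  using D_mult(2)[OF S smooth_on_cscale[OF S c smooth_on_const[of "mat 1"]] f z, of v]
  by (simp add: cscale_mult D_scalar(2)[OF S c z])

lemma holo_on_sd2: "holo_on f S \<Longrightarrow> z \<in> S \<Longrightarrow> sd2 v f z = 0"
  by (simp add: sd2_def holo_on_has_derivative(2) flip: mult.assoc)

lemma local_metric_theta_linear:
  assumes "local_metric S H" "z \<in> S"
  shows "linear (\<lambda>w. theta H w z)" "theta H (c *s w) z = cscale c (theta H w z)"
proof -
  interpret local_metric S H by fact
  show "linear (\<lambda>w. theta H w z)"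
    unfolding theta_def using linear_compose[OF D_linear_dir(1)[OF S smooth_H assms(2)] linear_matrix_mult(1)] by (simp add: o_def)
  show "theta H (c *s w) z = cscale c (theta H w z)"
    unfolding theta_def D_linear_dir(3)[OF S smooth_H assms(2)] by (rule cscale_mult)
qed

lemma local_metric_cov_linear:
  assumes "local_metric S H" "smooth_on B S" "z \<in> S"
  shows "linear (\<lambda>w. cov H w B z)" "cov H (c *s w) B z = cscale c (cov H w B z)"
proof -
  interpret local_metric S H by fact
  note th = local_metric_theta_linear[OF assms(1,3)]
  note d = D_linear_dir[OF S assms(2,3)]
  show "linear (\<lambda>w. cov H w B z)"
    unfolding cov_def
    using linear_compose[OF th(1) linear_matrix_mult(1)] linear_compose[OF th(1) linear_matrix_mult(2)]
    by (intro linear_compose_add linear_compose_sub d(1)) (simp_all add: o_def)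
  show "cov H (c *s w) B z = cscale c (cov H w B z)"
    unfolding cov_def th(2) d(3) by (simp add: cscale_mult cscale_add cscale_diff)
qed

text \<open>Separates the dependence on a direction from that on the point, for directions that vary
  with the point.\<close>

lemma complex_linear_expand:
  fixes \<Phi> :: "'n::finite pt \<Rightarrow> 'r::finite mtx"
  assumes "linear \<Phi>" "\<And>c w. \<Phi> (c *s w) = cscale c (\<Phi> w)"
  shows "\<Phi> w = (\<Sum>a\<in>UNIV. cscale (w $ a) (\<Phi> (axis a 1)))"
proof -
  have "axis a (w $ a) = w $ a *s (axis a 1 :: 'n pt)" for a by (simp add: axis_def vec_eq_iff)
  then have "w = (\<Sum>a\<in>UNIV. w $ a *s (axis a 1 :: 'n pt))" using vec_eq_sum_axis[of w] by simp
  then have "\<Phi> w = \<Phi> (\<Sum>a\<in>UNIV. w $ a *s (axis a 1 :: 'n pt))" by simp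
  then show ?thesis by (simp add: linear_sum[OF assms(1)] assms(2))
qed

locale frame_change =
  fixes V W :: "('n::finite pt) set" and T :: "'n pt \<Rightarrow> 'n pt" and g :: "'n pt \<Rightarrow> 'r::finite mtx"
  assumes V: "open V" and W: "open W" and T_img: "z \<in> V \<Longrightarrow> T z \<in> W"
    and T_holo: "holo_on (\<lambda>z. T z $ a) V" and g_holo: "holo_on (\<lambda>z. g z $ a' $ b') V"
    and inv_g: "z \<in> V \<Longrightarrow> invertible (g z)"
begin

abbreviation conjg :: "'n pt \<Rightarrow> 'r mtx \<Rightarrow> 'r mtx" where
  "conjg z A \<equiv> matrix_inv (g z) ** A ** g z"

lemma smooth_T: "smooth_on T V"
  by (intro smooth_on_vecI V holo_on_imp_smooth_on T_holo)

lemma smooth_g: "smooth_on g V"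
  by (intro smooth_on_vecI V holo_on_imp_smooth_on g_holo)

lemma T_deriv: "z \<in> V \<Longrightarrow> (T has_derivative (\<lambda>v. dd v T z)) (at z)"
  by (rule smooth_on_has_derivative[OF smooth_T V])

lemma T_nth: "z \<in> V \<Longrightarrow> dd v T z $ a = dd v (\<lambda>z. T z $ a) z"
  using dd_bounded_linear[OF bounded_linear_vec_nth V smooth_T] by metis

lemma T_smult: "z \<in> V \<Longrightarrow> dd (c *s v) T z = c *s dd v T z"
  by (simp add: vec_eq_iff T_nth holo_on_has_derivative(2)[OF T_holo])

lemma g_nth: "z \<in> V \<Longrightarrow> dd v g z $ a $ b = dd v (\<lambda>z. g z $ a $ b) z"
  using dd_bounded_linear[OF bounded_linear_compose[OF bounded_linear_vec_nth bounded_linear_vec_nth] V smooth_g] by metis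

lemma g_smult: "z \<in> V \<Longrightarrow> dd (c *s v) g z = cscale c (dd v g z)"
  by (simp add: vec_eq_iff cscale_def holo_on_has_derivative(2)[OF g_holo] g_nth)

lemma D_compose_T:
  fixes f :: "'n pt \<Rightarrow> 'r mtx"
  assumes f: "smooth_on f W" and z: "z \<in> V"
  shows "D1 v (\<lambda>z. f (T z)) z = D1 (dd v T z) f (T z)" "D2 v (\<lambda>z. f (T z)) z = D2 (dd v T z) f (T z)"
proof -
  have "dd v (\<lambda>z. f (T z)) z = dd (dd v T z) f (T z)" for v
    by (rule dd_eq) (rule has_derivative_compose[OF T_deriv[OF z] smooth_on_has_derivative[OF f W T_img[OF z]]])
  then show "D1 v (\<lambda>z. f (T z)) z = D1 (dd v T z) f (T z)" "D2 v (\<lambda>z. f (T z)) z = D2 (dd v T z) f (T z)"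
    by (simp_all add: D1_def D2_def T_smult[OF z])
qed

lemma smooth_compose_T: "smooth_on f W \<Longrightarrow> smooth_on (\<lambda>z. f (T z)) V"
  by (rule smooth_on_compose[OF V W T_img _ smooth_T])

lemma D2_g: "z \<in> V \<Longrightarrow> D2 v g z = 0"
  by (rule D2_eq_0) (rule g_smult)

lemma D1_adj_g: "z \<in> V \<Longrightarrow> D1 v (\<lambda>z. conj_transpose (g z)) z = 0"
  unfolding D1_def dd_bounded_linear[OF bounded_linear_conj_transpose V smooth_g]
  by (simp add: g_smult conj_transpose_cscale)

lemma metric_g: "local_metric V g"
  by unfold_locales (rule V smooth_g inv_g)+

lemma smooth_inv_g: "smooth_on (\<lambda>z. matrix_inv (g z)) V"
  by (rule local_metric.smooth_inv_H[OF metric_g])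

lemma D2_inv_g: "z \<in> V \<Longrightarrow> D2 v (\<lambda>z. matrix_inv (g z)) z = 0"
  unfolding local_metric.D_matrix_inv(2)[OF metric_g] by (simp add: D2_g)

context
  fixes \<Phi> :: "('n, 'r mtx) bil"
  assumes \<Phi>: "\<And>w. smooth_on (\<Phi> w) W"
    and lin: "\<And>y. y \<in> W \<Longrightarrow> linear (\<lambda>w. \<Phi> w y)" "\<And>y c w. y \<in> W \<Longrightarrow> \<Phi> (c *s w) y = cscale c (\<Phi> w y)"
begin

lemma pull_expand: "z \<in> V \<Longrightarrow> \<Phi> (dd v T z) (T z) = (\<Sum>a\<in>UNIV. cscale (dd v (\<lambda>z. T z $ a) z) (\<Phi> (axis a 1) (T z)))"
  by (subst complex_linear_expand[OF lin]) (simp_all add: T_img T_nth)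

lemma smooth_T_nth: "smooth_on (dd v (\<lambda>z. T z $ a)) V"
  by (intro smooth_on_dd holo_on_imp_smooth_on V T_holo)

lemma smooth_pull: "smooth_on (\<lambda>z. \<Phi> (dd v T z) (T z)) V"
  by (subst smooth_on_cong[OF V pull_expand], assumption)
    (intro smooth_on_sum V smooth_on_cscale smooth_T_nth smooth_compose_T \<Phi>)

text \<open>The direction \<open>dd v T z\<close> varies with z, but its components are holomorphic;
  \<partial>-bar does not see them and acts as if the direction were frozen. Complex linearity of
  \<Phi> is what brings in holomorphic components only.\<close>

lemma D2_pull:
  assumes z: "z \<in> V"
  shows "D2 u (\<lambda>z. \<Phi> (dd v T z) (T z)) z = D2 (dd u T z) (\<Phi> (dd v T z)) (T z)"
proof -
  let ?w = "dd v T z"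
  have "D2 u (\<lambda>z. \<Phi> (dd v T z) (T z)) z = D2 u (\<lambda>z. \<Sum>a\<in>UNIV. cscale (dd v (\<lambda>z. T z $ a) z) (\<Phi> (axis a 1) (T z))) z"
    by (rule D_cong(2)[OF V z pull_expand])
  also have "\<dots> = (\<Sum>a\<in>UNIV. D2 u (\<lambda>z. cscale (dd v (\<lambda>z. T z $ a) z) (\<Phi> (axis a 1) (T z))) z)"
    by (intro D2_sum[OF V _ z] smooth_on_cscale[OF V] smooth_T_nth smooth_compose_T \<Phi>)
  also have "\<dots> = (\<Sum>a\<in>UNIV. cscale (?w $ a) (D2 (dd u T z) (\<Phi> (axis a 1)) (T z)))"
    by (simp add: D2_cscale_fun[OF V smooth_T_nth smooth_compose_T[OF \<Phi>] z] holo_on_sd2[OF holo_on_dd[OF V T_holo] z]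
        D_compose_T(2)[OF \<Phi> z] T_nth[OF z])
  also have "\<dots> = D2 (dd u T z) (\<lambda>y. \<Sum>a\<in>UNIV. cscale (?w $ a) (\<Phi> (axis a 1) y)) (T z)"
    by (subst D2_sum[OF W _ T_img[OF z]]) (simp_all add: D_cscale(2)[OF W \<Phi> T_img[OF z]] smooth_on_cscale[OF W] \<Phi>)
  also have "\<dots> = D2 (dd u T z) (\<Phi> ?w) (T z)"
    by (rule D_cong(2)[OF W T_img[OF z]]) (rule complex_linear_expand[OF lin, symmetric])
  finally show ?thesis .
qed

lemma D2_conj_pull:
  assumes z: "z \<in> V"
  shows "D2 u (\<lambda>z. conjg z (\<Phi> (dd v T z) (T z))) z = conjg z (D2 (dd u T z) (\<Phi> (dd v T z)) (T z))"
  unfolding D_mult(2)[OF V smooth_on_matrix_mult[OF V smooth_inv_g smooth_pull] smooth_g z]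
    D_mult(2)[OF V smooth_inv_g smooth_pull z] D2_pull[OF z] D2_inv_g[OF z] D2_g[OF z]
  by simp

lemma smooth_conj_pull: "smooth_on (\<lambda>z. conjg z (\<Phi> (dd v T z) (T z))) V"
  by (intro smooth_on_matrix_mult V smooth_inv_g smooth_pull smooth_g)

end

end

locale metric_change = frame_change V W T g + M: local_metric V H + M': local_metric W H'
  for V W :: "('n::finite pt) set" and T and g :: "'n pt \<Rightarrow> 'r::finite mtx" and H H' +
  assumes H_change: "z \<in> V \<Longrightarrow> H z = conj_transpose (g z) ** H' (T z) ** g z"
begin

lemma D1_H_change:
  assumes z: "z \<in> V"
  shows "D1 v H z = conj_transpose (g z) ** (D1 (dd v T z) H' (T z) ** g z + H' (T z) ** D1 v g z)"
proof -
  note sm = smooth_on_bounded_linear[OF bounded_linear_conj_transpose V smooth_g] smooth_compose_T[OF M'.smooth_H]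
  have "D1 v H z = D1 v (\<lambda>z. conj_transpose (g z) ** H' (T z) ** g z) z"
    by (rule D_cong(1)[OF V z H_change])
  then show ?thesis
    unfolding D_mult(1)[OF V smooth_on_matrix_mult[OF V sm] smooth_g z] D_mult(1)[OF V sm z] D1_adj_g[OF z]
      D_compose_T(1)[OF M'.smooth_H z]
    by (simp add: matrix_distribs matrix_mul_assoc)
qed

text \<open>The gauge transformation of the connection. The conjugate transpose of g is
  antiholomorphic, so \<partial> only hits the other two factors of the transformed metric.\<close>

lemma theta_change:
  assumes z: "z \<in> V"
  shows "theta H v z = conjg z (theta H' (dd v T z) (T z)) + matrix_inv (g z) ** D1 v g z"
proof -
  let ?g = "g z" and ?h = "matrix_inv (g z)" and ?t = "theta H' (dd v T z) (T z)"
  have "H z ** (?h ** ?t ** ?g + ?h ** D1 v g z) = conj_transpose ?g ** H' (T z) ** (?g ** (?h ** (?t ** ?g + D1 v g z)))"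
    unfolding H_change[OF z] by (simp add: matrix_distribs matrix_mul_assoc)
  also have "\<dots> = conj_transpose ?g ** (H' (T z) ** ?t ** ?g + H' (T z) ** D1 v g z)"
    unfolding matrix_inv_cancel(1)[OF inv_g[OF z]] by (simp add: matrix_distribs matrix_mul_assoc)
  also have "H' (T z) ** ?t = D1 (dd v T z) H' (T z)"
    unfolding theta_def by (rule matrix_inv_cancel(1)[OF M'.inv_H[OF T_img[OF z]]])
  also have "conj_transpose ?g ** (D1 (dd v T z) H' (T z) ** ?g + H' (T z) ** D1 v g z) = D1 v H z"
    by (rule D1_H_change[OF z, symmetric])
  finally show ?thesis
    unfolding theta_def[of H] using matrix_inv_cancel(2)[OF M.inv_H[OF z]] by metis
qed

lemmas theta_lin' = local_metric_theta_linear[OF M'.local_metric_axioms]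

text \<open>The inhomogeneous term g^-1 \<partial>g of \<open>theta_change\<close> is holomorphic
  and is killed by \<partial>-bar.\<close>

lemma gcurv_change:
  assumes z: "z \<in> V"
  shows "gcurv H u v z = conjg z (gcurv H' (dd u T z) (dd v T z) (T z))"
proof -
  have D1g: "smooth_on (D1 v g) V" by (rule smooth_D1[OF V smooth_g])
  have "gcurv H u v z = D2 u (\<lambda>z. conjg z (theta H' (dd v T z) (T z)) + matrix_inv (g z) ** D1 v g z) z"
    unfolding gcurv_def by (rule D_cong(2)[OF V z theta_change])
  also have "\<dots> = D2 u (\<lambda>z. conjg z (theta H' (dd v T z) (T z))) z + D2 u (\<lambda>z. matrix_inv (g z) ** D1 v g z) z"
    by (rule D_add(2)[OF V _ _ z])
      (intro smooth_conj_pull M'.smooth_theta theta_lin', assumption+, rule smooth_on_matrix_mult[OF V smooth_inv_g D1g])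
  also have "D2 u (\<lambda>z. matrix_inv (g z) ** D1 v g z) z = 0"
  proof -
    have "D2 u (D1 v g) z = D1 v (D2 u g) z" by (rule D_commute(3)[OF V smooth_g z, symmetric])
    also have "\<dots> = D1 v (\<lambda>z. 0) z" by (rule D_cong(1)[OF V z D2_g])
    finally show ?thesis unfolding D_mult(2)[OF V smooth_inv_g D1g z] D2_inv_g[OF z] by simp
  qed
  also have "D2 u (\<lambda>z. conjg z (theta H' (dd v T z) (T z))) z = conjg z (gcurv H' (dd u T z) (dd v T z) (T z))"
    unfolding gcurv_def by (intro D2_conj_pull M'.smooth_theta theta_lin' z)
  finally show ?thesis by simp
qed

lemma ncurv_change:
  assumes z: "z \<in> V"
  shows "ncurv H u v z = conjg z (ncurv H' (dd u T z) (dd v T z) (T z))"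
  unfolding ncurv_def gcurv_change[OF z] by (simp add: matrix_distribs cscale_mult cscale_diff)

context
  fixes B B' :: "'n pt \<Rightarrow> 'r mtx"
  assumes B': "smooth_on B' W" and B_change: "\<And>z. z \<in> V \<Longrightarrow> B z = conjg z (B' (T z))"
begin

text \<open>The derivatives of g and g^-1 produced by conjugation cancel against the inhomogeneous
  term of the connection.\<close>

lemma cov_change:
  assumes z: "z \<in> V"
  shows "cov H v B z = conjg z (cov H' (dd v T z) B' (T z))"
proof -
  let ?g = "g z" and ?h = "matrix_inv (g z)" and ?t = "theta H' (dd v T z) (T z)" and ?B = "B' (T z)" and ?d = "D1 v g z"
  note sm = smooth_inv_g smooth_compose_T[OF B']
  have "D1 v B z = D1 v (\<lambda>z. conjg z (B' (T z))) z" by (rule D_cong(1)[OF V z B_change])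
  also have "\<dots> = - (?h ** ?d ** ?h ** ?B ** ?g) + ?h ** D1 (dd v T z) B' (T z) ** ?g + ?h ** ?B ** ?d"
    unfolding D_mult(1)[OF V smooth_on_matrix_mult[OF V sm] smooth_g z] D_mult(1)[OF V sm z]
      local_metric.D_matrix_inv(1)[OF metric_g z] D_compose_T(1)[OF B' z]
    by (simp add: matrix_distribs mat_minus_mult matrix_mul_assoc)
  finally have 1: "D1 v B z = - (?h ** ?d ** ?h ** ?B ** ?g) + ?h ** D1 (dd v T z) B' (T z) ** ?g + ?h ** ?B ** ?d" .
  have c: "?g ** (?h ** X) = X" "X ** ?g ** ?h = X" "X ** ?h ** ?g = X" for X
    using matrix_inv_cancel[OF inv_g[OF z]] by auto
  have 2: "theta H v z ** B z = ?h ** ?t ** ?B ** ?g + ?h ** ?d ** ?h ** ?B ** ?g"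
    "B z ** theta H v z = ?h ** ?B ** ?t ** ?g + ?h ** ?B ** ?d"
    unfolding theta_change[OF z] B_change[OF z] by (simp_all add: matrix_distribs matrix_mul_assoc c)
  show ?thesis unfolding cov_def[of H v B z] 1 2 cov_def[of H'] by (simp add: matrix_distribs matrix_mul_assoc)
qed

lemma dcurv_change:
  assumes z: "z \<in> V"
  shows "dcurv H B u v z = conjg z (dcurv H' B' (dd u T z) (dd v T z) (T z))"
proof -
  have "D2 u (cov H v B) z = conjg z (D2 (dd u T z) (cov H' (dd v T z) B') (T z))" for u v
  proof -
    have "D2 u (cov H v B) z = D2 u (\<lambda>z. conjg z (cov H' (dd v T z) B' (T z))) z"
      by (rule D_cong(2)[OF V z cov_change])
    also have "\<dots> = conjg z (D2 (dd u T z) (cov H' (dd v T z) B') (T z))"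
      by (intro D2_conj_pull M'.smooth_cov B' local_metric_cov_linear[OF M'.local_metric_axioms B'] z)
    finally show ?thesis .
  qed
  then show ?thesis unfolding dcurv_def by (simp add: matrix_distribs cscale_mult cscale_diff)
qed

end

end

section \<open>Densities on the manifold\<close>

lemma alternating_altz:
  assumes loc: "\<And>w w'. (\<And>k. k < N \<Longrightarrow> w k = w' k) \<Longrightarrow> T w = T w'"
    and lin: "\<And>w m. m < N \<Longrightarrow> linear (\<lambda>x. T (w(m := x)))"
  shows "alternating N (altz N T)"
  unfolding alternating_def
proof (intro conjI allI impI)
  show "altz N T v = altz N T w" if "\<forall>m<N. v m = w m" for v w
    by (rule altz_local[OF loc]) (use that in blast)+
  show "linear (\<lambda>x. altz N T (v(m := x)))" if m: "m < N" for v m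
    unfolding altz_def
  proof (intro linear_compose_sum ballI linear_compose_scale_right)
    fix \<sigma> assume "\<sigma> \<in> {\<sigma>. \<sigma> permutes {..<N}}"
    then have p: "\<sigma> permutes {..<N}" by simp
    have "(\<lambda>k. (v(m := x)) (\<sigma> k)) = (\<lambda>k. v (\<sigma> k))(inv \<sigma> m := x)" for x
      using permutes_inverses[OF p] by (auto simp: fun_eq_iff)
    then show "linear (\<lambda>x. T (\<lambda>k. (v(m := x)) (\<sigma> k)))"
      using lin permutes_in_image[OF permutes_inv[OF p]] m by simp
  qed
  show "altz N T v = 0" if v: "l < m \<and> m < N \<and> v l = v m" for v l m
  proof -
    \<comment> \<open>Composing with the exchange of the two equal arguments changes every sign and
      no value, so the sum equals its negative.\<close>
    let ?\<tau> = "swp l m"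
    have p: "?\<tau> permutes {..<N}" using v by (intro permutes_swap_id) auto
    have "permutation \<sigma>" if "\<sigma> permutes {..<N}" for \<sigma> using that permutation_permutes by blast
    then have sg: "sign (?\<tau> \<circ> \<sigma>) = - sign \<sigma>" if "\<sigma> permutes {..<N}" for \<sigma>
      using that p v by (simp add: sign_compose sign_swap_id)
    have "v (?\<tau> k) = v k" for k using v by (auto simp: Transposition.transpose_def)
    then have "altz N T v = (\<Sum>\<sigma> | \<sigma> permutes {..<N}. of_int (sign (?\<tau> \<circ> \<sigma>)) *\<^sub>R T (\<lambda>k. v (\<sigma> k)))"
      unfolding altz_def by (subst setum_permutations_compose_left[OF p]) simp
    also have "\<dots> = - altz N T v"
      unfolding altz_def sum_negf[symmetric] by (intro sum.cong refl) (simp add: sg)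
    finally have "2 *\<^sub>R altz N T v = 0" by (simp add: scaleR_2 eq_neg_iff_add_eq_0)
    then show ?thesis by simp
  qed
qed

lemma tword_slot_linear:
  fixes Fs :: "nat \<Rightarrow> 'n::finite pt \<Rightarrow> 'n pt \<Rightarrow> 'r::finite mtx"
  assumes Fs: "\<And>i b. i < J \<Longrightarrow> linear (\<lambda>a. Fs i a b)" "\<And>i a. i < J \<Longrightarrow> linear (Fs i a)"
    and u: "alternating q u" and m: "m < 2 * J + q"
  shows "linear (\<lambda>x. tword A Fs J u (w(m := x)))"
proof (cases "m < 2 * J")
  case True
  define a where "a = m div 2"
  have a: "a < J" using True by (auto simp: a_def)
  have ma: "m = 2 * a \<or> m = Suc (2 * a)" by (auto simp: a_def)
  let ?f = "\<lambda>i. Fs i (ev w i) (od w i)"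
  let ?L = "\<lambda>x. Fs a ((w(m := x)) (2 * a)) ((w(m := x)) (Suc (2 * a)))"
  have L: "linear ?L"
    using ma
  proof
    assume "m = 2 * a" then show ?thesis using Fs(1)[OF a, of "w (Suc (2 * a))"] by simp
  next
    assume "m = Suc (2 * a)" then show ?thesis using Fs(2)[OF a, of "w (2 * a)"] by simp
  qed
  have "2 * i \<noteq> m \<and> Suc (2 * i) \<noteq> m" if "i \<noteq> a" for i using that ma by presburger
  then have "(\<lambda>i. Fs i ((w(m := x)) (2 * i)) ((w(m := x)) (Suc (2 * i)))) = ?f(a := ?L x)" for x
    by (auto simp: fun_eq_iff)
  moreover have "(\<lambda>k. (w(m := x)) (2 * J + k)) = (\<lambda>k. w (2 * J + k))" for x using True by auto
  ultimately have e: "tword A Fs J u (w(m := x)) = trace (A ** (mprod (map ?f [0..<a]) ** ?L x ** mprod (map ?f [Suc a..<J])))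
     * u (\<lambda>k. w (2 * J + k))" for x
    unfolding tword_def pairprod_def by (simp only: mprod_split[OF a])
  show ?thesis
    unfolding e
    using linear_compose[OF linear_compose[OF linear_compose[OF linear_compose[OF linear_compose[OF L linear_matrix_mult(1)[of "mprod (map ?f [0..<a])"]]
        linear_matrix_mult(2)[of "mprod (map ?f [Suc a..<J])"]] linear_matrix_mult(1)[of A]] linear_trace] linear_times(2)[of "u (\<lambda>k. w (2 * J + k))"]]
    by (simp add: o_def)
next
  case False
  have "pairprod Fs J (w(m := x)) = pairprod Fs J w" for x
    by (rule pairprod_local) (use False in auto)
  moreover have "(\<lambda>k. (w(m := x)) (2 * J + k)) = (\<lambda>k. w (2 * J + k))(m - 2 * J := x)" for x
    by (rule ext) (use False in auto)
  moreover have "linear (\<lambda>x. u ((\<lambda>k. w (2 * J + k))(m - 2 * J := x)))"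
    using u m False by (simp add: alternating_def)
  from linear_compose[OF this linear_times(1)[of "trace (A ** pairprod Fs J w)"]]
  have "linear (\<lambda>x. trace (A ** pairprod Fs J w) * u ((\<lambda>k. w (2 * J + k))(m - 2 * J := x)))" by (simp add: o_def)
  ultimately show ?thesis unfolding tword_def by simp
qed

lemma alternating_tword:
  fixes Fs :: "nat \<Rightarrow> 'n::finite pt \<Rightarrow> 'n pt \<Rightarrow> 'r::finite mtx"
  assumes Fs: "\<And>i b. i < J \<Longrightarrow> linear (\<lambda>a. Fs i a b)" "\<And>i a. i < J \<Longrightarrow> linear (Fs i a)"
    and u: "alternating q u"
  shows "alternating (2 * J + q) (altz (2 * J + q) (tword A Fs J u))"
proof (rule alternating_altz)
  show "tword A Fs J u w = tword A Fs J u w'" if "\<And>k. k < 2 * J + q \<Longrightarrow> w k = w' k" for w w'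
  proof -
    have "pairprod Fs J w = pairprod Fs J w'" by (rule pairprod_local) (use that in auto)
    moreover have "u (\<lambda>k. w (2 * J + k)) = u (\<lambda>k. w' (2 * J + k))"
      using u that unfolding alternating_def by (metis add_less_cancel_left)
    ultimately show ?thesis by (simp add: tword_def)
  qed
qed (rule tword_slot_linear[OF Fs u])

lemma mprod_conj:
  assumes "g ** h = mat 1" "h ** g = (mat 1 :: 'r::finite mtx)"
  shows "mprod (map (\<lambda>i. h ** M i ** g) xs) = h ** mprod (map M xs) ** g"
proof (induction xs)
  case (Cons a xs)
  have "h ** M a ** g ** (h ** mprod (map M xs) ** g) = h ** M a ** (g ** h) ** mprod (map M xs) ** g"
    by (simp only: matrix_mul_assoc)
  then show ?case using Cons assms by (simp add: matrix_mul_assoc)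
qed (simp add: assms)

lemma tword_conj:
  assumes g: "g ** h = mat 1" "h ** g = (mat 1 :: 'r::finite mtx)"
    and Fs: "\<And>i a b. i < J \<Longrightarrow> Fs i a b = h ** Fs' i (D a) (D b) ** g" and u: "\<And>w. u w = u' (\<lambda>k. D (w k))"
  shows "tword (h ** A ** g) Fs J u w = tword A Fs' J u' (\<lambda>k. D (w k))"
proof -
  have "pairprod Fs J w = h ** pairprod Fs' J (\<lambda>k. D (w k)) ** g"
    unfolding pairprod_def mprod_conj[OF g, symmetric] by (intro arg_cong[of _ _ mprod] map_cong) (auto simp: Fs)
  moreover have "trace (h ** A ** g ** (h ** P ** g)) = trace (A ** P)" for P
  proof -
    have "h ** A ** g ** (h ** P ** g) = h ** (A ** (g ** h) ** P ** g)" by (simp only: matrix_mul_assoc)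
    also have "trace \<dots> = trace (A ** (g ** h) ** P ** g ** h)" by (rule trace_mul_sym)
    also have "A ** (g ** h) ** P ** g ** h = A ** (g ** h) ** P ** (g ** h)" by (simp only: matrix_mul_assoc)
    finally show ?thesis by (simp add: g)
  qed
  ultimately show ?thesis by (simp add: tword_def u)
qed

lemma linear_D2_family:
  fixes \<Phi> :: "'n::finite pt \<Rightarrow> 'n pt \<Rightarrow> 'r::finite mtx"
  assumes S: "open S" and \<Phi>: "\<And>w. smooth_on (\<Phi> w) S" and lin: "\<And>y. y \<in> S \<Longrightarrow> linear (\<lambda>w. \<Phi> w y)" and z: "z \<in> S"
  shows "linear (\<lambda>w. D2 u (\<Phi> w) z)"
proof (rule linearI)
  fix v w and r :: real
  have "D2 u (\<Phi> (v + w)) z = D2 u (\<lambda>y. \<Phi> v y + \<Phi> w y) z"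
    by (rule D_cong(2)[OF S z]) (simp add: linear_add[OF lin])
  then show "D2 u (\<Phi> (v + w)) z = D2 u (\<Phi> v) z + D2 u (\<Phi> w) z"
    using D_add(2)[OF S \<Phi> \<Phi> z] by simp
  have "D2 u (\<Phi> (r *\<^sub>R w)) z = D2 u (\<lambda>y. cscale (of_real r) (\<Phi> w y)) z"
    by (rule D_cong(2)[OF S z]) (simp add: linear_scale[OF lin] cscale_scaleR)
  then show "D2 u (\<Phi> (r *\<^sub>R w)) z = r *\<^sub>R D2 u (\<Phi> w) z"
    unfolding D_cscale(2)[OF S \<Phi> z] by (simp add: cscale_scaleR)
qed

lemma linear_antisym_family:
  fixes G :: "'n::finite pt \<Rightarrow> 'n pt \<Rightarrow> 'r::finite mtx"
  assumes "\<And>v. linear (\<lambda>u. G u v)" "\<And>u. linear (G u)"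
  shows "linear (\<lambda>u. cscale c (G u v - G v u))" "linear (\<lambda>v. cscale c (G u v - G v u))"
  using linear_compose[OF linear_compose_sub[OF assms(1) assms(2)] linear_cscale(1)[of c], of v v]
    linear_compose[OF linear_compose_sub[OF assms(2) assms(1)] linear_cscale(1)[of c], of u u]
  by (simp_all add: o_def)

context local_metric
begin

lemma linear_ncurv:
  assumes z: "z \<in> S"
  shows "linear (\<lambda>u. ncurv H u v z)" "linear (\<lambda>v. ncurv H u v z)"
proof -
  have "linear (\<lambda>u. gcurv H u v z)" "linear (\<lambda>v. gcurv H u v z)" for u v
    unfolding gcurv_def
    by (rule D_linear_dir(2)[OF S smooth_theta z])
      (rule linear_D2_family[OF S smooth_theta local_metric_theta_linear(1)[OF local_metric_axioms] z])
  then show "linear (\<lambda>u. ncurv H u v z)" "linear (\<lambda>v. ncurv H u v z)"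
    unfolding ncurv_def by (rule linear_antisym_family)+
qed

lemma linear_dcurv:
  assumes B: "smooth_on B S" and z: "z \<in> S"
  shows "linear (\<lambda>u. dcurv H B u v z)" "linear (\<lambda>v. dcurv H B u v z)"
proof -
  have "linear (\<lambda>u. D2 u (cov H v B) z)" "linear (\<lambda>v. D2 u (cov H v B) z)" for u v
    by (rule D_linear_dir(2)[OF S smooth_cov[OF B] z])
      (rule linear_D2_family[OF S smooth_cov[OF B] local_metric_cov_linear(1)[OF local_metric_axioms B] z])
  then show "linear (\<lambda>u. dcurv H B u v z)" "linear (\<lambda>v. dcurv H B u v z)"
    unfolding dcurv_def by (rule linear_antisym_family)+
qed

lemma cov_cong:
  assumes "\<And>y. y \<in> S \<Longrightarrow> B y = C y" "z \<in> S"
  shows "cov H v B z = cov H v C z"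
  unfolding cov_def using D_cong(1)[OF S assms(2,1)] assms by simp

lemma dcurv_cong:
  assumes "\<And>y. y \<in> S \<Longrightarrow> B y = C y" "z \<in> S"
  shows "dcurv H B u v z = dcurv H C u v z"
  unfolding dcurv_def using D_cong(2)[OF S assms(2) cov_cong[OF assms(1)]] by simp

lemma dcurv_add:
  assumes B: "smooth_on B S" and C: "smooth_on C S" and z: "z \<in> S"
  shows "dcurv H (\<lambda>z. B z + C z) u v z = dcurv H B u v z + dcurv H C u v z"
proof -
  have c: "cov H v (\<lambda>z. B z + C z) y = cov H v B y + cov H v C y" if "y \<in> S" for v y
    unfolding cov_def D_add(1)[OF S B C that] by (simp add: matrix_distribs)
  have "D2 u (cov H v (\<lambda>z. B z + C z)) z = D2 u (cov H v B) z + D2 u (cov H v C) z" for u v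
    using D_cong(2)[OF S z c] D_add(2)[OF S smooth_cov[OF B] smooth_cov[OF C] z] by simp
  then show ?thesis unfolding dcurv_def by (simp add: cscale_add(1)[symmetric] add_diff_add)
qed

end

section \<open>The charge density of a bundle\<close>

lemma pos_def_hermitian_invertible:
  assumes "pos_def_hermitian A" shows "invertible A"
proof (rule ccontr)
  assume "\<not> invertible A"
  then have "\<not> inj ((*v) A)" using invertible_left_inverse[of A] matrix_left_invertible_injective[of A] by blast
  then obtain y z where "A *v y = A *v z" "y \<noteq> z" by (auto simp: inj_def)
  then obtain x where x: "x \<noteq> 0" "A *v x = 0"
    using that[of "y - z"] by (simp add: matrix_vector_mult_diff_distrib)
  have "(\<Sum>a\<in>UNIV. \<Sum>b\<in>UNIV. cnj (x $ a) * A $ a $ b * x $ b) = (\<Sum>a\<in>UNIV. cnj (x $ a) * (A *v x) $ a)"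
    by (simp add: matrix_vector_mult_def sum_distrib_left mult.assoc)
  moreover have "0 < Re (\<Sum>a\<in>UNIV. \<Sum>b\<in>UNIV. cnj (x $ a) * A $ a $ b * x $ b)"
    using assms x(1) unfolding pos_def_hermitian_def by blast
  ultimately show False by (simp only: x(2) zero_index mult_zero_right sum.neutral_const zero_complex.sel less_irrefl)
qed

locale charged_bundle = cmanifold X
  for X :: "('a::t2_space, 'i, 'n::finite) atlas" +
  fixes E :: "('a, 'i, 'r::finite) cocycle"
    and \<omega> :: "('i, 'n, complex) form"
    and U :: "nat \<Rightarrow> ('i, 'n, complex) form"
  assumes holo_bundle: "holomorphic_bundle X E" and kaehler: "kaehler_form X \<omega>"
    and unipotent: "unipotent_form X U" and del_closed: "del_closed_form X (2 * l) (U (2 * l))"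
begin

lemma transition_img: "i \<in> charts X \<Longrightarrow> j \<in> charts X \<Longrightarrow> z \<in> overlap X i j \<Longrightarrow> transition X i j z \<in> img X j"
  using transition_overlap(1) overlap_subset by blast

abbreviation cmat :: "'i \<Rightarrow> 'i \<Rightarrow> 'n pt \<Rightarrow> 'r mtx" where
  "cmat i j z \<equiv> E j i (chart_inv X i z)"

definition om :: "'i \<Rightarrow> 'n pt \<Rightarrow> ('n, complex) bil" where
  "om i a b z = \<omega> i z (\<lambda>k. if k = 0 then a else b)"

lemma is_form_omega: "is_form X 2 \<omega>" and is_form_U: "is_form X k (U k)"
  using kaehler unipotent by (auto simp: kaehler_form_def unipotent_form_def)

lemma is_formD:
  assumes "is_form X k \<alpha>" "i \<in> charts X"
  shows "z \<in> img X i \<Longrightarrow> alternating k (\<alpha> i z)" "smooth_on (\<lambda>z. \<alpha> i z v) (img X i)"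
    "j \<in> charts X \<Longrightarrow> z \<in> overlap X i j \<Longrightarrow> \<alpha> i z v = \<alpha> j (transition X i j z) (\<lambda>m. dd (v m) (transition X i j) z)"
  using assms unfolding is_form_def by blast+

lemma omega_eq: "i \<in> charts X \<Longrightarrow> z \<in> img X i \<Longrightarrow> \<omega> i z w = om i (w 0) (w (Suc 0)) z"
proof -
  assume "i \<in> charts X" "z \<in> img X i"
  then have "alternating 2 (\<omega> i z)" by (rule is_formD(1)[OF is_form_omega])
  then have "(\<forall>m<2. w m = w' m) \<longrightarrow> \<omega> i z w = \<omega> i z w'" for w' unfolding alternating_def by blast
  then show ?thesis unfolding om_def by (simp add: less_2_cases_iff)
qed

lemma smooth_om: "i \<in> charts X \<Longrightarrow> smooth_on (om i a b) (img X i)"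
  unfolding om_def[abs_def] by (rule is_formD(2)[OF is_form_omega])

lemma om_linear:
  assumes "i \<in> charts X" "z \<in> img X i"
  shows "linear (\<lambda>a. om i a b z)" "linear (\<lambda>b. om i a b z)"
proof -
  have alt: "alternating 2 (\<omega> i z)" using assms by (rule is_formD(1)[OF is_form_omega])
  have "linear (\<lambda>x. \<omega> i z ((\<lambda>k. if k = 0 then a else b)(m := x)))" if "m < 2" for m
    using alt that unfolding alternating_def by blast
  from this[of 0] this[of "Suc 0"] show "linear (\<lambda>a. om i a b z)" "linear (\<lambda>b. om i a b z)"
    by (simp_all add: omega_eq[OF assms])
qed

lemma om_antisym:
  assumes "i \<in> charts X" "z \<in> img X i" shows "om i b a z = - om i a b z"
  using alternating_swap[OF is_formD(1)[OF is_form_omega assms], of 0 "Suc 0" "\<lambda>k. if k = 0 then a else b"]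
  by (simp add: omega_eq[OF assms])

lemma om_change:
  assumes "i \<in> charts X" "j \<in> charts X" "z \<in> overlap X i j"
  shows "om i a b z = om j (dd a (transition X i j) z) (dd b (transition X i j) z) (transition X i j z)"
  unfolding om_def by (subst is_formD(3)[OF is_form_omega assms]) (simp add: if_distrib[of "\<lambda>v. dd v _ _"] cong: if_cong)

text \<open>\<omega> is of type (1,1), so closedness splits by type.\<close>

lemma om_closed:
  assumes i: "i \<in> charts X" and z: "z \<in> img X i"
  shows "sd1 x (om i a b) z + sd1 a (om i b x) z + sd1 b (om i x a) z = 0"
    "sd2 x (om i a b) z + sd2 a (om i b x) z + sd2 b (om i x a) z = 0"
proof -
  note S = open_img[OF i]
  have cong: "dd v f z = dd v g z" if "\<And>y. y \<in> img X i \<Longrightarrow> f y = g y" for f g :: "'n pt \<Rightarrow> complex" and v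
    using dd_cong_open[OF S z that] by simp
  have cyc: "dd x (om i a b) z + dd a (om i b x) z + dd b (om i x a) z = 0" for x a b
  proof -
    define w where "w k = (if k = 0 then x else if k = Suc 0 then a else b)" for k :: nat
    have "ext_deriv 2 (\<omega> i) z w = 0" using kaehler i z by (auto simp: kaehler_form_def closed_form_def)
    moreover have "{..2::nat} = {0, Suc 0, Suc (Suc 0)}" by auto
    moreover have "dd v (\<lambda>y. \<omega> i y w') z = dd v (om i (w' 0) (w' (Suc 0))) z" for v w'
      by (rule cong) (rule omega_eq[OF i])
    ultimately have "dd x (om i a b) z - dd a (om i x b) z + dd b (om i x a) z = 0"
      by (simp add: ext_deriv_def omit_def w_def algebra_simps)
    moreover have "dd a (om i x b) z = dd a (\<lambda>y. - om i b x y) z" by (rule cong) (rule om_antisym[OF i])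
    moreover have "dd a (\<lambda>y. - om i b x y) z = - dd a (om i b x) z"
      by (rule dd_bounded_linear[OF bounded_linear_minus[OF bounded_linear_ident] S smooth_om[OF i] z])
    ultimately show ?thesis by simp
  qed
  have J: "om i (\<i> *s a) (\<i> *s b) y = om i a b y" if "y \<in> img X i" for a b y
  proof -
    have "\<omega> i y (\<lambda>m. \<i> *s (if m = 0 then a else b)) = \<omega> i y (\<lambda>m. if m = 0 then a else b)"
      using kaehler i that by (auto simp: kaehler_form_def)
    then show ?thesis by (simp add: omega_eq[OF i that])
  qed
  have "dd v (om i (\<i> *s a) (\<i> *s b)) z = dd v (om i a b) z" for v a b by (rule cong) (rule J)
  \<comment> \<open>Closedness at the vectors multiplied by i. Invariance of \<omega> removes the i
    from the arguments and leaves it on the directions of differentiation, which is what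
    \<open>sd1\<close> and \<open>sd2\<close> combine.\<close>
  then have cycJ: "dd (\<i> *s x) (om i a b) z + dd (\<i> *s a) (om i b x) z + dd (\<i> *s b) (om i x a) z = 0"
    using cyc[of "\<i> *s x" "\<i> *s a" "\<i> *s b"] by (simp only: add_ac)
  have "sd1 x (om i a b) z + sd1 a (om i b x) z + sd1 b (om i x a) z
     = ((dd x (om i a b) z + dd a (om i b x) z + dd b (om i x a) z)
       - \<i> * (dd (\<i> *s x) (om i a b) z + dd (\<i> *s a) (om i b x) z + dd (\<i> *s b) (om i x a) z)) / 2"
    "sd2 x (om i a b) z + sd2 a (om i b x) z + sd2 b (om i x a) z
     = ((dd x (om i a b) z + dd a (om i b x) z + dd b (om i x a) z)
       + \<i> * (dd (\<i> *s x) (om i a b) z + dd (\<i> *s a) (om i b x) z + dd (\<i> *s b) (om i x a) z)) / 2"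
    unfolding sd1_def sd2_def by (simp_all add: field_simps)
  then show "sd1 x (om i a b) z + sd1 a (om i b x) z + sd1 b (om i x a) z = 0"
    "sd2 x (om i a b) z + sd2 a (om i b x) z + sd2 b (om i x a) z = 0"
    unfolding cyc cycJ by simp_all
qed

text \<open>The (1,0) identity is the \<partial>-closedness of U; subtracting it from dU = 0 gives
  the (0,1) identity.\<close>

lemma U_closed:
  assumes i: "i \<in> charts X" and z: "z \<in> img X i"
  shows "(\<Sum>s\<le>2 * l. (- 1) ^ s * sd1 (w s) (\<lambda>y. U (2 * l) i y (omit s w)) z) = 0"
    "(\<Sum>s\<le>2 * l. (- 1) ^ s * sd2 (w s) (\<lambda>y. U (2 * l) i y (omit s w)) z) = 0"
proof -
  show 1: "(\<Sum>s\<le>2 * l. (- 1) ^ s * sd1 (w s) (\<lambda>y. U (2 * l) i y (omit s w)) z) = 0"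
    using del_closed[of l] i z unfolding del_closed_form_def del_def by (auto simp: del_dir_eq_sd1)
  have "(\<Sum>s\<le>2 * l. (- 1) ^ s * dd (w s) (\<lambda>y. U (2 * l) i y (omit s w)) z) = 0"
  proof -
    have "ext_deriv (2 * l) (U (2 * l) i) z w = 0" using unipotent i z by (auto simp: unipotent_form_def closed_form_def)
    moreover have "(- 1) ^ s *\<^sub>R c = (- 1) ^ s * c" for s :: nat and c :: complex
      by (cases "even s") auto
    ultimately show ?thesis by (simp add: ext_deriv_def)
  qed
  then show "(\<Sum>s\<le>2 * l. (- 1) ^ s * sd2 (w s) (\<lambda>y. U (2 * l) i y (omit s w)) z) = 0"
    using 1 by (simp add: dd_eq_sd1_sd2 ring_distribs sum.distrib)
qed

lemma local_forms:
  assumes "i \<in> charts X" "local_metric (img X i) H"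
  shows "local_forms (img X i) H (om i) (U (2 * l) i) l"
  using assms by (intro local_forms.intro local_forms_axioms.intro smooth_om om_antisym om_closed U_closed is_formD(2)[OF is_form_U])

lemma holo_cmat: "i \<in> charts X \<Longrightarrow> j \<in> charts X \<Longrightarrow> holo_on (\<lambda>z. cmat i j z $ a $ b) (overlap X i j)"
  using holo_bundle by (auto simp: holomorphic_bundle_def)

lemma cmat_inverse:
  assumes "i \<in> charts X" "j \<in> charts X" "z \<in> overlap X i j"
  shows "E i j (chart_inv X i z) ** cmat i j z = mat 1" "cmat i j z ** E i j (chart_inv X i z) = mat 1"
    "invertible (cmat i j z)" "matrix_inv (cmat i j z) = E i j (chart_inv X i z)"
proof -
  have x: "chart_inv X i z \<in> dom X i" "chart_inv X i z \<in> dom X j"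
    using assms by (auto simp: overlap_iff chart_inv_dom)
  have "E i j (chart_inv X i z) ** cmat i j z = E i i (chart_inv X i z)" "E i i (chart_inv X i z) = mat 1"
    using holo_bundle x assms unfolding holomorphic_bundle_def by blast+
  then show "E i j (chart_inv X i z) ** cmat i j z = mat 1" by simp
  then show 2: "cmat i j z ** E i j (chart_inv X i z) = mat 1" using matrix_left_right_inverse by blast
  from matrix_inv_unique[OF this] show "invertible (cmat i j z)" "matrix_inv (cmat i j z) = E i j (chart_inv X i z)" .
qed

lemma frame_change: "i \<in> charts X \<Longrightarrow> j \<in> charts X \<Longrightarrow> frame_change (overlap X i j) (img X j) (transition X i j) (cmat i j)"
  by (intro frame_change.intro open_overlap open_img holo_transition holo_cmat cmat_inverse(3) transition_img)

definition smooth_section :: "('i \<Rightarrow> 'n pt \<Rightarrow> 'r mtx) \<Rightarrow> bool" where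
  "smooth_section A \<longleftrightarrow> (\<forall>i\<in>charts X. smooth_on (A i) (img X i)) \<and>
    (\<forall>i\<in>charts X. \<forall>j\<in>charts X. \<forall>z\<in>overlap X i j.
       A i z = matrix_inv (cmat i j z) ** A j (transition X i j z) ** cmat i j z)"

lemma smooth_sectionD:
  assumes "smooth_section A" "i \<in> charts X"
  shows "smooth_on (A i) (img X i)"
    "j \<in> charts X \<Longrightarrow> z \<in> overlap X i j \<Longrightarrow> A i z = matrix_inv (cmat i j z) ** A j (transition X i j z) ** cmat i j z"
  using assms unfolding smooth_section_def by blast+

lemma hermitian_metricD:
  assumes "hermitian_metric X E h" "i \<in> charts X"
  shows "smooth_on (h i) (img X i)" "z \<in> img X i \<Longrightarrow> pos_def_hermitian (h i z)"
    "j \<in> charts X \<Longrightarrow> z \<in> overlap X i j \<Longrightarrow> h i z = conj_transpose (cmat i j z) ** h j (transition X i j z) ** cmat i j z"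
  using assms unfolding hermitian_metric_def by (auto simp: Let_def)

lemma local_metric: "hermitian_metric X E h \<Longrightarrow> i \<in> charts X \<Longrightarrow> local_metric (img X i) (h i)"
  by (intro local_metric.intro open_img hermitian_metricD(1) pos_def_hermitian_invertible hermitian_metricD(2))

lemma metric_change:
  assumes h: "hermitian_metric X E h" and ij: "i \<in> charts X" "j \<in> charts X"
  shows "metric_change (overlap X i j) (img X j) (transition X i j) (cmat i j) (h i) (h j)"
proof (intro metric_change.intro metric_change_axioms.intro frame_change ij local_metric h)
  show "local_metric (overlap X i j) (h i)"
    using local_metric[OF h ij(1)] overlap_subset[OF ij(1), of j] open_overlap[OF ij]
    by (auto simp: local_metric_def intro: smooth_on_subset)
qed (rule hermitian_metricD(3)[OF h ij])

text \<open>The transition matrices cancel under the trace, and the change of coordinates acts on a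
  top-degree alternating map by its real determinant.\<close>

lemma density_word:
  assumes A: "\<And>i. i \<in> charts X \<Longrightarrow> continuous_on (img X i) (A i)"
      "\<And>i j z. i \<in> charts X \<Longrightarrow> j \<in> charts X \<Longrightarrow> z \<in> overlap X i j \<Longrightarrow>
         A i z = matrix_inv (cmat i j z) ** A j (transition X i j z) ** cmat i j z"
    and cF: "\<And>i k a b. i \<in> charts X \<Longrightarrow> k < J \<Longrightarrow> continuous_on (img X i) (\<lambda>z. Fs k i a b z)"
    and lF: "\<And>i z k b. i \<in> charts X \<Longrightarrow> z \<in> img X i \<Longrightarrow> k < J \<Longrightarrow> linear (\<lambda>a. Fs k i a b z)"
      "\<And>i z k a. i \<in> charts X \<Longrightarrow> z \<in> img X i \<Longrightarrow> k < J \<Longrightarrow> linear (\<lambda>b. Fs k i a b z)"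
    and tF: "\<And>i j z k a b. i \<in> charts X \<Longrightarrow> j \<in> charts X \<Longrightarrow> z \<in> overlap X i j \<Longrightarrow> k < J \<Longrightarrow>
         Fs k i a b z = matrix_inv (cmat i j z) **
           Fs k j (dd a (transition X i j) z) (dd b (transition X i j) z) (transition X i j z) ** cmat i j z"
    and N: "2 * CARD('n) = 2 * J + q"
  shows "density (\<lambda>i z. altz (2 * CARD('n)) (tword (A i z) (\<lambda>k a b. Fs k i a b z) J (U q i z)) std_frame)"
  unfolding density_def
proof (intro conjI ballI)
  fix i assume i: "i \<in> charts X"
  show "continuous_on (img X i) (\<lambda>z. altz (2 * CARD('n)) (tword (A i z) (\<lambda>k a b. Fs k i a b z) J (U q i z)) std_frame)"
    unfolding tword_def pairprod_def
    by (intro continuous_on_altz continuous_intros bounded_linear.continuous_on[OF bounded_linear_trace]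
        bounded_bilinear.continuous_on[OF bounded_bilinear_matrix_mult] A(1)[OF i] continuous_on_mprod
        smooth_on_continuous[OF is_formD(2)[OF is_form_U i]]) (use cF[OF i] in auto)
next
  fix i j z assume ij: "i \<in> charts X" "j \<in> charts X" and z: "z \<in> overlap X i j"
  let ?T = "transition X i j" and ?g = "cmat i j z" and ?N = "2 * CARD('n)"
  have Tz: "?T z \<in> img X j" using transition_overlap(1)[OF ij z] overlap_subset[OF ij(2)] by blast
  note inv = cmat_inverse[OF ij z]
  let ?t = "tword (A j (?T z)) (\<lambda>k a b. Fs k j a b (?T z)) J (U q j (?T z))"
  have "tword (A i z) (\<lambda>k a b. Fs k i a b z) J (U q i z) w = ?t (\<lambda>k. dd (w k) ?T z)" for w
    unfolding A(2)[OF ij z]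
    by (rule tword_conj[where D = "\<lambda>v. dd v ?T z"])
      (use inv tF[OF ij z] is_formD(3)[OF is_form_U ij z] in \<open>simp_all only:\<close>)
  then have "altz ?N (tword (A i z) (\<lambda>k a b. Fs k i a b z) J (U q i z)) std_frame
      = altz ?N (\<lambda>w. ?t (\<lambda>k. dd (w k) ?T z)) std_frame" by (rule altz_cong)
  also have "\<dots> = altz ?N ?t (\<lambda>k. dd (std_frame k) ?T z)" by (simp add: altz_def)
  also have "\<dots> = det (rmat (\<lambda>v. dd v ?T z)) *\<^sub>R altz ?N ?t std_frame"
  proof (rule top_form_linear)
    show "alternating ?N (altz ?N ?t)"
      unfolding N by (rule alternating_tword) (use lF[OF ij(2) Tz] is_formD(1)[OF is_form_U ij(2) Tz] in auto)
  qed
  finally show "altz ?N (tword (A i z) (\<lambda>k a b. Fs k i a b z) J (U q i z)) std_frame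
      = det (rmat (\<lambda>v. dd v ?T z)) *\<^sub>R altz ?N ?t std_frame" .
qed

definition gfac :: "('i, 'n, 'r) metric \<Rightarrow> nat \<Rightarrow> nat \<Rightarrow> 'i \<Rightarrow> 'n pt \<Rightarrow> ('n, 'r mtx) bil" where
  "gfac h j k i a b z = factors (\<lambda>a b. ncurv (h i) a b z) (\<lambda>a b. om i a b z) j k a b"

context
  fixes h :: "('i, 'n, 'r) metric"
  assumes h: "hermitian_metric X E h"
begin

lemma gfac_facts:
  assumes i: "i \<in> charts X"
  shows "continuous_on (img X i) (\<lambda>z. gfac h j k i a b z)"
    "z \<in> img X i \<Longrightarrow> linear (\<lambda>a. gfac h j k i a b z)" "z \<in> img X i \<Longrightarrow> linear (\<lambda>b. gfac h j k i a b z)"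
    "i' \<in> charts X \<Longrightarrow> z \<in> overlap X i i' \<Longrightarrow> gfac h j k i a b z = matrix_inv (cmat i i' z) **
       gfac h j k i' (dd a (transition X i i') z) (dd b (transition X i i') z) (transition X i i' z) ** cmat i i' z"
proof -
  interpret local_metric "img X i" "h i" by (rule local_metric[OF h i])
  show "continuous_on (img X i) (\<lambda>z. gfac h j k i a b z)"
    by (rule smooth_on_continuous, cases "k < j")
      (simp_all add: gfac_def factors_def smooth_ncurv smooth_on_cscale[OF S smooth_om[OF i]])
  have o: "linear (\<lambda>a. cscale (om i a b z) (mat 1 :: 'r mtx))" "linear (\<lambda>b. cscale (om i a b z) (mat 1 :: 'r mtx))"
    if "z \<in> img X i" for a b
    using linear_compose[OF om_linear(1)[OF i that] linear_cscale(2)[of "mat 1"]]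
      linear_compose[OF om_linear(2)[OF i that] linear_cscale(2)[of "mat 1"]] by (simp_all add: o_def)
  show "z \<in> img X i \<Longrightarrow> linear (\<lambda>a. gfac h j k i a b z)" "z \<in> img X i \<Longrightarrow> linear (\<lambda>b. gfac h j k i a b z)"
    by (cases "k < j"; simp add: gfac_def factors_def linear_ncurv o)+
  assume i': "i' \<in> charts X" and z: "z \<in> overlap X i i'"
  show "gfac h j k i a b z = matrix_inv (cmat i i' z) **
       gfac h j k i' (dd a (transition X i i') z) (dd b (transition X i i') z) (transition X i i' z) ** cmat i i' z"
  proof (cases "k < j")
    case True
    then show ?thesis using metric_change.ncurv_change[OF metric_change[OF h i i'] z] by (simp add: gfac_def factors_def)
  next
    case False
    then show ?thesis
      using om_change[OF i i' z] matrix_inv(2)[OF cmat_inverse(3)[OF i i' z]] by (simp add: gfac_def factors_def cscale_mult)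
  qed
qed

lemma density_gfac:
  assumes A: "smooth_section A" and N: "d + j + l = CARD('n)"
  shows "density (\<lambda>i z. altz (2 * CARD('n)) (tword (A i z) (\<lambda>k a b. gfac h j k i a b z) (j + d) (U (2 * l) i z)) std_frame)"
proof (rule density_word[where q = "2 * l" and Fs = "\<lambda>k i a b z. gfac h j k i a b z"])
  show "2 * CARD('n) = 2 * (j + d) + 2 * l" using N by simp
qed (rule smooth_on_continuous[OF smooth_sectionD(1)[OF A]] smooth_sectionD(2)[OF A] gfac_facts; assumption)+

lemma density_dcurv:
  assumes A: "smooth_section A" and B: "smooth_section B" and N: "d + j + l = CARD('n)"
  shows "density (\<lambda>i z. altz (2 * CARD('n)) (tword (A i z) (\<lambda>k x y. if k = a then dcurv (h i) (B i) x y z else gfac h j k i x y z)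
      (j + d) (U (2 * l) i z)) std_frame)"
proof (rule density_word[where q = "2 * l" and Fs = "\<lambda>k i x y z. if k = a then dcurv (h i) (B i) x y z else gfac h j k i x y z"])
  fix i assume i: "i \<in> charts X"
  interpret local_metric "img X i" "h i" by (rule local_metric[OF h i])
  note Bi = smooth_sectionD(1)[OF B i]
  show "continuous_on (img X i) (A i)" by (rule smooth_on_continuous[OF smooth_sectionD(1)[OF A i]])
  fix k
  show "continuous_on (img X i) (\<lambda>z. if k = a then dcurv (h i) (B i) x y z else gfac h j k i x y z)" for x y
    by (cases "k = a") (simp_all add: gfac_facts(1)[OF i] smooth_on_continuous[OF smooth_dcurv[OF Bi]])
  show "linear (\<lambda>x. if k = a then dcurv (h i) (B i) x y z else gfac h j k i x y z)"
    "linear (\<lambda>y. if k = a then dcurv (h i) (B i) x y z else gfac h j k i x y z)" if "z \<in> img X i" for z x y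
    by (cases "k = a"; simp add: gfac_facts(2,3)[OF i that] linear_dcurv[OF Bi that])+
  fix i' z assume i': "i' \<in> charts X" and z: "z \<in> overlap X i i'"
  show "A i z = matrix_inv (cmat i i' z) ** A i' (transition X i i' z) ** cmat i i' z"
    by (rule smooth_sectionD(2)[OF A i i' z])
  show "(if k = a then dcurv (h i) (B i) x y z else gfac h j k i x y z) = matrix_inv (cmat i i' z) **
     (if k = a then dcurv (h i') (B i') (dd x (transition X i i') z) (dd y (transition X i i') z) (transition X i i' z)
      else gfac h j k i' (dd x (transition X i i') z) (dd y (transition X i i') z) (transition X i i' z)) ** cmat i i' z" for x y
    using metric_change.dcurv_change[OF metric_change[OF h i i'] smooth_sectionD(1)[OF B i'] smooth_sectionD(2)[OF B i i'] z]
      gfac_facts(4)[OF i i' z] by simp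
qed (use N in auto)

end

section \<open>Linear operations on densities and endomorphism sections\<close>

lemma density_add: "density f \<Longrightarrow> density g \<Longrightarrow> density (\<lambda>i z. f i z + g i z)"
  by (auto simp: density_def scaleR_add_right intro!: continuous_on_add)

lemma density_cmult: "density f \<Longrightarrow> density (\<lambda>i z. c * f i z)"
  by (auto simp: density_def intro!: continuous_on_mult continuous_on_const)

lemma density_diff: "density f \<Longrightarrow> density g \<Longrightarrow> density (\<lambda>i z. f i z - g i z)"
  using density_add[of f "\<lambda>i z. -1 * g i z"] density_cmult[of g "-1"] by simp

lemma density_sum: "(\<And>a. a \<in> I \<Longrightarrow> density (f a)) \<Longrightarrow> density (\<lambda>i z. \<Sum>a\<in>I. f a i z)"
  by (induction I rule: infinite_finite_induct) (auto intro!: density_add, auto simp: density_def)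

lemma smooth_section_mult: "smooth_section A \<Longrightarrow> smooth_section B \<Longrightarrow> smooth_section (\<lambda>i z. A i z ** B i z)"
proof -
  assume A: "smooth_section A" and B: "smooth_section B"
  have "matrix_inv g ** a ** g ** (matrix_inv g ** b ** g) = matrix_inv g ** (a ** b) ** g" if "invertible g" for g a b :: "'r mtx"
    using matrix_inv_cancel(3)[OF that, of "matrix_inv g ** a"] by (simp add: matrix_mul_assoc)
  then have "A i z ** B i z = matrix_inv (cmat i j z) ** (A j (transition X i j z) ** B j (transition X i j z)) ** cmat i j z"
    if "i \<in> charts X" "j \<in> charts X" "z \<in> overlap X i j" for i j z
    unfolding smooth_sectionD(2)[OF A that] smooth_sectionD(2)[OF B that] using cmat_inverse(3)[OF that] by blast
  then show ?thesis
    unfolding smooth_section_def by (auto intro!: smooth_on_matrix_mult open_img smooth_sectionD(1)[OF A] smooth_sectionD(1)[OF B])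
qed

lemma smooth_section_diff: "smooth_section A \<Longrightarrow> smooth_section B \<Longrightarrow> smooth_section (\<lambda>i z. A i z - B i z)"
  by (auto simp: smooth_section_def matrix_distribs intro!: smooth_on_diff open_img)

lemma smooth_section_add: "smooth_section A \<Longrightarrow> smooth_section B \<Longrightarrow> smooth_section (\<lambda>i z. A i z + B i z)"
  by (auto simp: smooth_section_def matrix_distribs intro!: smooth_on_add open_img)

lemma smooth_section_pou:
  assumes "smooth_section A" "k \<in> charts X"
  shows "smooth_section (\<lambda>i z. pou k (chart_inv X i z) *\<^sub>R A i z)"
  using assms transition_overlap(2)
  by (auto simp: smooth_section_def scaleR_matrix_mult intro!: smooth_on_scaleR open_img smooth_pou)

text \<open>
  The integrand of the exterior derivative of the one-form \<open>A \<mapsto> \<integral> tr (A D\<^sub>Z(h))\<close> on the space of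
  metrics, evaluated at \<open>A\<close> and \<open>B\<close>.
\<close>
definition cdens :: "(nat \<Rightarrow> complex) \<Rightarrow> ('i, 'n, 'r) metric \<Rightarrow> ('i \<Rightarrow> 'n pt \<Rightarrow> 'r mtx) \<Rightarrow> ('i \<Rightarrow> 'n pt \<Rightarrow> 'r mtx) \<Rightarrow>
   ('i, 'n, complex) form" where
  "cdens c h A B i z v = (\<Sum>(d, j, l)\<in>degree_triples CARD('n). charge_coeff c d j l *
     altz (2 * CARD('n)) (local_forms.cword (h i) (om i) (U (2 * l) i) j d (A i) (B i) z) v)"

text \<open>The divergence formula is used in a single chart only, but the words themselves
  transform correctly one by one; this permits moving the integral into the chart that contains the
  support.\<close>

lemma density_cdens:
  assumes h: "hermitian_metric X E h" and A: "smooth_section A" and B: "smooth_section B"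
  shows "density (\<lambda>i z. cdens c h A B i z std_frame)"
proof -
  define t where "t d j l i z = altz (2 * CARD('n)) (tword (A i z ** B i z - B i z ** A i z) (\<lambda>k a b. gfac h j k i a b z) (j + d) (U (2 * l) i z)) std_frame
    + (\<Sum>a<j. altz (2 * CARD('n)) (tword (A i z) (\<lambda>k x y. if k = a then dcurv (h i) (B i) x y z else gfac h j k i x y z) (j + d) (U (2 * l) i z)) std_frame
            - altz (2 * CARD('n)) (tword (B i z) (\<lambda>k x y. if k = a then dcurv (h i) (A i) x y z else gfac h j k i x y z) (j + d) (U (2 * l) i z)) std_frame)"
    for d j l i z
  have t: "density (t d j l)" if "d + j + l = CARD('n)" for d j l
    unfolding t_def[abs_def]
    by (intro density_add density_sum density_diff density_gfac density_dcurv h A B that smooth_section_diff smooth_section_mult)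
  have "altz (2 * CARD('n)) (local_forms.cword (h i) (om i) (U (2 * l) i) j d (A i) (B i) z) std_frame = t d j l i z"
    if i: "i \<in> charts X" for d j l i z
  proof -
    interpret local_forms "img X i" "h i" "om i" "U (2 * l) i" l by (rule local_forms[OF i local_metric[OF h i]])
    have f': "fac j z = (\<lambda>k x y. gfac h j k i x y z)" by (simp add: gfac_def fun_eq_iff)
    have f: "(\<lambda>k x y. gfac h j k i x y z)(a := K) = (\<lambda>k x y. if k = a then K x y else gfac h j k i x y z)" for a K
      by (auto simp: fun_eq_iff)
    show ?thesis unfolding cword_def[abs_def] altz_add altz_sum altz_diff f' f t_def ..
  qed
  then have "cdens c h A B i z std_frame = (\<Sum>(d, j, l)\<in>degree_triples CARD('n). charge_coeff c d j l * t d j l i z)"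
    if "i \<in> charts X" for i z
    unfolding cdens_def using that by (auto intro!: sum.cong)
  moreover have "density (\<lambda>i z. \<Sum>(d, j, l)\<in>degree_triples CARD('n). charge_coeff c d j l * t d j l i z)"
    by (rule density_sum) (auto simp: degree_triples_def intro!: density_cmult t)
  ultimately show ?thesis unfolding density_def by simp
qed

lemma density_charge_density:
  assumes h: "hermitian_metric X E h" and A: "smooth_section A"
  shows "density (\<lambda>i z. charge_density c (\<lambda>a b. om i a b z) (\<lambda>k. U k i z) CARD('n) (\<lambda>a b. ncurv (h i) a b z) (A i z) std_frame)"
proof -
  have "density (\<lambda>i z. \<Sum>(d, j, l)\<in>degree_triples CARD('n). charge_coeff c d j l *
      altz (2 * CARD('n)) (tword (A i z) (\<lambda>k a b. gfac h j k i a b z) (j + d) (U (2 * l) i z)) std_frame)"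
    by (rule density_sum) (auto simp: degree_triples_def intro!: density_cmult density_gfac h A)
  then show ?thesis by (simp add: charge_density_def gfac_def)
qed

lemma integral_over_cong:
  assumes "\<And>i z. i \<in> charts X \<Longrightarrow> z \<in> img X i \<Longrightarrow> \<eta> i z std_frame = \<eta>' i z std_frame"
  shows "integral_over X \<eta> = integral_over X \<eta>'"
  unfolding integral_over_pou
  by (intro sum.cong refl Bochner_Integration.integral_cong) (auto simp: assms pouset_charts)

lemma integrable_pou:
  assumes i: "i \<in> charts X" and f: "continuous_on (img X i) f"
  shows "integrable lborel (\<lambda>z. if z \<in> img X i then pou i (chart_inv X i z) *\<^sub>R f z else (0 :: complex))"
proof -
  let ?K = "closure {x. pou i x \<noteq> 0}"
  have "continuous_on (img X i) (\<lambda>z. pou i (chart_inv X i z) *\<^sub>R f z)"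
    by (intro continuous_on_scaleR f smooth_on_continuous smooth_pou i)
  note c = continuous_cutoff[OF i this closed_closure pou_support[OF i]]
  have "pou i (chart_inv X i z) *\<^sub>R f z = 0" if "chart_inv X i z \<notin> ?K" for z
    using that closure_subset[of "{x. pou i x \<noteq> 0}"] by auto
  from integrable_compact_support[OF c(1)[OF this] compact_chart_image(1)[OF i closed_closure pou_support[OF i]] c(2)[OF this]]
  show ?thesis .
qed

lemma integral_over_add:
  assumes "density (\<lambda>i z. \<eta> i z std_frame)" "density (\<lambda>i z. \<eta>' i z std_frame)"
  shows "integral_over X (\<lambda>i z v. \<eta> i z v + \<eta>' i z v) = integral_over X \<eta> + integral_over X \<eta>'"
  unfolding integral_over_pou sum.distrib[symmetric]
proof (intro sum.cong refl)
  fix i assume "i \<in> pouset"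
  then have i: "i \<in> charts X" by (rule pouset_charts)
  let ?f = "\<lambda>\<eta> z. if z \<in> img X i then pou i (chart_inv X i z) *\<^sub>R \<eta> i z std_frame else (0 :: complex)"
  have int: "integrable lborel (?f \<eta>)" "integrable lborel (?f \<eta>')"
    using assms i by (auto simp: density_def intro!: integrable_pou)
  have "?f (\<lambda>i z v. \<eta> i z v + \<eta>' i z v) = (\<lambda>z. ?f \<eta> z + ?f \<eta>' z)" by (auto simp: scaleR_add_right)
  then show "(LINT z|lborel. ?f (\<lambda>i z v. \<eta> i z v + \<eta>' i z v) z) = (LINT z|lborel. ?f \<eta> z) + (LINT z|lborel. ?f \<eta>' z)"
    using Bochner_Integration.integral_add[OF int] by simp
qed

lemma cword_add:
  fixes H A A' B :: "'n pt \<Rightarrow> 'r mtx"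
  assumes i: "i \<in> charts X" and h: "local_metric (img X i) H"
    and A: "smooth_on A (img X i)" and A': "smooth_on A' (img X i)" and z: "z \<in> img X i"
  shows "local_forms.cword H (om i) (U (2 * l) i) j d (\<lambda>z. A z + A' z) B z w
    = local_forms.cword H (om i) (U (2 * l) i) j d A B z w + local_forms.cword H (om i) (U (2 * l) i) j d A' B z w"
proof -
  interpret local_forms "img X i" H "om i" "U (2 * l) i" l by (rule local_forms[OF i h])
  have 1: "tword (M + M') Fs J u w = tword M Fs J u w + tword M' Fs J u w" for M M' :: "'r mtx" and Fs J and u :: "(nat \<Rightarrow> 'n pt) \<Rightarrow> complex" and w
    by (simp add: tword_def matrix_distribs trace_add ring_distribs)
  have 2: "(A z + A' z) ** B z - B z ** (A z + A' z) = (A z ** B z - B z ** A z) + (A' z ** B z - B z ** A' z)"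
    by (simp add: matrix_distribs)
  have 3: "tword (B z) ((fac j z)(a := \<lambda>x y. dcurv H (\<lambda>z. A z + A' z) x y z)) (j + d) u w
    = tword (B z) ((fac j z)(a := \<lambda>x y. dcurv H A x y z)) (j + d) u w + tword (B z) ((fac j z)(a := \<lambda>x y. dcurv H A' x y z)) (j + d) u w"
    if "a < j" for a u
    unfolding dcurv_add[OF A A' z] by (rule tword_upd_linear(2)) (use that in simp)
  have "(\<Sum>a<j. tword (A z + A' z) ((fac j z)(a := \<lambda>x y. dcurv H B x y z)) (j + d) (U (2 * l) i z) w
            - tword (B z) ((fac j z)(a := \<lambda>x y. dcurv H (\<lambda>z. A z + A' z) x y z)) (j + d) (U (2 * l) i z) w)
      = (\<Sum>a<j. (tword (A z) ((fac j z)(a := \<lambda>x y. dcurv H B x y z)) (j + d) (U (2 * l) i z) w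
            - tword (B z) ((fac j z)(a := \<lambda>x y. dcurv H A x y z)) (j + d) (U (2 * l) i z) w)
          + (tword (A' z) ((fac j z)(a := \<lambda>x y. dcurv H B x y z)) (j + d) (U (2 * l) i z) w
            - tword (B z) ((fac j z)(a := \<lambda>x y. dcurv H A' x y z)) (j + d) (U (2 * l) i z) w))"
    by (intro sum.cong refl) (simp add: 1 3)
  then show ?thesis unfolding cword_def 2 1 by (simp add: sum.distrib)
qed

text \<open>Additivity at 0 + 0.\<close>

lemma cword_zero:
  fixes H B :: "'n pt \<Rightarrow> 'r mtx"
  assumes i: "i \<in> charts X" and h: "local_metric (img X i) H" and z: "z \<in> img X i"
  shows "local_forms.cword H (om i) (U (2 * l) i) j d (\<lambda>z. 0) B z = (\<lambda>w. 0)"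
  using cword_add[OF i h smooth_on_const[of 0] smooth_on_const[of 0] z, of l j d B] by (simp add: fun_eq_iff)

lemma cword_cong:
  fixes H A A' B :: "'n pt \<Rightarrow> 'r mtx"
  assumes i: "i \<in> charts X" and h: "local_metric (img X i) H"
    and A: "\<And>y. y \<in> S \<Longrightarrow> A y = A' y" and oS: "open S" "S \<subseteq> img X i" and z: "z \<in> S"
  shows "local_forms.cword H (om i) (U (2 * l) i) j d A B z w = local_forms.cword H (om i) (U (2 * l) i) j d A' B z w"
proof -
  interpret local_forms "img X i" H "om i" "U (2 * l) i" l by (rule local_forms[OF i h])
  interpret T: local_metric S H
    using h oS unfolding local_metric_def by (blast intro: smooth_on_subset)
  have d: "dcurv H A x y z = dcurv H A' x y z" for x y by (rule T.dcurv_cong[OF A z])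
  show ?thesis unfolding cword_def by (simp only: A[OF z] d)
qed

text \<open>The cut-off section is supported in one chart, where the integral becomes an ordinary
  one and the integrand is a divergence of compactly supported functions.\<close>

lemma cdens_pou:
  assumes h: "hermitian_metric X E h" and A: "smooth_section A" and B: "smooth_section B" and k: "k \<in> charts X"
  shows "integral_over X (cdens c h (\<lambda>i z. pou k (chart_inv X i z) *\<^sub>R A i z) B) = 0"
proof -
  let ?A = "\<lambda>i z. pou k (chart_inv X i z) *\<^sub>R A i z" and ?K = "closure {x. pou k x \<noteq> 0}"
  have sA: "smooth_section ?A" by (rule smooth_section_pou[OF A k])
  have A0: "?A i z = 0" if "chart_inv X i z \<notin> ?K" for i z
    using that closure_subset[of "{x. pou k x \<noteq> 0}"] by auto
  have "integral_over X (cdens c h ?A B) = (LINT z|lborel. (if z \<in> img X k then cdens c h ?A B k z std_frame else 0))"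
  proof (rule integral_over_local[where \<eta> = "cdens c h ?A B" and K = ?K, OF density_cdens[OF h sA B] k closed_closure pou_support[OF k]])
    fix i z assume i: "i \<in> charts X" and z: "z \<in> img X i" "chart_inv X i z \<notin> ?K"
    note lm = local_metric[OF h i]
    let ?S = "{z \<in> img X i. chart_inv X i z \<in> - ?K}"
    have S: "open ?S" "?S \<subseteq> img X i" "z \<in> ?S" using open_vimage_chart_inv[OF i, of "- ?K"] z by auto
    have "local_forms.cword (h i) (om i) (U (2 * l) i) j d (?A i) (B i) z
      = local_forms.cword (h i) (om i) (U (2 * l) i) j d (\<lambda>z. 0) (B i) z" for l j d
      by (rule ext, rule cword_cong[OF i lm _ S]) (use A0 in blast)
    then show "cdens c h ?A B i z std_frame = 0" unfolding cdens_def by (simp add: cword_zero[OF i lm z(1)] altz_zero)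
  qed
  also have "\<dots> = 0"
  proof -
    have "null_integral (img X k) (\<lambda>z. cdens c h ?A B k z std_frame)"
      unfolding cdens_def
    proof (intro null_integral_sum)
      fix t assume "t \<in> degree_triples CARD('n)"
      then obtain d j l where t: "t = (d, j, l)" "d + j + l = CARD('n)" by (auto simp: degree_triples_def)
      interpret local_forms "img X k" "h k" "om k" "U (2 * l) k" l by (rule local_forms[OF k local_metric[OF h k]])
      have "null_integral (img X k) (\<lambda>z. altz (2 * CARD('n)) (cword j d (?A k) (B k) z) std_frame)"
        by (rule null_integral_cword[OF smooth_sectionD(1)[OF sA k] smooth_sectionD(1)[OF B k] _ compact_chart_image[OF k closed_closure pou_support[OF k]]])
          (use t A0 chart_image_iff[OF k pou_support[OF k]] in auto)
      from null_integral_mult[OF this] show "null_integral (img X k) (\<lambda>z. case t of (d, j, l) \<Rightarrow> charge_coeff c d j l *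
        altz (2 * CARD('n)) (local_forms.cword (h k) (om k) (U (2 * l) k) j d (?A k) (B k) z) std_frame)" by (simp add: t)
    qed
    then show ?thesis unfolding null_integral_def by (rule has_bochner_integral_integral_eq)
  qed
  finally show ?thesis .
qed

text \<open>The exterior derivative is additive in \<open>A\<close>, and \<open>A\<close> is the
  finite sum of its products with the partition functions; induction over the charts
  involved.\<close>

lemma integral_cdens:
  assumes h: "hermitian_metric X E h" and A: "smooth_section A" and B: "smooth_section B"
  shows "integral_over X (cdens c h A B) = 0"
proof -
  define P where "P I i z = (\<Sum>k\<in>I. pou k (chart_inv X i z) *\<^sub>R A i z)" for I i z
  have "smooth_section (P I) \<and> integral_over X (cdens c h (P I) B) = 0" if "I \<subseteq> pouset" "finite I" for I
    using that(2,1)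
  proof (induction I)
    case empty
    have s0: "smooth_section (\<lambda>i z. 0)" by (simp add: smooth_section_def)
    have "cdens c h (\<lambda>i z. 0) B i z v = 0" if "i \<in> charts X" "z \<in> img X i" for i z v
      unfolding cdens_def by (simp add: cword_zero[OF that(1) local_metric[OF h that(1)] that(2)] altz_zero)
    then have "integral_over X (cdens c h (\<lambda>i z. 0) B) = integral_over X (\<lambda>i z v. 0)"
      by (intro integral_over_cong)
    moreover have "integral_over X (\<lambda>i z v. 0) = 0" unfolding integral_over_pou by (simp cong: if_cong)
    ultimately show ?case using s0 by (simp add: P_def[abs_def])
  next
    case (insert k I)
    then have k: "k \<in> charts X" using pouset_charts by blast
    let ?A = "\<lambda>i z. pou k (chart_inv X i z) *\<^sub>R A i z"
    have IH: "smooth_section (P I)" "integral_over X (cdens c h (P I) B) = 0" using insert by auto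
    note sA = smooth_section_pou[OF A k]
    have e: "P (insert k I) = (\<lambda>i z. ?A i z + P I i z)" using insert by (simp add: P_def[abs_def])
    have "integral_over X (cdens c h (\<lambda>i z. ?A i z + P I i z) B) = integral_over X (\<lambda>i z v. cdens c h ?A B i z v + cdens c h (P I) B i z v)"
    proof (rule integral_over_cong)
      fix i z assume i: "i \<in> charts X" and z: "z \<in> img X i"
      show "cdens c h (\<lambda>i z. ?A i z + P I i z) B i z std_frame = cdens c h ?A B i z std_frame + cdens c h (P I) B i z std_frame"
        unfolding cdens_def sum.distrib[symmetric]
        by (intro sum.cong refl)
          (simp add: cword_add[OF i local_metric[OF h i] smooth_sectionD(1)[OF sA i] smooth_sectionD(1)[OF IH(1) i] z, THEN altz_cong]
            altz_add ring_distribs split: prod.split)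
    qed
    also have "\<dots> = 0"
      using integral_over_add[where \<eta> = "cdens c h ?A B" and \<eta>' = "cdens c h (P I) B", OF density_cdens[OF h sA B] density_cdens[OF h IH(1) B]] IH(2) cdens_pou[OF h A B k] by simp
    finally show ?case unfolding e using smooth_section_add[OF sA IH(1)] by simp
  qed
  from this[OF order_refl finite_pouset] have "integral_over X (cdens c h (P pouset) B) = 0" by simp
  moreover have "P pouset = A" by (simp add: P_def fun_eq_iff pou_sum flip: scaleR_sum_left)
  ultimately show ?thesis by simp
qed

end

section \<open>Families of metrics\<close>

abbreviation (input) sl :: "('p \<times> 'v \<Rightarrow> 'b) \<Rightarrow> 'p \<Rightarrow> 'v \<Rightarrow> 'b" where "sl F p \<equiv> \<lambda>z. F (p, z)"

lemma dd_matrix_inv: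
  fixes F :: "'a::euclidean_space \<Rightarrow> 'r::finite mtx"
  assumes S: "open S" and F: "smooth_on F S" and inv: "\<And>x. x \<in> S \<Longrightarrow> invertible (F x)" and x: "x \<in> S"
  shows "dd v (\<lambda>x. matrix_inv (F x)) x = - (matrix_inv (F x) ** dd v F x ** matrix_inv (F x))"
proof -
  have si: "smooth_on (\<lambda>x. matrix_inv (F x)) S" by (rule smooth_on_matrix_inv[OF S F inv])
  have "dd v (\<lambda>x. matrix_inv (F x) ** F x) x = 0"
    using dd_cong_open[OF S x, of "\<lambda>x. matrix_inv (F x) ** F x" "\<lambda>x. mat 1"] matrix_inv(2)[OF inv] by simp
  then have "dd v (\<lambda>x. matrix_inv (F x)) x ** F x = - (matrix_inv (F x) ** dd v F x)"
    unfolding dd_bilinear[OF bounded_bilinear_matrix_mult S si F x] by (simp add: add_eq_0_iff)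
  then have "dd v (\<lambda>x. matrix_inv (F x)) x ** F x ** matrix_inv (F x) = - (matrix_inv (F x) ** dd v F x) ** matrix_inv (F x)" by simp
  then show ?thesis unfolding matrix_inv_cancel(3)[OF inv[OF x]] by (simp add: mat_minus_mult)
qed

lemma smooth_on_cscale_const:
  fixes f :: "'a::real_normed_vector \<Rightarrow> 'r::finite mtx"
  shows "open S \<Longrightarrow> smooth_on f S \<Longrightarrow> smooth_on (\<lambda>x. cscale c (f x)) S"
  by (intro smooth_on_cscale smooth_on_const)

context
  fixes S :: "'v::euclidean_space set"
  assumes S: "open S"
begin

lemma open_product: "open (UNIV \<times> S :: ('p::euclidean_space \<times> 'v) set)"
  by (intro open_Times S open_UNIV)

context
  fixes F :: "'p::euclidean_space \<times> 'v \<Rightarrow> 'b::euclidean_space"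
  assumes F: "smooth_on F (UNIV \<times> S)"
begin

lemma smooth_slice: "smooth_on (sl F p) S"
  by (rule smooth_on_compose[OF S open_product _ F]) (auto intro!: smooth_on_Pair S)

lemma smooth_param: "z \<in> S \<Longrightarrow> smooth_on (\<lambda>p. F (p, z)) UNIV"
  by (rule smooth_on_compose[OF open_UNIV open_product _ F]) (auto intro!: smooth_on_Pair)

lemma F_deriv: "z \<in> S \<Longrightarrow> (F has_derivative (\<lambda>v. dd v F (p, z))) (at (p, z))"
  by (rule smooth_on_has_derivative[OF F open_product]) auto

lemma dd_slice: assumes "z \<in> S" shows "dd v (sl F p) z = dd (0, v) F (p, z)"
proof -
  have "((\<lambda>z. (p, z)) has_derivative (\<lambda>v. (0, v))) (at z)" by (auto intro!: derivative_eq_intros)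
  from has_derivative_compose[OF this F_deriv[OF assms]] show ?thesis by (rule dd_eq)
qed

lemma dd_param: assumes "z \<in> S" shows "dd q (\<lambda>p. F (p, z)) p = dd (q, 0) F (p, z)"
proof -
  have "((\<lambda>p. (p, z)) has_derivative (\<lambda>q. (q, 0))) (at p)" by (auto intro!: derivative_eq_intros)
  from has_derivative_compose[OF this F_deriv[OF assms]] show ?thesis by (rule dd_eq)
qed

end

end

context
  fixes S :: "('n::finite pt) set" and F :: "'p::euclidean_space \<times> ('n pt) \<Rightarrow> 'r::finite mtx"
  assumes S: "open S" and F: "smooth_on F (UNIV \<times> S)"
begin

text \<open>Parameter and coordinate derivatives are both directional derivatives of one joint
  function, in the directions (q, 0) and (0, v), and therefore commute.\<close>

lemma D_param:
  shows "smooth_on (\<lambda>x. D1 v (sl F (fst x)) (snd x)) (UNIV \<times> S)" "smooth_on (\<lambda>x. D2 v (sl F (fst x)) (snd x)) (UNIV \<times> S)"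
    "z \<in> S \<Longrightarrow> dd (q, 0) (\<lambda>x. D1 v (sl F (fst x)) (snd x)) (p, z) = D1 v (sl (dd (q, 0) F) p) z"
    "z \<in> S \<Longrightarrow> dd (q, 0) (\<lambda>x. D2 v (sl F (fst x)) (snd x)) (p, z) = D2 v (sl (dd (q, 0) F) p) z"
proof -
  note O = open_product[OF S]
  have e: "D1 v (sl F (fst x)) (snd x) = (1/2) *\<^sub>R (dd (0, v) F x - cscale \<i> (dd (0, \<i> *s v) F x))"
    "D2 v (sl F (fst x)) (snd x) = (1/2) *\<^sub>R (dd (0, v) F x + cscale \<i> (dd (0, \<i> *s v) F x))" if "x \<in> UNIV \<times> S" for x
    using that by (auto simp: D1_def D2_def dd_slice[OF S F])
  have sc: "smooth_on (\<lambda>x. cscale \<i> (dd (0, \<i> *s v) F x)) (UNIV \<times> S)" by (intro smooth_on_cscale_const O smooth_on_dd F)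
  note sm = smooth_on_diff[OF O smooth_on_dd[OF F] sc] smooth_on_add[OF O smooth_on_dd[OF F] sc]
  show "smooth_on (\<lambda>x. D1 v (sl F (fst x)) (snd x)) (UNIV \<times> S)" "smooth_on (\<lambda>x. D2 v (sl F (fst x)) (snd x)) (UNIV \<times> S)"
    by (subst smooth_on_cong[OF O e(1)], assumption, rule smooth_on_bounded_linear[OF bounded_linear_scaleR_right O sm(1)])
      (subst smooth_on_cong[OF O e(2)], assumption, rule smooth_on_bounded_linear[OF bounded_linear_scaleR_right O sm(2)])
  assume z: "z \<in> S"
  then have pz: "(p, z) \<in> UNIV \<times> S" by simp
  have sw: "dd (q, 0) (dd w F) (p, z) = dd w (dd (q, 0) F) (p, z)" for w by (rule dd_commute[OF O F pz])
  have sl': "dd v (sl (dd (q, 0) F) p) z = dd (0, v) (dd (q, 0) F) (p, z)" for v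
    by (rule dd_slice[OF S smooth_on_dd[OF F] z])
  note d = dd_bounded_linear[OF bounded_linear_scaleR_right O sm(1) pz] dd_bounded_linear[OF bounded_linear_scaleR_right O sm(2) pz]
    dd_bounded_linear[OF bounded_linear_cscale[OF S] O smooth_on_dd[OF F] pz] dd_add[OF O smooth_on_dd[OF F] sc pz]
  have m: "dd (q, 0) (\<lambda>x. dd (0, v) F x - cscale \<i> (dd (0, \<i> *s v) F x)) (p, z)
     = dd (q, 0) (dd (0, v) F) (p, z) - dd (q, 0) (\<lambda>x. cscale \<i> (dd (0, \<i> *s v) F x)) (p, z)"
    by (rule dd_eq) (rule has_derivative_diff[OF smooth_on_has_derivative[OF smooth_on_dd[OF F] O pz] smooth_on_has_derivative[OF sc O pz]])
  have "dd (q, 0) (\<lambda>x. D1 v (sl F (fst x)) (snd x)) (p, z) = dd (q, 0) (\<lambda>x. (1/2) *\<^sub>R (dd (0, v) F x - cscale \<i> (dd (0, \<i> *s v) F x))) (p, z)"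
    using dd_cong_open[OF O pz e(1)] by simp
  then show "dd (q, 0) (\<lambda>x. D1 v (sl F (fst x)) (snd x)) (p, z) = D1 v (sl (dd (q, 0) F) p) z"
    unfolding d m by (simp add: D1_def sw sl')
  have "dd (q, 0) (\<lambda>x. D2 v (sl F (fst x)) (snd x)) (p, z) = dd (q, 0) (\<lambda>x. (1/2) *\<^sub>R (dd (0, v) F x + cscale \<i> (dd (0, \<i> *s v) F x))) (p, z)"
    using dd_cong_open[OF O pz e(2)] by simp
  then show "dd (q, 0) (\<lambda>x. D2 v (sl F (fst x)) (snd x)) (p, z) = D2 v (sl (dd (q, 0) F) p) z"
    unfolding d by (simp add: D2_def sw sl')
qed

end

text \<open>The parameter type is left open: it is \<open>real\<close> for curves of metrics and
  \<open>real \<times> real\<close> for homotopies between them.\<close>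

locale local_family =
  fixes S :: "('n::finite pt) set" and F :: "'p::euclidean_space \<times> ('n pt) \<Rightarrow> 'r::finite mtx"
  assumes S: "open S" and F: "smooth_on F (UNIV \<times> S)" and inv_F: "z \<in> S \<Longrightarrow> invertible (F (p, z))"
begin

lemmas O = open_product[OF S]

lemma metric_slice: "local_metric S (sl F p)"
  by (intro local_metric.intro S smooth_slice[OF S F] inv_F)

definition lvel :: "'p \<Rightarrow> 'p \<times> ('n pt) \<Rightarrow> 'r mtx" where
  "lvel q x = matrix_inv (F x) ** dd (q, 0) F x"

lemma smooth_inv_F: "smooth_on (\<lambda>x. matrix_inv (F x)) (UNIV \<times> S)"
  by (rule smooth_on_matrix_inv[OF O F]) (auto intro: inv_F)

lemma smooth_lvel: "smooth_on (lvel q) (UNIV \<times> S)"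
  unfolding lvel_def[abs_def] by (intro smooth_on_matrix_mult[OF O] smooth_inv_F smooth_on_dd F)

lemma F_lvel: "z \<in> S \<Longrightarrow> dd (q, 0) F (p, z) = F (p, z) ** lvel q (p, z)"
  unfolding lvel_def by (rule matrix_inv_cancel(1)[OF inv_F, symmetric])

lemma dd_inv_F: "z \<in> S \<Longrightarrow> dd v (\<lambda>x. matrix_inv (F x)) (p, z) = - (matrix_inv (F (p, z)) ** dd v F (p, z) ** matrix_inv (F (p, z)))"
  by (rule dd_matrix_inv[OF O F]) (auto intro: inv_F)

text \<open>The Maurer-Cartan equation: differentiating the inverse gives the products, while the
  mixed second derivatives of the metric are symmetric and drop out.\<close>

lemma lvel_commutator:
  assumes z: "z \<in> S"
  shows "dd (q', 0) (lvel q) (p, z) - dd (q, 0) (lvel q') (p, z)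
    = lvel q (p, z) ** lvel q' (p, z) - lvel q' (p, z) ** lvel q (p, z)"
proof -
  have pz: "(p, z) \<in> UNIV \<times> S" using z by simp
  have "dd (q', 0) (lvel q) (p, z) = matrix_inv (F (p, z)) ** dd (q', 0) (dd (q, 0) F) (p, z) - lvel q' (p, z) ** lvel q (p, z)" for q q'
    unfolding lvel_def[abs_def] dd_bilinear[OF bounded_bilinear_matrix_mult O smooth_inv_F smooth_on_dd[OF F] pz] dd_inv_F[OF z]
    by (simp add: mat_minus_mult matrix_mul_assoc)
  then show ?thesis using dd_commute[OF O F pz, of "(q', 0)" "(q, 0)"] by simp
qed

lemma smooth_theta_param: "smooth_on (\<lambda>x. theta (sl F (fst x)) v (snd x)) (UNIV \<times> S)"
  unfolding theta_def using smooth_on_matrix_mult[OF O smooth_inv_F D_param(1)[OF S F]] by simp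

text \<open>With A = h^-1 dh along the parameter, the derivative of h^-1 \<partial>h is h^-1
  \<partial>(h A) - A h^-1 \<partial>h, which is \<partial>A plus the commutator of \<theta> with
  A.\<close>

lemma dd_theta_param:
  assumes z: "z \<in> S"
  shows "dd (q, 0) (\<lambda>x. theta (sl F (fst x)) v (snd x)) (p, z) = cov (sl F p) v (sl (lvel q) p) z"
proof -
  interpret M: local_metric S "sl F p" by (rule metric_slice)
  have pz: "(p, z) \<in> UNIV \<times> S" using z by simp
  let ?F = "F (p, z)" and ?h = "matrix_inv (F (p, z))" and ?A = "lvel q (p, z)" and ?t = "theta (sl F p) v z"
  have "dd (q, 0) (\<lambda>x. theta (sl F (fst x)) v (snd x)) (p, z)
    = ?h ** dd (q, 0) (\<lambda>x. D1 v (sl F (fst x)) (snd x)) (p, z) - ?h ** dd (q, 0) F (p, z) ** ?h ** D1 v (sl F p) z"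
    using dd_bilinear[OF bounded_bilinear_matrix_mult O smooth_inv_F D_param(1)[OF S F, of v] pz, where v = "(q, 0)"]
    by (simp add: theta_def dd_inv_F[OF z] mat_minus_mult)
  also have "dd (q, 0) (\<lambda>x. D1 v (sl F (fst x)) (snd x)) (p, z) = D1 v (sl (dd (q, 0) F) p) z"
    by (rule D_param(3)[OF S F z])
  also have "\<dots> = D1 v (\<lambda>z. F (p, z) ** lvel q (p, z)) z"
    by (rule D_cong(1)[OF S z F_lvel])
  also have "\<dots> = D1 v (sl F p) z ** ?A + ?F ** D1 v (sl (lvel q) p) z"
    by (rule D_mult(1)[OF S M.smooth_H smooth_slice[OF S smooth_lvel] z])
  finally show ?thesis
    using matrix_inv_cancel(2)[OF inv_F[OF z, of p]]
    by (simp add: cov_def theta_def lvel_def matrix_distribs matrix_mul_assoc)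
qed

lemma smooth_gcurv_param: "smooth_on (\<lambda>x. gcurv (sl F (fst x)) u v (snd x)) (UNIV \<times> S)"
  unfolding gcurv_def using D_param(2)[OF S smooth_theta_param, of u v] by simp

lemma smooth_ncurv_param: "smooth_on (\<lambda>x. ncurv (sl F (fst x)) u v (snd x)) (UNIV \<times> S)"
  unfolding ncurv_def by (intro smooth_on_cscale_const smooth_on_diff O smooth_gcurv_param)

text \<open>Applying \<partial>-bar to the variation of the connection form.\<close>

lemma dd_ncurv_param:
  assumes z: "z \<in> S"
  shows "dd (q, 0) (\<lambda>x. ncurv (sl F (fst x)) u v (snd x)) (p, z) = dcurv (sl F p) (sl (lvel q) p) u v z"
proof -
  have pz: "(p, z) \<in> UNIV \<times> S" using z by simp
  have g: "dd (q, 0) (\<lambda>x. gcurv (sl F (fst x)) u v (snd x)) (p, z) = D2 u (cov (sl F p) v (sl (lvel q) p)) z" for u v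
  proof -
    have "dd (q, 0) (\<lambda>x. gcurv (sl F (fst x)) u v (snd x)) (p, z) = D2 u (\<lambda>z. dd (q, 0) (\<lambda>x. theta (sl F (fst x)) v (snd x)) (p, z)) z"
      unfolding gcurv_def using D_param(4)[OF S smooth_theta_param[of v] z, where q = q and v = u and p = p] by simp
    also have "\<dots> = D2 u (cov (sl F p) v (sl (lvel q) p)) z" by (rule D_cong(2)[OF S z dd_theta_param])
    finally show ?thesis .
  qed
  have m: "dd (q, 0) (\<lambda>x. gcurv (sl F (fst x)) u v (snd x) - gcurv (sl F (fst x)) v u (snd x)) (p, z)
     = dd (q, 0) (\<lambda>x. gcurv (sl F (fst x)) u v (snd x)) (p, z) - dd (q, 0) (\<lambda>x. gcurv (sl F (fst x)) v u (snd x)) (p, z)"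
    by (rule dd_eq) (rule has_derivative_diff[OF smooth_on_has_derivative[OF smooth_gcurv_param O pz] smooth_on_has_derivative[OF smooth_gcurv_param O pz]])
  show ?thesis
    unfolding ncurv_def dcurv_def dd_bounded_linear[OF bounded_linear_cscale[OF S] O smooth_on_diff[OF O smooth_gcurv_param smooth_gcurv_param] pz] m g ..
qed

end

lemma dd_tword:
  fixes A :: "'p::euclidean_space \<Rightarrow> 'r::finite mtx" and u :: "(nat \<Rightarrow> 'v) \<Rightarrow> complex"
  assumes A: "smooth_on A UNIV" and Fs: "\<And>i a b. smooth_on (\<lambda>p. Fs p i a b) UNIV"
  shows "dd q (\<lambda>p. tword (A p) (Fs p) J u w) p = tword (dd q A p) (Fs p) J u w
    + (\<Sum>a<J. tword (A p) ((Fs p)(a := \<lambda>x y. dd q (\<lambda>p. Fs p a x y) p)) J u w)"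
proof -
  let ?M = "\<lambda>i p. Fs p i (ev w i) (od w i)"
  have Dm: "dd q (\<lambda>z. f z ** g z) p = dd q f p ** g p + f p ** dd q g p"
    if "smooth_on f UNIV" "smooth_on g UNIV" for f g :: "'p \<Rightarrow> 'r mtx"
    using dd_bilinear[OF bounded_bilinear_matrix_mult open_UNIV that, of p] by simp
  note L = mprod_leibniz[of "\<lambda>f. smooth_on f UNIV" "\<lambda>f. dd q f p" p "[0..<J]" ?M, OF Dm smooth_on_matrix_mult[OF open_UNIV]]
  have P: "smooth_on (\<lambda>p. mprod (map (\<lambda>i. ?M i p) [0..<J])) UNIV" by (rule L(1)) (use Fs in auto)
  have D: "dd q (\<lambda>p. mprod (map (\<lambda>i. ?M i p) [0..<J])) p = (\<Sum>a\<in>set [0..<J]. mprod (map ((\<lambda>i. ?M i p)(a := dd q (?M a) p)) [0..<J]))"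
    by (rule L(2)) (use Fs in auto)
  have "bounded_linear (\<lambda>X. trace X * u (\<lambda>k. w (2 * J + k)))"
    by (rule bounded_linear_compose[OF bounded_linear_mult_left bounded_linear_trace])
  from dd_bounded_linear[OF this open_UNIV smooth_on_matrix_mult[OF open_UNIV A P], where v = q and x = p]
  have "dd q (\<lambda>p. tword (A p) (Fs p) J u w) p
     = trace (dd q A p ** mprod (map (\<lambda>i. ?M i p) [0..<J]) + A p ** (\<Sum>a\<in>set [0..<J]. mprod (map ((\<lambda>i. ?M i p)(a := dd q (?M a) p)) [0..<J])))
       * u (\<lambda>k. w (2 * J + k))"
    unfolding tword_def pairprod_def Dm[OF A P] D by simp
  moreover have "(\<lambda>i. ?M i p)(a := dd q (?M a) p) = (\<lambda>i. ((Fs p)(a := \<lambda>x y. dd q (\<lambda>p. Fs p a x y) p)) i (ev w i) (od w i))" for a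
    by auto
  ultimately show ?thesis
    by (simp add: tword_def pairprod_def trace_add ring_distribs linear_sum[OF linear_matrix_mult(1)] linear_sum[OF linear_trace]
        sum_distrib_right atLeast0LessThan)
qed

section \<open>Integrals depending on parameters\<close>

text \<open>Passes to gauge integrals over one fixed box, to which the theorems on differentiation
  under the integral and on interchanging integrals are applied.\<close>

lemma lebesgue_eq_integral_cbox:
  fixes g :: "'v::euclidean_space \<Rightarrow> 'b::euclidean_space"
  assumes g: "continuous_on UNIV g" and K: "compact K" "K \<subseteq> cbox a b" and g0: "\<And>z. z \<notin> K \<Longrightarrow> g z = 0"
  shows "(LINT z|lborel. g z) = integral (cbox a b) g"
proof -
  have "(LINT z|lborel. g z) = integral UNIV g"
    by (rule integral_lborel[OF integrable_compact_support[OF g K(1) g0], symmetric])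
  also have "\<dots> = integral UNIV (\<lambda>z. if z \<in> cbox a b then g z else 0)" using g0 K(2) by (intro arg_cong[of _ _ "integral UNIV"] ext) auto
  also have "\<dots> = integral (cbox a b) g" by (rule integral_restrict_UNIV)
  finally show ?thesis .
qed

lemma continuous_slice: "continuous_on UNIV f \<Longrightarrow> continuous_on UNIV (\<lambda>z. f (p, z))"
  by (rule continuous_on_compose2[of UNIV f]) (auto intro!: continuous_intros)

context
  fixes f :: "'p::euclidean_space \<times> 'v::euclidean_space \<Rightarrow> complex" and K :: "'v set"
  assumes K: "compact K" and f0: "\<And>p z. z \<notin> K \<Longrightarrow> f (p, z) = 0"
begin

lemma continuous_on_lebesgue_param:
  assumes f: "continuous_on UNIV f"
  shows "continuous_on UNIV (\<lambda>p. LINT z|lborel. f (p, z))"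
proof -
  obtain a where a: "K \<subseteq> cbox (- a) a" using bounded_subset_cbox_symmetric[OF compact_imp_bounded[OF K]] by metis
  have "continuous_on (UNIV \<times> cbox (- a) a) (\<lambda>(p, z). f (p, z))" using continuous_on_subset[OF f] by simp
  from integral_continuous_on_param[OF this]
  show ?thesis by (simp add: lebesgue_eq_integral_cbox[OF continuous_slice[OF f] K a f0])
qed

lemma has_vector_derivative_lebesgue_param:
  assumes f: "smooth_on f UNIV"
  shows "((\<lambda>x. LINT z|lborel. f (p + x *\<^sub>R q, z)) has_vector_derivative (LINT z|lborel. dd (q, 0) f (p + x *\<^sub>R q, z))) (at x)"
    and "z \<notin> K \<Longrightarrow> dd (q, 0) f (p, z) = 0"
proof -
  have d0: "dd (q, 0) f (p, z) = 0" if "z \<notin> K" for p z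
  proof -
    have "open (UNIV \<times> - K :: ('p \<times> 'v) set)" by (intro open_Times) (use compact_imp_closed[OF K] in auto)
    from dd_cong_open[OF this, of "(p, z)" f "\<lambda>x. 0"] show ?thesis using that f0 by (auto simp: dd_const)
  qed
  then show "z \<notin> K \<Longrightarrow> dd (q, 0) f (p, z) = 0" .
  obtain a where a: "K \<subseteq> cbox (- a) a" using bounded_subset_cbox_symmetric[OF compact_imp_bounded[OF K]] by metis
  have cf: "continuous_on UNIV f" and cd: "continuous_on UNIV (dd (q, 0) f)"
    using smooth_on_continuous f smooth_on_dd[OF f] by auto
  have "((\<lambda>x. integral (cbox (- a) a) (\<lambda>z. f (p + x *\<^sub>R q, z))) has_vector_derivative
      integral (cbox (- a) a) (\<lambda>z. dd (q, 0) f (p + x *\<^sub>R q, z))) (at x within UNIV)"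
  proof (rule leibniz_rule_vector_derivative)
    fix x :: real and z :: 'v
    have gd: "(f has_derivative (\<lambda>v. dd v f (p + x *\<^sub>R q, z))) (at (p + x *\<^sub>R q, z))"
      by (rule smooth_on_has_derivative[OF f]) auto
    have "((\<lambda>x. (p + x *\<^sub>R q, z)) has_derivative (\<lambda>h. h *\<^sub>R (q, 0))) (at x)" by (auto intro!: derivative_eq_intros)
    from has_derivative_compose[OF this gd]
    show "((\<lambda>x. f (p + x *\<^sub>R q, z)) has_vector_derivative dd (q, 0) f (p + x *\<^sub>R q, z)) (at x within UNIV)"
      using linear_scale[OF has_derivative_linear[OF gd], of _ "(q, 0)"] by (simp add: has_vector_derivative_def)
  next
    show "(\<lambda>z. f (p + x *\<^sub>R q, z)) integrable_on cbox (- a) a" for x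
      by (rule integrable_continuous) (rule continuous_on_subset[OF continuous_slice[OF cf] subset_UNIV])
    show "continuous_on (UNIV \<times> cbox (- a) a) (\<lambda>(x, z). dd (q, 0) f (p + x *\<^sub>R q, z))"
      unfolding case_prod_unfold
      by (rule continuous_on_compose2[OF cd]) (auto intro!: continuous_intros)
  qed auto
  moreover have "(LINT z|lborel. dd (q, 0) f (y, z)) = integral (cbox (- a) a) (\<lambda>z. dd (q, 0) f (y, z))" for y
    by (rule lebesgue_eq_integral_cbox[OF _ K a d0])
      (rule continuous_on_compose2[OF cd], auto intro!: continuous_intros)
  ultimately show "((\<lambda>x. LINT z|lborel. f (p + x *\<^sub>R q, z)) has_vector_derivative (LINT z|lborel. dd (q, 0) f (p + x *\<^sub>R q, z))) (at x)"
    by (simp add: lebesgue_eq_integral_cbox[OF continuous_slice[OF cf] K a f0])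
qed

end

lemma integral_lebesgue_swap:
  fixes f :: "real \<times> 'v::euclidean_space \<Rightarrow> complex"
  assumes K: "compact K" and f0: "\<And>t z. z \<notin> K \<Longrightarrow> f (t, z) = 0" and f: "continuous_on UNIV f"
  shows "(LINT z|lborel. integral {0..1} (\<lambda>t. f (t, z))) = integral {0..1} (\<lambda>t. LINT z|lborel. f (t, z))"
proof -
  obtain a where a: "K \<subseteq> cbox (- a) a" using bounded_subset_cbox_symmetric[OF compact_imp_bounded[OF K]] by metis
  have "continuous_on (UNIV \<times> cbox 0 1) (\<lambda>(z, t). f (t, z))"
    unfolding case_prod_unfold by (rule continuous_on_compose2[OF f]) (auto intro!: continuous_intros)
  from integral_continuous_on_param[OF this] have "continuous_on UNIV (\<lambda>z. integral {0..1} (\<lambda>t. f (t, z)))" by simp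
  then have "(LINT z|lborel. integral {0..1} (\<lambda>t. f (t, z))) = integral (cbox (- a) a) (\<lambda>z. integral {0..1} (\<lambda>t. f (t, z)))"
    by (rule lebesgue_eq_integral_cbox[OF _ K a]) (simp add: f0)
  also have "\<dots> = integral {0..1} (\<lambda>t. integral (cbox (- a) a) (\<lambda>z. f (t, z)))"
  proof -
    have "continuous_on (cbox (- a, 0) (a, 1)) (\<lambda>(z, t). f (t, z))"
      unfolding case_prod_unfold by (rule continuous_on_compose2[OF f]) (auto intro!: continuous_intros)
    from integral_swap_continuous[OF this] show ?thesis by simp
  qed
  also have "\<dots> = integral {0..1} (\<lambda>t. LINT z|lborel. f (t, z))"
    by (simp add: lebesgue_eq_integral_cbox[OF continuous_slice[OF f] K a f0])
  finally show ?thesis .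
qed

section \<open>The first variation\<close>

context charged_bundle
begin

text \<open>The integrand of the one-form \<open>Th\<close> at a point, evaluated on the standard
  frame: a number that can be differentiated in the parameters of a family of metrics.\<close>

definition qd :: "(nat \<Rightarrow> complex) \<Rightarrow> ('i, 'n, 'r) metric \<Rightarrow> ('i \<Rightarrow> 'n pt \<Rightarrow> 'r mtx) \<Rightarrow> 'i \<Rightarrow> 'n pt \<Rightarrow> complex" where
  "qd c h A i z = charge_density c (\<lambda>a b. om i a b z) (\<lambda>k. U k i z) CARD('n) (\<lambda>a b. ncurv (h i) a b z) (A i z) std_frame"

text \<open>
  The one-form \<open>A \<mapsto> \<integral> tr (A D\<^sub>Z(h))\<close> on the space of metrics, for the coefficients of \<open>D\<^sub>Z\<close>.
\<close>
definition Th :: "(nat \<Rightarrow> complex) \<Rightarrow> ('i, 'n, 'r) metric \<Rightarrow> ('i \<Rightarrow> 'n pt \<Rightarrow> 'r mtx) \<Rightarrow> complex" where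
  "Th c h A = integral_over X (\<lambda>i z v. qd c h A i z)"

lemma qd_eq: "qd c h A i z = (\<Sum>(d, j, l)\<in>degree_triples CARD('n). charge_coeff c d j l *
    altz (2 * CARD('n)) (tword (A i z) (\<lambda>k a b. gfac h j k i a b z) (j + d) (U (2 * l) i z)) std_frame)"
  by (simp add: qd_def charge_density_def gfac_def)

definition metric_family :: "('p::euclidean_space \<Rightarrow> ('i, 'n, 'r) metric) \<Rightarrow> bool" where
  "metric_family G \<longleftrightarrow> (\<forall>p. hermitian_metric X E (G p)) \<and>
     (\<forall>i\<in>charts X. smooth_on (\<lambda>(p, z). G p i z) (UNIV \<times> img X i))"

definition gv :: "('p::euclidean_space \<Rightarrow> ('i, 'n, 'r) metric) \<Rightarrow> 'p \<Rightarrow> 'p \<Rightarrow> 'i \<Rightarrow> 'n pt \<Rightarrow> 'r mtx" where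
  "gv G q p i z = matrix_inv (G p i z) ** dd q (\<lambda>p. G p i z) p"

context
  fixes G :: "'p::euclidean_space \<Rightarrow> ('i, 'n, 'r) metric"
  assumes G: "metric_family G"
begin

lemma G_metric: "hermitian_metric X E (G p)"
  and G_smooth: "i \<in> charts X \<Longrightarrow> smooth_on (\<lambda>(p, z). G p i z) (UNIV \<times> img X i)"
  using G by (auto simp: metric_family_def)

lemma local_family: "i \<in> charts X \<Longrightarrow> local_family (img X i) (\<lambda>(p, z). G p i z)"
  by (intro local_family.intro open_img G_smooth)
    (auto intro: pos_def_hermitian_invertible hermitian_metricD(2)[OF G_metric])

lemma gv_lvel: "i \<in> charts X \<Longrightarrow> z \<in> img X i \<Longrightarrow> gv G q p i z = local_family.lvel (\<lambda>(p, z). G p i z) q (p, z)"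
  by (simp add: gv_def local_family.lvel_def[OF local_family] dd_param[OF open_img G_smooth, symmetric])

lemma smooth_param_G: "i \<in> charts X \<Longrightarrow> z \<in> img X i \<Longrightarrow> smooth_on (\<lambda>p. G p i z) UNIV"
  using smooth_param[OF open_img G_smooth] by fastforce

text \<open>The transition matrices do not depend on the parameter, so the derivative of the metric
  transforms like the metric, and the inverse metric removes the conjugate transpose.\<close>

lemma smooth_section_gv: "smooth_section (gv G q p)"
  unfolding smooth_section_def
proof (intro conjI ballI)
  fix i assume i: "i \<in> charts X"
  interpret local_family "img X i" "\<lambda>(p, z). G p i z" by (rule local_family[OF i])
  show "smooth_on (gv G q p i) (img X i)"
    using smooth_slice[OF S smooth_lvel] by (subst smooth_on_cong[OF S gv_lvel[OF i]]) auto
next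
  fix i j z assume ij: "i \<in> charts X" "j \<in> charts X" and z: "z \<in> overlap X i j"
  let ?g = "cmat i j z" and ?Tz = "transition X i j z"
  have zi: "z \<in> img X i" and zj: "?Tz \<in> img X j" using z overlap_subset[OF ij(1)] transition_img[OF ij z] by auto
  have inv: "invertible ?g" by (rule cmat_inverse(3)[OF ij z])
  have Gi: "G p i z = conj_transpose ?g ** G p j ?Tz ** ?g" for p by (rule hermitian_metricD(3)[OF G_metric ij z])
  have "bounded_linear (\<lambda>M. conj_transpose ?g ** M ** ?g)"
    using linear_compose[OF linear_matrix_mult(1)[of "conj_transpose ?g"] linear_matrix_mult(2)[of ?g], THEN linear_conv_bounded_linear[THEN iffD1]]
    by (simp add: o_def)
  from dd_bounded_linear[OF this open_UNIV smooth_param_G[OF ij(2) zj], of p]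
  have d: "dd q (\<lambda>p. G p i z) p = conj_transpose ?g ** dd q (\<lambda>p. G p j ?Tz) p ** ?g" unfolding Gi by simp
  have ivi: "invertible (G p i z)" and ivj: "invertible (G p j ?Tz)"
    using pos_def_hermitian_invertible hermitian_metricD(2)[OF G_metric] ij zi zj by blast+
  have "G p i z ** (matrix_inv ?g ** gv G q p j ?Tz ** ?g) = conj_transpose ?g ** G p j ?Tz ** (?g ** (matrix_inv ?g ** (gv G q p j ?Tz ** ?g)))"
    unfolding Gi by (simp add: matrix_mul_assoc)
  also have "\<dots> = conj_transpose ?g ** (G p j ?Tz ** gv G q p j ?Tz) ** ?g"
    unfolding matrix_inv_cancel(1)[OF inv] by (simp add: matrix_mul_assoc)
  also have "\<dots> = dd q (\<lambda>p. G p i z) p" unfolding gv_def matrix_inv_cancel(1)[OF ivj] d ..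
  finally show "gv G q p i z = matrix_inv ?g ** gv G q p j ?Tz ** ?g"
    unfolding gv_def[of G q p i z] using matrix_inv_cancel(2)[OF ivi] by metis
qed

lemma gfac_param:
  assumes i: "i \<in> charts X"
  shows "smooth_on (\<lambda>x. gfac (G (fst x)) j k i a b (snd x)) (UNIV \<times> img X i)"
    "z \<in> img X i \<Longrightarrow> dd q (\<lambda>p. gfac (G p) j k i a b z) p = (if k < j then dcurv (G p i) (gv G q p i) a b z else 0)"
proof -
  interpret local_family "img X i" "\<lambda>(p, z). G p i z" by (rule local_family[OF i])
  have o: "smooth_on (\<lambda>x. om i a b (snd x)) (UNIV \<times> img X i :: ('p \<times> _) set)"
    by (rule smooth_on_compose[OF O S _ smooth_om[OF i]]) (auto intro!: smooth_on_snd O)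
  show "smooth_on (\<lambda>x. gfac (G (fst x)) j k i a b (snd x)) (UNIV \<times> img X i)"
    using smooth_ncurv_param[of a b] by (cases "k < j") (simp_all add: gfac_def factors_def smooth_on_cscale[OF O o])
  assume z: "z \<in> img X i"
  show "dd q (\<lambda>p. gfac (G p) j k i a b z) p = (if k < j then dcurv (G p i) (gv G q p i) a b z else 0)"
  proof (cases "k < j")
    case True
    have "dd q (\<lambda>p. ncurv (G p i) a b z) p = dcurv (G p i) (\<lambda>z. lvel q (p, z)) a b z"
      using dd_param[OF S smooth_ncurv_param[of a b] z, where q = q and p = p] dd_ncurv_param[OF z, where q = q and p = p and u = a and v = b] by simp
    also have "\<dots> = dcurv (G p i) (gv G q p i) a b z"
      using local_metric.dcurv_cong[OF metric_slice[of p] gv_lvel[OF i, symmetric] z] by simp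
    finally show ?thesis using True by (simp add: gfac_def factors_def)
  next
    case False
    then show ?thesis by (simp add: gfac_def factors_def dd_const)
  qed
qed

lemma smooth_tword_param:
  assumes i: "i \<in> charts X"
  shows "smooth_on (\<lambda>x. tword (gv G q (fst x) i (snd x)) (\<lambda>k a b. gfac (G (fst x)) j k i a b (snd x)) J (U (2 * l) i (snd x)) w) (UNIV \<times> img X i)"
proof -
  interpret local_family "img X i" "\<lambda>(p, z). G p i z" by (rule local_family[OF i])
  have u: "smooth_on (\<lambda>x. U (2 * l) i (snd x) w) (UNIV \<times> img X i :: ('p \<times> _) set)" for w
    by (rule smooth_on_compose[OF O S _ is_formD(2)[OF is_form_U i]]) (auto intro!: smooth_on_snd O)
  have v: "smooth_on (\<lambda>x. gv G q (fst x) i (snd x)) (UNIV \<times> img X i)"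
    using smooth_lvel by (subst smooth_on_cong[OF O, where g = "lvel q"]) (auto simp: gv_lvel[OF i])
  show ?thesis
    unfolding tword_def pairprod_def
    by (intro smooth_on_mult[OF O] smooth_on_trace[OF O] smooth_on_matrix_mult[OF O] u v mprod_smooth[OF O] gfac_param(1)[OF i])
qed

lemma smooth_qd: "i \<in> charts X \<Longrightarrow> smooth_on (\<lambda>x. qd c (G (fst x)) (gv G q (fst x)) i (snd x)) (UNIV \<times> img X i)"
  unfolding qd_eq altz_def case_prod_unfold
  by (intro smooth_on_sum smooth_on_mult smooth_on_const smooth_on_scaleR open_product open_img smooth_tword_param)

lemma dd_tword_param:
  assumes i: "i \<in> charts X" and z: "z \<in> img X i"
  shows "dd q' (\<lambda>p. tword (gv G q p i z) (\<lambda>k a b. gfac (G p) j k i a b z) (j + d) u w) p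
    = tword (dd q' (\<lambda>p. gv G q p i z) p) (\<lambda>k a b. gfac (G p) j k i a b z) (j + d) u w
     + (\<Sum>a<j. tword (gv G q p i z) ((\<lambda>k a b. gfac (G p) j k i a b z)(a := \<lambda>x y. dcurv (G p i) (gv G q' p i) x y z)) (j + d) u w)"
proof -
  interpret local_family "img X i" "\<lambda>(p, z). G p i z" by (rule local_family[OF i])
  have v: "smooth_on (\<lambda>p. gv G q p i z) UNIV"
    using smooth_param[OF S smooth_lvel z] by (simp add: gv_lvel[OF i z])
  have f: "smooth_on (\<lambda>p. gfac (G p) j k i a b z) UNIV" for k a b
    using smooth_param[OF S gfac_param(1)[OF i] z] by simp
  have "dd q' (\<lambda>p. tword (gv G q p i z) (\<lambda>k a b. gfac (G p) j k i a b z) (j + d) u w) p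
    = tword (dd q' (\<lambda>p. gv G q p i z) p) (\<lambda>k a b. gfac (G p) j k i a b z) (j + d) u w
     + (\<Sum>a<j + d. tword (gv G q p i z) ((\<lambda>k a b. gfac (G p) j k i a b z)(a := \<lambda>x y. dd q' (\<lambda>p. gfac (G p) j a i x y z) p)) (j + d) u w)"
    by (rule dd_tword[OF v f])
  also have "(\<Sum>a<j + d. tword (gv G q p i z) ((\<lambda>k a b. gfac (G p) j k i a b z)(a := \<lambda>x y. dd q' (\<lambda>p. gfac (G p) j a i x y z) p)) (j + d) u w)
    = (\<Sum>a<j. tword (gv G q p i z) ((\<lambda>k a b. gfac (G p) j k i a b z)(a := \<lambda>x y. dcurv (G p i) (gv G q' p i) x y z)) (j + d) u w)"
    unfolding gfac_param(2)[OF i z]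
    by (rule sum.mono_neutral_cong_right) (auto simp: tword_upd linear_0[OF linear_trace])
  finally show ?thesis .
qed

text \<open>The two summands of \<open>cword\<close> arise from the Maurer-Cartan commutator of the
  two velocities and from the variation of the curvature; \<omega> and U are independent of the
  parameters.\<close>

lemma dd_qd:
  assumes i: "i \<in> charts X" and z: "z \<in> img X i"
  shows "dd q' (\<lambda>p. qd c (G p) (gv G q p) i z) p - dd q (\<lambda>p. qd c (G p) (gv G q' p) i z) p
    = cdens c (G p) (gv G q p) (gv G q' p) i z std_frame"
proof -
  interpret local_family "img X i" "\<lambda>(p, z). G p i z" by (rule local_family[OF i])
  define t where "t q j d l w p = tword (gv G q p i z) (\<lambda>k a b. gfac (G p) j k i a b z) (j + d) (U (2 * l) i z) w" for q j d l w p
  have st: "smooth_on (t q j d l w) UNIV" for q j d l w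
    using smooth_param[OF S smooth_tword_param[OF i] z] by (simp add: t_def[abs_def])
  have dt: "((\<lambda>p. \<Sum>(d, j, l)\<in>degree_triples CARD('n). charge_coeff c d j l * altz (2 * CARD('n)) (\<lambda>w. t q j d l w p) std_frame) has_derivative
      (\<lambda>v. \<Sum>(d, j, l)\<in>degree_triples CARD('n). charge_coeff c d j l * altz (2 * CARD('n)) (\<lambda>w. dd v (t q j d l w) p) std_frame)) (at p)" for q
    unfolding altz_def case_prod_unfold
    by (intro has_derivative_sum has_derivative_mult_right has_derivative_scaleR_right smooth_on_has_derivative[OF st]) auto
  have d: "dd q' (\<lambda>p. qd c (G p) (gv G q p) i z) p
     = (\<Sum>(d, j, l)\<in>degree_triples CARD('n). charge_coeff c d j l * altz (2 * CARD('n)) (\<lambda>w. dd q' (t q j d l w) p) std_frame)" for q q'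
    using dd_eq[OF dt] unfolding qd_eq t_def by simp
  have com: "dd q' (\<lambda>p. gv G q p i z) p - dd q (\<lambda>p. gv G q' p i z) p = gv G q p i z ** gv G q' p i z - gv G q' p i z ** gv G q p i z"
    using lvel_commutator[OF z, where q' = q' and q = q and p = p] dd_param[OF S smooth_lvel z] by (simp add: gv_lvel[OF i z])
  have tw: "tword M Fs J u w - tword M' Fs J u w = tword (M - M') Fs J u w" for M M' :: "'r mtx" and Fs J and u :: "(nat \<Rightarrow> 'n pt) \<Rightarrow> complex" and w
    by (simp add: tword_def matrix_distribs trace_sub ring_distribs)
  have "dd q' (t q j d l w) p - dd q (t q' j d l w) p = local_forms.cword (G p i) (om i) (U (2 * l) i) j d (gv G q p i) (gv G q' p i) z w"
    for j d l w
  proof -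
    have lf: "local_forms (img X i) (G p i) (om i) (U (2 * l) i) l" by (rule local_forms[OF i local_metric[OF G_metric i]])
    have f: "factors (\<lambda>a b. ncurv (G p i) a b z) (\<lambda>a b. om i a b z) j = (\<lambda>k a b. gfac (G p) j k i a b z)"
      by (simp add: gfac_def fun_eq_iff)
    show ?thesis
      unfolding t_def dd_tword_param[OF i z] local_forms.cword_def[OF lf] f sum_subtractf com[symmetric] tw[symmetric] by simp
  qed
  then show ?thesis
    unfolding d cdens_def sum_subtractf[symmetric]
    by (intro sum.cong refl) (auto simp: altz_diff[symmetric] simp flip: right_diff_distrib)
qed

end

end

section \<open>Path independence\<close>

context charged_bundle
begin

definition supp :: "'i \<Rightarrow> ('n pt) set" where "supp k = chart X k ` closure {x. pou k x \<noteq> 0}"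

lemma supp: assumes k: "k \<in> charts X" shows "compact (supp k)" "supp k \<subseteq> img X k"
  unfolding supp_def using compact_chart_image[OF k closed_closure pou_support[OF k]] .

lemma pou_0: "k \<in> charts X \<Longrightarrow> z \<in> img X k \<Longrightarrow> z \<notin> supp k \<Longrightarrow> pou k (chart_inv X k z) = 0"
  using chart_image_iff[OF _ pou_support, of k z] closure_subset[of "{x. pou k x \<noteq> 0}"] by (auto simp: supp_def)

context
  fixes G :: "'p::euclidean_space \<Rightarrow> ('i, 'n, 'r) metric" and c :: "nat \<Rightarrow> complex"
  assumes G: "metric_family G"
begin

text \<open>A summand of the integral over X, extended by zero. For charts k in the atlas it is
  smooth in all variables and supported over a compact set that does not depend on the
  parameter.\<close>

definition qk :: "'p \<Rightarrow> 'i \<Rightarrow> 'p \<times> ('n pt) \<Rightarrow> complex" where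
  "qk q k x = (if snd x \<in> img X k then pou k (chart_inv X k (snd x)) *\<^sub>R qd c (G (fst x)) (gv G q (fst x)) k (snd x) else 0)"

lemma qk_0: "k \<in> charts X \<Longrightarrow> z \<notin> supp k \<Longrightarrow> qk q k (p, z) = 0"
  by (simp add: qk_def pou_0)

lemma smooth_qk:
  assumes k: "k \<in> charts X"
  shows "smooth_on (qk q k) UNIV"
proof -
  let ?f = "\<lambda>x. pou k (chart_inv X k (snd x)) *\<^sub>R qd c (G (fst x)) (gv G q (fst x)) k (snd x)"
  note O = open_product[OF open_img[OF k]]
  have "smooth_on (\<lambda>x. pou k (chart_inv X k (snd x))) (UNIV \<times> img X k :: ('p \<times> _) set)"
    by (rule smooth_on_compose[OF O open_img[OF k] _ smooth_pou[OF k k]]) (auto intro!: smooth_on_snd O)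
  then have "smooth_on ?f (UNIV \<times> img X k)" by (intro smooth_on_scaleR O smooth_qd[OF G k])
  moreover have "closed (UNIV \<times> supp k :: ('p \<times> _) set)" by (intro closed_Times closed_UNIV compact_imp_closed supp k)
  moreover have "?f x = 0" if "x \<in> UNIV \<times> img X k - UNIV \<times> supp k" for x
    using pou_0[OF k, of "snd x"] that by (cases x) auto
  ultimately have "smooth_on (\<lambda>x. if x \<in> UNIV \<times> img X k then ?f x else 0) UNIV"
    using smooth_on_extend_by_zero[OF O, of ?f "UNIV \<times> supp k"] supp(2)[OF k] by blast
  moreover have "(\<lambda>x. if x \<in> UNIV \<times> img X k then ?f x else 0) = qk q k" by (auto simp: qk_def fun_eq_iff)
  ultimately show ?thesis by simp
qed

lemma Th_qk: "Th c (G p) (gv G q p) = (\<Sum>k\<in>pouset. LINT z|lborel. qk q k (p, z))"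
  by (simp add: Th_def integral_over_pou qk_def cong: if_cong)

lemma dd_qk:
  assumes k: "k \<in> charts X"
  shows "dd (q', 0) (qk q k) (p, z) =
    (if z \<in> img X k then pou k (chart_inv X k z) *\<^sub>R dd q' (\<lambda>p. qd c (G p) (gv G q p) k z) p else 0)"
proof -
  have "dd (q', 0) (qk q k) (p, z) = dd q' (\<lambda>p. qk q k (p, z)) p"
    using dd_param[where S = UNIV and F = "qk q k" and z = z and q = q' and p = p] smooth_qk[OF k] by simp
  also have "\<dots> = (if z \<in> img X k then pou k (chart_inv X k z) *\<^sub>R dd q' (\<lambda>p. qd c (G p) (gv G q p) k z) p else 0)"
  proof (cases "z \<in> img X k")
    case True
    have "smooth_on (\<lambda>p. qd c (G p) (gv G q p) k z) UNIV"
      using smooth_param[OF open_img[OF k] smooth_qd[OF G k] True] by simp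
    from dd_bounded_linear[OF bounded_linear_scaleR_right open_UNIV this] True show ?thesis by (simp add: qk_def)
  next
    case False
    then show ?thesis by (simp add: qk_def dd_const)
  qed
  finally show ?thesis .
qed

definition dTh :: "'p \<Rightarrow> 'p \<Rightarrow> 'p \<Rightarrow> complex" where
  "dTh q q' p = (\<Sum>k\<in>pouset. LINT z|lborel. dd (q', 0) (qk q k) (p, z))"

lemma dd_qk_0: "k \<in> charts X \<Longrightarrow> z \<notin> supp k \<Longrightarrow> dd (q', 0) (qk q k) (p, z) = 0"
  by (rule has_vector_derivative_lebesgue_param(2)[where f = "qk q k" and K = "supp k"]) (auto simp: supp(1) qk_0 smooth_qk)

lemma continuous_Th: "continuous_on UNIV (\<lambda>p. Th c (G p) (gv G q p))"
  unfolding Th_qk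
proof (rule continuous_on_sum)
  fix k assume "k \<in> pouset"
  then have k: "k \<in> charts X" by (rule pouset_charts)
  show "continuous_on UNIV (\<lambda>p. LINT z|lborel. qk q k (p, z))"
    by (rule continuous_on_lebesgue_param[where f = "qk q k", OF supp(1)[OF k] qk_0[OF k] smooth_on_continuous[OF smooth_qk[OF k]]])
qed

lemma continuous_dTh: "continuous_on UNIV (dTh q q')"
  unfolding dTh_def[abs_def]
proof (rule continuous_on_sum)
  fix k assume "k \<in> pouset"
  then have k: "k \<in> charts X" by (rule pouset_charts)
  show "continuous_on UNIV (\<lambda>p. LINT z|lborel. dd (q', 0) (qk q k) (p, z))"
    by (rule continuous_on_lebesgue_param[where f = "dd (q', 0) (qk q k)", OF supp(1)[OF k] dd_qk_0[OF k] smooth_on_continuous[OF smooth_on_dd[OF smooth_qk[OF k]]]])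
qed

lemma Th_deriv: "((\<lambda>x. Th c (G (p + x *\<^sub>R q')) (gv G q (p + x *\<^sub>R q'))) has_vector_derivative dTh q q' (p + x *\<^sub>R q')) (at x)"
  unfolding Th_qk dTh_def
proof (rule has_vector_derivative_sum)
  fix k assume "k \<in> pouset"
  then have k: "k \<in> charts X" by (rule pouset_charts)
  show "((\<lambda>x. LINT z|lborel. qk q k (p + x *\<^sub>R q', z)) has_vector_derivative (LINT z|lborel. dd (q', 0) (qk q k) (p + x *\<^sub>R q', z))) (at x)"
    by (rule has_vector_derivative_lebesgue_param(1)[where f = "qk q k", OF supp(1)[OF k] qk_0[OF k] smooth_qk[OF k]])
qed

text \<open>Closedness of the one-form, in the shape in which it is used: the difference of the
  mixed derivatives is the integral of \<open>cdens\<close>.\<close>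

lemma dTh_sym: "dTh q q' p = dTh q' q p"
proof -
  have int: "integrable lborel (\<lambda>z. dd (q', 0) (qk q k) (p, z))" if k: "k \<in> charts X" for k q q'
    by (rule integrable_compact_support[where f = "\<lambda>z. dd (q', 0) (qk q k) (p, z)", OF continuous_slice supp(1)[OF k] dd_qk_0[OF k]])
      (rule smooth_on_continuous[OF smooth_on_dd[OF smooth_qk[OF k]]])
  have "dTh q q' p - dTh q' q p = (\<Sum>k\<in>pouset. LINT z|lborel. dd (q', 0) (qk q k) (p, z) - dd (q, 0) (qk q' k) (p, z))"
    unfolding dTh_def sum_subtractf[symmetric]
    by (intro sum.cong refl Bochner_Integration.integral_diff[symmetric] int pouset_charts)
  also have "\<dots> = integral_over X (cdens c (G p) (gv G q p) (gv G q' p))"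
    unfolding integral_over_pou
  proof (intro sum.cong refl Bochner_Integration.integral_cong)
    fix k z assume "k \<in> pouset"
    then have k: "k \<in> charts X" by (rule pouset_charts)
    show "dd (q', 0) (qk q k) (p, z) - dd (q, 0) (qk q' k) (p, z)
      = (if z \<in> img X k then pou k (chart_inv X k z) *\<^sub>R cdens c (G p) (gv G q p) (gv G q' p) k z std_frame else 0)"
      by (simp add: dd_qk[OF k] scaleR_diff_right[symmetric] dd_qd[OF G k])
  qed
  also have "\<dots> = 0" by (rule integral_cdens[OF G_metric[OF G] smooth_section_gv[OF G] smooth_section_gv[OF G]])
  finally show ?thesis by simp
qed

end

lemma Th_cong:
  assumes "\<And>i z. i \<in> charts X \<Longrightarrow> z \<in> img X i \<Longrightarrow> h i z = h' i z" "\<And>i z. i \<in> charts X \<Longrightarrow> z \<in> img X i \<Longrightarrow> A i z = A' i z"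
  shows "Th c h A = Th c h' A'"
  unfolding Th_def
proof (rule integral_over_cong)
  fix i z assume i: "i \<in> charts X" and z: "z \<in> img X i"
  note S = open_img[OF i]
  have "theta (h i) v y = theta (h' i) v y" if "y \<in> img X i" for v y
    unfolding theta_def using D_cong(1)[OF S that assms(1)[OF i]] assms(1)[OF i that] by simp
  then have "gcurv (h i) a b z = gcurv (h' i) a b z" for a b
    unfolding gcurv_def by (rule D_cong(2)[OF S z])
  then show "qd c h A i z = qd c h' A' i z" unfolding qd_def ncurv_def using assms(2)[OF i z] by simp
qed

lemma Th_zero: "Th c h (\<lambda>i z. 0) = 0"
proof -
  have "tword (0 :: 'r mtx) Fs J u = (\<lambda>w. 0)" for Fs J and u :: "(nat \<Rightarrow> 'n pt) \<Rightarrow> complex"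
    by (simp add: fun_eq_iff tword_def linear_0[OF linear_trace])
  then have "qd c h (\<lambda>i z. 0) i z = 0" for i z
    by (simp add: qd_def charge_density_def altz_zero case_prod_unfold)
  then show ?thesis unfolding Th_def integral_over_pou by (simp cong: if_cong)
qed

text \<open>Stokes on the square: the s-derivative of the integral of \<Theta> in direction t is, by
  symmetry, the integral of the t-derivative of \<Theta> in direction s, hence a difference of
  boundary values.\<close>

lemma variation:
  fixes G :: "real \<times> real \<Rightarrow> ('i, 'n, 'r) metric"
  assumes G: "metric_family G"
  shows "((\<lambda>s. integral {0..1} (\<lambda>t. Th c (G (s, t)) (gv G (0, 1) (s, t)))) has_vector_derivative
    Th c (G (s, 1)) (gv G (1, 0) (s, 1)) - Th c (G (s, 0)) (gv G (1, 0) (s, 0))) (at s)"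
proof -
  have "((\<lambda>s. integral (cbox 0 1) (\<lambda>t. Th c (G (s, t)) (gv G (0, 1) (s, t)))) has_vector_derivative
    integral (cbox 0 1) (\<lambda>t. dTh G c (0, 1) (1, 0) (s, t))) (at s within UNIV)"
  proof (rule leibniz_rule_vector_derivative)
    show "((\<lambda>s. Th c (G (s, t)) (gv G (0, 1) (s, t))) has_vector_derivative dTh G c (0, 1) (1, 0) (s, t)) (at s within UNIV)" for s t
      using Th_deriv[OF G, where p = "(0, t)" and q' = "(1, 0)" and q = "(0, 1)" and x = s] by simp
    show "(\<lambda>t. Th c (G (s, t)) (gv G (0, 1) (s, t))) integrable_on cbox 0 1" for s
      by (rule integrable_continuous) (rule continuous_on_compose2[OF continuous_Th[OF G]], auto intro!: continuous_intros)
    show "continuous_on (UNIV \<times> cbox 0 1) (\<lambda>(s, t). dTh G c (0, 1) (1, 0) (s, t))"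
      using continuous_on_subset[OF continuous_dTh[OF G]] by simp
  qed auto
  moreover have "((\<lambda>t. dTh G c (0, 1) (1, 0) (s, t)) has_integral
      Th c (G (s, 1)) (gv G (1, 0) (s, 1)) - Th c (G (s, 0)) (gv G (1, 0) (s, 0))) {0..1}"
  proof (rule fundamental_theorem_of_calculus)
    fix t :: real
    show "((\<lambda>t. Th c (G (s, t)) (gv G (1, 0) (s, t))) has_vector_derivative dTh G c (0, 1) (1, 0) (s, t)) (at t within {0..1})"
      using Th_deriv[OF G, where p = "(s, 0)" and q' = "(0, 1)" and q = "(1, 0)" and x = t and c = c]
      unfolding dTh_sym[OF G, of c "(1, 0)" "(0, 1)"] by (auto intro: has_vector_derivative_at_within)
  qed simp
  ultimately show ?thesis by (simp add: integral_unique)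
qed

section \<open>Reparametrisation and interpolation of families of metrics\<close>

lemma metric_family_compose:
  assumes G: "metric_family G" and r: "smooth_on r UNIV"
  shows "metric_family (\<lambda>q. G (r q))"
  unfolding metric_family_def
proof (intro conjI allI ballI G_metric[OF G])
  fix i assume i: "i \<in> charts X"
  note O = open_product[OF open_img[OF i]]
  have "smooth_on (\<lambda>x. r (fst x)) (UNIV \<times> img X i)"
    by (rule smooth_on_compose[OF O open_UNIV _ r]) (auto intro!: smooth_on_fst O)
  then have "smooth_on (\<lambda>x. (\<lambda>(p, z). G p i z) (r (fst x), snd x)) (UNIV \<times> img X i)"
    by (intro smooth_on_compose[OF O O _ G_smooth[OF G i]]) (auto intro!: smooth_on_Pair smooth_on_snd O)
  then show "smooth_on (\<lambda>(q, z). G (r q) i z) (UNIV \<times> img X i)" by (simp add: case_prod_unfold)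
qed

lemma metric_family_const:
  assumes h: "hermitian_metric X E h"
  shows "metric_family (\<lambda>p::'p::euclidean_space. h)"
  unfolding metric_family_def case_prod_unfold
proof (intro conjI allI ballI h)
  fix i assume i: "i \<in> charts X"
  note O = open_product[OF open_img[OF i]]
  show "smooth_on (\<lambda>x. h i (snd x)) (UNIV \<times> img X i :: ('p \<times> _) set)"
    by (rule smooth_on_compose[OF O open_img[OF i] _ hermitian_metricD(1)[OF h i]]) (auto intro!: smooth_on_snd O)
qed

lemma hermitian_metric_convex:
  assumes h: "hermitian_metric X E h" and k: "hermitian_metric X E k" and f: "0 \<le> f" "f \<le> 1"
  shows "hermitian_metric X E (\<lambda>i z. (1 - f) *\<^sub>R h i z + f *\<^sub>R k i z)"
  unfolding hermitian_metric_def Let_def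
proof (intro conjI ballI)
  fix i assume i: "i \<in> charts X"
  show "smooth_on (\<lambda>z. (1 - f) *\<^sub>R h i z + f *\<^sub>R k i z) (img X i)"
    by (intro smooth_on_add smooth_on_scaleR smooth_on_const open_img i hermitian_metricD(1)[OF h] hermitian_metricD(1)[OF k])
  fix z assume z: "z \<in> img X i"
  note hz = hermitian_metricD(2)[OF h i z, unfolded pos_def_hermitian_def] and kz = hermitian_metricD(2)[OF k i z, unfolded pos_def_hermitian_def]
  show "pos_def_hermitian ((1 - f) *\<^sub>R h i z + f *\<^sub>R k i z)"
    unfolding pos_def_hermitian_def
  proof (intro conjI allI impI)
    show "conj_transpose ((1 - f) *\<^sub>R h i z + f *\<^sub>R k i z) = (1 - f) *\<^sub>R h i z + f *\<^sub>R k i z"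
      using hz kz by (simp add: linear_add[OF linear_conj_transpose] linear_scale[OF linear_conj_transpose])
    fix \<xi> :: "complex^'r" assume \<xi>: "\<xi> \<noteq> 0"
    define Q where "Q A = Re (\<Sum>a\<in>UNIV. \<Sum>b\<in>UNIV. cnj (\<xi> $ a) * A $ a $ b * \<xi> $ b)" for A :: "'r mtx"
    have "Q ((1 - f) *\<^sub>R h i z + f *\<^sub>R k i z) = (1 - f) * Q (h i z) + f * Q (k i z)"
    proof -
      have "(\<Sum>a\<in>UNIV. \<Sum>b\<in>UNIV. cnj (\<xi> $ a) * ((1 - f) *\<^sub>R h i z + f *\<^sub>R k i z) $ a $ b * \<xi> $ b)
        = (1 - f) *\<^sub>R (\<Sum>a\<in>UNIV. \<Sum>b\<in>UNIV. cnj (\<xi> $ a) * h i z $ a $ b * \<xi> $ b)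
          + f *\<^sub>R (\<Sum>a\<in>UNIV. \<Sum>b\<in>UNIV. cnj (\<xi> $ a) * k i z $ a $ b * \<xi> $ b)"
        unfolding scaleR_sum_right sum.distrib[symmetric]
        by (intro sum.cong refl) (simp add: scaleR_conv_of_real[where 'a = complex] algebra_simps)
      then show ?thesis by (simp add: Q_def)
    qed
    moreover have "0 < Q (h i z)" "0 < Q (k i z)" using hz kz \<xi> by (auto simp: Q_def)
    moreover have "0 < (1 - f) * a + f * b" if "0 < a" "0 < b" for a b :: real
      using that f by (cases "f = 0") (auto intro!: add_nonneg_pos)
    ultimately show "0 < Re (\<Sum>a\<in>UNIV. \<Sum>b\<in>UNIV. cnj (\<xi> $ a) * ((1 - f) *\<^sub>R h i z + f *\<^sub>R k i z) $ a $ b * \<xi> $ b)"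
      unfolding Q_def by simp
  qed
next
  fix i j z assume ij: "i \<in> charts X" "j \<in> charts X" and z: "z \<in> overlap X i j"
  show "(1 - f) *\<^sub>R h i z + f *\<^sub>R k i z =
    conj_transpose (cmat i j z) ** ((1 - f) *\<^sub>R h j (transition X i j z) + f *\<^sub>R k j (transition X i j z)) ** cmat i j z"
    unfolding hermitian_metricD(3)[OF h ij z] hermitian_metricD(3)[OF k ij z] by (simp add: matrix_distribs scaleR_matrix_mult)
qed

lemma metric_family_convex:
  assumes G: "metric_family G" and G': "metric_family G'" and f: "smooth_on f UNIV" "\<And>p. 0 \<le> f p" "\<And>p. f p \<le> 1"
  shows "metric_family (\<lambda>p i z. (1 - f p) *\<^sub>R G p i z + f p *\<^sub>R G' p i z)"
  unfolding metric_family_def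
proof (intro conjI allI ballI hermitian_metric_convex G_metric[OF G] G_metric[OF G'] f)
  fix i assume i: "i \<in> charts X"
  note O = open_product[OF open_img[OF i]]
  have "smooth_on (\<lambda>x. f (fst x)) (UNIV \<times> img X i)"
    by (rule smooth_on_compose[OF O open_UNIV _ f(1)]) (auto intro!: smooth_on_fst O)
  then have "smooth_on (\<lambda>x. (1 - f (fst x)) *\<^sub>R (\<lambda>(p, z). G p i z) x + f (fst x) *\<^sub>R (\<lambda>(p, z). G' p i z) x) (UNIV \<times> img X i)"
    by (intro smooth_on_add smooth_on_scaleR smooth_on_diff smooth_on_const O G_smooth[OF G i] G_smooth[OF G' i])
  then show "smooth_on (\<lambda>(p, z). (1 - f p) *\<^sub>R G p i z + f p *\<^sub>R G' p i z) (UNIV \<times> img X i)"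
    by (simp add: case_prod_unfold)
qed

definition mc :: "(nat \<Rightarrow> complex) \<Rightarrow> nat \<Rightarrow> complex" where
  "mc \<rho> d = complex_of_real (Im (cis (- phase X E \<omega> \<rho> U) * \<rho> d))"

lemma metric_curve_iff: "metric_curve X E \<gamma> \<longleftrightarrow> metric_family \<gamma>"
  by (simp add: metric_curve_def metric_family_def)

lemma velocity_gv:
  assumes \<gamma>: "metric_family \<gamma>" and i: "i \<in> charts X" and z: "z \<in> img X i"
  shows "velocity \<gamma> t i z = gv \<gamma> 1 t i z"
proof -
  note d = smooth_on_has_derivative[OF smooth_param_G[OF \<gamma> i z] open_UNIV UNIV_I]
  have L: "(\<lambda>v. dd v (\<lambda>t. \<gamma> t i z) t) = (\<lambda>v. v *\<^sub>R dd 1 (\<lambda>t. \<gamma> t i z) t)"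
    using linear_scale[OF has_derivative_linear[OF d[of t]], of _ 1] unfolding real_scaleR_def mult_1_right by (rule ext)
  have "((\<lambda>t. \<gamma> t i z) has_vector_derivative dd 1 (\<lambda>t. \<gamma> t i z) t) (at t)"
    unfolding has_vector_derivative_def by (rule has_derivative_eq_rhs[OF d[of t] L])
  then show ?thesis by (simp add: velocity_def gv_def vector_derivative_at)
qed

lemma U_local: "i \<in> charts X \<Longrightarrow> z \<in> img X i \<Longrightarrow> (\<And>m. m < k \<Longrightarrow> w m = w' m) \<Longrightarrow> U k i z w = U k i z w'"
  using is_formD(1)[OF is_form_U, of i z k] unfolding alternating_def by blast

text \<open>Interchanging the integrals over the path and over X turns the functional into the path
  integral of the one-form \<open>Th\<close>.\<close>

lemma M_Z_along_eq:
  assumes \<gamma>: "metric_family \<gamma>"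
  shows "M_Z_along X E \<omega> \<rho> U \<gamma> = integral {0..1} (\<lambda>t. Th (mc \<rho>) (\<gamma> t) (gv \<gamma> 1 t))"
proof -
  have q: "trace (charge_form (mc \<rho>) (\<omega> i) (\<lambda>k. U k i) (\<lambda>k. bott_chern \<gamma> k i) z std_frame)
      = integral {0..1} (\<lambda>t. qd (mc \<rho>) (\<gamma> t) (gv \<gamma> 1 t) i z)"
    if i: "i \<in> charts X" and z: "z \<in> img X i" for i z
  proof -
    interpret local_family "img X i" "\<lambda>(p, z). \<gamma> p i z" by (rule local_family[OF \<gamma> i])
    note c = smooth_on_continuous[THEN continuous_on_subset, OF _ subset_UNIV]
    have "trace (charge_form (mc \<rho>) (\<omega> i) (\<lambda>k. U k i) (\<lambda>k. bott_chern \<gamma> k i) z std_frame)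
      = integral {0..1} (\<lambda>t. charge_density (mc \<rho>) (\<lambda>a b. om i a b z) (\<lambda>k. U k i z) CARD('n) (\<lambda>a b. ncurv (\<gamma> t i) a b z) (velocity \<gamma> t i z) std_frame)"
    proof (rule trace_charge_form_integral[where F = "\<lambda>t. normalized_curvature (\<gamma> t i)" and V = "\<lambda>t. velocity \<gamma> t i"])
      show "\<omega> i z w = om i (w 0) (w (Suc 0)) z" for w by (rule omega_eq[OF i z])
      show "U k i z w = U k i z w'" if "\<And>m. m < k \<Longrightarrow> w m = w' m" for k w w' using U_local[OF i z that] .
      show "normalized_curvature (\<gamma> t i) z w = ncurv (\<gamma> t i) (w 0) (w (Suc 0)) z" for t w
        by (rule local_metric.normalized_curvature_eq[OF local_metric[OF G_metric[OF \<gamma>] i] z])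
      show "continuous_on {0..1} (\<lambda>t. ncurv (\<gamma> t i) a b z)" for a b
        using c[OF smooth_param[OF S smooth_ncurv_param[of a b] z]] by simp
      show "continuous_on {0..1} (\<lambda>t. velocity \<gamma> t i z)"
        using c[OF smooth_param[OF S smooth_lvel z, of 1]] by (simp add: velocity_gv[OF \<gamma> i z] gv_lvel[OF \<gamma> i z])
      show "bott_chern \<gamma> j i z w = integral {0..1} (\<lambda>t. sym_product ((0, \<lambda>y w. velocity \<gamma> t i y) # replicate j (2, normalized_curvature (\<gamma> t i))) z w)" for j w
        by (simp add: bott_chern_def)
    qed
    then show ?thesis by (simp add: qd_def velocity_gv[OF \<gamma> i z])
  qed
  note k' = pouset_charts
  have "M_Z_along X E \<omega> \<rho> U \<gamma> = (\<Sum>k\<in>pouset. LINT z|lborel. integral {0..1} (\<lambda>t. qk \<gamma> (mc \<rho>) 1 k (t, z)))"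
    unfolding M_Z_along_def mc_def[symmetric] integral_over_pou
  proof (intro sum.cong refl Bochner_Integration.integral_cong)
    fix k z assume "k \<in> pouset"
    then have k: "k \<in> charts X" by (rule pouset_charts)
    show "(if z \<in> img X k then pou k (chart_inv X k z) *\<^sub>R trace (charge_form (mc \<rho>) (\<omega> k) (\<lambda>j. U j k) (\<lambda>j. bott_chern \<gamma> j k) z std_frame) else 0)
      = integral {0..1} (\<lambda>t. qk \<gamma> (mc \<rho>) 1 k (t, z))"
      by (simp add: qk_def[OF \<gamma>] q[OF k])
  qed
  also have "\<dots> = (\<Sum>k\<in>pouset. integral {0..1} (\<lambda>t. LINT z|lborel. qk \<gamma> (mc \<rho>) 1 k (t, z)))"
  proof (intro sum.cong refl)
    fix k assume "k \<in> pouset"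
    then have k: "k \<in> charts X" by (rule pouset_charts)
    show "(LINT z|lborel. integral {0..1} (\<lambda>t. qk \<gamma> (mc \<rho>) 1 k (t, z))) = integral {0..1} (\<lambda>t. LINT z|lborel. qk \<gamma> (mc \<rho>) 1 k (t, z))"
      by (rule integral_lebesgue_swap[OF supp(1)[OF k] qk_0[OF \<gamma> k] smooth_on_continuous[OF smooth_qk[OF \<gamma> k]]])
  qed
  also have "\<dots> = integral {0..1} (\<lambda>t. \<Sum>k\<in>pouset. LINT z|lborel. qk \<gamma> (mc \<rho>) 1 k (t, z))"
  proof (rule integral_sum[symmetric, OF finite_pouset])
    fix k assume "k \<in> pouset"
    then have k: "k \<in> charts X" by (rule pouset_charts)
    have "continuous_on UNIV (\<lambda>t. LINT z|lborel. qk \<gamma> (mc \<rho>) 1 k (t, z))"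
      by (rule continuous_on_lebesgue_param[where f = "qk \<gamma> (mc \<rho>) 1 k", OF supp(1)[OF k] qk_0[OF \<gamma> k] smooth_on_continuous[OF smooth_qk[OF \<gamma> k]]])
    then show "(\<lambda>t. LINT z|lborel. qk \<gamma> (mc \<rho>) 1 k (t, z)) integrable_on {0..1}"
      by (intro integrable_continuous_interval) (rule continuous_on_subset, auto)
  qed
  finally show ?thesis by (simp add: Th_qk[OF \<gamma>])
qed

lemma gv_slice:
  fixes G :: "real \<times> real \<Rightarrow> ('i, 'n, 'r) metric"
  assumes G: "metric_family G" and i: "i \<in> charts X" and z: "z \<in> img X i"
  shows "gv (\<lambda>t. G (s, t)) 1 t i z = gv G (0, 1) (s, t) i z" "gv G (1, 0) (s, t) i z = gv (\<lambda>s. G (s, t)) 1 s i z"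
proof -
  have sm: "smooth_on (\<lambda>p. G p i z) (UNIV \<times> UNIV)" using smooth_param_G[OF G i z] by simp
  show "gv (\<lambda>t. G (s, t)) 1 t i z = gv G (0, 1) (s, t) i z" "gv G (1, 0) (s, t) i z = gv (\<lambda>s. G (s, t)) 1 s i z"
    unfolding gv_def dd_slice[OF open_UNIV sm UNIV_I] dd_param[OF open_UNIV sm UNIV_I] by (rule refl)+
qed

lemma gv_const: "(\<And>p. G p i z = C) \<Longrightarrow> gv G q p i z = 0"
  by (simp add: gv_def dd_const)

lemma variation_M_Z_along:
  fixes G :: "real \<times> real \<Rightarrow> ('i, 'n, 'r) metric"
  assumes G: "metric_family G"
  shows "((\<lambda>s. M_Z_along X E \<omega> \<rho> U (\<lambda>t. G (s, t))) has_vector_derivative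
    Th (mc \<rho>) (G (s, 1)) (gv (\<lambda>s. G (s, 1)) 1 s) - Th (mc \<rho>) (G (s, 0)) (gv (\<lambda>s. G (s, 0)) 1 s)) (at s)"
proof -
  have "smooth_on (Pair s) UNIV" for s :: real by (intro smooth_on_Pair) auto
  from M_Z_along_eq[OF metric_family_compose[OF G this]]
  have "M_Z_along X E \<omega> \<rho> U (\<lambda>t. G (s, t)) = integral {0..1} (\<lambda>t. Th (mc \<rho>) (G (s, t)) (gv (\<lambda>t. G (s, t)) 1 t))" for s .
  also have "Th (mc \<rho>) (G (s, t)) (gv (\<lambda>t. G (s, t)) 1 t) = Th (mc \<rho>) (G (s, t)) (gv G (0, 1) (s, t))" for s t
    by (rule Th_cong) (auto simp: gv_slice(1)[OF G])
  moreover have "Th (mc \<rho>) (G (s, t)) (gv G (1, 0) (s, t)) = Th (mc \<rho>) (G (s, t)) (gv (\<lambda>s. G (s, t)) 1 s)" for s t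
    by (rule Th_cong) (auto simp: gv_slice(2)[OF G])
  ultimately show ?thesis using variation[OF G, of "mc \<rho>" s] by simp
qed

lemma Th_gv_const:
  assumes "\<And>s i z. i \<in> charts X \<Longrightarrow> z \<in> img X i \<Longrightarrow> G s i z = C i z"
  shows "Th c h (gv G q s) = 0"
proof -
  have "Th c h (gv G q s) = Th c h (\<lambda>i z. 0)"
    by (rule Th_cong) (auto intro!: gv_const assms)
  then show ?thesis by (simp add: Th_zero)
qed

text \<open>Families of metrics are parametrised by whole Euclidean spaces, so a convex
  interpolation needs a smooth weight that stays in the unit interval on the whole line and equals 0
  at 0 and 1 at 1. This is the square of sin(2 arctan t).\<close>

definition chi :: "real \<Rightarrow> real" where "chi t = (2 * t / (1 + t\<^sup>2))\<^sup>2"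

lemma chi: "chi 0 = 0" "chi 1 = 1" "0 \<le> chi t" "chi t \<le> 1"
proof -
  have pos: "0 < 1 + t\<^sup>2" by (simp add: add_pos_nonneg)
  have "\<bar>2 * t\<bar> \<le> 1 + t\<^sup>2" using zero_le_power2[of "1 - \<bar>t\<bar>"] by (simp add: power2_diff abs_mult)
  then have "\<bar>2 * t / (1 + t\<^sup>2)\<bar> \<le> 1" using pos by (simp add: abs_divide)
  then show "chi t \<le> 1" unfolding chi_def by (rule abs_square_le_1[THEN iffD2])
qed (simp_all add: chi_def)

lemma smooth_chi: "smooth_on chi UNIV"
proof -
  have "1 + t\<^sup>2 \<noteq> 0" for t :: real using zero_le_power2[of t] by linarith
  then show ?thesis
    unfolding chi_def[abs_def]
    by (intro smooth_on_power smooth_on_divide smooth_on_mult smooth_on_add smooth_on_const smooth_on_ident open_UNIV)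
qed

lemma smooth_fst_snd: "smooth_on (fst :: real \<times> real \<Rightarrow> real) UNIV" "smooth_on (snd :: real \<times> real \<Rightarrow> real) UNIV"
  using smooth_on_fst[OF open_UNIV smooth_on_ident] smooth_on_snd[OF open_UNIV smooth_on_ident] by auto

lemma smooth_chi_compose: "smooth_on r UNIV \<Longrightarrow> smooth_on (\<lambda>p. chi (r p)) UNIV"
  by (rule smooth_on_compose[OF open_UNIV open_UNIV _ smooth_chi]) auto

text \<open>The two paths are joined by their pointwise convex combinations. All of these have the
  same end points, so both boundary terms of the variation vanish.\<close>

lemma M_Z_along_path_independent:
  assumes p: "metric_path X E h' h \<gamma>" and q: "metric_path X E h' h \<gamma>'"
  shows "M_Z_along X E \<omega> \<rho> U \<gamma> = M_Z_along X E \<omega> \<rho> U \<gamma>'"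
proof -
  define G where "G p = (\<lambda>i z. (1 - chi (fst p)) *\<^sub>R \<gamma> (snd p) i z + chi (fst p) *\<^sub>R \<gamma>' (snd p) i z)" for p
  have f: "metric_family \<gamma>" "metric_family \<gamma>'" using p q by (auto simp: metric_path_def metric_curve_iff)
  have G: "metric_family G"
    unfolding G_def[abs_def]
    by (intro metric_family_convex metric_family_compose[OF f(1)] metric_family_compose[OF f(2)] smooth_fst_snd smooth_chi_compose chi)
  have e: "\<gamma> t i z = \<gamma>' t i z" if "t \<in> {0, 1}" "i \<in> charts X" "z \<in> img X i" for t i z
    using p q that by (auto simp: metric_path_def same_metric_def)
  \<comment> \<open>At t = 0 and t = 1 the two paths agree on the chart images, so the interpolation
    does not depend on s there.\<close>
  have z: "Th (mc \<rho>) h (gv (\<lambda>s. G (s, t)) 1 s) = 0" if "t \<in> {0, 1}" for t h s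
    by (rule Th_gv_const[where C = "\<gamma> t"]) (use e[OF that] in \<open>simp add: G_def flip: scaleR_add_left\<close>)
  have "((\<lambda>s. M_Z_along X E \<omega> \<rho> U (\<lambda>t. G (s, t))) has_vector_derivative 0) (at s within UNIV)" for s
    using variation_M_Z_along[OF G, of \<rho> s] by (simp add: z)
  from has_vector_derivative_zero_constant[OF convex_UNIV this]
  have "M_Z_along X E \<omega> \<rho> U (\<lambda>t. G (0, t)) = M_Z_along X E \<omega> \<rho> U (\<lambda>t. G (1, t))" by (metis UNIV_I)
  then show ?thesis by (simp add: G_def chi)
qed

lemma M_Z_eq:
  assumes "metric_path X E h' h \<gamma>"
  shows "M_Z X E \<omega> \<rho> U h h' = M_Z_along X E \<omega> \<rho> U \<gamma>"
  unfolding M_Z_def by (rule M_Z_along_path_independent[OF someI[of "metric_path X E h' h", OF assms] assms])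

text \<open>By path independence the value at each point of the curve may be computed along the
  interpolation from the reference metric. These paths form a smooth two-parameter family whose
  initial end is fixed, so only the other boundary term survives.\<close>

lemma first_variation:
  assumes \<gamma>: "metric_curve X E \<gamma>" and h: "hermitian_metric X E h_ref"
  shows "((\<lambda>s. M_Z X E \<omega> \<rho> U (\<gamma> s) h_ref) has_vector_derivative Th (mc \<rho>) (\<gamma> s) (gv \<gamma> 1 s)) (at s)"
proof -
  define G where "G p = (\<lambda>i z. (1 - chi (snd p)) *\<^sub>R h_ref i z + chi (snd p) *\<^sub>R \<gamma> (fst p) i z)" for p
  have f: "metric_family \<gamma>" using \<gamma> by (simp add: metric_curve_iff)
  have G: "metric_family G"
    unfolding G_def[abs_def]
    by (intro metric_family_convex metric_family_compose[OF f] metric_family_const h smooth_fst_snd smooth_chi_compose chi)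
  have "smooth_on (Pair s) UNIV" for s :: real by (intro smooth_on_Pair) auto
  from metric_family_compose[OF G this]
  have "metric_path X E h_ref (\<gamma> s) (\<lambda>t. G (s, t))" for s
    by (simp add: metric_path_def metric_curve_iff same_metric_def) (simp add: G_def chi)
  from M_Z_eq[OF this, of \<rho>] have e: "M_Z X E \<omega> \<rho> U (\<gamma> s) h_ref = M_Z_along X E \<omega> \<rho> U (\<lambda>t. G (s, t))" for s .
  have "Th (mc \<rho>) (G (s, 0)) (gv (\<lambda>s. G (s, 0)) 1 s) = 0"
    by (rule Th_gv_const[where C = h_ref]) (simp add: G_def chi)
  moreover have "(\<lambda>s. G (s, 1)) = \<gamma>" by (simp add: G_def chi fun_eq_iff)
  ultimately show ?thesis unfolding e using variation_M_Z_along[OF G, of \<rho> s] by (metis diff_zero)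
qed

end

section \<open>Adjoints\<close>

lemma trace_conj_transpose: "trace (conj_transpose A) = cnj (trace A)"
  by (simp add: trace_def conj_transpose_def)

lemma conj_transpose_congruence:
  fixes G M :: "'r::finite mtx"
  shows "conj_transpose (conj_transpose G ** M ** G) = conj_transpose G ** conj_transpose M ** G"
  by (simp add: conj_transpose_mult matrix_mul_assoc)

lemma trace_conj_transpose_mult:
  fixes Q :: "'r::finite mtx"
  shows "trace (conj_transpose Q ** Q) = of_real (\<Sum>a\<in>UNIV. \<Sum>b\<in>UNIV. (cmod (Q $ b $ a))\<^sup>2)"
  by (simp only: trace_def matrix_matrix_mult_def conj_transpose_def vec_lambda_beta of_real_sum complex_norm_square mult.commute)

lemma sum_norm_square_eq_0:
  fixes Q :: "'r::finite mtx"
  shows "(\<Sum>a\<in>UNIV. \<Sum>b\<in>UNIV. (cmod (Q $ b $ a))\<^sup>2) = 0 \<longleftrightarrow> Q = 0"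
  by (auto simp: sum_nonneg_eq_0_iff sum_nonneg vec_eq_iff)

lemma trace_nondegenerate:
  fixes T :: "'r::finite mtx"
  assumes "\<And>A. trace (A ** T) = 0" shows "T = 0"
  using assms[of "conj_transpose T"] unfolding trace_conj_transpose_mult of_real_eq_0_iff sum_norm_square_eq_0 .

context
  fixes H :: "'r::finite mtx"
  assumes inv: "invertible H" and herm: "conj_transpose H = H"
begin

lemma matrix_inv_hermitian: "conj_transpose (matrix_inv H) = matrix_inv H"
proof -
  have "conj_transpose (matrix_inv H ** H) = mat 1" using matrix_inv(2)[OF inv] by simp
  then have "H ** conj_transpose (matrix_inv H) = mat 1" by (simp add: conj_transpose_mult herm)
  then show ?thesis using matrix_inv_unique(2) by metis
qed

lemma adj_idem: "adj H (adj H A) = A"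
  using matrix_inv_cancel[OF inv]
  by (simp add: adj_def conj_transpose_mult herm matrix_inv_hermitian matrix_mul_assoc)

lemma adj_mult: "adj H (A ** B) = adj H B ** adj H A"
  using matrix_inv_cancel(3)[OF inv, of "matrix_inv H ** conj_transpose B"]
  by (simp add: adj_def conj_transpose_mult matrix_mul_assoc)

lemma adj_mat_1: "adj H (mat 1) = mat 1"
  using matrix_inv(2)[OF inv] by (simp add: adj_def)

lemma adj_mprod: "adj H (mprod As) = mprod (rev (map (adj H) As))"
  by (induction As) (simp_all add: adj_mat_1 adj_mult mprod_append)

lemma trace_adj: "trace (adj H A) = cnj (trace A)"
  unfolding adj_def trace_mul_sym[of "_ ** _" H] matrix_inv_cancel(1)[OF inv] matrix_mul_assoc matrix_inv(1)[OF inv]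
  by (simp add: trace_conj_transpose)

text \<open>Since tr(A adj(T)) is the conjugate of tr(adj(A) T), the adjoint of the unknown
  endomorphism is moved to the test matrix.\<close>

lemma trace_Im_endo: "trace (A ** Im_endo H T) = (trace (A ** T) - cnj (trace (adj H A ** T))) / (2 * \<i>)"
proof -
  have "trace (A ** adj H T) = trace (adj H (T ** adj H A))" by (simp add: adj_mult adj_idem)
  also have "\<dots> = cnj (trace (adj H A ** T))" unfolding trace_adj by (rule arg_cong[OF trace_mul_sym])
  finally show ?thesis by (simp add: Im_endo_def cscale_mult matrix_distribs trace_sub)
qed

lemma adj_Im_endo: "adj H (Im_endo H T) = Im_endo H T"
proof -
  have "adj H (cscale c A) = cscale (cnj c) (adj H A)" for c A
    by (simp add: adj_def conj_transpose_cscale cscale_mult)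
  moreover have "adj H (A - B) = adj H A - adj H B" for A B
    by (simp add: adj_def linear_diff[OF linear_conj_transpose] matrix_distribs)
  ultimately show ?thesis by (simp add: Im_endo_def adj_idem cscale_diff) (simp add: cscale_def vec_eq_iff field_simps)
qed

lemma adj_hermitian: "adj H T = T \<longleftrightarrow> conj_transpose (H ** T) = H ** T"
proof
  assume "adj H T = T"
  then have "H ** T = H ** (matrix_inv H ** (conj_transpose T ** H))" by (simp add: adj_def matrix_mul_assoc)
  then show "conj_transpose (H ** T) = H ** T" using matrix_inv_cancel(1)[OF inv] by (simp add: conj_transpose_mult herm)
next
  assume "conj_transpose (H ** T) = H ** T"
  moreover have "adj H T = matrix_inv H ** conj_transpose (H ** T)" by (simp add: adj_def conj_transpose_mult herm matrix_mul_assoc)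
  ultimately have "adj H T = matrix_inv H ** (H ** T)" by simp
  then show "adj H T = T" using matrix_inv_cancel(2)[OF inv] by simp
qed

text \<open>The adjoint reverses the order of the self-adjoint curvature factors; reversing the
  order of their pairs of slots is an even permutation and restores it. The scalar factors are
  real.\<close>

lemma cnj_tword_adj:
  assumes om: "\<And>a b. om a b \<in> \<real>" and u: "\<And>w. u w \<in> \<real>" and F: "\<And>a b. adj H (F a b) = F a b"
    and N: "2 * j \<le> N"
  shows "cnj (altz N (tword (adj H A) (factors F om j) (j + d) u) v) = altz N (tword A (factors F om j) (j + d) u) v"
proof -
  define \<pi> where "\<pi> i = (if i < j then j - Suc i else i)" for i
  have inv: "\<pi> (\<pi> i) = i" for i by (auto simp: \<pi>_def)
  then have \<pi>: "\<pi> permutes {..<j}" unfolding permutes_def by (auto simp: \<pi>_def[of "_::nat"] split: if_splits) (metis inv)+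
  have "cnj (tword (adj H A) (factors F om j) (j + d) u w) = tword A (factors F om j) (j + d) u (\<lambda>k. w (lift2 \<pi> k))" for w
  proof -
    let ?f = "\<lambda>i. F (ev w i) (od w i)"
    have s: "cnj (spart om u j d w)
      = spart om u j d w"
      using om u by (simp add: Reals_cnj_iff)
    have hi: "lift2 \<pi> k = k" if "2 * j \<le> k" for k
      using that by (auto simp: lift2_def \<pi>_def)
    have "cnj (trace (adj H A ** mprod (map ?f [0..<j]))) = trace (A ** mprod (rev (map (adj H \<circ> ?f) [0..<j])))"
      unfolding trace_adj[symmetric] adj_mult adj_idem adj_mprod by (simp add: trace_mul_sym[of A])
    also have "rev (map (adj H \<circ> ?f) [0..<j]) = map (\<lambda>i. ?f (\<pi> i)) [0..<j]"
      by (rule nth_equalityI) (auto simp: rev_nth F \<pi>_def)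
    finally show ?thesis
      unfolding tword_factors complex_cnj_mult[of "_ * _" "trace _"] s by (simp add: pairprod_def hi)
  qed
  moreover have "linear cnj" by (rule bounded_linear.linear[OF bounded_linear_cnj])
  ultimately have "cnj (altz N (tword (adj H A) (factors F om j) (j + d) u) v)
    = altz N (\<lambda>w. tword A (factors F om j) (j + d) u (\<lambda>k. w (lift2 \<pi> k))) v"
    by (simp add: altz_linear[symmetric])
  also have "\<dots> = altz N (tword A (factors F om j) (j + d) u) v" by (rule altz_lift2[OF \<pi> N])
  finally show ?thesis .
qed

lemma cnj_charge_density_adj:
  assumes om: "\<And>a b. om a b \<in> \<real>" and u: "\<And>k w. u k w \<in> \<real>" and F: "\<And>a b. adj H (F a b) = F a b"
  shows "cnj (charge_density c om u n F (adj H A) v) = charge_density (\<lambda>d. cnj (c d)) om u n F A v"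
proof -
  have "cnj (charge_coeff c d j l * altz (2 * n) (tword (adj H A) (factors F om j) (j + d) (u (2 * l))) v)
     = charge_coeff (\<lambda>d. cnj (c d)) d j l * altz (2 * n) (tword A (factors F om j) (j + d) (u (2 * l))) v"
    if "d + j + l = n" for d j l
    using cnj_tword_adj[where om = om and u = "u (2 * l)" and F = F and N = "2 * n" and j = j and d = d and A = A and v = v, OF om u F] that
    by (simp add: charge_coeff_def)
  then show ?thesis
    unfolding charge_density_def cnj_sum by (intro sum.cong refl) (auto simp: degree_triples_def)
qed

end

lemma charge_density_diff:
  "charge_density (\<lambda>d. (a * c d - b * c' d) / e) om u n F A v = (a * charge_density c om u n F A v - b * charge_density c' om u n F A v) / e"
  unfolding charge_density_def sum_distrib_left sum_subtractf[symmetric] sum_divide_distrib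
  by (intro sum.cong refl) (auto simp: charge_coeff_def divide_inverse algebra_simps)

lemma conj_transpose_D:
  fixes f :: "'n::finite pt \<Rightarrow> 'r::finite mtx"
  assumes S: "open S" and f: "smooth_on f S" and z: "z \<in> S"
  shows "conj_transpose (D1 v f z) = D2 v (\<lambda>z. conj_transpose (f z)) z" "conj_transpose (D2 v f z) = D1 v (\<lambda>z. conj_transpose (f z)) z"
  unfolding D1_def D2_def dd_bounded_linear[OF bounded_linear_conj_transpose S f z]
  by (simp_all add: linear_scale[OF linear_conj_transpose] linear_add[OF linear_conj_transpose] linear_diff[OF linear_conj_transpose]
      conj_transpose_cscale) (simp_all add: cscale_def vec_eq_iff)

text \<open>H times the unsymmetrised curvature is \<partial>-bar_u \<partial>_v H -
  (\<partial>-bar_u H) H^-1 (\<partial>_v H). Conjugate transposition exchanges u and v in this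
  expression, and the factor i compensates the sign of the antisymmetrisation.\<close>

lemma (in local_metric) adj_ncurv:
  assumes herm: "\<And>z. z \<in> S \<Longrightarrow> conj_transpose (H z) = H z" and z: "z \<in> S"
  shows "adj (H z) (ncurv H u v z) = ncurv H u v z"
proof -
  have c: "conj_transpose (D1 v H z) = D2 v H z" "conj_transpose (D2 v H z) = D1 v H z" if "z \<in> S" for v z
    using conj_transpose_D[OF S smooth_H that, of v] D_cong[OF S that herm] by simp_all
  have Hg: "H z ** gcurv H u v z = D2 u (D1 v H) z - D2 u H z ** matrix_inv (H z) ** D1 v H z" for u v
    unfolding gcurv_def theta_def[abs_def] D_mult(2)[OF S smooth_inv_H smooth_D1[OF S smooth_H] z] D_matrix_inv(2)[OF z]
    using matrix_inv_cancel[OF inv_H[OF z]] matrix_inv(1)[OF inv_H[OF z]]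
    by (simp add: matrix_distribs mat_minus_mult matrix_mul_assoc)
  have "conj_transpose (D2 u (D1 v H) z) = D1 u (D2 v H) z" for u v
  proof -
    have "conj_transpose (D2 u (D1 v H) z) = D1 u (\<lambda>z. conj_transpose (D1 v H z)) z"
      by (rule conj_transpose_D(2)[OF S smooth_D1[OF S smooth_H] z])
    also have "\<dots> = D1 u (D2 v H) z" by (rule D_cong(1)[OF S z c(1)])
    finally show ?thesis .
  qed
  then have g: "conj_transpose (H z ** gcurv H u v z) = H z ** gcurv H v u z" for u v
    unfolding Hg
    by (simp add: linear_diff[OF linear_conj_transpose] conj_transpose_mult c[OF z] matrix_inv_hermitian[OF inv_H[OF z] herm[OF z]]
        matrix_mul_assoc D_commute(3)[OF S smooth_H z])
  show ?thesis
    unfolding adj_hermitian[OF inv_H[OF z] herm[OF z]] ncurv_def cscale_mult matrix_distribs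
    by (simp add: conj_transpose_cscale linear_diff[OF linear_conj_transpose] g) (simp add: cscale_def vec_eq_iff field_simps)
qed

section \<open>The Euler-Lagrange equation\<close>

context charged_bundle
begin

text \<open>Self-adjoint curvature and real \<omega> and U let the imaginary part pass to the
  coefficients; this identifies D_Z with the integrand of the functional.\<close>

lemma trace_D_Z:
  assumes h: "hermitian_metric X E h" and i: "i \<in> charts X" and z: "z \<in> img X i"
  shows "trace (A ** D_Z X E \<omega> \<rho> U h i z v)
    = charge_density (mc \<rho>) (\<lambda>a b. om i a b z) (\<lambda>k. U k i z) CARD('n) (\<lambda>a b. ncurv (h i) a b z) A v"
proof -
  interpret local_metric "img X i" "h i" by (rule local_metric[OF h i])
  have herm: "conj_transpose (h i y) = h i y" if "y \<in> img X i" for y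
    using hermitian_metricD(2)[OF h i that] by (simp add: pos_def_hermitian_def)
  let ?CD = "\<lambda>c A. charge_density c (\<lambda>a b. om i a b z) (\<lambda>k. U k i z) CARD('n) (\<lambda>a b. ncurv (h i) a b z) A v"
  have T: "trace (A ** Z_tilde \<rho> \<omega> U h i z v) = ?CD \<rho> A" for A
    unfolding Z_tilde_def
  proof (rule trace_charge_form)
    show "\<omega> i z w = om i (w 0) (w (Suc 0)) z" for w by (rule omega_eq[OF i z])
    show "U k i z w = U k i z w'" if "\<And>m. m < k \<Longrightarrow> w m = w' m" for k w w' using U_local[OF i z that] .
    show "normalized_curvature (h i) z w = ncurv (h i) (w 0) (w (Suc 0)) z" for w by (rule normalized_curvature_eq[OF z])
  qed
  have "om i a b z \<in> \<real>" "U k i z w \<in> \<real>" for a b k w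
    using kaehler unipotent i z by (auto simp: kaehler_form_def unipotent_form_def real_form_def om_def)
  then have cn: "cnj (?CD c (adj (h i z) A)) = ?CD (\<lambda>d. cnj (c d)) A" for c A
    by (intro cnj_charge_density_adj inv_H herm z adj_ncurv) auto
  let ?e = "cis (- phase X E \<omega> \<rho> U)"
  have "trace (A ** D_Z X E \<omega> \<rho> U h i z v) = (?e * ?CD \<rho> A - cnj (?e * ?CD \<rho> (adj (h i z) A))) / (2 * \<i>)"
    unfolding D_Z_def trace_Im_endo[OF inv_H[OF z] herm[OF z]] cscale_mult by (simp add: T)
  \<comment> \<open>By \<open>cn\<close>, conjugating the density at the adjoint of \<open>A\<close>
    conjugates nothing but the coefficients.\<close>
  also have "\<dots> = (?e * ?CD \<rho> A - cnj ?e * ?CD (\<lambda>d. cnj (\<rho> d)) A) / (2 * \<i>)"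
    by (simp only: complex_cnj_mult cn)
  also have "\<dots> = ?CD (\<lambda>d. (?e * \<rho> d - cnj ?e * cnj (\<rho> d)) / (2 * \<i>)) A"
    by (simp only: charge_density_diff)
  also have "(\<lambda>d. (?e * \<rho> d - cnj ?e * cnj (\<rho> d)) / (2 * \<i>)) = mc \<rho>"
  proof
    fix d
    have "(w - cnj w) / (2 * \<i>) = of_real (Im w)" for w
      unfolding complex_diff_cnj by (simp add: complex_eq_iff)
    from this[of "?e * \<rho> d"] have "(?e * \<rho> d - cnj (?e * \<rho> d)) / (2 * \<i>) = of_real (Im (?e * \<rho> d))" .
    then show "(?e * \<rho> d - cnj ?e * cnj (\<rho> d)) / (2 * \<i>) = mc \<rho> d" by (simp only: mc_def complex_cnj_mult)
  qed
  finally show ?thesis .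
qed

lemma qd_D_Z:
  assumes "hermitian_metric X E h" "i \<in> charts X" "z \<in> img X i"
  shows "qd (mc \<rho>) h A i z = trace (A i z ** D_Z X E \<omega> \<rho> U h i z std_frame)"
  unfolding qd_def by (rule trace_D_Z[OF assms, symmetric])

text \<open>D_Z has top degree, so its value on any tuple is a multiple of the one on the standard
  frame. Alternation is available for scalar words, hence the detour through traces against all
  matrices.\<close>

lemma D_Z_top_form:
  assumes h: "hermitian_metric X E h" and i: "i \<in> charts X" and z: "z \<in> img X i"
    and 0: "D_Z X E \<omega> \<rho> U h i z std_frame = 0"
  shows "D_Z X E \<omega> \<rho> U h i z v = 0"
proof (rule trace_nondegenerate)
  fix A :: "'r mtx"
  let ?\<eta> = "\<lambda>v. trace (A ** D_Z X E \<omega> \<rho> U h i z v)"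
  have alt: "alternating (2 * CARD('n)) (altz (2 * CARD('n)) (tword A (factors (\<lambda>a b. ncurv (h i) a b z) (\<lambda>a b. om i a b z) j) (j + d) (U (2 * l) i z)))"
    if "d + j + l = CARD('n)" for d j l
  proof -
    have "alternating (2 * (j + d) + 2 * l) (altz (2 * (j + d) + 2 * l) (tword A (\<lambda>k a b. gfac h j k i a b z) (j + d) (U (2 * l) i z)))"
      by (rule alternating_tword[OF gfac_facts(2)[OF h i z] gfac_facts(3)[OF h i z] is_formD(1)[OF is_form_U i z]])
    moreover have "2 * (j + d) + 2 * l = 2 * CARD('n)" using that by simp
    ultimately show ?thesis by (simp add: gfac_def[abs_def])
  qed
  have t: "altz (2 * CARD('n)) (tword A (factors (\<lambda>a b. ncurv (h i) a b z) (\<lambda>a b. om i a b z) j) (j + d) (U (2 * l) i z)) v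
    = det (\<chi> s. ofC (v (index_of s))) *\<^sub>R altz (2 * CARD('n)) (tword A (factors (\<lambda>a b. ncurv (h i) a b z) (\<lambda>a b. om i a b z) j) (j + d) (U (2 * l) i z)) std_frame"
    if "d + j + l = CARD('n)" for d j l
    by (rule top_form_eq[OF alt[OF that]])
  have "?\<eta> v = det (\<chi> s. ofC (v (index_of s))) *\<^sub>R ?\<eta> std_frame"
    unfolding trace_D_Z[OF h i z] charge_density_def scaleR_sum_right
    by (intro sum.cong refl) (auto simp: degree_triples_def t)
  then show "?\<eta> v = 0" using 0 by (simp add: linear_0[OF linear_trace])
qed

lemma Z_critical_imp_critical:
  assumes h: "hermitian_metric X E h" and h_ref: "hermitian_metric X E h_ref" and crit: "Z_critical X E \<omega> \<rho> U h"
  shows "critical_point X E (\<lambda>k. M_Z X E \<omega> \<rho> U k h_ref) h"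
  unfolding critical_point_def
proof (intro allI impI)
  fix \<gamma> assume \<gamma>: "metric_curve X E \<gamma> \<and> same_metric X (\<gamma> 0) h"
  have "Th (mc \<rho>) (\<gamma> 0) (gv \<gamma> 1 0) = Th (mc \<rho>) h (gv \<gamma> 1 0)"
    by (rule Th_cong) (use \<gamma> in \<open>auto simp: same_metric_def\<close>)
  also have "\<dots> = integral_over X (\<lambda>i z v. 0)"
    unfolding Th_def
  proof (rule integral_over_cong)
    fix i z assume "i \<in> charts X" "z \<in> img X i"
    then show "qd (mc \<rho>) h (gv \<gamma> 1 0) i z = 0"
      using crit by (simp add: qd_D_Z[OF h] Z_critical_def linear_0[OF linear_trace])
  qed
  also have "\<dots> = 0" unfolding integral_over_pou by (simp cong: if_cong)
  finally show "((\<lambda>s. M_Z X E \<omega> \<rho> U (\<gamma> s) h_ref) has_vector_derivative 0) (at 0)"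
    using first_variation[of \<gamma> h_ref \<rho> 0] \<gamma> h_ref by simp
qed

text \<open>
  For self-adjoint \<open>A\<close> this is positive definite for all \<open>s\<close>, because
  \<open>1 + s A + s\<^sup>2 A\<^sup>2 = (1 + s A / 2)\<^sup>2 + 3 s\<^sup>2 A\<^sup>2 / 4\<close>; a linear curve \<open>h (1 + s A)\<close> is not.
\<close>
definition quad_curve :: "('i, 'n, 'r) metric \<Rightarrow> ('i \<Rightarrow> 'n pt \<Rightarrow> 'r mtx) \<Rightarrow> real \<Rightarrow> ('i, 'n, 'r) metric" where
  "quad_curve h A s i z = h i z + s *\<^sub>R (h i z ** A i z) + s\<^sup>2 *\<^sub>R (h i z ** A i z ** A i z)"

lemma pos_def_quad:
  fixes H A :: "'r mtx"
  assumes H: "pos_def_hermitian H" and A: "conj_transpose (H ** A) = H ** A"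
  shows "pos_def_hermitian (H + s *\<^sub>R (H ** A) + s\<^sup>2 *\<^sub>R (H ** A ** A))"
proof -
  have herm: "conj_transpose H = H" using H by (simp add: pos_def_hermitian_def)
  have AH: "conj_transpose A ** H = H ** A" using A by (simp add: conj_transpose_mult herm)
  define ip where "ip x y = (\<Sum>a\<in>UNIV. cnj (x $ a) * y $ a)" for x y :: "complex^'r"
  have q: "(\<Sum>a\<in>UNIV. \<Sum>b\<in>UNIV. cnj (\<xi> $ a) * M $ a $ b * \<xi> $ b) = ip \<xi> (M *v \<xi>)" for M :: "'r mtx" and \<xi>
    by (simp add: ip_def matrix_vector_mult_def sum_distrib_left mult.assoc)
  have pos: "0 < Re (ip \<xi> (H *v \<xi>))" if "\<xi> \<noteq> 0" for \<xi>
    using H that unfolding pos_def_hermitian_def q by blast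
  have nn: "0 \<le> Re (ip \<xi> (H *v \<xi>))" for \<xi>
    using pos[of \<xi>] by (cases "\<xi> = 0") (auto simp: ip_def)
  have ipT: "ip x (conj_transpose M *v y) = ip (M *v x) y" for M :: "'r mtx" and x y
  proof -
    have "ip x (conj_transpose M *v y) = (\<Sum>a\<in>UNIV. \<Sum>b\<in>UNIV. cnj (x $ a) * (cnj (M $ b $ a) * y $ b))"
      by (simp add: ip_def matrix_vector_mult_def conj_transpose_def sum_distrib_left)
    also have "\<dots> = (\<Sum>b\<in>UNIV. \<Sum>a\<in>UNIV. cnj (x $ a) * (cnj (M $ b $ a) * y $ b))" by (rule sum.swap)
    also have "\<dots> = ip (M *v x) y"
      by (simp add: ip_def matrix_vector_mult_def sum_distrib_left sum_distrib_right mult_ac)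
    finally show ?thesis .
  qed
  let ?P = "mat 1 + (s / 2) *\<^sub>R A"
  have e: "H + s *\<^sub>R (H ** A) + s\<^sup>2 *\<^sub>R (H ** A ** A) = conj_transpose ?P ** H ** ?P + (3 / 4 * s\<^sup>2) *\<^sub>R (conj_transpose A ** H ** A)"
  proof -
    have P: "conj_transpose ?P ** H = H + (s / 2) *\<^sub>R (H ** A)"
      by (simp add: linear_add[OF linear_conj_transpose] linear_scale[OF linear_conj_transpose] matrix_distribs scaleR_matrix_mult AH)
    have lin: "H + s *\<^sub>R B + s\<^sup>2 *\<^sub>R C = H + (s / 2) *\<^sub>R B + (s / 2) *\<^sub>R (B + (s / 2) *\<^sub>R C) + (3 / 4 * s\<^sup>2) *\<^sub>R C" for B C
      by (simp add: vec_eq_iff complex_eq_iff power2_eq_square field_simps)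
    then show ?thesis unfolding P AH by (subst lin) (simp add: matrix_distribs scaleR_matrix_mult)
  qed
  show ?thesis
    unfolding pos_def_hermitian_def
  proof (intro conjI allI impI)
    have "conj_transpose (conj_transpose B ** H ** B) = conj_transpose B ** H ** B" for B :: "'r mtx"
      by (simp add: conj_transpose_congruence herm)
    then show "conj_transpose (H + s *\<^sub>R (H ** A) + s\<^sup>2 *\<^sub>R (H ** A ** A)) = H + s *\<^sub>R (H ** A) + s\<^sup>2 *\<^sub>R (H ** A ** A)"
      unfolding e linear_add[OF linear_conj_transpose, of "conj_transpose ?P ** H ** ?P"] linear_scale[OF linear_conj_transpose, of "3 / 4 * s\<^sup>2"]
      by (simp only:)
    fix \<xi> :: "complex^'r" assume \<xi>: "\<xi> \<noteq> 0"
    have sv: "((r *\<^sub>R M) *v \<xi>) = r *\<^sub>R (M *v \<xi>)" for r and M :: "'r mtx"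
      by (simp add: matrix_vector_mult_def vec_eq_iff scaleR_sum_right)
    have sp: "ip x (y + r *\<^sub>R z) = ip x y + r *\<^sub>R ip x z" for x y z r
      by (simp add: ip_def sum.distrib scaleR_sum_right ring_distribs)
    have c: "ip \<xi> ((conj_transpose B ** H ** B) *v \<xi>) = ip (B *v \<xi>) (H *v (B *v \<xi>))" for B
      by (simp add: ipT flip: matrix_vector_mul_assoc)
    have "Re (ip \<xi> ((H + s *\<^sub>R (H ** A) + s\<^sup>2 *\<^sub>R (H ** A ** A)) *v \<xi>))
      = Re (ip (?P *v \<xi>) (H *v (?P *v \<xi>))) + 3 / 4 * s\<^sup>2 * Re (ip (A *v \<xi>) (H *v (A *v \<xi>)))"
      unfolding e matrix_vector_mult_add_rdistrib[of "conj_transpose ?P ** H ** ?P"] sv sp c by simp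
    also have "\<dots> > 0"
    \<comment> \<open>If the first square vanishes, then s and A \<xi> cannot, and the second square
      is positive.\<close>
    proof (cases "?P *v \<xi> = 0")
      case False
      then show ?thesis using pos[OF False] nn[of "A *v \<xi>"] by (intro add_pos_nonneg) auto
    next
      case True
      then have "\<xi> + (s / 2) *\<^sub>R (A *v \<xi>) = 0" by (simp add: matrix_vector_mult_add_rdistrib sv)
      then have "s \<noteq> 0" "A *v \<xi> \<noteq> 0" using \<xi> by auto
      then show ?thesis using pos[of "A *v \<xi>"] nn[of "?P *v \<xi>"] by (intro add_nonneg_pos) auto
    qed
    finally show "0 < Re (\<Sum>a\<in>UNIV. \<Sum>b\<in>UNIV. cnj (\<xi> $ a) * (H + s *\<^sub>R (H ** A) + s\<^sup>2 *\<^sub>R (H ** A ** A)) $ a $ b * \<xi> $ b)"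
      unfolding q .
  qed
qed

context
  fixes h :: "('i, 'n, 'r) metric" and A
  assumes h: "hermitian_metric X E h" and A: "smooth_section A"
    and self_adjoint: "\<And>i z. i \<in> charts X \<Longrightarrow> z \<in> img X i \<Longrightarrow> conj_transpose (h i z ** A i z) = h i z ** A i z"
begin

lemma metric_curve_quad: "metric_curve X E (quad_curve h A)"
  unfolding metric_curve_def hermitian_metric_def Let_def
proof (intro conjI allI ballI)
  fix i assume i: "i \<in> charts X"
  note S = open_img[OF i] and sm = hermitian_metricD(1)[OF h i] smooth_sectionD(1)[OF A i]
  show "smooth_on (quad_curve h A s i) (img X i)" for s
    unfolding quad_curve_def[abs_def]
    by (intro smooth_on_add smooth_on_scaleR smooth_on_const smooth_on_matrix_mult S sm)
  show "pos_def_hermitian (quad_curve h A s i z)" if "z \<in> img X i" for s z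
    unfolding quad_curve_def by (rule pos_def_quad[OF hermitian_metricD(2)[OF h i that] self_adjoint[OF i that]])
  note O = open_product[OF S]
  have sm': "smooth_on (\<lambda>x. h i (snd x)) (UNIV \<times> img X i :: (real \<times> _) set)" "smooth_on (\<lambda>x. A i (snd x)) (UNIV \<times> img X i :: (real \<times> _) set)"
    by (rule smooth_on_compose[OF O S _ sm(1)] smooth_on_compose[OF O S _ sm(2)]; auto intro!: smooth_on_snd O)+
  show "smooth_on (\<lambda>(s, z). quad_curve h A s i z) (UNIV \<times> img X i)"
    unfolding quad_curve_def case_prod_unfold
    by (intro smooth_on_add smooth_on_scaleR smooth_on_power smooth_on_fst smooth_on_ident smooth_on_matrix_mult O sm')
next
  fix i j z s assume ij: "i \<in> charts X" "j \<in> charts X" and z: "z \<in> overlap X i j"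
  let ?g = "cmat i j z" and ?h = "h j (transition X i j z)" and ?A = "A j (transition X i j z)"
  have c: "Y ** ?g ** matrix_inv ?g = Y" for Y :: "'r mtx" by (rule matrix_inv_cancel(3)[OF cmat_inverse(3)[OF ij z]])
  have 1: "h i z = conj_transpose ?g ** ?h ** ?g" by (rule hermitian_metricD(3)[OF h ij z])
  have 2: "A i z = matrix_inv ?g ** ?A ** ?g" by (rule smooth_sectionD(2)[OF A ij z])
  have 3: "h i z ** A i z = conj_transpose ?g ** (?h ** ?A) ** ?g" unfolding 1 2 by (simp add: matrix_mul_assoc c)
  have 4: "h i z ** A i z ** A i z = conj_transpose ?g ** (?h ** ?A ** ?A) ** ?g" unfolding 3 unfolding 2 by (simp add: matrix_mul_assoc c)
  show "quad_curve h A s i z = conj_transpose ?g ** quad_curve h A s j (transition X i j z) ** ?g"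
    unfolding quad_curve_def 4 unfolding 3 unfolding 1 by (simp add: matrix_distribs scaleR_matrix_mult)
qed

lemma quad_curve_0: "quad_curve h A 0 = h"
  by (simp add: quad_curve_def fun_eq_iff)

lemma gv_quad_curve:
  assumes i: "i \<in> charts X" and z: "z \<in> img X i"
  shows "gv (quad_curve h A) 1 0 i z = A i z"
proof -
  have "((\<lambda>s. quad_curve h A s i z) has_derivative (\<lambda>s. s *\<^sub>R (h i z ** A i z))) (at 0)"
    unfolding quad_curve_def by (auto intro!: derivative_eq_intros)
  then have "dd 1 (\<lambda>s. quad_curve h A s i z) 0 = 1 *\<^sub>R (h i z ** A i z)" by (rule dd_eq)
  then show ?thesis
    using matrix_inv_cancel(2)[OF pos_def_hermitian_invertible[OF hermitian_metricD(2)[OF h i z]]] by (simp add: gv_def quad_curve_0)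
qed

text \<open>\<open>quad_curve\<close> is an admissible curve with initial velocity \<open>A\<close>,
  so criticality and the first variation give two values for the same derivative.\<close>

lemma critical_imp_Th_0:
  assumes h_ref: "hermitian_metric X E h_ref" and crit: "critical_point X E (\<lambda>k. M_Z X E \<omega> \<rho> U k h_ref) h"
  shows "Th (mc \<rho>) h A = 0"
proof -
  have "((\<lambda>s. M_Z X E \<omega> \<rho> U (quad_curve h A s) h_ref) has_vector_derivative 0) (at 0)"
    using crit metric_curve_quad by (auto simp: critical_point_def same_metric_def quad_curve_0)
  then have "Th (mc \<rho>) (quad_curve h A 0) (gv (quad_curve h A) 1 0) = 0"
    using first_variation[OF metric_curve_quad h_ref] vector_derivative_unique_at by blast
  moreover have "Th (mc \<rho>) (quad_curve h A 0) (gv (quad_curve h A) 1 0) = Th (mc \<rho>) h A"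
    by (rule Th_cong) (simp_all add: quad_curve_0 gv_quad_curve)
  ultimately show ?thesis by simp
qed

end

lemma smooth_qd_const:
  assumes h: "hermitian_metric X E h" and i: "i \<in> charts X"
  shows "smooth_on (\<lambda>z. qd c h (\<lambda>i z. M) i z) (img X i)"
proof -
  note S = open_img[OF i]
  have "smooth_on (\<lambda>z. gfac h j k i a b z) (img X i)" for j k a b
    using smooth_slice[OF S gfac_param(1)[OF metric_family_const[where 'p = real, OF h] i], of j k a b 0] by simp
  then show ?thesis
    unfolding qd_eq altz_def case_prod_unfold tword_def pairprod_def
    by (intro smooth_on_sum smooth_on_mult smooth_on_const smooth_on_scaleR smooth_on_trace smooth_on_matrix_mult mprod_smooth S
        is_formD(2)[OF is_form_U i])
qed

text \<open>Each matrix entry is the trace against a matrix unit, that is, a value of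
  \<open>qd\<close>, whose smoothness is known.\<close>

lemma smooth_D_Z:
  assumes h: "hermitian_metric X E h" and i: "i \<in> charts X"
  shows "smooth_on (\<lambda>z. D_Z X E \<omega> \<rho> U h i z std_frame) (img X i)"
proof (intro smooth_on_vecI open_img i)
  fix a b
  define M :: "'r mtx" where "M = (\<chi> x y. if x = b \<and> y = a then 1 else 0)"
  have "trace (M ** T) = T $ a $ b" for T
  proof -
    have "trace (M ** T) = (\<Sum>x\<in>UNIV. if x = b then (\<Sum>y\<in>UNIV. if y = a then T $ y $ x else 0) else 0)"
      unfolding trace_def
    proof (intro sum.cong refl)
      fix x show "(M ** T) $ x $ x = (if x = b then \<Sum>y\<in>UNIV. if y = a then T $ y $ x else 0 else 0)"
        by (cases "x = b") (auto simp: matrix_matrix_mult_def M_def mult_if_delta intro!: sum.cong)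
    qed
    then show ?thesis by simp
  qed
  then have "D_Z X E \<omega> \<rho> U h i z std_frame $ a $ b = qd (mc \<rho>) h (\<lambda>i z. M) i z" if "z \<in> img X i" for z
    using qd_D_Z[OF h i that, of \<rho> "\<lambda>i z. M"] by simp
  then show "smooth_on (\<lambda>z. D_Z X E \<omega> \<rho> U h i z std_frame $ a $ b) (img X i)"
    using smooth_qd_const[OF h i, of "mc \<rho>" M] by (subst smooth_on_cong[OF open_img[OF i]])
qed

text \<open>Transports an endomorphism-valued function from the chart \<open>i0\<close> to all
  frames, with value 0 outside its domain. It is a smooth section when \<open>B\<close> is smooth
  and vanishes off a compact subset of the chart.\<close>

definition extend_endo :: "'i \<Rightarrow> ('n pt \<Rightarrow> 'r mtx) \<Rightarrow> 'i \<Rightarrow> 'n pt \<Rightarrow> 'r mtx" where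
  "extend_endo i0 B i z = (if chart_inv X i z \<in> dom X i0 then matrix_inv (cmat i i0 z) ** B (transition X i i0 z) ** cmat i i0 z else 0)"

context
  fixes i0 and B :: "'n pt \<Rightarrow> 'r mtx" and L
  assumes i0: "i0 \<in> charts X" and B: "smooth_on B (img X i0)" and L: "compact L" "L \<subseteq> img X i0"
    and B0: "\<And>z. z \<in> img X i0 - L \<Longrightarrow> B z = 0"
begin

lemma extend_endo_0:
  assumes i: "i \<in> charts X" and z: "z \<in> img X i" "chart_inv X i z \<notin> chart_inv X i0 ` L"
  shows "extend_endo i0 B i z = 0"
proof (cases "chart_inv X i z \<in> dom X i0")
  case True
  then have o: "z \<in> overlap X i i0" using overlap_iff[OF i] z by blast
  have "transition X i i0 z \<notin> L"
    using transition_overlap(2)[OF i i0 o] z(2) by (metis imageI)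
  then have "B (transition X i i0 z) = 0" using B0 transition_img[OF i i0 o] by blast
  then show ?thesis by (simp add: extend_endo_def)
qed (simp add: extend_endo_def)

lemma extend_endo_i0: assumes z: "z \<in> img X i0" shows "extend_endo i0 B i0 z = B z"
proof -
  have x: "chart_inv X i0 z \<in> dom X i0" by (rule chart_inv_dom[OF i0 z])
  then have "cmat i0 i0 z = mat 1" using holo_bundle i0 by (auto simp: holomorphic_bundle_def)
  moreover have "matrix_inv (mat 1 :: 'r mtx) = mat 1" by (rule matrix_inv_unique(2)) simp
  ultimately show ?thesis using x by (simp add: extend_endo_def transition_def chart_chart_inv[OF i0 z])
qed

lemma smooth_section_extend_endo: "smooth_section (extend_endo i0 B)"
  unfolding smooth_section_def
proof (intro conjI ballI)
  fix i assume i: "i \<in> charts X"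
  show "smooth_on (extend_endo i0 B i) (img X i)"
  proof (rule smooth_on_extension[OF i0 L i _ extend_endo_0[OF i]])
    interpret frame_change "overlap X i i0" "img X i0" "transition X i i0" "cmat i i0" by (rule frame_change[OF i i0])
    have "smooth_on (\<lambda>z. conjg z (B (transition X i i0 z))) (overlap X i i0)"
      by (intro smooth_on_matrix_mult V smooth_inv_g smooth_g smooth_compose_T B)
    moreover have "extend_endo i0 B i z = conjg z (B (transition X i i0 z))" if "z \<in> overlap X i i0" for z
      unfolding extend_endo_def by (rule if_P) (use that overlap_iff[OF i] in blast)
    ultimately show "smooth_on (extend_endo i0 B i) (overlap X i i0)"
      using smooth_on_cong[OF V, of "extend_endo i0 B i" "\<lambda>z. conjg z (B (transition X i i0 z))"] by simp
  qed
next
  fix i j z assume ij: "i \<in> charts X" "j \<in> charts X" and z: "z \<in> overlap X i j"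
  let ?Tz = "transition X i j z" and ?x = "chart_inv X i z"
  have x: "chart_inv X j ?Tz = ?x" by (rule transition_overlap(2)[OF ij z])
  show "extend_endo i0 B i z = matrix_inv (cmat i j z) ** extend_endo i0 B j ?Tz ** cmat i j z"
  proof (cases "?x \<in> dom X i0")
    case True
    have zi: "z \<in> img X i" and xij: "?x \<in> dom X i" "?x \<in> dom X j" using z overlap_iff[OF ij(1)] chart_inv_dom[OF ij(1)] by auto
    have o: "?Tz \<in> overlap X j i0" using transition_img[OF ij z] x True overlap_iff[OF ij(2)] by simp
    have P: "invertible (cmat j i0 ?Tz)" and Q: "invertible (cmat i j z)" using cmat_inverse(3) ij i0 o z by blast+
    have c: "cmat i i0 z = cmat j i0 ?Tz ** cmat i j z"
      using holo_bundle ij i0 xij True unfolding x holomorphic_bundle_def by auto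
    have "cmat j i0 ?Tz ** cmat i j z ** (matrix_inv (cmat i j z) ** matrix_inv (cmat j i0 ?Tz)) = mat 1"
      using matrix_inv_cancel(1)[OF Q, of "matrix_inv (cmat j i0 ?Tz)"] matrix_inv(1)[OF P] by (simp flip: matrix_mul_assoc)
    then have ci: "matrix_inv (cmat i i0 z) = matrix_inv (cmat i j z) ** matrix_inv (cmat j i0 ?Tz)"
      unfolding c by (rule matrix_inv_unique(2))
    have "transition X i i0 z = transition X j i0 ?Tz" by (simp add: transition_def x[unfolded transition_def])
    then show ?thesis using True unfolding extend_endo_def ci unfolding c x by (simp add: matrix_mul_assoc)
  qed (simp add: extend_endo_def x)
qed

lemma extend_endo_self_adjoint:
  assumes h: "hermitian_metric X E h" and hB: "\<And>z. z \<in> img X i0 \<Longrightarrow> conj_transpose (h i0 z ** B z) = h i0 z ** B z"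
    and i: "i \<in> charts X" and z: "z \<in> img X i"
  shows "conj_transpose (h i z ** extend_endo i0 B i z) = h i z ** extend_endo i0 B i z"
proof (cases "chart_inv X i z \<in> dom X i0")
  case True
  then have o: "z \<in> overlap X i i0" using overlap_iff[OF i] z by blast
  let ?g = "cmat i i0 z" and ?h = "h i0 (transition X i i0 z)" and ?B = "B (transition X i i0 z)"
  have c: "Y ** ?g ** matrix_inv ?g = Y" for Y :: "'r mtx" by (rule matrix_inv_cancel(3)[OF cmat_inverse(3)[OF i i0 o]])
  have "h i z ** extend_endo i0 B i z = conj_transpose ?g ** (?h ** ?B) ** ?g"
    using True unfolding hermitian_metricD(3)[OF h i i0 o] extend_endo_def by (simp add: matrix_mul_assoc c)
  then show ?thesis using hB[OF transition_img[OF i i0 o]] by (simp only: conj_transpose_congruence)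
next
  case False
  then show ?thesis by (simp add: extend_endo_def linear_0[OF linear_conj_transpose])
qed

end

lemma critical_imp_Z_critical:
  assumes h: "hermitian_metric X E h" and h_ref: "hermitian_metric X E h_ref"
    and crit: "critical_point X E (\<lambda>k. M_Z X E \<omega> \<rho> U k h_ref) h"
  shows "Z_critical X E \<omega> \<rho> U h"
  unfolding Z_critical_def
proof (intro ballI allI)
  fix i z0 v assume i: "i \<in> charts X" and z0: "z0 \<in> img X i"
  note S = open_img[OF i]
  obtain r where r: "0 < r" "cball z0 r \<subseteq> img X i" using S z0 open_contains_cball by blast
  define T where "T z = D_Z X E \<omega> \<rho> U h i z std_frame" for z
  \<comment> \<open>With \<open>Q = h T\<close> Hermitian, \<open>h T h\<close> is self-adjoint and \<open>tr (h T h T) = tr (Q\<^sup>* Q)\<close>.\<close>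
  define B where "B z = bump z0 r z *\<^sub>R (h i z ** T z ** h i z)" for z
  have inv: "invertible (h i z)" and herm: "conj_transpose (h i z) = h i z" if "z \<in> img X i" for z
    using hermitian_metricD(2)[OF h i that] pos_def_hermitian_invertible by (auto simp: pos_def_hermitian_def)
  have Q: "conj_transpose (h i z ** T z) = h i z ** T z" if "z \<in> img X i" for z
    unfolding adj_hermitian[OF inv[OF that] herm[OF that], symmetric] T_def D_Z_def by (rule adj_Im_endo[OF inv[OF that] herm[OF that]])
  have sB: "smooth_on B (img X i)" and sT: "smooth_on T (img X i)"
    unfolding B_def[abs_def] T_def[abs_def]
    by (intro smooth_on_scaleR smooth_on_matrix_mult S hermitian_metricD(1)[OF h i] smooth_D_Z[OF h i]
        smooth_on_subset[OF smooth_on_bump subset_UNIV])+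
  have B0: "B z = 0" if "z \<in> img X i - cball z0 r" for z
    using that bump_eq_0_iff[OF r(1), of z0 z] by (auto simp: B_def)
  note L = compact_cball[of z0 r] r(2)
  let ?A = "extend_endo i B" and ?K = "chart_inv X i ` cball z0 r"
  note sA = smooth_section_extend_endo[OF i sB L B0]
  have "conj_transpose (h i z ** B z) = h i z ** B z" if "z \<in> img X i" for z
  proof -
    have "h i z ** B z = bump z0 r z *\<^sub>R (conj_transpose (h i z) ** (h i z ** T z) ** h i z)"
      using herm[OF that] by (simp add: B_def scaleR_matrix_mult matrix_mul_assoc)
    then show ?thesis by (simp only: linear_scale[OF linear_conj_transpose] conj_transpose_congruence Q[OF that])
  qed
  then have "Th (mc \<rho>) h ?A = 0"
    by (intro critical_imp_Th_0[OF h sA _ h_ref crit] extend_endo_self_adjoint[OF i sB L B0 h])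
  define f where "f z = (if z \<in> img X i then Re (trace (B z ** T z)) else 0)" for z
  have tr: "trace (B z ** T z) = of_real (bump z0 r z * (\<Sum>a\<in>UNIV. \<Sum>b\<in>UNIV. (cmod ((h i z ** T z) $ b $ a))\<^sup>2))" if "z \<in> img X i" for z
  proof -
    have "trace (h i z ** T z ** h i z ** T z) = trace (conj_transpose (h i z ** T z) ** (h i z ** T z))"
      unfolding Q[OF that] by (simp add: matrix_mul_assoc)
    then show ?thesis
      unfolding trace_conj_transpose_mult by (simp add: B_def scaleR_matrix_mult trace_scaleR scaleR_conv_of_real[where 'a = complex])
  qed
  have "Th (mc \<rho>) h ?A = (LINT z|lborel. (if z \<in> img X i then qd (mc \<rho>) h ?A i z else 0))"
    unfolding Th_def
  proof (rule integral_over_local[where K = ?K and \<eta> = "\<lambda>i z v. qd (mc \<rho>) h ?A i z"])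
    show "density (\<lambda>i z. qd (mc \<rho>) h ?A i z)" unfolding qd_def by (rule density_charge_density[OF h sA])
    show "closed ?K" by (rule closed_chart_inv_image(1)[OF i L])
    show "?K \<subseteq> dom X i" by (rule closed_chart_inv_image(2)[OF i L])
    show "qd (mc \<rho>) h ?A j z = 0" if "j \<in> charts X" "z \<in> img X j" "chart_inv X j z \<notin> ?K" for j z
    proof -
      have "extend_endo i B j z = 0" by (rule extend_endo_0[OF i sB L B0 that])
      then show ?thesis unfolding qd_D_Z[OF h that(1,2)] by (simp add: linear_0[OF linear_trace])
    qed
  qed (rule i)
  also have "\<dots> = (LINT z|lborel. complex_of_real (f z))"
  proof (intro Bochner_Integration.integral_cong refl)
    fix z
    have "extend_endo i B i z = B z" if "z \<in> img X i" by (rule extend_endo_i0[OF i sB L B0 that])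
    then show "(if z \<in> img X i then qd (mc \<rho>) h ?A i z else 0) = complex_of_real (f z)"
      by (simp add: f_def qd_D_Z[OF h i] tr flip: T_def)
  qed
  finally have int: "(LINT z|lborel. f z) = 0" using \<open>Th (mc \<rho>) h ?A = 0\<close> by simp
  have cf: "continuous_on UNIV f"
    unfolding f_def
  proof (rule continuous_on_extend_by_zero[OF S _ closed_cball r(2)])
    show "continuous_on (img X i) (\<lambda>z. Re (trace (B z ** T z)))"
      by (intro continuous_on_Re smooth_on_continuous smooth_on_trace smooth_on_matrix_mult S sB sT)
    show "Re (trace (B z ** T z)) = 0" if "z \<in> img X i" "z \<notin> cball z0 r" for z
      using B0[of z] that by (simp add: linear_0[OF linear_trace])
  qed
  have f0: "f z = 0" if "z \<notin> cball z0 r" for z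
    using B0[of z] that by (simp add: f_def linear_0[OF linear_trace])
  have fn: "0 \<le> f z" for z
    unfolding f_def using tr[of z] bump_nonneg[of z0 r z] by (auto intro!: mult_nonneg_nonneg sum_nonneg)
  \<comment> \<open>A box whose interior contains the support, since the vanishing criterion for
    nonnegative continuous functions is applied on a nondegenerate box.\<close>
  obtain a where a: "cball z0 r \<subseteq> box (- a) a" using bounded_subset_box_symmetric[OF bounded_cball] by metis
  have z0': "z0 \<in> box (- a) a" using a r(1) by auto
  have "(LINT z|lborel. f z) = integral (cbox (- a) a) f"
    by (rule lebesgue_eq_integral_cbox[OF cf L(1) order_trans[OF a box_subset_cbox] f0])
  moreover have "box (- a) a \<noteq> {}" using z0' by blast
  ultimately have "\<forall>z\<in>cbox (- a) a. f z = 0"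
    using integral_cbox_eq_0_iff[OF continuous_on_subset[OF cf subset_UNIV] _ fn, of "- a" a] int by simp
  moreover have "z0 \<in> cbox (- a) a" using z0' box_subset_cbox by blast
  ultimately have "f z0 = 0" by simp
  \<comment> \<open>Only the centre is evaluated: the bump is positive there, and \<open>z0\<close>
    was arbitrary.\<close>
  then have "bump z0 r z0 * (\<Sum>a\<in>UNIV. \<Sum>b\<in>UNIV. (cmod ((h i z0 ** T z0) $ b $ a))\<^sup>2) = 0"
    using z0 tr[OF z0] by (simp add: f_def)
  then have "h i z0 ** T z0 = 0"
    using bump_eq_0_iff[OF r(1), of z0 z0] r(1) unfolding mult_eq_0_iff sum_norm_square_eq_0 by simp
  then have "T z0 = matrix_inv (h i z0) ** 0" using matrix_inv_cancel(2)[OF inv[OF z0]] by metis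
  then have "D_Z X E \<omega> \<rho> U h i z0 std_frame = 0" by (simp add: T_def)
  then show "D_Z X E \<omega> \<rho> U h i z0 v = 0" by (rule D_Z_top_form[OF h i z0])
qed

end

theorem theorem4p5p8:
  fixes X :: "('a::t2_space, 'i, 'n::finite) atlas"
    and E :: "('a, 'i, 'r::finite) cocycle"
    and \<omega> :: "('i, 'n, complex) form"
    and U :: "nat \<Rightarrow> ('i, 'n, complex) form"
    and \<rho> :: "nat \<Rightarrow> complex"
    and h h_ref :: "('i, 'n, 'r) metric"
  assumes "compact_complex_manifold X"
    and "kaehler_form X \<omega>"
    and "holomorphic_bundle X E"
    and "stability_vector CARD('n) \<rho>"
    and "unipotent_form X U"
    and "\<And>l. del_closed_form X (2 * l) (U (2 * l))"
    and "central_charge X E \<omega> \<rho> U \<noteq> 0"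
    and "hermitian_metric X E h_ref"
    and "hermitian_metric X E h"
  shows "critical_point X E (\<lambda>k. M_Z X E \<omega> \<rho> U k h_ref) h \<longleftrightarrow> Z_critical X E \<omega> \<rho> U h"
proof -
  interpret charged_bundle X E \<omega> U
    by unfold_locales (rule assms)+
  show ?thesis
    using critical_imp_Z_critical[OF assms(9,8)] Z_critical_imp_critical[OF assms(9,8)] by blast
qed

end
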